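(* Let $0\to B\to A\xrightarrow{\tau}A/B\to0$ be a short exact sequence of algebras with bracket and let $M$ be a representation of $A/B$ (regarded as a representation of $A$ via $\tau$). Then there is an exact sequence of vector spaces $$0\to H^0_{\mathsf{AWB}}(A/B,M)\to H^0_{\mathsf{AWB}}(A,M)\to \mathrm{Hom}_{A/B}(B_{\mathrm{ab}},M)\to H^1_{\mathsf{AWB}}(A/B,M)\xrightarrow{\tau^\star}H^1_{\mathsf{AWB}}(A,M)$$ $$\xrightarrow{\ r\ }\mathrm{XExt}_A(B,M)\xrightarrow{\ \gamma\ }H^2_{\mathsf{AWB}}(A/B,M)\xrightarrow{\ \tau^*\ }H^2_{\mathsf{AWB}}(A,M),$$ where $\tau^\star$ and $\tau^*$ are induced by $\tau$, and $r$, $\gamma$ are the linear maps defined in the context.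
   Context: Fix a field $\mathbb K$; all vector spaces, algebras and linear maps are over $\mathbb K$. An algebra with bracket (AWB) is an associative (not necessarily commutative or unital) algebra $A$ with a bilinear map $[-,-]\colon A\times A\to A$ such that $[ab,c]=[a,c]b+a[b,c]$. Homomorphisms preserve product and bracket. An AWB is abelian if product and bracket are zero. A two-sided ideal $B$ of $A$ is a subspace with $AB,BA,[A,B],[B,A]\subseteq B$. An action of an AWB $A$ on an AWB $C$ consists of four bilinear maps $(a,c)\mapsto a\cdot c$, $(a,c)\mapsto\{a,c\}$, $(c,a)\mapsto c\cdot a$, $(c,a)\mapsto\{c,a\}$ with values in $C$ such that (A) $(a_1a_2)\cdot c=a_1\cdot(a_2\cdot c)$, $c\cdot(a_1a_2)=(c\cdot a_1)\cdot a_2$, $(a_1\cdot c)\cdot a_2=a_1\cdot(c\cdot a_2)$, $\{a_1\cdot c,a_2\}=a_1\cdot\{c,a_2\}+[a_1,a_2]\cdot c$, $\{c\cdot a_1,a_2\}=\{c,a_2\}\cdot a_1+c\cdot[a_1,a_2]$, $\{a_1a_2,c\}=a_1\cdot\{a_2,c\}+\{a_1,c\}\cdot a_2$; (B) $(c_1c_2)\cdot a=c_1(c_2\cdot a)$, $a\cdot(c_1c_2)=(a\cdot c_1)c_2$, $(c_1\cdot a)c_2=c_1(a\cdot c_2)$, $[c_1\cdot a,c_2]=c_1\{a,c_2\}+[c_1,c_2]\cdot a$, $[a\cdot c_1,c_2]=a\cdot[c_1,c_2]+\{a,c_2\}c_1$, $\{c_1c_2,a\}=c_1\{c_2,a\}+\{c_1,a\}c_2$.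 A representation of $A$ is a vector space $M$ with four such bilinear maps satisfying (A); equivalently, an action of $A$ on the abelian AWB $M$. Cohomology, for a representation $M$ of an AWB $A$. $K^{-1}(A,M)=\mathrm{Hom}(A,M)$; $K^0(A,M)$: pairs $(f,g)$ of linear maps $f\colon A^{\otimes2}\to M$, $g\colon A\to\mathrm{Hom}(A,M)$; $K^1(A,M)$: pairs $(\mathsf f,\mathsf g)$ of linear maps $\mathsf f\colon A^{\otimes3}\to M$, $\mathsf g\colon A^{\otimes2}\to\mathrm{Hom}(A,M)$. $\partial^{-1}(h)=(f,g)$ with $f(a_0,a_1)=-a_0\cdot h(a_1)+h(a_0a_1)-h(a_0)\cdot a_1$, $g(a_0)(a_1)=-\{a_0,h(a_1)\}+h[a_0,a_1]-\{h(a_0),a_1\}$. $\partial^0(f,g)=(\mathsf f,\mathsf g)$ with $\mathsf f(a_0,a_1,a_2)=-(a_0\cdot f(a_1,a_2)-f(a_0a_1,a_2)+f(a_0,a_1a_2)-f(a_0,a_1)\cdot a_2)$ and $\mathsf g(a_0,a_1)(a_2)=a_0\cdot g(a_1)(a_2)+g(a_0)(a_2)\cdot a_1-g(a_0a_1)(a_2)-\{f(a_0,a_1),a_2\}+f([a_0,a_2],a_1)+f(a_0,[a_1,a_2])$. A $1$-cocycle is $(\mathsf f,\mathsf g)\in K^1(A,M)$ with $$a_0\cdot\mathsf f(a_1,a_2,a_3)-\mathsf f(a_0a_1,a_2,a_3)+\mathsf f(a_0,a_1a_2,a_3)-\mathsf f(a_0,a_1,a_2a_3)+\mathsf f(a_0,a_1,a_2)\cdot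 a_3=0,$$ $$\{\mathsf f(a_0,a_1,a_2),a_3\}-\mathsf f([a_0,a_3],a_1,a_2)-\mathsf f(a_0,[a_1,a_3],a_2)-\mathsf f(a_0,a_1,[a_2,a_3])$$ $$=a_0\cdot\mathsf g(a_1,a_2)(a_3)-\mathsf g(a_0a_1,a_2)(a_3)+\mathsf g(a_0,a_1a_2)(a_3)-\mathsf g(a_0,a_1)(a_3)\cdot a_2.$$ $H^0_{\mathsf{AWB}}(A,M)=\ker\partial^{-1}$, $H^1_{\mathsf{AWB}}(A,M)=\ker\partial^0/\mathrm{Im}\,\partial^{-1}$, $H^2_{\mathsf{AWB}}(A,M)=\{1\text{-cocycles}\}/\mathrm{Im}\,\partial^0$. The maps $\tau^\star,\tau^*$ are given by precomposing cochains with $\tau$ in each argument. $H^1$ and abelian extensions: an abelian extension of $A$ by $M$ is a short exact sequence of AWBs $E\colon 0\to M\xrightarrow{i}E\xrightarrow{p}A\to0$, $M$ an abelian AWB, inducing the given representation: if $p(e)=a$ then $i(a\cdot m)=e\,i(m)$, $i(m\cdot a)=i(m)e$, $i\{a,m\}=[e,i(m)]$, $i\{m,a\}=[i(m),e]$. For a linear section $s$ of $p$, $f(a_0,a_1)=i^{-1}(s(a_0)s(a_1)-s(a_0a_1))$, $g(a_0)(a_1)=i^{-1}([s(a_0),s(a_1)]-s[a_0,a_1])$ define a class in $H^1_{\mathsf{AWB}}(A,M)$; this gives a known bijection from equivalence classes of abelian extensions to $H^1_{\mathsf{AWB}}(A,M)$. $[[B,B]]$ is the two-sided ideal of $B$ generated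 by all $bb'$, $[b,b']$ with $b,b'\in B$; $B_{\mathrm{ab}}=B/[[B,B]]$. $\mathrm{Hom}_{A/B}(B_{\mathrm{ab}},M)$ is the space of linear maps $\varphi\colon B_{\mathrm{ab}}\to M$ preserving the action of $A/B$, i.e. writing $\bar b$ for the class of $b$: $\varphi(\overline{ab})=\tau(a)\cdot\varphi(\bar b)$, $\varphi(\overline{ba})=\varphi(\bar b)\cdot\tau(a)$, $\varphi(\overline{[a,b]})=\{\tau(a),\varphi(\bar b)\}$, $\varphi(\overline{[b,a]})=\{\varphi(\bar b),\tau(a)\}$ for all $a\in A$, $b\in B$. An $A$-crossed extension of $B$ by $M$ is a short exact sequence of AWBs $\mathsf e\colon 0\to M\xrightarrow{i}C\xrightarrow{\nu}B\to0$ with an action of $A$ on $C$ such that $\nu$, viewed as a map $C\to A$, is a crossed module: $\nu(c\cdot a)=\nu(c)a$, $\nu(a\cdot c)=a\nu(c)$, $\nu\{c,a\}=[\nu(c),a]$, $\nu\{a,c\}=[a,\nu(c)]$, $\nu(c)\cdot c'=cc'=c\cdot\nu(c')$, $\{\nu(c),c'\}=[c,c']=\{c,\nu(c')\}$; and such that the action of $A$ on $C$ restricts on $M$ to the given one. Two such, $\mathsf e,\mathsf e'$, are congruent if there is an AWB homomorphism $\varphi\colon C\to C'$ preserving the action of $A$ with $\nu'\varphi=\nu$, $\varphi i=i'$. $\mathrm{XExt}_A(B,M)$ is the set of congruence classes. It is a vector space: $\mathrm{cl}(\mathsf e)+\mathrm{cl}(\mathsf e')$ is the class of $0\to M\to(C\times_BC')/\{(i(m),-i'(m))\mid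 m\in M\}\to B\to0$ (with $C\times_BC'=\{(c,c')\mid\nu(c)=\nu'(c')\}$, $m\mapsto\mathrm{cl}(i(m),0)$, $\mathrm{cl}(c,c')\mapsto\nu(c)$, componentwise operations and action); $\lambda\,\mathrm{cl}(\mathsf e)$, $\lambda\in\mathbb K$, is the class of $0\to M\to(M\times C)/\{(\lambda m,-i(m))\mid m\in M\}\to B\to0$ (with $m\mapsto\mathrm{cl}(m,0)$, $\mathrm{cl}(m,c)\mapsto\nu(c)$, componentwise operations and action); zero is the class of $0\to M\to M\times B\to B\to0$ with componentwise action. The map $r$: if a class in $H^1_{\mathsf{AWB}}(A,M)$ corresponds to $0\to M\xrightarrow{i}E\xrightarrow{p}A\to0$, its image is the class of $0\to M\to E\times_AB\xrightarrow{\pi_2}B\to0$, where $E\times_AB=\{(e,b)\mid p(e)=b\}$, $\pi_2(e,b)=b$, and for $a\in A$ and any $e'\in E$ with $p(e')=a$: $a\cdot(e,b)=(e'e,ab)$, $(e,b)\cdot a=(ee',ba)$, $\{a,(e,b)\}=([e',e],[a,b])$, $\{(e,b),a\}=([e,e'],[b,a])$. The map $\gamma$: given $\mathsf e$, it defines the crossed extension $0\to M\xrightarrow{i}C\xrightarrow{\nu}A\xrightarrow{\tau}A/B\to0$ of $A/B$ by $M$, and $\gamma(\mathrm{cl}(\mathsf e))$ is the associated class in $H^2_{\mathsf{AWB}}(A/B,M)$: choose linear sections $s\colon A/B\to A$ of $\tau$ and $\rho\colon B\to C$ of $\nu$; for $x,y,z\in A/B$ put $f(x,y)=\rho(s(x)s(y)-s(xy))$,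 $g(x)(y)=\rho([s(x),s(y)]-s[x,y])$, and take the class of the $1$-cocycle $(\mathsf f,\mathsf g)$ (with values in $M\cong i(M)$) with $\mathsf f(x,y,z)=-(s(x)\cdot f(y,z)-f(xy,z)+f(x,yz)-f(x,y)\cdot s(z))$ and $\mathsf g(x,y)(z)=s(x)\cdot g(y)(z)-g(xy)(z)+g(x)(z)\cdot s(y)-\{f(x,y),s(z)\}+f([x,z],y)+f(x,[y,z])$. *)

theory Defs
  imports "HOL-Algebra.Module" "HOL-Algebra.QuotRing"
begin

section \<open>Linear algebra over HOL-Algebra modules\<close>

text \<open>Vector spaces are modules over a field \<open>K\<close>.  The ring components \<open>mult\<close> and \<open>one\<close> of a
  \<^const>\<open>module\<close> record play no role for a vector space.\<close>

definition lin_map ::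
  "'k ring \<Rightarrow> ('k, 'v, 'x) module_scheme \<Rightarrow> ('k, 'w, 'y) module_scheme \<Rightarrow> ('v \<Rightarrow> 'w) \<Rightarrow> bool" where
  "lin_map K V W f \<longleftrightarrow> f \<in> carrier V \<rightarrow> carrier W \<and>
     (\<forall>x\<in>carrier V. \<forall>y\<in>carrier V. f (x \<oplus>\<^bsub>V\<^esub> y) = f x \<oplus>\<^bsub>W\<^esub> f y) \<and>
     (\<forall>k\<in>carrier K. \<forall>x\<in>carrier V. f (k \<odot>\<^bsub>V\<^esub> x) = k \<odot>\<^bsub>W\<^esub> f x)"

definition bilin_map ::
  "'k ring \<Rightarrow> ('k, 'u, 'x) module_scheme \<Rightarrow> ('k, 'v, 'y) module_scheme \<Rightarrow> ('k, 'w, 'z) module_scheme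
     \<Rightarrow> ('u \<Rightarrow> 'v \<Rightarrow> 'w) \<Rightarrow> bool" where
  "bilin_map K U V W f \<longleftrightarrow>
     (\<forall>u\<in>carrier U. lin_map K V W (f u)) \<and> (\<forall>v\<in>carrier V. lin_map K U W (\<lambda>u. f u v))"

definition lin_section ::
  "'k ring \<Rightarrow> ('k, 'v, 'x) module_scheme \<Rightarrow> ('v \<Rightarrow> 'w) \<Rightarrow> ('k, 'w, 'y) module_scheme \<Rightarrow> ('w \<Rightarrow> 'v) \<Rightarrow> bool"
  where
  "lin_section K V p W s \<longleftrightarrow> lin_map K W V s \<and> (\<forall>w\<in>carrier W. p (s w) = w)"

text \<open>Functions are normalised to be \<^const>\<open>extensional\<close>, so that equality of elements of \<open>hom_mod\<close> is
  equality on the carrier.\<close>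

definition hom_mod ::
  "'k ring \<Rightarrow> ('k, 'v, 'x) module_scheme \<Rightarrow> ('k, 'w, 'y) module_scheme \<Rightarrow> ('k, 'v \<Rightarrow> 'w) module" where
  "hom_mod K V W = \<lparr>carrier = {h \<in> extensional (carrier V). lin_map K V W h},
     mult = undefined, one = undefined,
     zero = (\<lambda>v\<in>carrier V. \<zero>\<^bsub>W\<^esub>),
     add = (\<lambda>h h'. \<lambda>v\<in>carrier V. h v \<oplus>\<^bsub>W\<^esub> h' v),
     smult = (\<lambda>k h. \<lambda>v\<in>carrier V. k \<odot>\<^bsub>W\<^esub> h v)\<rparr>"

definition mod_prod ::
  "('k, 'v, 'x) module_scheme \<Rightarrow> ('k, 'w, 'y) module_scheme \<Rightarrow> ('k, 'v \<times> 'w) module" where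
  "mod_prod V W = \<lparr>carrier = carrier V \<times> carrier W,
     mult = undefined, one = undefined,
     zero = (\<zero>\<^bsub>V\<^esub>, \<zero>\<^bsub>W\<^esub>),
     add = (\<lambda>(v, w) (v', w'). (v \<oplus>\<^bsub>V\<^esub> v', w \<oplus>\<^bsub>W\<^esub> w')),
     smult = (\<lambda>k (v, w). (k \<odot>\<^bsub>V\<^esub> v, k \<odot>\<^bsub>W\<^esub> w))\<rparr>"

definition mod_quot :: "('k, 'v, 'x) module_scheme \<Rightarrow> 'v set \<Rightarrow> ('k, 'v set) module" where
  "mod_quot V W = \<lparr>carrier = a_rcosets\<^bsub>V\<^esub> W,
     mult = undefined, one = undefined,
     zero = W,
     add = set_add V,
     smult = (\<lambda>k X. \<Union>x\<in>X. W +>\<^bsub>V\<^esub> (k \<odot>\<^bsub>V\<^esub> x))\<rparr>"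

text \<open>Exactness of \<open>U \<rightarrow> V \<rightarrow> W\<close> as a sequence of vector spaces and linear maps.\<close>

definition exact_at ::
  "'k ring \<Rightarrow> ('k, 'u, 'x) module_scheme \<Rightarrow> ('u \<Rightarrow> 'v) \<Rightarrow> ('k, 'v, 'y) module_scheme
     \<Rightarrow> ('v \<Rightarrow> 'w) \<Rightarrow> ('k, 'w, 'z) module_scheme \<Rightarrow> bool" where
  "exact_at K U f V g W \<longleftrightarrow> module K U \<and> module K V \<and> module K W \<and>
     lin_map K U V f \<and> lin_map K V W g \<and> f ` carrier U = a_kernel V W g"


section \<open>Algebras with bracket\<close>

text \<open>The component \<open>mult\<close> is the product of the algebra, \<open>brk A x y\<close> is \<open>[x, y]\<close>; algebras are not
  assumed unital, and the component \<open>one\<close> is never referred to.\<close>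

record ('k, 'a) awb = "('k, 'a) module" +
  brk :: "'a \<Rightarrow> 'a \<Rightarrow> 'a"

locale AWB = field K + module K A for K :: "'k ring" and A :: "('k, 'a) awb" +
  assumes mult_bilin: "bilin_map K A A A (mult A)"
    and mult_assoc: "\<lbrakk>x \<in> carrier A; y \<in> carrier A; z \<in> carrier A\<rbrakk>
      \<Longrightarrow> (x \<otimes>\<^bsub>A\<^esub> y) \<otimes>\<^bsub>A\<^esub> z = x \<otimes>\<^bsub>A\<^esub> (y \<otimes>\<^bsub>A\<^esub> z)"
    and brk_bilin: "bilin_map K A A A (brk A)"
    and brk_mult: "\<lbrakk>a \<in> carrier A; b \<in> carrier A; c \<in> carrier A\<rbrakk>
      \<Longrightarrow> brk A (a \<otimes>\<^bsub>A\<^esub> b) c = brk A a c \<otimes>\<^bsub>A\<^esub> b \<oplus>\<^bsub>A\<^esub> a \<otimes>\<^bsub>A\<^esub> brk A b c"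

definition awb_hom :: "'k ring \<Rightarrow> ('k, 'a) awb \<Rightarrow> ('k, 'b) awb \<Rightarrow> ('a \<Rightarrow> 'b) set" where
  "awb_hom K A B = {f. lin_map K A B f \<and>
     (\<forall>x\<in>carrier A. \<forall>y\<in>carrier A. f (x \<otimes>\<^bsub>A\<^esub> y) = f x \<otimes>\<^bsub>B\<^esub> f y \<and> f (brk A x y) = brk B (f x) (f y))}"

definition abelian_awb :: "('k, 'm) module \<Rightarrow> ('k, 'm) awb" where
  "abelian_awb M = \<lparr>carrier = carrier M, mult = (\<lambda>x y. \<zero>\<^bsub>M\<^esub>), one = undefined, zero = \<zero>\<^bsub>M\<^esub>,
     add = add M, smult = smult M, brk = (\<lambda>x y. \<zero>\<^bsub>M\<^esub>)\<rparr>"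

definition awb_prod :: "('k, 'a) awb \<Rightarrow> ('k, 'b) awb \<Rightarrow> ('k, 'a \<times> 'b) awb" where
  "awb_prod A B = \<lparr>carrier = carrier A \<times> carrier B,
     mult = (\<lambda>(a, b) (a', b'). (a \<otimes>\<^bsub>A\<^esub> a', b \<otimes>\<^bsub>B\<^esub> b')), one = undefined,
     zero = (\<zero>\<^bsub>A\<^esub>, \<zero>\<^bsub>B\<^esub>),
     add = (\<lambda>(a, b) (a', b'). (a \<oplus>\<^bsub>A\<^esub> a', b \<oplus>\<^bsub>B\<^esub> b')),
     smult = (\<lambda>k (a, b). (k \<odot>\<^bsub>A\<^esub> a, k \<odot>\<^bsub>B\<^esub> b)),
     brk = (\<lambda>(a, b) (a', b'). (brk A a a', brk B b b'))\<rparr>"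

definition awb_quot :: "('k, 'a) awb \<Rightarrow> 'a set \<Rightarrow> ('k, 'a set) awb" where
  "awb_quot A I = \<lparr>carrier = a_rcosets\<^bsub>A\<^esub> I, mult = rcoset_mult A I, one = undefined, zero = I,
     add = set_add A,
     smult = (\<lambda>k X. \<Union>x\<in>X. I +>\<^bsub>A\<^esub> (k \<odot>\<^bsub>A\<^esub> x)),
     brk = (\<lambda>X Y. \<Union>x\<in>X. \<Union>y\<in>Y. I +>\<^bsub>A\<^esub> brk A x y)\<rparr>"

definition two_sided_ideal :: "'k ring \<Rightarrow> ('k, 'a) awb \<Rightarrow> 'a set \<Rightarrow> bool" where
  "two_sided_ideal K A I \<longleftrightarrow> submodule I K A \<and>
     (\<forall>a\<in>carrier A. \<forall>x\<in>I. a \<otimes>\<^bsub>A\<^esub> x \<in> I \<and> x \<otimes>\<^bsub>A\<^esub> a \<in> I \<and> brk A a x \<in> I \<and> brk A x a \<in> I)"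

definition comm_ideal :: "'k ring \<Rightarrow> ('k, 'a) awb \<Rightarrow> 'a set" where
  "comm_ideal K A = \<Inter>{I. two_sided_ideal K A I \<and>
     (\<forall>x\<in>carrier A. \<forall>y\<in>carrier A. x \<otimes>\<^bsub>A\<^esub> y \<in> I \<and> brk A x y \<in> I)}"

definition abelianization :: "'k ring \<Rightarrow> ('k, 'a) awb \<Rightarrow> ('k, 'a set) awb" where
  "abelianization K A = awb_quot A (comm_ideal K A)"

definition short_exact ::
  "'k ring \<Rightarrow> ('k, 'x) awb \<Rightarrow> ('x \<Rightarrow> 'y) \<Rightarrow> ('k, 'y) awb \<Rightarrow> ('y \<Rightarrow> 'z) \<Rightarrow> ('k, 'z) awb \<Rightarrow> bool" where
  "short_exact K X i Y p Z \<longleftrightarrow> AWB K X \<and> AWB K Y \<and> AWB K Z \<and>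
     i \<in> awb_hom K X Y \<and> p \<in> awb_hom K Y Z \<and>
     inj_on i (carrier X) \<and> i ` carrier X = a_kernel Y Z p \<and> p ` carrier Y = carrier Z"


section \<open>Actions and representations\<close>

text \<open>The four maps are \<open>lact \<alpha> a c = a \<cdot> c\<close>, \<open>lbr \<alpha> a c = {a, c}\<close>, \<open>ract \<alpha> c a = c \<cdot> a\<close> and
  \<open>rbr \<alpha> c a = {c, a}\<close>.\<close>

record ('a, 'c) action =
  lact :: "'a \<Rightarrow> 'c \<Rightarrow> 'c"
  lbr :: "'a \<Rightarrow> 'c \<Rightarrow> 'c"
  ract :: "'c \<Rightarrow> 'a \<Rightarrow> 'c"
  rbr :: "'c \<Rightarrow> 'a \<Rightarrow> 'c"

definition action_bilin ::
  "'k ring \<Rightarrow> ('k, 'a) awb \<Rightarrow> ('k, 'c, 'z) module_scheme \<Rightarrow> ('a, 'c) action \<Rightarrow> bool" where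
  "action_bilin K A C \<alpha> \<longleftrightarrow> bilin_map K A C C (lact \<alpha>) \<and> bilin_map K A C C (lbr \<alpha>) \<and>
     bilin_map K C A C (ract \<alpha>) \<and> bilin_map K C A C (rbr \<alpha>)"

definition action_A ::
  "('k, 'a) awb \<Rightarrow> ('k, 'c, 'z) module_scheme \<Rightarrow> ('a, 'c) action \<Rightarrow> bool" where
  "action_A A C \<alpha> \<longleftrightarrow> (\<forall>a1\<in>carrier A. \<forall>a2\<in>carrier A. \<forall>c\<in>carrier C.
     lact \<alpha> (a1 \<otimes>\<^bsub>A\<^esub> a2) c = lact \<alpha> a1 (lact \<alpha> a2 c) \<and>
     ract \<alpha> c (a1 \<otimes>\<^bsub>A\<^esub> a2) = ract \<alpha> (ract \<alpha> c a1) a2 \<and>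
     ract \<alpha> (lact \<alpha> a1 c) a2 = lact \<alpha> a1 (ract \<alpha> c a2) \<and>
     rbr \<alpha> (lact \<alpha> a1 c) a2 = lact \<alpha> a1 (rbr \<alpha> c a2) \<oplus>\<^bsub>C\<^esub> lact \<alpha> (brk A a1 a2) c \<and>
     rbr \<alpha> (ract \<alpha> c a1) a2 = ract \<alpha> (rbr \<alpha> c a2) a1 \<oplus>\<^bsub>C\<^esub> ract \<alpha> c (brk A a1 a2) \<and>
     lbr \<alpha> (a1 \<otimes>\<^bsub>A\<^esub> a2) c = lact \<alpha> a1 (lbr \<alpha> a2 c) \<oplus>\<^bsub>C\<^esub> ract \<alpha> (lbr \<alpha> a1 c) a2)"

definition action_B :: "('k, 'a) awb \<Rightarrow> ('k, 'c) awb \<Rightarrow> ('a, 'c) action \<Rightarrow> bool" where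
  "action_B A C \<alpha> \<longleftrightarrow> (\<forall>c1\<in>carrier C. \<forall>c2\<in>carrier C. \<forall>a\<in>carrier A.
     ract \<alpha> (c1 \<otimes>\<^bsub>C\<^esub> c2) a = c1 \<otimes>\<^bsub>C\<^esub> ract \<alpha> c2 a \<and>
     lact \<alpha> a (c1 \<otimes>\<^bsub>C\<^esub> c2) = lact \<alpha> a c1 \<otimes>\<^bsub>C\<^esub> c2 \<and>
     ract \<alpha> c1 a \<otimes>\<^bsub>C\<^esub> c2 = c1 \<otimes>\<^bsub>C\<^esub> lact \<alpha> a c2 \<and>
     brk C (ract \<alpha> c1 a) c2 = c1 \<otimes>\<^bsub>C\<^esub> lbr \<alpha> a c2 \<oplus>\<^bsub>C\<^esub> ract \<alpha> (brk C c1 c2) a \<and>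
     brk C (lact \<alpha> a c1) c2 = lact \<alpha> a (brk C c1 c2) \<oplus>\<^bsub>C\<^esub> lbr \<alpha> a c2 \<otimes>\<^bsub>C\<^esub> c1 \<and>
     rbr \<alpha> (c1 \<otimes>\<^bsub>C\<^esub> c2) a = c1 \<otimes>\<^bsub>C\<^esub> rbr \<alpha> c2 a \<oplus>\<^bsub>C\<^esub> rbr \<alpha> c1 a \<otimes>\<^bsub>C\<^esub> c2)"

definition awb_action :: "'k ring \<Rightarrow> ('k, 'a) awb \<Rightarrow> ('k, 'c) awb \<Rightarrow> ('a, 'c) action \<Rightarrow> bool" where
  "awb_action K A C \<alpha> \<longleftrightarrow> AWB K A \<and> AWB K C \<and> action_bilin K A C \<alpha> \<and> action_A A C \<alpha> \<and> action_B A C \<alpha>"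

definition representation ::
  "'k ring \<Rightarrow> ('k, 'a) awb \<Rightarrow> ('k, 'm) module \<Rightarrow> ('a, 'm) action \<Rightarrow> bool" where
  "representation K A M \<rho> \<longleftrightarrow> AWB K A \<and> module K M \<and> action_bilin K A M \<rho> \<and> action_A A M \<rho>"

definition rep_along :: "('a \<Rightarrow> 'q) \<Rightarrow> ('q, 'm) action \<Rightarrow> ('a, 'm) action" where
  "rep_along \<tau> \<rho> = \<lparr>lact = (\<lambda>a m. lact \<rho> (\<tau> a) m), lbr = (\<lambda>a m. lbr \<rho> (\<tau> a) m),
     ract = (\<lambda>m a. ract \<rho> m (\<tau> a)), rbr = (\<lambda>m a. rbr \<rho> m (\<tau> a))\<rparr>"

definition self_action :: "('k, 'a) awb \<Rightarrow> ('a, 'a) action" where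
  "self_action A = \<lparr>lact = mult A, lbr = brk A, ract = mult A, rbr = brk A\<rparr>"

definition action_prod :: "('a, 'c) action \<Rightarrow> ('a, 'd) action \<Rightarrow> ('a, 'c \<times> 'd) action" where
  "action_prod \<alpha> \<beta> =
    \<lparr>lact = (\<lambda>a (c, d). (lact \<alpha> a c, lact \<beta> a d)), lbr = (\<lambda>a (c, d). (lbr \<alpha> a c, lbr \<beta> a d)),
     ract = (\<lambda>(c, d) a. (ract \<alpha> c a, ract \<beta> d a)), rbr = (\<lambda>(c, d) a. (rbr \<alpha> c a, rbr \<beta> d a))\<rparr>"

definition action_quot :: "('k, 'c) awb \<Rightarrow> 'c set \<Rightarrow> ('a, 'c) action \<Rightarrow> ('a, 'c set) action" where
  "action_quot C I \<alpha> =
    \<lparr>lact = (\<lambda>a X. \<Union>x\<in>X. I +>\<^bsub>C\<^esub> lact \<alpha> a x), lbr = (\<lambda>a X. \<Union>x\<in>X. I +>\<^bsub>C\<^esub> lbr \<alpha> a x),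
     ract = (\<lambda>X a. \<Union>x\<in>X. I +>\<^bsub>C\<^esub> ract \<alpha> x a), rbr = (\<lambda>X a. \<Union>x\<in>X. I +>\<^bsub>C\<^esub> rbr \<alpha> x a)\<rparr>"


section \<open>Cohomology\<close>

text \<open>A linear map on a tensor power is represented by the corresponding multilinear map in curried
  form, i.e. by an element of an iterated \<^const>\<open>hom_mod\<close>.\<close>

abbreviation hom2 ::
  "'k ring \<Rightarrow> ('k, 'a) awb \<Rightarrow> ('k, 'm) module \<Rightarrow> ('k, 'a \<Rightarrow> 'a \<Rightarrow> 'm) module" where
  "hom2 K A M \<equiv> hom_mod K A (hom_mod K A M)"

abbreviation hom3 ::
  "'k ring \<Rightarrow> ('k, 'a) awb \<Rightarrow> ('k, 'm) module \<Rightarrow> ('k, 'a \<Rightarrow> 'a \<Rightarrow> 'a \<Rightarrow> 'm) module" where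
  "hom3 K A M \<equiv> hom_mod K A (hom2 K A M)"

type_synonym ('a, 'm) cochain0 = "('a \<Rightarrow> 'a \<Rightarrow> 'm) \<times> ('a \<Rightarrow> 'a \<Rightarrow> 'm)"
type_synonym ('a, 'm) cochain1 = "('a \<Rightarrow> 'a \<Rightarrow> 'a \<Rightarrow> 'm) \<times> ('a \<Rightarrow> 'a \<Rightarrow> 'a \<Rightarrow> 'm)"

definition Km1 :: "'k ring \<Rightarrow> ('k, 'a) awb \<Rightarrow> ('k, 'm) module \<Rightarrow> ('k, 'a \<Rightarrow> 'm) module" where
  "Km1 K A M = hom_mod K A M"

definition K0 :: "'k ring \<Rightarrow> ('k, 'a) awb \<Rightarrow> ('k, 'm) module \<Rightarrow> ('k, ('a, 'm) cochain0) module" where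
  "K0 K A M = mod_prod (hom2 K A M) (hom2 K A M)"

definition K1 :: "'k ring \<Rightarrow> ('k, 'a) awb \<Rightarrow> ('k, 'm) module \<Rightarrow> ('k, ('a, 'm) cochain1) module" where
  "K1 K A M = mod_prod (hom3 K A M) (hom3 K A M)"

definition dm1 ::
  "('k, 'a) awb \<Rightarrow> ('k, 'm) module \<Rightarrow> ('a, 'm) action \<Rightarrow> ('a \<Rightarrow> 'm) \<Rightarrow> ('a, 'm) cochain0" where
  "dm1 A M \<rho> h =
    ((\<lambda>a0\<in>carrier A. \<lambda>a1\<in>carrier A.
        \<ominus>\<^bsub>M\<^esub> (lact \<rho> a0 (h a1)) \<oplus>\<^bsub>M\<^esub> h (a0 \<otimes>\<^bsub>A\<^esub> a1) \<ominus>\<^bsub>M\<^esub> ract \<rho> (h a0) a1),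
     (\<lambda>a0\<in>carrier A. \<lambda>a1\<in>carrier A.
        \<ominus>\<^bsub>M\<^esub> (lbr \<rho> a0 (h a1)) \<oplus>\<^bsub>M\<^esub> h (brk A a0 a1) \<ominus>\<^bsub>M\<^esub> rbr \<rho> (h a0) a1))"

definition d0 ::
  "('k, 'a) awb \<Rightarrow> ('k, 'm) module \<Rightarrow> ('a, 'm) action \<Rightarrow> ('a, 'm) cochain0 \<Rightarrow> ('a, 'm) cochain1" where
  "d0 A M \<rho> = (\<lambda>(f, g).
    ((\<lambda>a0\<in>carrier A. \<lambda>a1\<in>carrier A. \<lambda>a2\<in>carrier A.
        \<ominus>\<^bsub>M\<^esub> (lact \<rho> a0 (f a1 a2) \<ominus>\<^bsub>M\<^esub> f (a0 \<otimes>\<^bsub>A\<^esub> a1) a2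
             \<oplus>\<^bsub>M\<^esub> f a0 (a1 \<otimes>\<^bsub>A\<^esub> a2) \<ominus>\<^bsub>M\<^esub> ract \<rho> (f a0 a1) a2)),
     (\<lambda>a0\<in>carrier A. \<lambda>a1\<in>carrier A. \<lambda>a2\<in>carrier A.
        lact \<rho> a0 (g a1 a2) \<oplus>\<^bsub>M\<^esub> ract \<rho> (g a0 a2) a1 \<ominus>\<^bsub>M\<^esub> g (a0 \<otimes>\<^bsub>A\<^esub> a1) a2
          \<ominus>\<^bsub>M\<^esub> rbr \<rho> (f a0 a1) a2 \<oplus>\<^bsub>M\<^esub> f (brk A a0 a2) a1 \<oplus>\<^bsub>M\<^esub> f a0 (brk A a1 a2))))"

definition cocycles1 ::
  "'k ring \<Rightarrow> ('k, 'a) awb \<Rightarrow> ('k, 'm) module \<Rightarrow> ('a, 'm) action \<Rightarrow> ('a, 'm) cochain1 set" where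
  "cocycles1 K A M \<rho> = {(f, g) \<in> carrier (K1 K A M).
    \<forall>a0\<in>carrier A. \<forall>a1\<in>carrier A. \<forall>a2\<in>carrier A. \<forall>a3\<in>carrier A.
      lact \<rho> a0 (f a1 a2 a3) \<ominus>\<^bsub>M\<^esub> f (a0 \<otimes>\<^bsub>A\<^esub> a1) a2 a3 \<oplus>\<^bsub>M\<^esub> f a0 (a1 \<otimes>\<^bsub>A\<^esub> a2) a3
        \<ominus>\<^bsub>M\<^esub> f a0 a1 (a2 \<otimes>\<^bsub>A\<^esub> a3) \<oplus>\<^bsub>M\<^esub> ract \<rho> (f a0 a1 a2) a3 = \<zero>\<^bsub>M\<^esub> \<and>
      rbr \<rho> (f a0 a1 a2) a3 \<ominus>\<^bsub>M\<^esub> f (brk A a0 a3) a1 a2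
        \<ominus>\<^bsub>M\<^esub> f a0 (brk A a1 a3) a2 \<ominus>\<^bsub>M\<^esub> f a0 a1 (brk A a2 a3)
      = lact \<rho> a0 (g a1 a2 a3) \<ominus>\<^bsub>M\<^esub> g (a0 \<otimes>\<^bsub>A\<^esub> a1) a2 a3
        \<oplus>\<^bsub>M\<^esub> g a0 (a1 \<otimes>\<^bsub>A\<^esub> a2) a3 \<ominus>\<^bsub>M\<^esub> ract \<rho> (g a0 a1 a3) a2}"

definition H0 ::
  "'k ring \<Rightarrow> ('k, 'a) awb \<Rightarrow> ('k, 'm) module \<Rightarrow> ('a, 'm) action \<Rightarrow> ('k, 'a \<Rightarrow> 'm) module" where
  "H0 K A M \<rho> = (Km1 K A M)\<lparr>carrier := a_kernel (Km1 K A M) (K0 K A M) (dm1 A M \<rho>)\<rparr>"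

definition cobound0 ::
  "'k ring \<Rightarrow> ('k, 'a) awb \<Rightarrow> ('k, 'm) module \<Rightarrow> ('a, 'm) action \<Rightarrow> ('a, 'm) cochain0 set" where
  "cobound0 K A M \<rho> = dm1 A M \<rho> ` carrier (Km1 K A M)"

definition H1 ::
  "'k ring \<Rightarrow> ('k, 'a) awb \<Rightarrow> ('k, 'm) module \<Rightarrow> ('a, 'm) action
     \<Rightarrow> ('k, ('a, 'm) cochain0 set) module" where
  "H1 K A M \<rho> = mod_quot ((K0 K A M)\<lparr>carrier := a_kernel (K0 K A M) (K1 K A M) (d0 A M \<rho>)\<rparr>)
     (cobound0 K A M \<rho>)"

definition class1 ::
  "'k ring \<Rightarrow> ('k, 'a) awb \<Rightarrow> ('k, 'm) module \<Rightarrow> ('a, 'm) action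
     \<Rightarrow> ('a, 'm) cochain0 \<Rightarrow> ('a, 'm) cochain0 set" where
  "class1 K A M \<rho> z = cobound0 K A M \<rho> +>\<^bsub>K0 K A M\<^esub> z"

definition cobound1 ::
  "'k ring \<Rightarrow> ('k, 'a) awb \<Rightarrow> ('k, 'm) module \<Rightarrow> ('a, 'm) action \<Rightarrow> ('a, 'm) cochain1 set" where
  "cobound1 K A M \<rho> = d0 A M \<rho> ` carrier (K0 K A M)"

definition H2 ::
  "'k ring \<Rightarrow> ('k, 'a) awb \<Rightarrow> ('k, 'm) module \<Rightarrow> ('a, 'm) action
     \<Rightarrow> ('k, ('a, 'm) cochain1 set) module" where
  "H2 K A M \<rho> = mod_quot ((K1 K A M)\<lparr>carrier := cocycles1 K A M \<rho>\<rparr>) (cobound1 K A M \<rho>)"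

definition class2 ::
  "'k ring \<Rightarrow> ('k, 'a) awb \<Rightarrow> ('k, 'm) module \<Rightarrow> ('a, 'm) action
     \<Rightarrow> ('a, 'm) cochain1 \<Rightarrow> ('a, 'm) cochain1 set" where
  "class2 K A M \<rho> z = cobound1 K A M \<rho> +>\<^bsub>K1 K A M\<^esub> z"

text \<open>Maps induced by \<open>\<tau> :: A \<rightarrow> Q\<close>; \<open>\<rho>\<close> is the representation of \<open>Q\<close>.  Here and below a map on classes
  is given as \<^const>\<open>the_elem\<close> of the set of its values on all representatives (and all choices).\<close>

definition tau_H0 :: "('k, 'a) awb \<Rightarrow> ('a \<Rightarrow> 'q) \<Rightarrow> ('q \<Rightarrow> 'm) \<Rightarrow> 'a \<Rightarrow> 'm" where
  "tau_H0 A \<tau> h = (\<lambda>a\<in>carrier A. h (\<tau> a))"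

definition tau_H1 ::
  "'k ring \<Rightarrow> ('k, 'a) awb \<Rightarrow> ('k, 'm) module \<Rightarrow> ('q, 'm) action \<Rightarrow> ('a \<Rightarrow> 'q)
     \<Rightarrow> ('q, 'm) cochain0 set \<Rightarrow> ('a, 'm) cochain0 set" where
  "tau_H1 K A M \<rho> \<tau> X = the_elem ((\<lambda>(f, g). class1 K A M (rep_along \<tau> \<rho>)
     ((\<lambda>a0\<in>carrier A. \<lambda>a1\<in>carrier A. f (\<tau> a0) (\<tau> a1)),
      (\<lambda>a0\<in>carrier A. \<lambda>a1\<in>carrier A. g (\<tau> a0) (\<tau> a1)))) ` X)"

definition tau_H2 ::
  "'k ring \<Rightarrow> ('k, 'a) awb \<Rightarrow> ('k, 'm) module \<Rightarrow> ('q, 'm) action \<Rightarrow> ('a \<Rightarrow> 'q)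
     \<Rightarrow> ('q, 'm) cochain1 set \<Rightarrow> ('a, 'm) cochain1 set" where
  "tau_H2 K A M \<rho> \<tau> X = the_elem ((\<lambda>(f, g). class2 K A M (rep_along \<tau> \<rho>)
     ((\<lambda>a0\<in>carrier A. \<lambda>a1\<in>carrier A. \<lambda>a2\<in>carrier A. f (\<tau> a0) (\<tau> a1) (\<tau> a2)),
      (\<lambda>a0\<in>carrier A. \<lambda>a1\<in>carrier A. \<lambda>a2\<in>carrier A. g (\<tau> a0) (\<tau> a1) (\<tau> a2)))) ` X)"

text \<open>The pair \<open>(j (s x s y - s (x y)), j ([s x, s y] - s [x, y]))\<close> attached to a linear map
  \<open>s :: A \<rightarrow> X\<close>.\<close>

definition factor_set ::
  "('k, 'a) awb \<Rightarrow> ('k, 'x) awb \<Rightarrow> ('a \<Rightarrow> 'x) \<Rightarrow> ('x \<Rightarrow> 'm) \<Rightarrow> ('a, 'm) cochain0" where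
  "factor_set A X s j =
    ((\<lambda>a0\<in>carrier A. \<lambda>a1\<in>carrier A. j (s a0 \<otimes>\<^bsub>X\<^esub> s a1 \<ominus>\<^bsub>X\<^esub> s (a0 \<otimes>\<^bsub>A\<^esub> a1))),
     (\<lambda>a0\<in>carrier A. \<lambda>a1\<in>carrier A. j (brk X (s a0) (s a1) \<ominus>\<^bsub>X\<^esub> s (brk A a0 a1))))"


section \<open>The space \<open>Hom\<^bsub>A/B\<^esub>(B\<^bsub>ab\<^esub>, M)\<close>\<close>

text \<open>From here on \<open>B\<close> is a subset of (the carrier of) \<open>A\<close>; the algebra \<open>B\<close> is \<open>A\<lparr>carrier := B\<rparr>\<close>.\<close>

definition ab_class :: "'k ring \<Rightarrow> ('k, 'a) awb \<Rightarrow> 'a set \<Rightarrow> 'a \<Rightarrow> 'a set" where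
  "ab_class K A B b = comm_ideal K (A\<lparr>carrier := B\<rparr>) +>\<^bsub>A\<lparr>carrier := B\<rparr>\<^esub> b"

definition Hom_ab ::
  "'k ring \<Rightarrow> ('k, 'a) awb \<Rightarrow> 'a set \<Rightarrow> ('k, 'm) module \<Rightarrow> ('q, 'm) action \<Rightarrow> ('a \<Rightarrow> 'q)
     \<Rightarrow> ('k, 'a set \<Rightarrow> 'm) module" where
  "Hom_ab K A B M \<rho> \<tau> = (hom_mod K (abelianization K (A\<lparr>carrier := B\<rparr>)) M)\<lparr>carrier :=
     {\<phi> \<in> carrier (hom_mod K (abelianization K (A\<lparr>carrier := B\<rparr>)) M).
       \<forall>a\<in>carrier A. \<forall>b\<in>B.
         \<phi> (ab_class K A B (a \<otimes>\<^bsub>A\<^esub> b)) = lact \<rho> (\<tau> a) (\<phi> (ab_class K A B b)) \<and>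
         \<phi> (ab_class K A B (b \<otimes>\<^bsub>A\<^esub> a)) = ract \<rho> (\<phi> (ab_class K A B b)) (\<tau> a) \<and>
         \<phi> (ab_class K A B (brk A a b)) = lbr \<rho> (\<tau> a) (\<phi> (ab_class K A B b)) \<and>
         \<phi> (ab_class K A B (brk A b a)) = rbr \<rho> (\<phi> (ab_class K A B b)) (\<tau> a)}\<rparr>"

definition restr_ab :: "'k ring \<Rightarrow> ('k, 'a) awb \<Rightarrow> 'a set \<Rightarrow> ('a \<Rightarrow> 'm) \<Rightarrow> 'a set \<Rightarrow> 'm" where
  "restr_ab K A B h = (\<lambda>X\<in>carrier (abelianization K (A\<lparr>carrier := B\<rparr>)). the_elem (h ` X))"

text \<open>The connecting map sends \<open>\<phi>\<close> to the class of the push-forward along \<open>\<phi>\<close> of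
  \<open>0 \<rightarrow> B\<^bsub>ab\<^esub> \<rightarrow> A / [[B, B]] \<rightarrow> A / B \<rightarrow> 0\<close>.\<close>

definition connecting ::
  "'k ring \<Rightarrow> ('k, 'a) awb \<Rightarrow> 'a set \<Rightarrow> ('k, 'q) awb \<Rightarrow> ('k, 'm) module \<Rightarrow> ('q, 'm) action \<Rightarrow> ('a \<Rightarrow> 'q)
     \<Rightarrow> ('a set \<Rightarrow> 'm) \<Rightarrow> ('q, 'm) cochain0 set" where
  "connecting K A B Q M \<rho> \<tau> \<phi> =
     the_elem {class1 K Q M \<rho> (factor_set Q A s (\<lambda>b. \<phi> (ab_class K A B b))) | s. lin_section K A \<tau> Q s}"


section \<open>Abelian extensions\<close>

record ('k, 'm, 'e, 'a) extension =
  ext_obj :: "('k, 'e) awb"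
  ext_inc :: "'m \<Rightarrow> 'e"
  ext_proj :: "'e \<Rightarrow> 'a"

definition abelian_extension ::
  "'k ring \<Rightarrow> ('k, 'a) awb \<Rightarrow> ('k, 'm) module \<Rightarrow> ('a, 'm) action \<Rightarrow> ('k, 'm, 'e, 'a) extension \<Rightarrow> bool"
  where
  "abelian_extension K A M \<rho> E \<longleftrightarrow>
     short_exact K (abelian_awb M) (ext_inc E) (ext_obj E) (ext_proj E) A \<and>
     (\<forall>e\<in>carrier (ext_obj E). \<forall>m\<in>carrier M.
        ext_inc E (lact \<rho> (ext_proj E e) m) = e \<otimes>\<^bsub>ext_obj E\<^esub> ext_inc E m \<and>
        ext_inc E (ract \<rho> m (ext_proj E e)) = ext_inc E m \<otimes>\<^bsub>ext_obj E\<^esub> e \<and>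
        ext_inc E (lbr \<rho> (ext_proj E e) m) = brk (ext_obj E) e (ext_inc E m) \<and>
        ext_inc E (rbr \<rho> m (ext_proj E e)) = brk (ext_obj E) (ext_inc E m) e)"

definition extension_class ::
  "'k ring \<Rightarrow> ('k, 'a) awb \<Rightarrow> ('k, 'm) module \<Rightarrow> ('a, 'm) action \<Rightarrow> ('k, 'm, 'e, 'a) extension
     \<Rightarrow> ('a, 'm) cochain0 set" where
  "extension_class K A M \<rho> E = the_elem
     {class1 K A M \<rho> (factor_set A (ext_obj E) s (inv_into (carrier M) (ext_inc E))) | s.
        lin_section K (ext_obj E) (ext_proj E) A s}"


section \<open>Crossed extensions\<close>

record ('k, 'm, 'c, 'a) xext =
  xobj :: "('k, 'c) awb"
  xinc :: "'m \<Rightarrow> 'c"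
  xproj :: "'c \<Rightarrow> 'a"
  xact :: "('a, 'c) action"

definition crossed_module ::
  "'k ring \<Rightarrow> ('k, 'a) awb \<Rightarrow> ('k, 'c) awb \<Rightarrow> ('a, 'c) action \<Rightarrow> ('c \<Rightarrow> 'a) \<Rightarrow> bool" where
  "crossed_module K A C \<alpha> \<nu> \<longleftrightarrow> awb_action K A C \<alpha> \<and> \<nu> \<in> awb_hom K C A \<and>
     (\<forall>c\<in>carrier C. \<forall>a\<in>carrier A.
        \<nu> (ract \<alpha> c a) = \<nu> c \<otimes>\<^bsub>A\<^esub> a \<and> \<nu> (lact \<alpha> a c) = a \<otimes>\<^bsub>A\<^esub> \<nu> c \<and>
        \<nu> (rbr \<alpha> c a) = brk A (\<nu> c) a \<and> \<nu> (lbr \<alpha> a c) = brk A a (\<nu> c)) \<and>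
     (\<forall>c\<in>carrier C. \<forall>c'\<in>carrier C.
        lact \<alpha> (\<nu> c) c' = c \<otimes>\<^bsub>C\<^esub> c' \<and> c \<otimes>\<^bsub>C\<^esub> c' = ract \<alpha> c (\<nu> c') \<and>
        lbr \<alpha> (\<nu> c) c' = brk C c c' \<and> brk C c c' = rbr \<alpha> c (\<nu> c'))"

text \<open>\<open>\<rho>\<close> is the representation of \<open>A\<close> on \<open>M\<close>.\<close>

definition crossed_extension ::
  "'k ring \<Rightarrow> ('k, 'a) awb \<Rightarrow> 'a set \<Rightarrow> ('k, 'm) module \<Rightarrow> ('a, 'm) action \<Rightarrow> ('k, 'm, 'c, 'a) xext \<Rightarrow> bool"
  where
  "crossed_extension K A B M \<rho> e \<longleftrightarrow>
     short_exact K (abelian_awb M) (xinc e) (xobj e) (xproj e) (A\<lparr>carrier := B\<rparr>) \<and>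
     crossed_module K A (xobj e) (xact e) (xproj e) \<and>
     (\<forall>a\<in>carrier A. \<forall>m\<in>carrier M.
        lact (xact e) a (xinc e m) = xinc e (lact \<rho> a m) \<and>
        ract (xact e) (xinc e m) a = xinc e (ract \<rho> m a) \<and>
        lbr (xact e) a (xinc e m) = xinc e (lbr \<rho> a m) \<and>
        rbr (xact e) (xinc e m) a = xinc e (rbr \<rho> m a))"

definition congruent ::
  "'k ring \<Rightarrow> ('k, 'a) awb \<Rightarrow> ('k, 'm) module \<Rightarrow> ('k, 'm, 'c, 'a) xext \<Rightarrow> ('k, 'm, 'd, 'a) xext \<Rightarrow> bool" where
  "congruent K A M e e' \<longleftrightarrow> (\<exists>\<phi> \<in> awb_hom K (xobj e) (xobj e').
     (\<forall>a\<in>carrier A. \<forall>c\<in>carrier (xobj e).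
        \<phi> (lact (xact e) a c) = lact (xact e') a (\<phi> c) \<and>
        \<phi> (ract (xact e) c a) = ract (xact e') (\<phi> c) a \<and>
        \<phi> (lbr (xact e) a c) = lbr (xact e') a (\<phi> c) \<and>
        \<phi> (rbr (xact e) c a) = rbr (xact e') (\<phi> c) a) \<and>
     (\<forall>c\<in>carrier (xobj e). xproj e' (\<phi> c) = xproj e c) \<and>
     (\<forall>m\<in>carrier M. \<phi> (xinc e m) = xinc e' m))"

text \<open>A congruence class is represented by its members whose underlying type is \<open>'m \<times> 'a\<close>.  No class is
  lost: for a crossed extension \<open>e\<close> over any type \<open>'c\<close>, the set \<open>C\<close> is in bijection with
  \<open>M \<times> B\<close>, and transporting the structure along a bijection gives a congruent crossed extension over
  \<open>'m \<times> 'a\<close>.  The class \<open>xcl\<close> is defined for crossed extensions over any type.\<close>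

definition xcl ::
  "'k ring \<Rightarrow> ('k, 'a) awb \<Rightarrow> 'a set \<Rightarrow> ('k, 'm) module \<Rightarrow> ('a, 'm) action \<Rightarrow> ('k, 'm, 'c, 'a) xext
     \<Rightarrow> ('k, 'm, 'm \<times> 'a, 'a) xext set" where
  "xcl K A B M \<rho> e = {e'. crossed_extension K A B M \<rho> e' \<and> congruent K A M e e'}"

definition fibre_prod ::
  "('k, 'c) awb \<Rightarrow> ('c \<Rightarrow> 'a) \<Rightarrow> ('k, 'd) awb \<Rightarrow> ('d \<Rightarrow> 'a) \<Rightarrow> ('k, 'c \<times> 'd) awb" where
  "fibre_prod C p D q = (awb_prod C D)\<lparr>carrier := {(c, d). c \<in> carrier C \<and> d \<in> carrier D \<and> p c = q d}\<rparr>"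

definition xzero ::
  "('k, 'a) awb \<Rightarrow> 'a set \<Rightarrow> ('k, 'm) module \<Rightarrow> ('a, 'm) action \<Rightarrow> ('k, 'm, 'm \<times> 'a, 'a) xext" where
  "xzero A B M \<rho> = \<lparr>xobj = awb_prod (abelian_awb M) (A\<lparr>carrier := B\<rparr>),
     xinc = (\<lambda>m. (m, \<zero>\<^bsub>A\<^esub>)), xproj = snd, xact = action_prod \<rho> (self_action A)\<rparr>"

definition xadd ::
  "('k, 'm) module \<Rightarrow> ('k, 'm, 'c, 'a) xext \<Rightarrow> ('k, 'm, 'd, 'a) xext \<Rightarrow> ('k, 'm, ('c \<times> 'd) set, 'a) xext"
  where
  "xadd M e e' =
    (let P = fibre_prod (xobj e) (xproj e) (xobj e') (xproj e');
         I = {(xinc e m, \<ominus>\<^bsub>xobj e'\<^esub> (xinc e' m)) | m. m \<in> carrier M}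
     in \<lparr>xobj = awb_quot P I,
         xinc = (\<lambda>m. I +>\<^bsub>P\<^esub> (xinc e m, \<zero>\<^bsub>xobj e'\<^esub>)),
         xproj = (\<lambda>X. the_elem ((\<lambda>(c, c'). xproj e c) ` X)),
         xact = action_quot P I (action_prod (xact e) (xact e'))\<rparr>)"

definition xsmult ::
  "('k, 'm) module \<Rightarrow> ('a, 'm) action \<Rightarrow> 'k \<Rightarrow> ('k, 'm, 'c, 'a) xext \<Rightarrow> ('k, 'm, ('m \<times> 'c) set, 'a) xext"
  where
  "xsmult M \<rho> k e =
    (let P = awb_prod (abelian_awb M) (xobj e);
         I = {(k \<odot>\<^bsub>M\<^esub> m, \<ominus>\<^bsub>xobj e\<^esub> (xinc e m)) | m. m \<in> carrier M}
     in \<lparr>xobj = awb_quot P I,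
         xinc = (\<lambda>m. I +>\<^bsub>P\<^esub> (m, \<zero>\<^bsub>xobj e\<^esub>)),
         xproj = (\<lambda>X. the_elem ((\<lambda>(m, c). xproj e c) ` X)),
         xact = action_quot P I (action_prod \<rho> (xact e))\<rparr>)"

definition XExt ::
  "'k ring \<Rightarrow> ('k, 'a) awb \<Rightarrow> 'a set \<Rightarrow> ('k, 'm) module \<Rightarrow> ('a, 'm) action
     \<Rightarrow> ('k, ('k, 'm, 'm \<times> 'a, 'a) xext set) module" where
  "XExt K A B M \<rho> =
    \<lparr>carrier = xcl K A B M \<rho> ` {e :: ('k, 'm, 'm \<times> 'a, 'a) xext. crossed_extension K A B M \<rho> e},
     mult = undefined, one = undefined,
     zero = xcl K A B M \<rho> (xzero A B M \<rho>),
     add = (\<lambda>X Y. the_elem {xcl K A B M \<rho> (xadd M e e') | e e'. e \<in> X \<and> e' \<in> Y}),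
     smult = (\<lambda>k X. the_elem {xcl K A B M \<rho> (xsmult M \<rho> k e) | e. e \<in> X})\<rparr>"


section \<open>The maps \<open>r\<close> and \<open>\<gamma>\<close>\<close>

text \<open>In \<open>pullback_xext\<close> the element \<open>inv_into (carrier (ext_obj E)) (ext_proj E) a\<close> is a chosen
  preimage of \<open>a\<close>; the action does not depend on it because \<open>B\<close> acts trivially on \<open>M\<close>.\<close>

definition pullback_xext ::
  "('k, 'a) awb \<Rightarrow> 'a set \<Rightarrow> ('k, 'm, 'e, 'a) extension \<Rightarrow> ('k, 'm, 'e \<times> 'a, 'a) xext" where
  "pullback_xext A B E =
    (let X = ext_obj E; lift = inv_into (carrier X) (ext_proj E)
     in \<lparr>xobj = fibre_prod X (ext_proj E) (A\<lparr>carrier := B\<rparr>) (\<lambda>b. b),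
         xinc = (\<lambda>m. (ext_inc E m, \<zero>\<^bsub>A\<^esub>)),
         xproj = snd,
         xact = \<lparr>lact = (\<lambda>a (e, b). (lift a \<otimes>\<^bsub>X\<^esub> e, a \<otimes>\<^bsub>A\<^esub> b)),
                 lbr = (\<lambda>a (e, b). (brk X (lift a) e, brk A a b)),
                 ract = (\<lambda>(e, b) a. (e \<otimes>\<^bsub>X\<^esub> lift a, b \<otimes>\<^bsub>A\<^esub> a)),
                 rbr = (\<lambda>(e, b) a. (brk X e (lift a), brk A b a))\<rparr>\<rparr>)"

text \<open>\<open>\<rho>\<close> is the representation of \<open>A\<close>.  As for crossed extensions, every abelian extension of \<open>A\<close> by
  \<open>M\<close> is equivalent to one with underlying type \<open>'m \<times> 'a\<close>.\<close>

definition map_r ::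
  "'k ring \<Rightarrow> ('k, 'a) awb \<Rightarrow> 'a set \<Rightarrow> ('k, 'm) module \<Rightarrow> ('a, 'm) action
     \<Rightarrow> ('a, 'm) cochain0 set \<Rightarrow> ('k, 'm, 'm \<times> 'a, 'a) xext set" where
  "map_r K A B M \<rho> X = the_elem {xcl K A B M \<rho> (pullback_xext A B E) |
     E :: ('k, 'm, 'm \<times> 'a, 'a) extension. abelian_extension K A M \<rho> E \<and> extension_class K A M \<rho> E = X}"

definition gamma_cocycle ::
  "('k, 'a) awb \<Rightarrow> ('k, 'q) awb \<Rightarrow> ('k, 'm) module \<Rightarrow> ('k, 'm, 'c, 'a) xext
     \<Rightarrow> ('q \<Rightarrow> 'a) \<Rightarrow> ('a \<Rightarrow> 'c) \<Rightarrow> ('q, 'm) cochain1" where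
  "gamma_cocycle A Q M e s \<sigma> =
    (let C = xobj e; \<alpha> = xact e; j = inv_into (carrier M) (xinc e); (f, g) = factor_set Q A s \<sigma>
     in ((\<lambda>x\<in>carrier Q. \<lambda>y\<in>carrier Q. \<lambda>z\<in>carrier Q.
            j (\<ominus>\<^bsub>C\<^esub> (lact \<alpha> (s x) (f y z) \<ominus>\<^bsub>C\<^esub> f (x \<otimes>\<^bsub>Q\<^esub> y) z
                    \<oplus>\<^bsub>C\<^esub> f x (y \<otimes>\<^bsub>Q\<^esub> z) \<ominus>\<^bsub>C\<^esub> ract \<alpha> (f x y) (s z)))),
         (\<lambda>x\<in>carrier Q. \<lambda>y\<in>carrier Q. \<lambda>z\<in>carrier Q.
            j (lact \<alpha> (s x) (g y z) \<ominus>\<^bsub>C\<^esub> g (x \<otimes>\<^bsub>Q\<^esub> y) z \<oplus>\<^bsub>C\<^esub> ract \<alpha> (g x z) (s y)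
               \<ominus>\<^bsub>C\<^esub> rbr \<alpha> (f x y) (s z) \<oplus>\<^bsub>C\<^esub> f (brk Q x z) y \<oplus>\<^bsub>C\<^esub> f x (brk Q y z)))))"

text \<open>\<open>\<rho>\<close> is the representation of \<open>Q = A / B\<close>.\<close>

definition map_gamma ::
  "'k ring \<Rightarrow> ('k, 'a) awb \<Rightarrow> 'a set \<Rightarrow> ('k, 'q) awb \<Rightarrow> ('k, 'm) module \<Rightarrow> ('q, 'm) action \<Rightarrow> ('a \<Rightarrow> 'q)
     \<Rightarrow> ('k, 'm, 'm \<times> 'a, 'a) xext set \<Rightarrow> ('q, 'm) cochain1 set" where
  "map_gamma K A B Q M \<rho> \<tau> X = the_elem {class2 K Q M \<rho> (gamma_cocycle A Q M e s \<sigma>) | e s \<sigma>.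
     e \<in> X \<and> lin_section K A \<tau> Q s \<and> lin_section K (xobj e) (xproj e) (A\<lparr>carrier := B\<rparr>) \<sigma>}"

end

theory Submission
  imports Defs "HOL-Algebra.Free_Abelian_Groups"
begin

text \<open>Inflation along \<open>\<tau>\<close> embeds the cochain complex of \<open>Q = A / B\<close> into that of \<open>A\<close>, and the sequence is
  the long exact sequence of this pair once the two remaining terms are recognised as relative
  cohomology.  A homomorphism \<open>B\<^sub>a\<^sub>b \<rightarrow> M\<close> preserving the action is the restriction to \<open>B\<close> of a linear map
  \<open>h\<close> on \<open>A\<close> whose coboundary is inflated.  A crossed extension becomes \<open>M \<times> B\<close> after choosing a linear
  section of \<open>\<nu>\<close>, and its action is then given by bilinear maps on \<open>A \<times> B\<close> and \<open>B \<times> A\<close>, which extend to a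
  cochain \<open>z\<close> on \<open>A\<close>.  The axioms (A) say that the coboundary of \<open>z\<close> vanishes when an argument lies in
  \<open>B\<close>, i.e. is inflated from \<open>Q\<close>; two cochains give congruent extensions iff they differ by a coboundary
  and an inflated cochain.  Under this identification \<open>r\<close> sends a cocycle to itself, and \<open>\<gamma>\<close> sends \<open>z\<close> to
  the cocycle on \<open>Q\<close> inflating to the coboundary of \<open>z\<close>.\<close>

section \<open>Linear identities in abelian groups\<close>

text \<open>Over a field the maps \<tau> and \<nu> have linear sections, so the short exact
  sequences split linearly and all structure becomes multilinear data on \<open>A\<close>. The
  obstacle is that the terms of the sequence are classes of very different objects: cosets,
  homomorphisms on a quotient, congruence classes of records. Each is therefore presented as the
  image of a submodule of cochains under an explicit map (\<open>class1\<close>,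
  \<open>restr_ab\<close>, \<open>xclass\<close>, \<open>class2\<close>) compatible with sums and
  scalars. Linearity and exactness are then checked on cochains: apply the coboundary, observe that
  the result is inflated, and use that inflation is injective. The relative cocycles in the two
  degrees are \<open>relZm1\<close>, taken modulo inflated maps, and \<open>relZ0\<close>, taken
  modulo coboundaries and inflated cochains. Everything rests on \<open>B\<close> acting by zero on
  \<open>M\<close>: this removes the action terms with an acting argument in \<open>B\<close>, makes
  the defect of each axiom independent of the component in \<open>M\<close>, and makes the choice of
  preimages in the definition of \<open>r\<close> harmless.\<close>

context abelian_group
begin

text \<open>\<open>formal x u\<close> says that \<open>x\<close> is the value of the formal integer combination \<open>u\<close>.  It reduces a
  linear identity in \<open>G\<close> to an identity in the free abelian group, which is a type class instance,
  so that the simplifier's cancellation procedures apply and no carrier conditions remain.\<close>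

definition formal :: "'a \<Rightarrow> ('a \<Rightarrow>\<^sub>0 int) \<Rightarrow> bool" where
  "formal x u \<longleftrightarrow> x \<in> carrier G \<and> Poly_Mapping.keys u \<subseteq> carrier G \<and>
     (\<forall>h \<in> hom (free_Abelian_group (carrier G)) (add_monoid G).
        (\<forall>y\<in>carrier G. h (frag_of y) = y) \<longrightarrow> h u = x)"

lemma formal_atom: "x \<in> carrier G \<Longrightarrow> formal x (frag_of x)"
  by (simp add: formal_def)

lemma formal_add: "formal x u \<Longrightarrow> formal y v \<Longrightarrow> formal (x \<oplus> y) (u + v)"
  using Poly_Mapping.keys_add[of u v]
  by (auto simp: formal_def hom_def Pi_def)

lemma formal_zero: "formal \<zero> 0"
proof -
  have "h 0 = \<zero>" if h: "h \<in> hom (free_Abelian_group (carrier G)) (add_monoid G)" for h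
    using hom_one[OF h] by (simp add: a_group)
  then show ?thesis by (auto simp: formal_def)
qed

lemma formal_neg: assumes "formal x u" shows "formal (\<ominus> x) (- u)"
proof -
  have "h (- u) = \<ominus> (h u)" if h: "h \<in> hom (free_Abelian_group (carrier G)) (add_monoid G)" for h
  proof -
    interpret group_hom "free_Abelian_group (carrier G)" "add_monoid G" h
      using h by (simp add: group_hom_def group_hom_axioms_def a_group)
    show ?thesis using hom_inv[of u] assms by (simp add: formal_def a_inv_def)
  qed
  then show ?thesis using assms by (auto simp: formal_def)
qed

lemma formal_minus: "formal x u \<Longrightarrow> formal y v \<Longrightarrow> formal (x \<ominus> y) (u - v)"
  using formal_add[OF _ formal_neg, of x u y v] by (simp add: a_minus_def)

text \<open>The universal property of the free abelian group provides an evaluation \<open>h\<close>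
  fixing all generators. So the quantifier in \<open>formal\<close> is not vacuous, and
  \<open>x = h u = h v = y\<close>.\<close>

lemma formal_eq:
  assumes "formal x u" "formal y v" "u = v" shows "x = y"
proof -
  obtain h where h: "h \<in> hom (free_Abelian_group (carrier G)) (add_monoid G)"
      "\<And>y. y\<in>carrier G \<Longrightarrow> h (frag_of y) = y"
    using comm_group.free_Abelian_group_universal[OF a_comm_group, of "\<lambda>x. x" "carrier G"] by auto
  then show ?thesis using assms by (auto simp: formal_def)
qed

lemmas formal_op = formal_minus formal_add formal_neg formal_zero

lemma add_minus_cancel: "x \<in> carrier G \<Longrightarrow> y \<in> carrier G \<Longrightarrow> x \<oplus> (y \<ominus> x) = y"
  \<comment> \<open>The pattern of all later linear identities: \<open>formal_op\<close> decomposes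
    both sides along the additive operations, \<open>formal_atom\<close> takes the leaves once
    \<open>simp\<close> proves that they lie in the carrier, and the last \<open>simp\<close>
    compares two combinations of generators.\<close>
  by (rule formal_eq, (rule formal_op | (rule formal_atom, (simp; fail)))+, simp)

lemma eq_add_minus: "x \<in> carrier G \<Longrightarrow> y \<in> carrier G \<Longrightarrow> x = (x \<ominus> y) \<oplus> y"
  by (rule formal_eq, (rule formal_op | (rule formal_atom, (simp; fail)))+, simp)

lemma minus_eq_zero: "x \<in> carrier G \<Longrightarrow> y \<in> carrier G \<Longrightarrow> x \<ominus> y = \<zero> \<Longrightarrow> x = y"
  using eq_add_minus[of x y] by simp

end

section \<open>Linear maps\<close>

lemma module_ag: "module K V \<Longrightarrow> abelian_group V"
  by (simp add: module_def)

text \<open>Collected under the bare hypothesis \<open>module K V\<close>, so that the rules can be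
  instantiated for many modules side by side without interpreting a locale for each.\<close>

lemma module_ops:
  assumes "module K V"
  shows "\<zero>\<^bsub>V\<^esub> \<in> carrier V"
    "\<And>x y. x \<in> carrier V \<Longrightarrow> y \<in> carrier V \<Longrightarrow> x \<oplus>\<^bsub>V\<^esub> y \<in> carrier V"
    "\<And>x y. x \<in> carrier V \<Longrightarrow> y \<in> carrier V \<Longrightarrow> x \<ominus>\<^bsub>V\<^esub> y \<in> carrier V"
    "\<And>x. x \<in> carrier V \<Longrightarrow> \<ominus>\<^bsub>V\<^esub> x \<in> carrier V"
    "\<And>k x. k \<in> carrier K \<Longrightarrow> x \<in> carrier V \<Longrightarrow> k \<odot>\<^bsub>V\<^esub> x \<in> carrier V"
    "\<And>k x y. k \<in> carrier K \<Longrightarrow> x \<in> carrier V \<Longrightarrow> y \<in> carrier V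
       \<Longrightarrow> k \<odot>\<^bsub>V\<^esub> (x \<oplus>\<^bsub>V\<^esub> y) = k \<odot>\<^bsub>V\<^esub> x \<oplus>\<^bsub>V\<^esub> k \<odot>\<^bsub>V\<^esub> y"
    "\<And>k x y. k \<in> carrier K \<Longrightarrow> x \<in> carrier V \<Longrightarrow> y \<in> carrier V
       \<Longrightarrow> k \<odot>\<^bsub>V\<^esub> (x \<ominus>\<^bsub>V\<^esub> y) = k \<odot>\<^bsub>V\<^esub> x \<ominus>\<^bsub>V\<^esub> k \<odot>\<^bsub>V\<^esub> y"
    "\<And>k x. k \<in> carrier K \<Longrightarrow> x \<in> carrier V \<Longrightarrow> k \<odot>\<^bsub>V\<^esub> (\<ominus>\<^bsub>V\<^esub> x) = \<ominus>\<^bsub>V\<^esub> (k \<odot>\<^bsub>V\<^esub> x)"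
    "\<And>k. k \<in> carrier K \<Longrightarrow> k \<odot>\<^bsub>V\<^esub> \<zero>\<^bsub>V\<^esub> = \<zero>\<^bsub>V\<^esub>"
    "\<And>x. x \<in> carrier V \<Longrightarrow> x \<oplus>\<^bsub>V\<^esub> \<zero>\<^bsub>V\<^esub> = x"
    "\<And>x. x \<in> carrier V \<Longrightarrow> \<zero>\<^bsub>V\<^esub> \<oplus>\<^bsub>V\<^esub> x = x"
    "\<And>x. x \<in> carrier V \<Longrightarrow> x \<ominus>\<^bsub>V\<^esub> x = \<zero>\<^bsub>V\<^esub>"
    "\<And>x. x \<in> carrier V \<Longrightarrow> x \<ominus>\<^bsub>V\<^esub> \<zero>\<^bsub>V\<^esub> = x"
    "\<And>x. x \<in> carrier V \<Longrightarrow> \<ominus>\<^bsub>V\<^esub> (\<ominus>\<^bsub>V\<^esub> x) = x"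
    "\<ominus>\<^bsub>V\<^esub> \<zero>\<^bsub>V\<^esub> = \<zero>\<^bsub>V\<^esub>"
proof -
  interpret module K V by fact
  show "\<And>k x y. k \<in> carrier K \<Longrightarrow> x \<in> carrier V \<Longrightarrow> y \<in> carrier V
       \<Longrightarrow> k \<odot>\<^bsub>V\<^esub> (x \<ominus>\<^bsub>V\<^esub> y) = k \<odot>\<^bsub>V\<^esub> x \<ominus>\<^bsub>V\<^esub> k \<odot>\<^bsub>V\<^esub> y"
    by (simp add: a_minus_def smult_r_distr smult_r_minus)
  show "\<And>x. x \<in> carrier V \<Longrightarrow> x \<ominus>\<^bsub>V\<^esub> x = \<zero>\<^bsub>V\<^esub>"
    by (simp add: a_minus_def M.r_neg)
  show "\<ominus>\<^bsub>V\<^esub> \<zero>\<^bsub>V\<^esub> = \<zero>\<^bsub>V\<^esub>" by (rule M.minus_equality) simp_all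
  then show "\<And>x. x \<in> carrier V \<Longrightarrow> x \<ominus>\<^bsub>V\<^esub> \<zero>\<^bsub>V\<^esub> = x"
    by (simp add: a_minus_def)
qed (simp_all add: module.smult_r_distr[OF assms] module.smult_r_minus[OF assms]
      module.smult_closed[OF assms] module.smult_r_null[OF assms] abelian_group.minus_minus[OF module_ag[OF assms]]
      abelian_group.minus_closed[OF module_ag[OF assms]] abelian_group.a_inv_closed[OF module_ag[OF assms]]
      abelian_monoid.a_closed[OF abelian_group.axioms(1)[OF module_ag[OF assms]]]
      abelian_monoid.zero_closed[OF abelian_group.axioms(1)[OF module_ag[OF assms]]]
      abelian_monoid.l_zero[OF abelian_group.axioms(1)[OF module_ag[OF assms]]]
      abelian_monoid.r_zero[OF abelian_group.axioms(1)[OF module_ag[OF assms]]])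

lemma lin_mapI:
  assumes "\<And>x. x \<in> carrier V \<Longrightarrow> f x \<in> carrier W"
    "\<And>x y. x \<in> carrier V \<Longrightarrow> y \<in> carrier V \<Longrightarrow> f (x \<oplus>\<^bsub>V\<^esub> y) = f x \<oplus>\<^bsub>W\<^esub> f y"
    "\<And>k x. k \<in> carrier K \<Longrightarrow> x \<in> carrier V \<Longrightarrow> f (k \<odot>\<^bsub>V\<^esub> x) = k \<odot>\<^bsub>W\<^esub> f x"
  shows "lin_map K V W f"
  using assms by (auto simp: lin_map_def)

lemma lin_mapD:
  assumes "lin_map K V W f"
  shows "\<And>x. x \<in> carrier V \<Longrightarrow> f x \<in> carrier W"
    "\<And>x y. x \<in> carrier V \<Longrightarrow> y \<in> carrier V \<Longrightarrow> f (x \<oplus>\<^bsub>V\<^esub> y) = f x \<oplus>\<^bsub>W\<^esub> f y"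
    "\<And>k x. k \<in> carrier K \<Longrightarrow> x \<in> carrier V \<Longrightarrow> f (k \<odot>\<^bsub>V\<^esub> x) = k \<odot>\<^bsub>W\<^esub> f x"
  using assms by (auto simp: lin_map_def)

lemma add_hom_rules:
  assumes V: "abelian_group V" and W: "abelian_group W"
    and cl: "\<And>x. x \<in> carrier V \<Longrightarrow> f x \<in> carrier W"
    and add: "\<And>x y. x \<in> carrier V \<Longrightarrow> y \<in> carrier V \<Longrightarrow> f (x \<oplus>\<^bsub>V\<^esub> y) = f x \<oplus>\<^bsub>W\<^esub> f y"
  shows "f \<zero>\<^bsub>V\<^esub> = \<zero>\<^bsub>W\<^esub>"
    "\<And>x. x \<in> carrier V \<Longrightarrow> f (\<ominus>\<^bsub>V\<^esub> x) = \<ominus>\<^bsub>W\<^esub> f x"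
    "\<And>x y. x \<in> carrier V \<Longrightarrow> y \<in> carrier V \<Longrightarrow> f (x \<ominus>\<^bsub>V\<^esub> y) = f x \<ominus>\<^bsub>W\<^esub> f y"
proof -
  interpret V: abelian_group V by fact
  interpret W: abelian_group W by fact
  show z: "f \<zero>\<^bsub>V\<^esub> = \<zero>\<^bsub>W\<^esub>"
    using add[of "\<zero>\<^bsub>V\<^esub>" "\<zero>\<^bsub>V\<^esub>"] cl[of "\<zero>\<^bsub>V\<^esub>"] by simp
  show n: "f (\<ominus>\<^bsub>V\<^esub> x) = \<ominus>\<^bsub>W\<^esub> f x" if "x \<in> carrier V" for x
    using add[of "\<ominus>\<^bsub>V\<^esub> x" x] cl that z by (simp add: V.l_neg W.minus_equality)
  show "f (x \<ominus>\<^bsub>V\<^esub> y) = f x \<ominus>\<^bsub>W\<^esub> f y" if "x \<in> carrier V" "y \<in> carrier V" for x y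
    using that n add by (simp add: a_minus_def)
qed

lemma lin_map_rules:
  assumes V: "module K V" and W: "module K W" and f: "lin_map K V W f"
  shows "\<And>x. x \<in> carrier V \<Longrightarrow> f x \<in> carrier W"
    "\<And>x y. x \<in> carrier V \<Longrightarrow> y \<in> carrier V \<Longrightarrow> f (x \<oplus>\<^bsub>V\<^esub> y) = f x \<oplus>\<^bsub>W\<^esub> f y"
    "\<And>k x. k \<in> carrier K \<Longrightarrow> x \<in> carrier V \<Longrightarrow> f (k \<odot>\<^bsub>V\<^esub> x) = k \<odot>\<^bsub>W\<^esub> f x"
    "f \<zero>\<^bsub>V\<^esub> = \<zero>\<^bsub>W\<^esub>"
    "\<And>x. x \<in> carrier V \<Longrightarrow> f (\<ominus>\<^bsub>V\<^esub> x) = \<ominus>\<^bsub>W\<^esub> f x"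
    "\<And>x y. x \<in> carrier V \<Longrightarrow> y \<in> carrier V \<Longrightarrow> f (x \<ominus>\<^bsub>V\<^esub> y) = f x \<ominus>\<^bsub>W\<^esub> f y"
  using lin_mapD[OF f] add_hom_rules[OF module_ag[OF V] module_ag[OF W], of f] by simp_all

lemma lin_map_cong:
  assumes "module K V" "\<And>x. x \<in> carrier V \<Longrightarrow> f x = g x"
  shows "lin_map K V W f \<longleftrightarrow> lin_map K V W g"
  unfolding lin_map_def using assms module_ops[OF assms(1)] by (auto simp: Pi_def)

lemma bilin_mapD:
  assumes "bilin_map K U V W f"
  shows "u \<in> carrier U \<Longrightarrow> lin_map K V W (f u)" "v \<in> carrier V \<Longrightarrow> lin_map K U W (\<lambda>u. f u v)"
  using assms by (auto simp: bilin_map_def)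

lemma bilin_rules:
  assumes U: "module K U" and V: "module K V" and W: "module K W" and f: "bilin_map K U V W f"
  shows "\<And>u v. u \<in> carrier U \<Longrightarrow> v \<in> carrier V \<Longrightarrow> f u v \<in> carrier W"
    "\<And>u u' v. u \<in> carrier U \<Longrightarrow> u' \<in> carrier U \<Longrightarrow> v \<in> carrier V
       \<Longrightarrow> f (u \<oplus>\<^bsub>U\<^esub> u') v = f u v \<oplus>\<^bsub>W\<^esub> f u' v"
    "\<And>u v v'. u \<in> carrier U \<Longrightarrow> v \<in> carrier V \<Longrightarrow> v' \<in> carrier V
       \<Longrightarrow> f u (v \<oplus>\<^bsub>V\<^esub> v') = f u v \<oplus>\<^bsub>W\<^esub> f u v'"
    "\<And>u u' v. u \<in> carrier U \<Longrightarrow> u' \<in> carrier U \<Longrightarrow> v \<in> carrier V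
       \<Longrightarrow> f (u \<ominus>\<^bsub>U\<^esub> u') v = f u v \<ominus>\<^bsub>W\<^esub> f u' v"
    "\<And>u v v'. u \<in> carrier U \<Longrightarrow> v \<in> carrier V \<Longrightarrow> v' \<in> carrier V
       \<Longrightarrow> f u (v \<ominus>\<^bsub>V\<^esub> v') = f u v \<ominus>\<^bsub>W\<^esub> f u v'"
    "\<And>u v. u \<in> carrier U \<Longrightarrow> v \<in> carrier V \<Longrightarrow> f (\<ominus>\<^bsub>U\<^esub> u) v = \<ominus>\<^bsub>W\<^esub> f u v"
    "\<And>u v. u \<in> carrier U \<Longrightarrow> v \<in> carrier V \<Longrightarrow> f u (\<ominus>\<^bsub>V\<^esub> v) = \<ominus>\<^bsub>W\<^esub> f u v"
    "\<And>v. v \<in> carrier V \<Longrightarrow> f \<zero>\<^bsub>U\<^esub> v = \<zero>\<^bsub>W\<^esub>"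
    "\<And>u. u \<in> carrier U \<Longrightarrow> f u \<zero>\<^bsub>V\<^esub> = \<zero>\<^bsub>W\<^esub>"
    "\<And>k u v. k \<in> carrier K \<Longrightarrow> u \<in> carrier U \<Longrightarrow> v \<in> carrier V
       \<Longrightarrow> f (k \<odot>\<^bsub>U\<^esub> u) v = k \<odot>\<^bsub>W\<^esub> f u v"
    "\<And>k u v. k \<in> carrier K \<Longrightarrow> u \<in> carrier U \<Longrightarrow> v \<in> carrier V
       \<Longrightarrow> f u (k \<odot>\<^bsub>V\<^esub> v) = k \<odot>\<^bsub>W\<^esub> f u v"
  using lin_map_rules[OF V W bilin_mapD(1)[OF f]] lin_map_rules[OF U W bilin_mapD(2)[OF f]]
  by simp_all

lemma lin_map_id: "lin_map K V V (\<lambda>x. x)"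
  by (rule lin_mapI) auto

lemma lin_map_comp: "lin_map K V W f \<Longrightarrow> lin_map K U V g \<Longrightarrow> lin_map K U W (\<lambda>x. f (g x))"
  by (rule lin_mapI) (auto simp: lin_mapD)

lemma bilin_comp_l:
  "bilin_map K U V W f \<Longrightarrow> lin_map K T U g \<Longrightarrow> v \<in> carrier V \<Longrightarrow> lin_map K T W (\<lambda>t. f (g t) v)"
  by (rule lin_map_comp[OF bilin_mapD(2)])

lemma bilin_comp_r:
  "bilin_map K U V W f \<Longrightarrow> lin_map K T V g \<Longrightarrow> u \<in> carrier U \<Longrightarrow> lin_map K T W (\<lambda>t. f u (g t))"
  by (rule lin_map_comp[OF bilin_mapD(1)])

lemma lin_map_add:
  assumes W: "module K W" and f: "lin_map K V W f" and g: "lin_map K V W g"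
  shows "lin_map K V W (\<lambda>x. f x \<oplus>\<^bsub>W\<^esub> g x)"
proof (rule lin_mapI)
  interpret W: abelian_group W using W by (rule module_ag)
  fix x y assume "x \<in> carrier V" "y \<in> carrier V"
  then show "f (x \<oplus>\<^bsub>V\<^esub> y) \<oplus>\<^bsub>W\<^esub> g (x \<oplus>\<^bsub>V\<^esub> y) = f x \<oplus>\<^bsub>W\<^esub> g x \<oplus>\<^bsub>W\<^esub> (f y \<oplus>\<^bsub>W\<^esub> g y)"
    by (simp add: lin_mapD[OF f] lin_mapD[OF g] W.a_ac)
qed (simp_all add: lin_mapD[OF f] lin_mapD[OF g] module_ops[OF W])

lemma lin_map_neg:
  assumes W: "module K W" and f: "lin_map K V W f"
  shows "lin_map K V W (\<lambda>x. \<ominus>\<^bsub>W\<^esub> f x)"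
proof (rule lin_mapI)
  interpret W: abelian_group W using W by (rule module_ag)
  fix x y assume "x \<in> carrier V" "y \<in> carrier V"
  then show "\<ominus>\<^bsub>W\<^esub> f (x \<oplus>\<^bsub>V\<^esub> y) = \<ominus>\<^bsub>W\<^esub> f x \<oplus>\<^bsub>W\<^esub> \<ominus>\<^bsub>W\<^esub> f y"
    by (simp add: lin_mapD[OF f] W.minus_add)
qed (simp_all add: lin_mapD[OF f] module_ops[OF W])

lemma lin_map_minus:
  assumes W: "module K W" and f: "lin_map K V W f" and g: "lin_map K V W g"
  shows "lin_map K V W (\<lambda>x. f x \<ominus>\<^bsub>W\<^esub> g x)"
  unfolding a_minus_def by (rule lin_map_add[OF W f lin_map_neg[OF W g]])

lemma lin_map_smult:
  assumes W: "module K W" and k: "k \<in> carrier K" and f: "lin_map K V W f"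
  shows "lin_map K V W (\<lambda>x. k \<odot>\<^bsub>W\<^esub> f x)"
proof (rule lin_mapI)
  interpret W: module K W by fact
  fix c x assume "c \<in> carrier K" "x \<in> carrier V"
  then show "k \<odot>\<^bsub>W\<^esub> f (c \<odot>\<^bsub>V\<^esub> x) = c \<odot>\<^bsub>W\<^esub> (k \<odot>\<^bsub>W\<^esub> f x)"
    using k by (simp add: lin_mapD[OF f] W.smult_assoc1[symmetric] W.m_comm)
qed (simp_all add: lin_mapD[OF f] module_ops[OF W] k)

lemma lin_map_zero: "module K W \<Longrightarrow> lin_map K V W (\<lambda>x. \<zero>\<^bsub>W\<^esub>)"
  by (rule lin_mapI) (simp_all add: module_ops)

lemma lin_map_restrict:
  "module K V \<Longrightarrow> lin_map K V W (\<lambda>x\<in>carrier V. f x) \<longleftrightarrow> lin_map K V W f"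
  by (rule lin_map_cong) auto

lemma bilin_mapI:
  "(\<And>u. u \<in> carrier U \<Longrightarrow> lin_map K V W (f u)) \<Longrightarrow> (\<And>v. v \<in> carrier V \<Longrightarrow> lin_map K U W (\<lambda>u. f u v))
     \<Longrightarrow> bilin_map K U V W f"
  by (simp add: bilin_map_def)

lemma bilin_map_restrict:
  assumes "module K U" "module K V"
  shows "bilin_map K U V W (\<lambda>u\<in>carrier U. \<lambda>v\<in>carrier V. f u v) \<longleftrightarrow> bilin_map K U V W f"
  unfolding bilin_map_def
  by (intro arg_cong2[where f="(\<and>)"] ball_cong lin_map_cong refl assms)  (simp_all add: lin_map_restrict assms)

definition trilin_map where
  "trilin_map K U W f \<longleftrightarrow> (\<forall>u\<in>carrier U. bilin_map K U U W (f u)) \<and>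
     (\<forall>v\<in>carrier U. \<forall>w\<in>carrier U. lin_map K U W (\<lambda>u. f u v w))"

lemma trilin_mapI:
  "(\<And>u v. u \<in> carrier U \<Longrightarrow> v \<in> carrier U \<Longrightarrow> lin_map K U W (\<lambda>x. f u v x)) \<Longrightarrow>
   (\<And>u v. u \<in> carrier U \<Longrightarrow> v \<in> carrier U \<Longrightarrow> lin_map K U W (\<lambda>x. f u x v)) \<Longrightarrow>
   (\<And>u v. u \<in> carrier U \<Longrightarrow> v \<in> carrier U \<Longrightarrow> lin_map K U W (\<lambda>x. f x u v)) \<Longrightarrow> trilin_map K U W f"
  by (simp add: trilin_map_def bilin_map_def)

lemma trilin_mapD:
  assumes "trilin_map K U W f" "u \<in> carrier U" "v \<in> carrier U"
  shows "lin_map K U W (\<lambda>x. f u v x)" "lin_map K U W (\<lambda>x. f u x v)" "lin_map K U W (\<lambda>x. f x u v)"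
  using assms by (auto simp: trilin_map_def bilin_map_def)

lemma trilin_map_restrict:
  assumes "module K U"
  shows "trilin_map K U W (\<lambda>u\<in>carrier U. \<lambda>v\<in>carrier U. \<lambda>w\<in>carrier U. f u v w) \<longleftrightarrow> trilin_map K U W f"
  unfolding trilin_map_def
  by (intro arg_cong2[where f="(\<and>)"] ball_cong lin_map_cong refl assms)
    (simp_all add: lin_map_restrict bilin_map_restrict assms)

section \<open>Modules of linear maps\<close>

lemma hom_mod_carrier: "h \<in> carrier (hom_mod K V W) \<longleftrightarrow> h \<in> extensional (carrier V) \<and> lin_map K V W h"
  by (simp add: hom_mod_def)

lemma hom_mod_ops:
  "\<zero>\<^bsub>hom_mod K V W\<^esub> = (\<lambda>v\<in>carrier V. \<zero>\<^bsub>W\<^esub>)"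
  "f \<oplus>\<^bsub>hom_mod K V W\<^esub> g = (\<lambda>v\<in>carrier V. f v \<oplus>\<^bsub>W\<^esub> g v)"
  "k \<odot>\<^bsub>hom_mod K V W\<^esub> f = (\<lambda>v\<in>carrier V. k \<odot>\<^bsub>W\<^esub> f v)"
  by (simp_all add: hom_mod_def)

lemma module_hom_mod:
  assumes V: "module K V" and W: "module K W"
  shows "module K (hom_mod K V W)"
proof -
  interpret W: module K W by fact
  have neg: "\<exists>y\<in>carrier (hom_mod K V W). y \<oplus>\<^bsub>hom_mod K V W\<^esub> x = \<zero>\<^bsub>hom_mod K V W\<^esub>"
    if "x \<in> carrier (hom_mod K V W)" for x
    using that
    by (intro bexI[of _ "\<lambda>v\<in>carrier V. \<ominus>\<^bsub>W\<^esub> x v"])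
      (auto simp: hom_mod_carrier hom_mod_ops lin_map_restrict V lin_map_neg W lin_mapD W.l_neg
        intro!: restrict_ext)
  show ?thesis
  proof (intro moduleI abelian_groupI W.R.is_cring)
    show "\<And>x. x \<in> carrier (hom_mod K V W) \<Longrightarrow>
      \<exists>y\<in>carrier (hom_mod K V W). y \<oplus>\<^bsub>hom_mod K V W\<^esub> x = \<zero>\<^bsub>hom_mod K V W\<^esub>" by (rule neg)
  qed (auto simp: hom_mod_carrier hom_mod_ops lin_map_restrict V lin_map_add lin_map_smult lin_map_zero W
      lin_mapD W.a_ac W.smult_l_distr W.smult_r_distr W.smult_assoc1 fun_eq_iff extensional_def)
qed

text \<open>Elements of \<open>hom_mod\<close> are extensional and its operations are pointwise.
  Linearity of \<open>F\<close> as a map into \<open>hom_mod\<close> is therefore linearity of every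
  \<open>\<lambda>u. F u v\<close>.\<close>

lemma hom2_iff:
  assumes V: "module K V"
  shows "F \<in> carrier (hom_mod K V (hom_mod K V W)) \<longleftrightarrow>
    F \<in> extensional (carrier V) \<and> (\<forall>a\<in>carrier V. F a \<in> extensional (carrier V)) \<and> bilin_map K V V W F"
proof -
  have eq: "F x = (\<lambda>v\<in>carrier V. g v) \<longleftrightarrow> (\<forall>v\<in>carrier V. F x v = g v)"
    if "F x \<in> extensional (carrier V)" for F :: "'b \<Rightarrow> 'b \<Rightarrow> 'd" and x g
    using that by (auto simp: fun_eq_iff extensional_def)
  show ?thesis
    unfolding hom_mod_carrier lin_map_def bilin_map_def
    using module_ops[OF V]
    by (auto simp: Pi_def eq hom_mod_carrier hom_mod_ops lin_map_def)
qed

text \<open>The two inner arguments are covered by \<open>hom2_iff\<close>. Linearity in the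
  outermost one is an equation between extensional functions, hence again pointwise.\<close>

lemma hom3_iff:
  assumes V: "module K V" 
  shows "F \<in> carrier (hom_mod K V (hom_mod K V (hom_mod K V W))) \<longleftrightarrow>
    F \<in> extensional (carrier V) \<and> (\<forall>a\<in>carrier V. F a \<in> extensional (carrier V) \<and>
    (\<forall>b\<in>carrier V. F a b \<in> extensional (carrier V))) \<and> trilin_map K V W F"
  (is "?L \<longleftrightarrow> ?R")
proof
  assume ?L
  then have e: "F \<in> extensional (carrier V)" and F: "lin_map K V (hom_mod K V (hom_mod K V W)) F"
    unfolding hom_mod_carrier[of F] by auto
  have "lin_map K V W (\<lambda>u. F u v w)" if "v \<in> carrier V" "w \<in> carrier V" for v w
  proof (rule lin_mapI)
    show "F x v w \<in> carrier W" if "x \<in> carrier V" for x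
      using lin_mapD(1)[OF F that] lin_mapD(1)[OF bilin_mapD(1), of K V V W "F x" v w] \<open>v \<in> _\<close> \<open>w \<in> _\<close>
      by (simp add: hom2_iff[OF V])
  qed (simp_all add: that lin_mapD[OF F] hom_mod_ops)
  then show ?R using e lin_mapD(1)[OF F] by (auto simp: hom2_iff[OF V] trilin_map_def)
next
  assume R: ?R
  have *: "f = (\<lambda>v\<in>carrier V. \<lambda>w\<in>carrier V. g v w)"
    if "f \<in> extensional (carrier V)" "\<And>v. v \<in> carrier V \<Longrightarrow> f v \<in> extensional (carrier V)"
      "\<And>v w. v \<in> carrier V \<Longrightarrow> w \<in> carrier V \<Longrightarrow> f v w = g v w" for f g :: "'b \<Rightarrow> 'b \<Rightarrow> 'd"
    using that by (auto simp: fun_eq_iff extensional_def)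
  have t: "trilin_map K V W F" and b: "bilin_map K V V W (F x)" if "x \<in> carrier V" for x
    using R that by (auto simp: trilin_map_def)
  have "lin_map K V (hom_mod K V (hom_mod K V W)) F"
  proof (rule lin_mapI)
    show "F (x \<oplus>\<^bsub>V\<^esub> y) = F x \<oplus>\<^bsub>hom_mod K V (hom_mod K V W)\<^esub> F y"
      if xy: "x \<in> carrier V" "y \<in> carrier V" for x y
      using R xy trilin_mapD(3)[OF t[OF xy(1)], THEN lin_mapD(2)]
      by (simp add: hom_mod_ops module_ops[OF V] cong: restrict_cong) (intro *; simp add: module_ops[OF V])
    show "F (k \<odot>\<^bsub>V\<^esub> x) = k \<odot>\<^bsub>hom_mod K V (hom_mod K V W)\<^esub> F x"
      if xy: "k \<in> carrier K" "x \<in> carrier V" for k x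
      using R xy trilin_mapD(3)[OF t[OF xy(2)], THEN lin_mapD(3)]
      by (simp add: hom_mod_ops module_ops[OF V] cong: restrict_cong) (intro *; simp add: module_ops[OF V])
  qed (use R b in \<open>simp add: hom2_iff[OF V]\<close>)
  then show ?L using R by (simp add: hom_mod_carrier[of F])
qed

lemma mod_prod_simps:
  "carrier (mod_prod V W) = carrier V \<times> carrier W"
  "\<zero>\<^bsub>mod_prod V W\<^esub> = (\<zero>\<^bsub>V\<^esub>, \<zero>\<^bsub>W\<^esub>)"
  "(v, w) \<oplus>\<^bsub>mod_prod V W\<^esub> (v', w') = (v \<oplus>\<^bsub>V\<^esub> v', w \<oplus>\<^bsub>W\<^esub> w')"
  "k \<odot>\<^bsub>mod_prod V W\<^esub> (v, w) = (k \<odot>\<^bsub>V\<^esub> v, k \<odot>\<^bsub>W\<^esub> w)"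
  by (simp_all add: mod_prod_def)

lemma module_mod_prod:
  assumes V: "module K V" and W: "module K W"
  shows "module K (mod_prod V W)"
proof -
  interpret V: module K V by fact
  interpret W: module K W by fact
  show ?thesis
  proof (intro moduleI abelian_groupI V.R.is_cring)
    fix x assume "x \<in> carrier (mod_prod V W)"
    then show "\<exists>y\<in>carrier (mod_prod V W). y \<oplus>\<^bsub>mod_prod V W\<^esub> x = \<zero>\<^bsub>mod_prod V W\<^esub>"
      by (intro bexI[of _ "(\<ominus>\<^bsub>V\<^esub> fst x, \<ominus>\<^bsub>W\<^esub> snd x)"]) (auto simp: mod_prod_simps V.l_neg W.l_neg)
  qed (auto simp: mod_prod_simps V.a_ac W.a_ac V.smult_l_distr V.smult_r_distr W.smult_l_distr
      W.smult_r_distr V.smult_assoc1 W.smult_assoc1)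
qed

section \<open>Quotient modules\<close>

text \<open>A surjection compatible with the operations carries every module axiom to its target. It
  serves for quotients, for \<open>Hom_ab\<close> and \<open>XExt\<close>, whose operations are
  known only on representatives, and with the identity as \<pi> for records that share their linear
  structure.\<close>

lemma module_image:
  assumes V: "module K V" and c: "carrier T = \<pi> ` carrier V"
    and add: "\<And>x y. x \<in> carrier V \<Longrightarrow> y \<in> carrier V \<Longrightarrow> \<pi> x \<oplus>\<^bsub>T\<^esub> \<pi> y = \<pi> (x \<oplus>\<^bsub>V\<^esub> y)"
    and smult: "\<And>k x. k \<in> carrier K \<Longrightarrow> x \<in> carrier V \<Longrightarrow> k \<odot>\<^bsub>T\<^esub> \<pi> x = \<pi> (k \<odot>\<^bsub>V\<^esub> x)"
    and zero: "\<zero>\<^bsub>T\<^esub> = \<pi> \<zero>\<^bsub>V\<^esub>"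
  shows "module K T"
proof -
  interpret V: module K V by fact
  show ?thesis
  proof (intro moduleI abelian_groupI V.R.is_cring)
    fix x assume "x \<in> carrier T"
    then obtain x' where "x = \<pi> x'" "x' \<in> carrier V" by (auto simp: c)
    then show "\<exists>y\<in>carrier T. y \<oplus>\<^bsub>T\<^esub> x = \<zero>\<^bsub>T\<^esub>"
      by (intro bexI[of _ "\<pi> (\<ominus>\<^bsub>V\<^esub> x')"]) (simp_all add: c add zero V.l_neg)
  qed (unfold c, ((elim imageE)?, simp add: add smult zero V.a_ac V.smult_l_distr V.smult_r_distr
      V.smult_assoc1)+)
qed

lemma submodule_rules:
  assumes V: "module K V" and I: "submodule I K V"
  shows "\<zero>\<^bsub>V\<^esub> \<in> I" "\<And>x. x \<in> I \<Longrightarrow> x \<in> carrier V"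
    "\<And>x y. x \<in> I \<Longrightarrow> y \<in> I \<Longrightarrow> x \<oplus>\<^bsub>V\<^esub> y \<in> I"
    "\<And>x. x \<in> I \<Longrightarrow> \<ominus>\<^bsub>V\<^esub> x \<in> I"
    "\<And>x y. x \<in> I \<Longrightarrow> y \<in> I \<Longrightarrow> x \<ominus>\<^bsub>V\<^esub> y \<in> I"
    "\<And>k x. k \<in> carrier K \<Longrightarrow> x \<in> I \<Longrightarrow> k \<odot>\<^bsub>V\<^esub> x \<in> I"
  using module.submoduleE[OF V I] subgroup.one_closed[OF submodule.axioms(1)[OF I]]
  by (auto simp: a_minus_def)

lemma coset_mem:
  "y \<in> I +>\<^bsub>V\<^esub> x \<longleftrightarrow> (\<exists>w\<in>I. y = w \<oplus>\<^bsub>V\<^esub> x)"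
  by (auto simp: a_r_coset_def')

lemma coset_eqI:
  assumes V: "module K V" and I: "submodule I K V" and "x \<in> carrier V" "w \<in> I"
  shows "I +>\<^bsub>V\<^esub> (w \<oplus>\<^bsub>V\<^esub> x) = I +>\<^bsub>V\<^esub> x"
proof -
  interpret V: module K V by fact
  have "w \<oplus>\<^bsub>V\<^esub> x \<in> I +>\<^bsub>V\<^esub> x" using assms by (auto simp: coset_mem)
  then show ?thesis
    using V.a_repr_independence[of "w \<oplus>\<^bsub>V\<^esub> x" I x] assms submodule.axioms(1)[OF I] by simp
qed

lemma coset_self:
  assumes V: "module K V" and I: "submodule I K V" and "x \<in> carrier V"
  shows "x \<in> I +>\<^bsub>V\<^esub> x"
  using assms submodule_rules(1)[OF V I] by (force simp: coset_mem module_ops[OF V])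

lemma coset_eq_iff:
  assumes V: "module K V" and I: "submodule I K V" and "x \<in> carrier V" "y \<in> carrier V"
  shows "I +>\<^bsub>V\<^esub> x = I +>\<^bsub>V\<^esub> y \<longleftrightarrow> (\<exists>w\<in>I. x = w \<oplus>\<^bsub>V\<^esub> y)"
  using coset_eqI[OF V I] coset_self[OF V I] assms by (metis coset_mem)

lemma coset_add:
  assumes V: "module K V" and I: "submodule I K V" and "x \<in> carrier V" "y \<in> carrier V"
  shows "set_add V (I +>\<^bsub>V\<^esub> x) (I +>\<^bsub>V\<^esub> y) = I +>\<^bsub>V\<^esub> (x \<oplus>\<^bsub>V\<^esub> y)"
proof -
  interpret V: module K V by fact
  interpret abelian_subgroup I V
    using submodule.axioms(1)[OF I] by (simp add: abelian_subgroupI3 additive_subgroup.intro V.abelian_group_axioms)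
  show ?thesis using assms by (simp add: a_rcos_sum)
qed

lemma coset_smult:
  assumes V: "module K V" and I: "submodule I K V" and x: "x \<in> carrier V" and k: "k \<in> carrier K"
  shows "(\<Union>t\<in>I +>\<^bsub>V\<^esub> x. I +>\<^bsub>V\<^esub> (k \<odot>\<^bsub>V\<^esub> t)) = I +>\<^bsub>V\<^esub> (k \<odot>\<^bsub>V\<^esub> x)"
proof -
  have "I +>\<^bsub>V\<^esub> (k \<odot>\<^bsub>V\<^esub> t) = I +>\<^bsub>V\<^esub> (k \<odot>\<^bsub>V\<^esub> x)" if "t \<in> I +>\<^bsub>V\<^esub> x" for t
    using that x k submodule_rules[OF V I] coset_eqI[OF V I] by (auto simp: coset_mem module_ops[OF V])
  then show ?thesis using coset_self[OF V I x] by blast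
qed

lemma coset_zero:
  assumes V: "module K V" and I: "submodule I K V" shows "I +>\<^bsub>V\<^esub> \<zero>\<^bsub>V\<^esub> = I"
  using module_ops(10)[OF V] submodule_rules[OF V I] by (auto simp: coset_mem)

lemma coset_carrier: "I +>\<^bsub>V\<lparr>carrier := Z\<rparr>\<^esub> x = I +>\<^bsub>V\<^esub> x"
  by (simp add: a_r_coset_def')

lemma mod_quot_carrier: "carrier (mod_quot V I) = (\<lambda>x. I +>\<^bsub>V\<^esub> x) ` carrier V"
  by (auto simp: mod_quot_def A_RCOSETS_def')

lemma mod_quot_ops:
  assumes "module K V" "submodule I K V"
  shows "\<And>x y. x \<in> carrier V \<Longrightarrow> y \<in> carrier V \<Longrightarrow>
      (I +>\<^bsub>V\<^esub> x) \<oplus>\<^bsub>mod_quot V I\<^esub> (I +>\<^bsub>V\<^esub> y) = I +>\<^bsub>V\<^esub> (x \<oplus>\<^bsub>V\<^esub> y)"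
    "\<And>k x. k \<in> carrier K \<Longrightarrow> x \<in> carrier V \<Longrightarrow>
      k \<odot>\<^bsub>mod_quot V I\<^esub> (I +>\<^bsub>V\<^esub> x) = I +>\<^bsub>V\<^esub> (k \<odot>\<^bsub>V\<^esub> x)"
    "\<zero>\<^bsub>mod_quot V I\<^esub> = I +>\<^bsub>V\<^esub> \<zero>\<^bsub>V\<^esub>"
  using assms by (simp_all add: mod_quot_def coset_add coset_smult coset_zero)

lemma module_mod_quot:
  assumes "module K V" "submodule I K V" shows "module K (mod_quot V I)"
  by (rule module_image[OF assms(1) mod_quot_carrier]) (use assms in \<open>simp_all add: mod_quot_ops\<close>)

text \<open>Linearity of a map defined on classes is checked on representatives; each map of the
  exact sequence that starts from a space of classes is treated in this way.\<close>

lemma lin_map_image: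
  assumes V: "module K V" and c: "carrier T = \<pi> ` carrier V"
    and add: "\<And>x y. x \<in> carrier V \<Longrightarrow> y \<in> carrier V \<Longrightarrow> \<pi> x \<oplus>\<^bsub>T\<^esub> \<pi> y = \<pi> (x \<oplus>\<^bsub>V\<^esub> y)"
    and smult: "\<And>k x. k \<in> carrier K \<Longrightarrow> x \<in> carrier V \<Longrightarrow> k \<odot>\<^bsub>T\<^esub> \<pi> x = \<pi> (k \<odot>\<^bsub>V\<^esub> x)"
    and g: "lin_map K V W (\<lambda>x. g (\<pi> x))"
  shows "lin_map K T W g"
proof (rule lin_mapI)
  note G = lin_mapD[OF g]
  show "g x \<in> carrier W" if "x \<in> carrier T" for x using that G by (auto simp: c)
  show "g (x \<oplus>\<^bsub>T\<^esub> y) = g x \<oplus>\<^bsub>W\<^esub> g y" if xy: "x \<in> carrier T" "y \<in> carrier T" for x y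
  proof -
    obtain x' y' where *: "x = \<pi> x'" "y = \<pi> y'" "x' \<in> carrier V" "y' \<in> carrier V" using xy by (auto simp: c)
    then show ?thesis using G(2)[of x' y'] by (simp add: add)
  qed
  show "g (k \<odot>\<^bsub>T\<^esub> x) = k \<odot>\<^bsub>W\<^esub> g x" if "k \<in> carrier K" "x \<in> carrier T" for k x
    using that G(3) by (auto simp: c smult)
qed

section \<open>Linear sections\<close>

text \<open>A maximal submodule on which \<open>p\<close> has trivial kernel is a complement of the
  kernel, and the inverse of \<open>p\<close> on it is the section. Zorn's lemma replaces the choice
  of a basis.\<close>

lemma lin_section_exists:
  assumes K: "field K" and V: "module K V" and W: "module K W" and p: "lin_map K V W p"
    and surj: "p ` carrier V = carrier W"
  obtains s where "lin_section K V p W s"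
proof -
  interpret K: field K by fact
  interpret V: module K V by fact
  interpret W: module K W by fact
  note P = lin_map_rules[OF V W p]
  \<comment> \<open>Submodules meeting the kernel of \<open>p\<close> only in zero. A union of a
    chain of them is again one.\<close>
  define \<S> where "\<S> = {S. submodule S K V \<and> (\<forall>x\<in>S. p x = \<zero>\<^bsub>W\<^esub> \<longrightarrow> x = \<zero>\<^bsub>V\<^esub>)}"
  have "\<exists>S\<in>\<S>. \<forall>X\<in>\<S>. S \<subseteq> X \<longrightarrow> X = S"
  proof (rule subset_Zorn_nonempty)
    have "{\<zero>\<^bsub>V\<^esub>} \<in> \<S>" by (auto simp: \<S>_def intro!: V.submoduleI)
    then show "\<S> \<noteq> {}" by blast
    fix C assume C: "C \<noteq> {}" "subset.chain \<S> C"
    then have sub: "submodule S K V" if "S \<in> C" for S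
      using that by (auto simp: \<S>_def subset.chain_def)
    note rl = submodule_rules[OF V sub]
    have "submodule (\<Union>C) K V"
    proof (rule V.submoduleI)
      fix a b assume "a \<in> \<Union>C" "b \<in> \<Union>C"
      then obtain S T where "a \<in> S" "b \<in> T" "S \<in> C" "T \<in> C" by blast
      moreover from this have "S \<subseteq> T \<or> T \<subseteq> S" using C(2) by (auto simp: subset.chain_def)
      ultimately show "a \<oplus>\<^bsub>V\<^esub> b \<in> \<Union>C" using rl(3)[of S a b] rl(3)[of T a b] by blast
    next
      show "\<zero>\<^bsub>V\<^esub> \<in> \<Union>C" using C(1) rl(1) by fast
  qed (auto intro: rl(2) rl(4) rl(6))
    then show "\<Union>C \<in> \<S>" using C(2) by (auto simp: \<S>_def subset.chain_def)
  qed
  then obtain S where S: "S \<in> \<S>" and max: "\<And>X. X \<in> \<S> \<Longrightarrow> S \<subseteq> X \<Longrightarrow> X = S" by blast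
  then have sub: "submodule S K V" and S0: "\<And>x. x \<in> S \<Longrightarrow> p x = \<zero>\<^bsub>W\<^esub> \<Longrightarrow> x = \<zero>\<^bsub>V\<^esub>" by (auto simp: \<S>_def)
  note rl = submodule_rules[OF V sub]
  have onto: "w \<in> p ` S" if w: "w \<in> carrier W" for w
  proof (rule ccontr)
    assume nw: "w \<notin> p ` S"
    obtain v where v: "v \<in> carrier V" "w = p v" using w surj by blast
    \<comment> \<open>If \<open>w\<close> is missed, enlarging \<open>S\<close> by the line through
      a preimage \<open>v\<close> still gives a member of \<S>, against maximality.\<close>
    define X where "X = {x \<oplus>\<^bsub>V\<^esub> k \<odot>\<^bsub>V\<^esub> v | x k. x \<in> S \<and> k \<in> carrier K}"
    have XI: "x \<oplus>\<^bsub>V\<^esub> k \<odot>\<^bsub>V\<^esub> v \<in> X" if "x \<in> S" "k \<in> carrier K" for x k using that by (auto simp: X_def)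
    have "submodule X K V"
    proof (rule V.submoduleI)
      show "X \<subseteq> carrier V" using rl v by (auto simp: X_def)
      show "\<zero>\<^bsub>V\<^esub> \<in> X" using XI[of "\<zero>\<^bsub>V\<^esub>" "\<zero>\<^bsub>K\<^esub>"] rl v by simp
      show "\<ominus>\<^bsub>V\<^esub> a \<in> X" if a: "a \<in> X" for a
      proof -
        obtain x k where x: "x \<in> S" "k \<in> carrier K" "a = x \<oplus>\<^bsub>V\<^esub> k \<odot>\<^bsub>V\<^esub> v" using a by (auto simp: X_def)
        then show ?thesis using XI[of "\<ominus>\<^bsub>V\<^esub> x" "\<ominus>\<^bsub>K\<^esub> k"] v rl
          by (simp add: V.minus_add V.smult_l_minus)
      qed
      show "a \<oplus>\<^bsub>V\<^esub> b \<in> X" if ab: "a \<in> X" "b \<in> X" for a b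
      proof -
        obtain x k y l where x: "x \<in> S" "k \<in> carrier K" "a = x \<oplus>\<^bsub>V\<^esub> k \<odot>\<^bsub>V\<^esub> v"
          "y \<in> S" "l \<in> carrier K" "b = y \<oplus>\<^bsub>V\<^esub> l \<odot>\<^bsub>V\<^esub> v" using ab by (auto simp: X_def)
        then show ?thesis using XI[of "x \<oplus>\<^bsub>V\<^esub> y" "k \<oplus>\<^bsub>K\<^esub> l"] v rl
          by (simp add: V.smult_l_distr V.M.a_ac)
      qed
      show "c \<odot>\<^bsub>V\<^esub> a \<in> X" if c: "c \<in> carrier K" "a \<in> X" for c a
      proof -
        obtain x k where x: "x \<in> S" "k \<in> carrier K" "a = x \<oplus>\<^bsub>V\<^esub> k \<odot>\<^bsub>V\<^esub> v" using c by (auto simp: X_def)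
        then show ?thesis using XI[of "c \<odot>\<^bsub>V\<^esub> x" "c \<otimes>\<^bsub>K\<^esub> k"] v rl c
          by (simp add: V.smult_r_distr V.smult_assoc1)
      qed
    qed
    moreover have "a = \<zero>\<^bsub>V\<^esub>" if a: "a \<in> X" "p a = \<zero>\<^bsub>W\<^esub>" for a
    proof -
      obtain x k where x: "x \<in> S" "k \<in> carrier K" "a = x \<oplus>\<^bsub>V\<^esub> k \<odot>\<^bsub>V\<^esub> v" using a by (auto simp: X_def)
      \<comment> \<open>Otherwise division by \<open>k\<close> exhibits \<open>w\<close> as the
        image of an element of \<open>S\<close>. This is where the scalars being a field
        enters.\<close>
      have k0: "k = \<zero>\<^bsub>K\<^esub>"
      proof (rule ccontr)
        assume "k \<noteq> \<zero>\<^bsub>K\<^esub>"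
        then have k: "inv\<^bsub>K\<^esub> k \<in> carrier K" "inv\<^bsub>K\<^esub> k \<otimes>\<^bsub>K\<^esub> k = \<one>\<^bsub>K\<^esub>"
          using x K.field_Units by (auto intro: K.Units_l_inv K.Units_inv_closed)
        have "p x \<oplus>\<^bsub>W\<^esub> k \<odot>\<^bsub>W\<^esub> w = \<zero>\<^bsub>W\<^esub>" using a x rl v P by simp
        then have "p (\<ominus>\<^bsub>V\<^esub> x) = k \<odot>\<^bsub>W\<^esub> w"
          using x rl(2) w P by (simp add: W.minus_equality[symmetric] W.M.a_comm W.minus_equality)
        then have "p (inv\<^bsub>K\<^esub> k \<odot>\<^bsub>V\<^esub> (\<ominus>\<^bsub>V\<^esub> x)) = w"
          using x rl k w P(3)[of "inv\<^bsub>K\<^esub> k" "\<ominus>\<^bsub>V\<^esub> x"] by (simp add: W.smult_assoc1[symmetric])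
        moreover have "inv\<^bsub>K\<^esub> k \<odot>\<^bsub>V\<^esub> (\<ominus>\<^bsub>V\<^esub> x) \<in> S" using x k by (simp add: rl(4,6))
        ultimately show False using nw by blast
      qed
      with x v rl have "a = x" by simp
      then show ?thesis using S0 x a by simp
    qed
    ultimately have "X \<in> \<S>" by (simp add: \<S>_def)
    moreover have "x \<in> X" if "x \<in> S" for x using XI[OF that K.zero_closed] rl(2)[OF that] v by simp
    ultimately have "X = S" by (intro max subsetI)
    moreover have "v \<in> X" using XI[of "\<zero>\<^bsub>V\<^esub>" "\<one>\<^bsub>K\<^esub>"] rl v by simp
    ultimately show False using nw v by blast
  qed
  define s where "s = inv_into S p"
  have sS: "s w \<in> S" and ps: "p (s w) = w" if "w \<in> carrier W" for w
    using onto[OF that] by (auto simp: s_def inv_into_into f_inv_into_f)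
  \<comment> \<open>An element of \<open>S\<close> is determined by its image, and \<open>S\<close>
    is closed under sums and multiples. So \<open>s\<close> is additive and homogeneous.\<close>
  have uniq: "s w = x" if "x \<in> S" "p x = w" for x w
  proof -
    have w: "w \<in> carrier W" using that rl P by auto
    have "p (s w \<ominus>\<^bsub>V\<^esub> x) = \<zero>\<^bsub>W\<^esub>" using that sS[OF w] ps[OF w] rl(2) w P by (simp add: module_ops[OF W])
    then have "s w \<ominus>\<^bsub>V\<^esub> x = \<zero>\<^bsub>V\<^esub>" using S0[OF rl(5)[OF sS[OF w] that(1)]] by simp
    then show ?thesis by (rule V.M.minus_eq_zero[OF rl(2)[OF sS[OF w]] rl(2)[OF that(1)]])
  qed
  have "lin_map K W V s"
  proof (rule lin_mapI)
    show "s (x \<oplus>\<^bsub>W\<^esub> y) = s x \<oplus>\<^bsub>V\<^esub> s y" if "x \<in> carrier W" "y \<in> carrier W" for x y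
      using that by (intro uniq) (simp_all add: rl sS ps P)
    show "s (k \<odot>\<^bsub>W\<^esub> x) = k \<odot>\<^bsub>V\<^esub> s x" if "k \<in> carrier K" "x \<in> carrier W" for x k
      using that by (intro uniq) (simp_all add: rl sS ps P)
  qed (simp add: rl(2) sS)
  then show ?thesis using that ps by (auto simp: lin_section_def)
qed

section \<open>Cohomology of a representation\<close>

text \<open>Only the axioms (A) are assumed, and \<open>M\<close> may carry further record fields.
  The same rewriting then serves for the representation \<open>M\<close> and for the algebra
  \<open>C\<close> of a crossed extension.\<close>

locale actmod =
  fixes K :: "'k ring" and A :: "('k, 'a) awb" and M :: "('k, 'm, 'z) module_scheme" and \<rho> :: "('a, 'm) action"
  assumes awb: "AWB K A" and mM: "module K M" and bil: "action_bilin K A M \<rho>" and actA: "action_A A M \<rho>"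
begin

lemma mA: "module K A" and fK: "field K"
  using awb by (auto simp: AWB_def)

lemma agA: "abelian_group A" and agM: "abelian_group M"
  using mA mM by (auto intro: module_ag)

lemma bils: "bilin_map K A M M (lact \<rho>)" "bilin_map K A M M (lbr \<rho>)" "bilin_map K M A M (ract \<rho>)" "bilin_map K M A M (rbr \<rho>)"
   "bilin_map K A A A (mult A)" "bilin_map K A A A (brk A)"
  using bil AWB.mult_bilin[OF awb] AWB.brk_bilin[OF awb] by (auto simp: action_bilin_def)

lemmas [simp] = bilin_rules[OF mA mM mM bils(1)] bilin_rules[OF mA mM mM bils(2)]
  bilin_rules[OF mM mA mM bils(3)] bilin_rules[OF mM mA mM bils(4)] bilin_rules[OF mA mA mA bils(5)]
  bilin_rules[OF mA mA mA bils(6)] module_ops[OF mM] module_ops[OF mA]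

text \<open>Oriented so that products disappear from the acting arguments, right actions move inside
  left ones, and brackets with a translate are expanded. Cochain identities then become linear
  identities between normal forms, within reach of \<open>feq\<close>.\<close>

lemma act_simps [simp]:
  assumes "a1 \<in> carrier A" "a2 \<in> carrier A" "c \<in> carrier M"
  shows "lact \<rho> (a1 \<otimes>\<^bsub>A\<^esub> a2) c = lact \<rho> a1 (lact \<rho> a2 c)"
     "ract \<rho> c (a1 \<otimes>\<^bsub>A\<^esub> a2) = ract \<rho> (ract \<rho> c a1) a2"
     "ract \<rho> (lact \<rho> a1 c) a2 = lact \<rho> a1 (ract \<rho> c a2)"
     "rbr \<rho> (lact \<rho> a1 c) a2 = lact \<rho> a1 (rbr \<rho> c a2) \<oplus>\<^bsub>M\<^esub> lact \<rho> (brk A a1 a2) c"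
     "rbr \<rho> (ract \<rho> c a1) a2 = ract \<rho> (rbr \<rho> c a2) a1 \<oplus>\<^bsub>M\<^esub> ract \<rho> c (brk A a1 a2)"
     "lbr \<rho> (a1 \<otimes>\<^bsub>A\<^esub> a2) c = lact \<rho> a1 (lbr \<rho> a2 c) \<oplus>\<^bsub>M\<^esub> ract \<rho> (lbr \<rho> a1 c) a2"
  using actA assms unfolding action_A_def by blast+

lemma alg_simps [simp]:
  assumes "x \<in> carrier A" "y \<in> carrier A" "z \<in> carrier A"
  shows "(x \<otimes>\<^bsub>A\<^esub> y) \<otimes>\<^bsub>A\<^esub> z = x \<otimes>\<^bsub>A\<^esub> (y \<otimes>\<^bsub>A\<^esub> z)"
    "brk A (x \<otimes>\<^bsub>A\<^esub> y) z = brk A x z \<otimes>\<^bsub>A\<^esub> y \<oplus>\<^bsub>A\<^esub> x \<otimes>\<^bsub>A\<^esub> brk A y z"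
  using AWB.mult_assoc[OF awb] AWB.brk_mult[OF awb] assms by auto

lemmas feq = abelian_group.formal_eq[OF agM]
lemmas fop = abelian_group.formal_op[OF agM]
lemmas fatom = abelian_group.formal_atom[OF agM]

lemmas lin_intros = lin_map_add[OF mM] lin_map_neg[OF mM] lin_map_minus[OF mM]
  bilin_comp_l[OF bils(1)] bilin_comp_r[OF bils(1)] bilin_comp_l[OF bils(2)] bilin_comp_r[OF bils(2)]
  bilin_comp_l[OF bils(3)] bilin_comp_r[OF bils(3)] bilin_comp_l[OF bils(4)] bilin_comp_r[OF bils(4)]
  bilin_comp_l[OF bils(5)] bilin_comp_r[OF bils(5)] bilin_comp_l[OF bils(6)] bilin_comp_r[OF bils(6)]
  lin_map_id

end

locale rep = actmod K A M \<rho> for K :: "'k ring" and A :: "('k, 'a) awb" and M :: "('k, 'm) module" and \<rho>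
begin

lemma Km1_iff: "h \<in> carrier (Km1 K A M) \<longleftrightarrow> h \<in> extensional (carrier A) \<and> lin_map K A M h"
  by (simp add: Km1_def hom_mod_carrier)

lemma K0_iff: "(f, g) \<in> carrier (K0 K A M) \<longleftrightarrow>
   f \<in> extensional (carrier A) \<and> (\<forall>a\<in>carrier A. f a \<in> extensional (carrier A)) \<and> bilin_map K A A M f \<and>
   g \<in> extensional (carrier A) \<and> (\<forall>a\<in>carrier A. g a \<in> extensional (carrier A)) \<and> bilin_map K A A M g"
  by (simp add: K0_def mod_prod_simps hom2_iff[OF mA] conj_assoc)

lemma K1_iff: "(f, g) \<in> carrier (K1 K A M) \<longleftrightarrow>
   f \<in> extensional (carrier A) \<and> (\<forall>a\<in>carrier A. f a \<in> extensional (carrier A) \<and>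
     (\<forall>b\<in>carrier A. f a b \<in> extensional (carrier A))) \<and> trilin_map K A M f \<and>
   g \<in> extensional (carrier A) \<and> (\<forall>a\<in>carrier A. g a \<in> extensional (carrier A) \<and>
     (\<forall>b\<in>carrier A. g a b \<in> extensional (carrier A))) \<and> trilin_map K A M g"
  by (simp add: K1_def mod_prod_simps hom3_iff[OF mA] conj_assoc)

lemma mKm1: "module K (Km1 K A M)" and mK0: "module K (K0 K A M)" and mK1: "module K (K1 K A M)"
  by (simp_all add: Km1_def K0_def K1_def module_mod_prod module_hom_mod mA mM)

lemma K0_add: "a \<in> carrier A \<Longrightarrow> b \<in> carrier A \<Longrightarrow> fst (z \<oplus>\<^bsub>K0 K A M\<^esub> w) a b = fst z a b \<oplus>\<^bsub>M\<^esub> fst w a b"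
  "a \<in> carrier A \<Longrightarrow> b \<in> carrier A \<Longrightarrow> snd (z \<oplus>\<^bsub>K0 K A M\<^esub> w) a b = snd z a b \<oplus>\<^bsub>M\<^esub> snd w a b"
  "a \<in> carrier A \<Longrightarrow> b \<in> carrier A \<Longrightarrow> fst (k \<odot>\<^bsub>K0 K A M\<^esub> z) a b = k \<odot>\<^bsub>M\<^esub> fst z a b"
  "a \<in> carrier A \<Longrightarrow> b \<in> carrier A \<Longrightarrow> snd (k \<odot>\<^bsub>K0 K A M\<^esub> z) a b = k \<odot>\<^bsub>M\<^esub> snd z a b"
  "a \<in> carrier A \<Longrightarrow> b \<in> carrier A \<Longrightarrow> fst (\<zero>\<^bsub>K0 K A M\<^esub>) a b = \<zero>\<^bsub>M\<^esub>"
  "a \<in> carrier A \<Longrightarrow> b \<in> carrier A \<Longrightarrow> snd (\<zero>\<^bsub>K0 K A M\<^esub>) a b = \<zero>\<^bsub>M\<^esub>"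
  by (cases z; cases w; simp add: K0_def mod_prod_simps hom_mod_ops)+

lemma K1_add: "a \<in> carrier A \<Longrightarrow> b \<in> carrier A \<Longrightarrow> c \<in> carrier A \<Longrightarrow> fst (z \<oplus>\<^bsub>K1 K A M\<^esub> w) a b c = fst z a b c \<oplus>\<^bsub>M\<^esub> fst w a b c"
  "a \<in> carrier A \<Longrightarrow> b \<in> carrier A \<Longrightarrow> c \<in> carrier A \<Longrightarrow> snd (z \<oplus>\<^bsub>K1 K A M\<^esub> w) a b c = snd z a b c \<oplus>\<^bsub>M\<^esub> snd w a b c"
  "a \<in> carrier A \<Longrightarrow> b \<in> carrier A \<Longrightarrow> c \<in> carrier A \<Longrightarrow> fst (k \<odot>\<^bsub>K1 K A M\<^esub> z) a b c = k \<odot>\<^bsub>M\<^esub> fst z a b c"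
  "a \<in> carrier A \<Longrightarrow> b \<in> carrier A \<Longrightarrow> c \<in> carrier A \<Longrightarrow> snd (k \<odot>\<^bsub>K1 K A M\<^esub> z) a b c = k \<odot>\<^bsub>M\<^esub> snd z a b c"
  "a \<in> carrier A \<Longrightarrow> b \<in> carrier A \<Longrightarrow> c \<in> carrier A \<Longrightarrow> fst (\<zero>\<^bsub>K1 K A M\<^esub>) a b c = \<zero>\<^bsub>M\<^esub>"
  "a \<in> carrier A \<Longrightarrow> b \<in> carrier A \<Longrightarrow> c \<in> carrier A \<Longrightarrow> snd (\<zero>\<^bsub>K1 K A M\<^esub>) a b c = \<zero>\<^bsub>M\<^esub>"
  by (cases z; cases w; simp add: K1_def mod_prod_simps hom_mod_ops)+

lemma Km1_add: "a \<in> carrier A \<Longrightarrow> (h \<oplus>\<^bsub>Km1 K A M\<^esub> h') a = h a \<oplus>\<^bsub>M\<^esub> h' a"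
  "a \<in> carrier A \<Longrightarrow> (k \<odot>\<^bsub>Km1 K A M\<^esub> h) a = k \<odot>\<^bsub>M\<^esub> h a"
  "a \<in> carrier A \<Longrightarrow> \<zero>\<^bsub>Km1 K A M\<^esub> a = \<zero>\<^bsub>M\<^esub>"
  by (simp_all add: Km1_def hom_mod_ops)

lemma K0_eqI:
  assumes "z \<in> carrier (K0 K A M)" "w \<in> carrier (K0 K A M)"
    "\<And>a b. a \<in> carrier A \<Longrightarrow> b \<in> carrier A \<Longrightarrow> fst z a b = fst w a b"
    "\<And>a b. a \<in> carrier A \<Longrightarrow> b \<in> carrier A \<Longrightarrow> snd z a b = snd w a b"
  shows "z = w"
proof -
  have "f = g" if "f \<in> extensional (carrier A)" "\<forall>a\<in>carrier A. f a \<in> extensional (carrier A)"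
    "g \<in> extensional (carrier A)" "\<forall>a\<in>carrier A. g a \<in> extensional (carrier A)"
    "\<And>a b. a \<in> carrier A \<Longrightarrow> b \<in> carrier A \<Longrightarrow> f a b = g a b" for f g :: "'a \<Rightarrow> 'a \<Rightarrow> 'm"
    using that by (metis extensionalityI)
  then show ?thesis using assms by (cases z; cases w) (simp add: K0_iff)
qed

lemma K1_eqI:
  assumes "z \<in> carrier (K1 K A M)" "w \<in> carrier (K1 K A M)"
    "\<And>a b c. a \<in> carrier A \<Longrightarrow> b \<in> carrier A \<Longrightarrow> c \<in> carrier A \<Longrightarrow> fst z a b c = fst w a b c"
    "\<And>a b c. a \<in> carrier A \<Longrightarrow> b \<in> carrier A \<Longrightarrow> c \<in> carrier A \<Longrightarrow> snd z a b c = snd w a b c"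
  shows "z = w"
proof -
  have "f = g" if f: "f \<in> extensional (carrier A)" "\<forall>a\<in>carrier A. f a \<in> extensional (carrier A) \<and> (\<forall>b\<in>carrier A. f a b \<in> extensional (carrier A))"
    and g: "g \<in> extensional (carrier A)" "\<forall>a\<in>carrier A. g a \<in> extensional (carrier A) \<and> (\<forall>b\<in>carrier A. g a b \<in> extensional (carrier A))"
    and e: "\<And>a b c. a \<in> carrier A \<Longrightarrow> b \<in> carrier A \<Longrightarrow> c \<in> carrier A \<Longrightarrow> f a b c = g a b c" for f g :: "'a \<Rightarrow> 'a \<Rightarrow> 'a \<Rightarrow> 'm"
  proof (rule extensionalityI[OF f(1) g(1)])
    fix a assume a: "a \<in> carrier A"
    show "f a = g a"
    proof (rule extensionalityI[of _ "carrier A"])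
      fix b assume b: "b \<in> carrier A"
      show "f a b = g a b" by (rule extensionalityI[of _ "carrier A"]) (use f g a b e in auto)
    qed (use f g a in auto)
  qed
  then show ?thesis using assms by (cases z; cases w) (simp add: K1_iff)
qed

lemma dm1_val:
  assumes "a \<in> carrier A" "b \<in> carrier A"
  shows "fst (dm1 A M \<rho> h) a b = \<ominus>\<^bsub>M\<^esub> (lact \<rho> a (h b)) \<oplus>\<^bsub>M\<^esub> h (a \<otimes>\<^bsub>A\<^esub> b) \<ominus>\<^bsub>M\<^esub> ract \<rho> (h a) b"
   "snd (dm1 A M \<rho> h) a b = \<ominus>\<^bsub>M\<^esub> (lbr \<rho> a (h b)) \<oplus>\<^bsub>M\<^esub> h (brk A a b) \<ominus>\<^bsub>M\<^esub> rbr \<rho> (h a) b"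
  using assms by (simp_all add: dm1_def)

lemma d0_val:
  assumes "a0 \<in> carrier A" "a1 \<in> carrier A" "a2 \<in> carrier A"
  shows "fst (d0 A M \<rho> z) a0 a1 a2 = \<ominus>\<^bsub>M\<^esub> (lact \<rho> a0 (fst z a1 a2) \<ominus>\<^bsub>M\<^esub> fst z (a0 \<otimes>\<^bsub>A\<^esub> a1) a2
             \<oplus>\<^bsub>M\<^esub> fst z a0 (a1 \<otimes>\<^bsub>A\<^esub> a2) \<ominus>\<^bsub>M\<^esub> ract \<rho> (fst z a0 a1) a2)"
   "snd (d0 A M \<rho> z) a0 a1 a2 = lact \<rho> a0 (snd z a1 a2) \<oplus>\<^bsub>M\<^esub> ract \<rho> (snd z a0 a2) a1 \<ominus>\<^bsub>M\<^esub> snd z (a0 \<otimes>\<^bsub>A\<^esub> a1) a2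
          \<ominus>\<^bsub>M\<^esub> rbr \<rho> (fst z a0 a1) a2 \<oplus>\<^bsub>M\<^esub> fst z (brk A a0 a2) a1 \<oplus>\<^bsub>M\<^esub> fst z a0 (brk A a1 a2)"
  using assms by (cases z, simp add: d0_def)+

lemma K0_bil: assumes "z \<in> carrier (K0 K A M)" shows "bilin_map K A A M (fst z)" "bilin_map K A A M (snd z)"
  using assms by (cases z, simp add: K0_iff)+

lemmas K0_rules = bilin_rules[OF mA mA mM K0_bil(1)] bilin_rules[OF mA mA mM K0_bil(2)]

lemma dm1_K0: assumes "h \<in> carrier (Km1 K A M)" shows "dm1 A M \<rho> h \<in> carrier (K0 K A M)"
proof -
  have h: "lin_map K A M h" using assms by (simp add: Km1_iff)
  note [simp] = lin_map_rules[OF mA mM h]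
  show ?thesis
    unfolding dm1_def K0_iff
    by (auto simp: bilin_map_restrict mA intro!: bilin_mapI lin_intros lin_map_comp[OF h])
qed

lemma d0_K1: assumes z: "z \<in> carrier (K0 K A M)" shows "d0 A M \<rho> z \<in> carrier (K1 K A M)"
proof -
  note [simp] = K0_rules[OF z]
  note I = lin_intros bilin_comp_l[OF K0_bil(1)[OF z]] bilin_comp_r[OF K0_bil(1)[OF z]]
    bilin_comp_l[OF K0_bil(2)[OF z]] bilin_comp_r[OF K0_bil(2)[OF z]]
  \<comment> \<open>Writing \<open>d0\<close> as the restriction of its own values lets linearity be
    tested in each argument separately on the formulas of \<open>d0_val\<close>.\<close>
  have "d0 A M \<rho> z = (\<lambda>a0\<in>carrier A. \<lambda>a1\<in>carrier A. \<lambda>a2\<in>carrier A. fst (d0 A M \<rho> z) a0 a1 a2,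
     \<lambda>a0\<in>carrier A. \<lambda>a1\<in>carrier A. \<lambda>a2\<in>carrier A. snd (d0 A M \<rho> z) a0 a1 a2)"
    by (cases z) (simp add: d0_def cong: restrict_cong)
  also have "\<dots> \<in> carrier (K1 K A M)"
    unfolding K1_iff trilin_map_restrict[OF mA]
    by (auto intro!: trilin_mapI) (subst lin_map_cong[OF mA d0_val(1)] lin_map_cong[OF mA d0_val(2)]; auto intro!: I)+
  finally show ?thesis .
qed

lemma dm1_lin: "lin_map K (Km1 K A M) (K0 K A M) (dm1 A M \<rho>)"
proof (rule lin_mapI)
  fix h h' assume hh: "h \<in> carrier (Km1 K A M)" "h' \<in> carrier (Km1 K A M)"
  then have l: "lin_map K A M h" "lin_map K A M h'" by (auto simp: Km1_iff)
  note [simp] = lin_map_rules[OF mA mM l(1)] lin_map_rules[OF mA mM l(2)] Km1_add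
  show "dm1 A M \<rho> (h \<oplus>\<^bsub>Km1 K A M\<^esub> h') = dm1 A M \<rho> h \<oplus>\<^bsub>K0 K A M\<^esub> dm1 A M \<rho> h'"
    by (rule K0_eqI; (intro dm1_K0 module_ops[OF mK0] module_ops[OF mKm1] hh)?; simp add: K0_add dm1_val)
      (rule feq, (rule fop | (rule fatom, (simp; fail)))+, simp add: algebra_simps)+
next
  fix k h assume hh: "k \<in> carrier K" "h \<in> carrier (Km1 K A M)"
  then have l: "lin_map K A M h" by (auto simp: Km1_iff)
  note [simp] = lin_map_rules[OF mA mM l] Km1_add hh
  show "dm1 A M \<rho> (k \<odot>\<^bsub>Km1 K A M\<^esub> h) = k \<odot>\<^bsub>K0 K A M\<^esub> dm1 A M \<rho> h"
    by (rule K0_eqI; (intro dm1_K0 module_ops[OF mK0] module_ops[OF mKm1] hh)?; simp add: K0_add dm1_val)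
qed (rule dm1_K0)

lemma d0_lin: "lin_map K (K0 K A M) (K1 K A M) (d0 A M \<rho>)"
proof (rule lin_mapI)
  fix h h' assume hh: "h \<in> carrier (K0 K A M)" "h' \<in> carrier (K0 K A M)"
  note [simp] = K0_rules[OF hh(1)] K0_rules[OF hh(2)] K0_add
  show "d0 A M \<rho> (h \<oplus>\<^bsub>K0 K A M\<^esub> h') = d0 A M \<rho> h \<oplus>\<^bsub>K1 K A M\<^esub> d0 A M \<rho> h'"
    by (rule K1_eqI; (intro d0_K1 module_ops[OF mK1] module_ops[OF mK0] hh)?; simp add: K1_add d0_val)
      (rule feq, (rule fop | (rule fatom, (simp; fail)))+, simp add: algebra_simps)+
next
  fix k h assume hh: "k \<in> carrier K" "h \<in> carrier (K0 K A M)"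
  note [simp] = K0_rules[OF hh(2)] hh K0_add
  show "d0 A M \<rho> (k \<odot>\<^bsub>K0 K A M\<^esub> h) = k \<odot>\<^bsub>K1 K A M\<^esub> d0 A M \<rho> h"
    by (rule K1_eqI; (intro d0_K1 module_ops[OF mK1] module_ops[OF mK0] hh)?; simp add: K1_add d0_val)
qed (rule d0_K1)

text \<open>The terms in which one argument sits alone under \<open>h\<close> cancel by (A): in the
  first component by its three product axioms, in the second by its three bracket axioms, one for
  each position of that argument. The terms with all three arguments under \<open>h\<close> cancel
  by associativity and by the rule for the bracket of a product.\<close>

lemma d0_dm1: assumes hh: "h \<in> carrier (Km1 K A M)" shows "d0 A M \<rho> (dm1 A M \<rho> h) = \<zero>\<^bsub>K1 K A M\<^esub>"
proof -
  have "lin_map K A M h" using assms by (simp add: Km1_iff)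
  note [simp] = lin_map_rules[OF mA mM this]
  show ?thesis
    by (rule K1_eqI; (intro d0_K1 dm1_K0 module_ops[OF mK1] hh)?; simp add: K1_add d0_val dm1_val)
      (rule feq, (rule fop | (rule fatom, (simp; fail)))+, simp add: algebra_simps)+
qed

text \<open>The composite of consecutive coboundaries vanishes once more. The next coboundary is
  present only through the two cocycle equations, the second of which couples the components
  \<open>F\<close> and \<open>G\<close>.\<close>

lemma d0_cocycles1: assumes z: "z \<in> carrier (K0 K A M)" shows "d0 A M \<rho> z \<in> cocycles1 K A M \<rho>"
proof -
  note [simp] = K0_rules[OF z]
  obtain F G where FG: "d0 A M \<rho> z = (F, G)" by (cases "d0 A M \<rho> z")
  then have F: "F = fst (d0 A M \<rho> z)" and G: "G = snd (d0 A M \<rho> z)" by simp_all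
  have "(F, G) \<in> cocycles1 K A M \<rho>"
    unfolding cocycles1_def mem_Collect_eq case_prod_conv
  proof (intro conjI ballI)
    show "(F, G) \<in> carrier (K1 K A M)" using d0_K1[OF z] FG by simp
    fix a0 a1 a2 a3 assume [simp]: "a0 \<in> carrier A" "a1 \<in> carrier A" "a2 \<in> carrier A" "a3 \<in> carrier A"
    show "lact \<rho> a0 (F a1 a2 a3) \<ominus>\<^bsub>M\<^esub> F (a0 \<otimes>\<^bsub>A\<^esub> a1) a2 a3 \<oplus>\<^bsub>M\<^esub> F a0 (a1 \<otimes>\<^bsub>A\<^esub> a2) a3
        \<ominus>\<^bsub>M\<^esub> F a0 a1 (a2 \<otimes>\<^bsub>A\<^esub> a3) \<oplus>\<^bsub>M\<^esub> ract \<rho> (F a0 a1 a2) a3 = \<zero>\<^bsub>M\<^esub>"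
      by (simp add: F d0_val) (rule feq, (rule fop | (rule fatom, (simp; fail)))+, simp add: algebra_simps)
    show "rbr \<rho> (F a0 a1 a2) a3 \<ominus>\<^bsub>M\<^esub> F (brk A a0 a3) a1 a2
        \<ominus>\<^bsub>M\<^esub> F a0 (brk A a1 a3) a2 \<ominus>\<^bsub>M\<^esub> F a0 a1 (brk A a2 a3)
      = lact \<rho> a0 (G a1 a2 a3) \<ominus>\<^bsub>M\<^esub> G (a0 \<otimes>\<^bsub>A\<^esub> a1) a2 a3
        \<oplus>\<^bsub>M\<^esub> G a0 (a1 \<otimes>\<^bsub>A\<^esub> a2) a3 \<ominus>\<^bsub>M\<^esub> ract \<rho> (G a0 a1 a3) a2"
      by (simp add: F G d0_val) (rule feq, (rule fop | (rule fatom, (simp; fail)))+, simp add: algebra_simps)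
  qed
  then show ?thesis by (simp add: FG)
qed

end

text \<open>Maps on classes are given as \<open>the_elem\<close> of the set of values on all
  representatives and choices. Well-definedness thus means that one choice exists and that all
  choices give the same value.\<close>

lemma the_elem_image: "x \<in> X \<Longrightarrow> (\<And>y. y \<in> X \<Longrightarrow> f y = c) \<Longrightarrow> the_elem (f ` X) = c"
  by (rule the_elem_image_unique[THEN trans]) auto

lemma the_elem_Collect: "P x \<Longrightarrow> (\<And>y. P y \<Longrightarrow> f y = c) \<Longrightarrow> the_elem {f y | y. P y} = c"
  using the_elem_image[of x "Collect P" f c] by (simp add: setcompr_eq_image)

lemma submoduleI':
  assumes V: "module K V" and "S \<subseteq> carrier V" "\<zero>\<^bsub>V\<^esub> \<in> S"
    "\<And>x y. x \<in> S \<Longrightarrow> y \<in> S \<Longrightarrow> x \<oplus>\<^bsub>V\<^esub> y \<in> S"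
    and s: "\<And>k x. k \<in> carrier K \<Longrightarrow> x \<in> S \<Longrightarrow> k \<odot>\<^bsub>V\<^esub> x \<in> S"
  shows "submodule S K V"
proof -
  interpret V: module K V by fact
  show ?thesis
  proof (rule V.submoduleI)
    fix x assume x: "x \<in> S"
    then have "x \<in> carrier V" using assms by auto
    then have "\<ominus>\<^bsub>V\<^esub> x = (\<ominus>\<^bsub>K\<^esub> \<one>\<^bsub>K\<^esub>) \<odot>\<^bsub>V\<^esub> x" by (simp add: V.smult_l_minus)
    then show "\<ominus>\<^bsub>V\<^esub> x \<in> S" using s[OF _ x] by simp
  qed (use assms in auto)
qed

lemma submodule_kernel:
  assumes V: "module K V" and W: "module K W" and f: "lin_map K V W f"
  shows "submodule (a_kernel V W f) K V"
  by (rule submoduleI'[OF V])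
    (auto simp: a_kernel_def' lin_map_rules[OF V W f] module_ops[OF V] module_ops[OF W])

lemma submodule_image:
  assumes V: "module K V" and W: "module K W" and f: "lin_map K V W f"
  shows "submodule (f ` carrier V) K W"
proof (rule submoduleI'[OF W])
  note [simp] = lin_map_rules[OF V W f] module_ops[OF V]
  show "\<zero>\<^bsub>W\<^esub> \<in> f ` carrier V" by (rule image_eqI[of _ _ "\<zero>\<^bsub>V\<^esub>"]) simp_all
  show "x \<oplus>\<^bsub>W\<^esub> y \<in> f ` carrier V" if xy: "x \<in> f ` carrier V" "y \<in> f ` carrier V" for x y
  proof -
    obtain x' y' where *: "x = f x'" "y = f y'" "x' \<in> carrier V" "y' \<in> carrier V" using xy by auto
    then show ?thesis by (intro image_eqI[of _ _ "x' \<oplus>\<^bsub>V\<^esub> y'"]) simp_all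
  qed
  show "k \<odot>\<^bsub>W\<^esub> x \<in> f ` carrier V" if kx: "k \<in> carrier K" "x \<in> f ` carrier V" for k x
  proof -
    obtain x' where *: "x = f x'" "x' \<in> carrier V" using kx by auto
    then show ?thesis using kx by (intro image_eqI[of _ _ "k \<odot>\<^bsub>V\<^esub> x'"]) simp_all
  qed
  show "f ` carrier V \<subseteq> carrier W" by auto
qed

lemma submodule_restrict:
  assumes V: "module K V" and I: "submodule I K V" and Z: "submodule Z K V" and "I \<subseteq> Z"
  shows "submodule I K (V\<lparr>carrier := Z\<rparr>)"
  by (rule submoduleI'[OF submodule.submodule_is_module[OF Z V]])
    (use assms submodule_rules[OF V I] in auto)

section \<open>Cocycles, coboundaries and the cohomology spaces\<close>

context rep
begin

definition "Z1 = a_kernel (K0 K A M) (K1 K A M) (d0 A M \<rho>)"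

lemma Z1_iff: "z \<in> Z1 \<longleftrightarrow> z \<in> carrier (K0 K A M) \<and> d0 A M \<rho> z = \<zero>\<^bsub>K1 K A M\<^esub>"
  by (simp add: Z1_def a_kernel_def')

lemma Z1_sub: "submodule Z1 K (K0 K A M)"
  unfolding Z1_def by (rule submodule_kernel[OF mK0 mK1 d0_lin])

lemma cobound0_sub: "submodule (cobound0 K A M \<rho>) K (K0 K A M)"
  unfolding cobound0_def by (rule submodule_image[OF mKm1 mK0 dm1_lin])

lemma cobound1_sub: "submodule (cobound1 K A M \<rho>) K (K1 K A M)"
  unfolding cobound1_def by (rule submodule_image[OF mK0 mK1 d0_lin])

lemma K1_tri: assumes "z \<in> carrier (K1 K A M)" shows "trilin_map K A M (fst z)" "trilin_map K A M (snd z)"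
  using assms by (cases z, simp add: K1_iff)+

lemma K1_closed: assumes "z \<in> carrier (K1 K A M)" "a \<in> carrier A" "b \<in> carrier A" "c \<in> carrier A"
  shows "fst z a b c \<in> carrier M" "snd z a b c \<in> carrier M"
  using lin_mapD(1)[OF trilin_mapD(1)[OF K1_tri(1)]] lin_mapD(1)[OF trilin_mapD(1)[OF K1_tri(2)]] assms
  by blast+

lemma cocycles1_iff: "z \<in> cocycles1 K A M \<rho> \<longleftrightarrow> z \<in> carrier (K1 K A M) \<and>
    (\<forall>a0\<in>carrier A. \<forall>a1\<in>carrier A. \<forall>a2\<in>carrier A. \<forall>a3\<in>carrier A.
      lact \<rho> a0 (fst z a1 a2 a3) \<ominus>\<^bsub>M\<^esub> fst z (a0 \<otimes>\<^bsub>A\<^esub> a1) a2 a3 \<oplus>\<^bsub>M\<^esub> fst z a0 (a1 \<otimes>\<^bsub>A\<^esub> a2) a3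
        \<ominus>\<^bsub>M\<^esub> fst z a0 a1 (a2 \<otimes>\<^bsub>A\<^esub> a3) \<oplus>\<^bsub>M\<^esub> ract \<rho> (fst z a0 a1 a2) a3 = \<zero>\<^bsub>M\<^esub> \<and>
      rbr \<rho> (fst z a0 a1 a2) a3 \<ominus>\<^bsub>M\<^esub> fst z (brk A a0 a3) a1 a2
        \<ominus>\<^bsub>M\<^esub> fst z a0 (brk A a1 a3) a2 \<ominus>\<^bsub>M\<^esub> fst z a0 a1 (brk A a2 a3)
      = lact \<rho> a0 (snd z a1 a2 a3) \<ominus>\<^bsub>M\<^esub> snd z (a0 \<otimes>\<^bsub>A\<^esub> a1) a2 a3
        \<oplus>\<^bsub>M\<^esub> snd z a0 (a1 \<otimes>\<^bsub>A\<^esub> a2) a3 \<ominus>\<^bsub>M\<^esub> ract \<rho> (snd z a0 a1 a3) a2)"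
  by (cases z) (simp only: cocycles1_def mem_Collect_eq case_prod_conv fst_conv snd_conv)

lemma cocycles1_sub: "submodule (cocycles1 K A M \<rho>) K (K1 K A M)"
proof (rule submoduleI'[OF mK1])
  \<comment> \<open>Only linearity in the cochain is at stake here, so the axioms of the action and
    of the algebra are kept from expanding arguments; the terms stay atoms that match on both
    sides.\<close>
  note [simp del] = act_simps alg_simps
  show "cocycles1 K A M \<rho> \<subseteq> carrier (K1 K A M)" by (auto simp: cocycles1_iff)
  show "\<zero>\<^bsub>K1 K A M\<^esub> \<in> cocycles1 K A M \<rho>"
    by (simp add: cocycles1_iff K1_add module_ops[OF mK1])
  show "z \<oplus>\<^bsub>K1 K A M\<^esub> w \<in> cocycles1 K A M \<rho>" if zw: "z \<in> cocycles1 K A M \<rho>" "w \<in> cocycles1 K A M \<rho>" for z w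
  proof -
    have c: "z \<in> carrier (K1 K A M)" "w \<in> carrier (K1 K A M)" using zw by (auto simp: cocycles1_iff)
    note [simp] = K1_closed[OF c(1)] K1_closed[OF c(2)] K1_add
    show ?thesis unfolding cocycles1_iff[of "z \<oplus>\<^bsub>K1 K A M\<^esub> w"]
    proof (intro conjI ballI)
      fix a0 a1 a2 a3 assume a[simp]: "a0 \<in> carrier A" "a1 \<in> carrier A" "a2 \<in> carrier A" "a3 \<in> carrier A"
      let ?L = "\<lambda>z. lact \<rho> a0 (fst z a1 a2 a3) \<ominus>\<^bsub>M\<^esub> fst z (a0 \<otimes>\<^bsub>A\<^esub> a1) a2 a3 \<oplus>\<^bsub>M\<^esub> fst z a0 (a1 \<otimes>\<^bsub>A\<^esub> a2) a3
        \<ominus>\<^bsub>M\<^esub> fst z a0 a1 (a2 \<otimes>\<^bsub>A\<^esub> a3) \<oplus>\<^bsub>M\<^esub> ract \<rho> (fst z a0 a1 a2) a3"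
      have "?L (z \<oplus>\<^bsub>K1 K A M\<^esub> w) = ?L z \<oplus>\<^bsub>M\<^esub> ?L w"
        by simp (rule feq, (rule fop | (rule fatom, (simp; fail)))+, simp add: algebra_simps)
      also have "?L z = \<zero>\<^bsub>M\<^esub>" using zw(1) a unfolding cocycles1_iff by blast
      also have "?L w = \<zero>\<^bsub>M\<^esub>" using zw(2) a unfolding cocycles1_iff by blast
      finally show "?L (z \<oplus>\<^bsub>K1 K A M\<^esub> w) = \<zero>\<^bsub>M\<^esub>" by simp
      let ?R = "\<lambda>z. rbr \<rho> (fst z a0 a1 a2) a3 \<ominus>\<^bsub>M\<^esub> fst z (brk A a0 a3) a1 a2
        \<ominus>\<^bsub>M\<^esub> fst z a0 (brk A a1 a3) a2 \<ominus>\<^bsub>M\<^esub> fst z a0 a1 (brk A a2 a3)"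
      let ?S = "\<lambda>z. lact \<rho> a0 (snd z a1 a2 a3) \<ominus>\<^bsub>M\<^esub> snd z (a0 \<otimes>\<^bsub>A\<^esub> a1) a2 a3
        \<oplus>\<^bsub>M\<^esub> snd z a0 (a1 \<otimes>\<^bsub>A\<^esub> a2) a3 \<ominus>\<^bsub>M\<^esub> ract \<rho> (snd z a0 a1 a3) a2"
      have "?R (z \<oplus>\<^bsub>K1 K A M\<^esub> w) = ?R z \<oplus>\<^bsub>M\<^esub> ?R w"
        by simp (rule feq, (rule fop | (rule fatom, (simp; fail)))+, simp add: algebra_simps)
      also have "?R z = ?S z" using zw(1) a unfolding cocycles1_iff by blast
      also have "?R w = ?S w" using zw(2) a unfolding cocycles1_iff by blast
      also have "?S z \<oplus>\<^bsub>M\<^esub> ?S w = ?S (z \<oplus>\<^bsub>K1 K A M\<^esub> w)"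
        by simp (rule feq, (rule fop | (rule fatom, (simp; fail)))+, simp add: algebra_simps)
      finally show "?R (z \<oplus>\<^bsub>K1 K A M\<^esub> w) = ?S (z \<oplus>\<^bsub>K1 K A M\<^esub> w)" .
    qed (rule module_ops(2)[OF mK1 c])
  qed
  show "k \<odot>\<^bsub>K1 K A M\<^esub> z \<in> cocycles1 K A M \<rho>" if kz: "k \<in> carrier K" "z \<in> cocycles1 K A M \<rho>" for k z
  proof -
    have c: "z \<in> carrier (K1 K A M)" using kz by (auto simp: cocycles1_iff)
    note [simp] = K1_closed[OF c] K1_add kz(1)
    show ?thesis unfolding cocycles1_iff[of "k \<odot>\<^bsub>K1 K A M\<^esub> z"]
    proof (intro conjI ballI)
      fix a0 a1 a2 a3 assume a[simp]: "a0 \<in> carrier A" "a1 \<in> carrier A" "a2 \<in> carrier A" "a3 \<in> carrier A"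
      let ?L = "\<lambda>z. lact \<rho> a0 (fst z a1 a2 a3) \<ominus>\<^bsub>M\<^esub> fst z (a0 \<otimes>\<^bsub>A\<^esub> a1) a2 a3 \<oplus>\<^bsub>M\<^esub> fst z a0 (a1 \<otimes>\<^bsub>A\<^esub> a2) a3
        \<ominus>\<^bsub>M\<^esub> fst z a0 a1 (a2 \<otimes>\<^bsub>A\<^esub> a3) \<oplus>\<^bsub>M\<^esub> ract \<rho> (fst z a0 a1 a2) a3"
      have "?L (k \<odot>\<^bsub>K1 K A M\<^esub> z) = k \<odot>\<^bsub>M\<^esub> ?L z" by simp
      also have "?L z = \<zero>\<^bsub>M\<^esub>" using kz(2) a unfolding cocycles1_iff by blast
      finally show "?L (k \<odot>\<^bsub>K1 K A M\<^esub> z) = \<zero>\<^bsub>M\<^esub>" by simp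
      let ?R = "\<lambda>z. rbr \<rho> (fst z a0 a1 a2) a3 \<ominus>\<^bsub>M\<^esub> fst z (brk A a0 a3) a1 a2
        \<ominus>\<^bsub>M\<^esub> fst z a0 (brk A a1 a3) a2 \<ominus>\<^bsub>M\<^esub> fst z a0 a1 (brk A a2 a3)"
      let ?S = "\<lambda>z. lact \<rho> a0 (snd z a1 a2 a3) \<ominus>\<^bsub>M\<^esub> snd z (a0 \<otimes>\<^bsub>A\<^esub> a1) a2 a3
        \<oplus>\<^bsub>M\<^esub> snd z a0 (a1 \<otimes>\<^bsub>A\<^esub> a2) a3 \<ominus>\<^bsub>M\<^esub> ract \<rho> (snd z a0 a1 a3) a2"
      have "?R (k \<odot>\<^bsub>K1 K A M\<^esub> z) = k \<odot>\<^bsub>M\<^esub> ?R z" by simp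
      also have "?R z = ?S z" using kz(2) a unfolding cocycles1_iff by blast
      also have "k \<odot>\<^bsub>M\<^esub> ?S z = ?S (k \<odot>\<^bsub>K1 K A M\<^esub> z)" by simp
      finally show "?R (k \<odot>\<^bsub>K1 K A M\<^esub> z) = ?S (k \<odot>\<^bsub>K1 K A M\<^esub> z)" .
    qed (rule module_ops(5)[OF mK1 kz(1) c])
  qed
qed

lemma cobound0_Z1: "cobound0 K A M \<rho> \<subseteq> Z1"
  by (auto simp: cobound0_def Z1_iff d0_dm1 dm1_K0)

lemma cobound1_cocycles1: "cobound1 K A M \<rho> \<subseteq> cocycles1 K A M \<rho>"
  by (auto simp: cobound1_def d0_cocycles1)

lemma mZ1: "module K ((K0 K A M)\<lparr>carrier := Z1\<rparr>)"
  by (rule submodule.submodule_is_module[OF Z1_sub mK0])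

lemma mcocycles1: "module K ((K1 K A M)\<lparr>carrier := cocycles1 K A M \<rho>\<rparr>)"
  by (rule submodule.submodule_is_module[OF cocycles1_sub mK1])

lemma H0_carrier: "h \<in> carrier (H0 K A M \<rho>) \<longleftrightarrow> h \<in> carrier (Km1 K A M) \<and> dm1 A M \<rho> h = \<zero>\<^bsub>K0 K A M\<^esub>"
  by (simp add: H0_def a_kernel_def')

lemma mH0: "module K (H0 K A M \<rho>)"
  unfolding H0_def by (intro submodule.submodule_is_module[OF _ mKm1] submodule_kernel mKm1 mK0 dm1_lin)

lemma H1_carrier: "carrier (H1 K A M \<rho>) = class1 K A M \<rho> ` Z1"
  by (simp add: H1_def mod_quot_carrier class1_def coset_carrier flip: Z1_def)

lemma H1_ops:
  "\<And>z w. z \<in> Z1 \<Longrightarrow> w \<in> Z1 \<Longrightarrow>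
     class1 K A M \<rho> z \<oplus>\<^bsub>H1 K A M \<rho>\<^esub> class1 K A M \<rho> w = class1 K A M \<rho> (z \<oplus>\<^bsub>K0 K A M\<^esub> w)"
  "\<And>k z. k \<in> carrier K \<Longrightarrow> z \<in> Z1 \<Longrightarrow>
     k \<odot>\<^bsub>H1 K A M \<rho>\<^esub> class1 K A M \<rho> z = class1 K A M \<rho> (k \<odot>\<^bsub>K0 K A M\<^esub> z)"
  "\<zero>\<^bsub>H1 K A M \<rho>\<^esub> = class1 K A M \<rho> \<zero>\<^bsub>K0 K A M\<^esub>"
  using mod_quot_ops[OF mZ1 submodule_restrict[OF mK0 cobound0_sub Z1_sub cobound0_Z1]]
  by (simp_all add: H1_def class1_def coset_carrier flip: Z1_def)

lemma mH1: "module K (H1 K A M \<rho>)"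
  using module_mod_quot[OF mZ1 submodule_restrict[OF mK0 cobound0_sub Z1_sub cobound0_Z1]]
  by (simp add: H1_def flip: Z1_def)

lemma H2_carrier: "carrier (H2 K A M \<rho>) = class2 K A M \<rho> ` cocycles1 K A M \<rho>"
  by (simp add: H2_def mod_quot_carrier class2_def coset_carrier)

lemma H2_ops:
  "\<And>z w. z \<in> cocycles1 K A M \<rho> \<Longrightarrow> w \<in> cocycles1 K A M \<rho> \<Longrightarrow>
     class2 K A M \<rho> z \<oplus>\<^bsub>H2 K A M \<rho>\<^esub> class2 K A M \<rho> w = class2 K A M \<rho> (z \<oplus>\<^bsub>K1 K A M\<^esub> w)"
  "\<And>k z. k \<in> carrier K \<Longrightarrow> z \<in> cocycles1 K A M \<rho> \<Longrightarrow>
     k \<odot>\<^bsub>H2 K A M \<rho>\<^esub> class2 K A M \<rho> z = class2 K A M \<rho> (k \<odot>\<^bsub>K1 K A M\<^esub> z)"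
  "\<zero>\<^bsub>H2 K A M \<rho>\<^esub> = class2 K A M \<rho> \<zero>\<^bsub>K1 K A M\<^esub>"
  using mod_quot_ops[OF mcocycles1 submodule_restrict[OF mK1 cobound1_sub cocycles1_sub cobound1_cocycles1]]
  by (simp_all add: H2_def class2_def coset_carrier)

lemma mH2: "module K (H2 K A M \<rho>)"
  using module_mod_quot[OF mcocycles1 submodule_restrict[OF mK1 cobound1_sub cocycles1_sub cobound1_cocycles1]]
  by (simp add: H2_def)

lemma class1_mem: "w \<in> class1 K A M \<rho> z \<longleftrightarrow> (\<exists>h\<in>carrier (Km1 K A M). w = dm1 A M \<rho> h \<oplus>\<^bsub>K0 K A M\<^esub> z)"
  by (auto simp: class1_def coset_mem cobound0_def)

lemma class2_mem: "w \<in> class2 K A M \<rho> z \<longleftrightarrow> (\<exists>h\<in>carrier (K0 K A M). w = d0 A M \<rho> h \<oplus>\<^bsub>K1 K A M\<^esub> z)"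
  by (auto simp: class2_def coset_mem cobound1_def)

lemma class1_eq_iff:
  assumes "z \<in> carrier (K0 K A M)" "w \<in> carrier (K0 K A M)"
  shows "class1 K A M \<rho> z = class1 K A M \<rho> w \<longleftrightarrow> (\<exists>h\<in>carrier (Km1 K A M). z = dm1 A M \<rho> h \<oplus>\<^bsub>K0 K A M\<^esub> w)"
  unfolding class1_def coset_eq_iff[OF mK0 cobound0_sub assms] by (auto simp: cobound0_def)

lemma class2_eq_iff:
  assumes "z \<in> carrier (K1 K A M)" "w \<in> carrier (K1 K A M)"
  shows "class2 K A M \<rho> z = class2 K A M \<rho> w \<longleftrightarrow> (\<exists>h\<in>carrier (K0 K A M). z = d0 A M \<rho> h \<oplus>\<^bsub>K1 K A M\<^esub> w)"
  unfolding class2_def coset_eq_iff[OF mK1 cobound1_sub assms] by (auto simp: cobound1_def)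

end

section \<open>Inflation along the quotient map\<close>

text \<open>\<open>B\<close> is a subset of \<open>A\<close> included by the identity function, so
  exactness in the middle says that \<open>B\<close> is the kernel of \<tau>. \<open>Q\<close> is
  any model of the quotient.\<close>

locale setting =
  fixes K :: "'k ring"
    and A :: "('k, 'a) awb" and B :: "'a set" and Q :: "('k, 'q) awb" and \<tau> :: "'a \<Rightarrow> 'q"
    and M :: "('k, 'm) module" and \<rho> :: "('q, 'm) action"
  assumes fK: "field K"
    and se: "short_exact K (A\<lparr>carrier := B\<rparr>) (\<lambda>b. b) A \<tau> Q"
    and repQ: "representation K Q M \<rho>"
begin

abbreviation \<rho>' where "\<rho>' \<equiv> rep_along \<tau> \<rho>"

lemma awbA: "AWB K A" and awbQ: "AWB K Q" and awbB: "AWB K (A\<lparr>carrier := B\<rparr>)"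
  and mA: "module K A" and mQ: "module K Q" and mB: "module K (A\<lparr>carrier := B\<rparr>)" and mM: "module K M"
  using se repQ by (auto simp: short_exact_def representation_def AWB_def)

lemma tau_lin: "lin_map K A Q \<tau>" and tau_surj: "\<tau> ` carrier A = carrier Q"
  and tau_mult [simp]: "\<And>x y. x \<in> carrier A \<Longrightarrow> y \<in> carrier A \<Longrightarrow> \<tau> (x \<otimes>\<^bsub>A\<^esub> y) = \<tau> x \<otimes>\<^bsub>Q\<^esub> \<tau> y"
  and tau_brk [simp]: "\<And>x y. x \<in> carrier A \<Longrightarrow> y \<in> carrier A \<Longrightarrow> \<tau> (brk A x y) = brk Q (\<tau> x) (\<tau> y)"
  and B_iff: "\<And>b. b \<in> B \<longleftrightarrow> b \<in> carrier A \<and> \<tau> b = \<zero>\<^bsub>Q\<^esub>"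
  using se by (auto simp: short_exact_def awb_hom_def a_kernel_def')

lemmas tau_rules [simp] = lin_map_rules[OF mA mQ tau_lin]

lemma rep_along_simps:
  "lact \<rho>' a m = lact \<rho> (\<tau> a) m" "lbr \<rho>' a m = lbr \<rho> (\<tau> a) m"
  "ract \<rho>' m a = ract \<rho> m (\<tau> a)" "rbr \<rho>' m a = rbr \<rho> m (\<tau> a)"
  by (simp_all add: rep_along_def)

sublocale QR: rep K Q M \<rho>
  by (rule rep.intro, rule actmod.intro) (use repQ in \<open>auto simp: representation_def\<close>)

sublocale AR: rep K A M "rep_along \<tau> \<rho>"
proof (rule rep.intro, rule actmod.intro)
  show "action_bilin K A M \<rho>'"
    unfolding action_bilin_def
    by (auto intro!: bilin_mapI lin_mapI simp: rep_along_simps module_ops[OF mA] module_ops[OF mM])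
  show "action_A A M \<rho>'"
    by (auto simp: action_A_def rep_along_simps)
qed (rule awbA mM)+

lemma B_in: "b \<in> B \<Longrightarrow> b \<in> carrier A" and B_tau: "b \<in> B \<Longrightarrow> \<tau> b = \<zero>\<^bsub>Q\<^esub>"
  by (auto simp: B_iff)

lemma B_closed:
  "\<zero>\<^bsub>A\<^esub> \<in> B"
  "b \<in> B \<Longrightarrow> b' \<in> B \<Longrightarrow> b \<oplus>\<^bsub>A\<^esub> b' \<in> B"  "b \<in> B \<Longrightarrow> b' \<in> B \<Longrightarrow> b \<ominus>\<^bsub>A\<^esub> b' \<in> B" "b \<in> B \<Longrightarrow> \<ominus>\<^bsub>A\<^esub> b \<in> B"
  "k \<in> carrier K \<Longrightarrow> b \<in> B \<Longrightarrow> k \<odot>\<^bsub>A\<^esub> b \<in> B"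
  "a \<in> carrier A \<Longrightarrow> b \<in> B \<Longrightarrow> a \<otimes>\<^bsub>A\<^esub> b \<in> B" "a \<in> carrier A \<Longrightarrow> b \<in> B \<Longrightarrow> b \<otimes>\<^bsub>A\<^esub> a \<in> B"
  "a \<in> carrier A \<Longrightarrow> b \<in> B \<Longrightarrow> brk A a b \<in> B" "a \<in> carrier A \<Longrightarrow> b \<in> B \<Longrightarrow> brk A b a \<in> B"
  by (simp_all add: B_iff)

text \<open>The representation of \<open>A\<close> factors through \<tau>, which kills
  \<open>B\<close>.\<close>

lemma B_act:
  assumes "b \<in> B" "m \<in> carrier M"
  shows "lact \<rho>' b m = \<zero>\<^bsub>M\<^esub>" "lbr \<rho>' b m = \<zero>\<^bsub>M\<^esub>" "ract \<rho>' m b = \<zero>\<^bsub>M\<^esub>" "rbr \<rho>' m b = \<zero>\<^bsub>M\<^esub>"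
  using assms by (simp_all add: rep_along_simps B_tau)

definition infl1 :: "('q \<Rightarrow> 'm) \<Rightarrow> 'a \<Rightarrow> 'm" where "infl1 h = (\<lambda>a\<in>carrier A. h (\<tau> a))"
definition infl2 :: "('q, 'm) cochain0 \<Rightarrow> ('a, 'm) cochain0" where
  "infl2 z = ((\<lambda>a\<in>carrier A. \<lambda>b\<in>carrier A. fst z (\<tau> a) (\<tau> b)), (\<lambda>a\<in>carrier A. \<lambda>b\<in>carrier A. snd z (\<tau> a) (\<tau> b)))"
definition infl3 :: "('q, 'm) cochain1 \<Rightarrow> ('a, 'm) cochain1" where
  "infl3 z = ((\<lambda>a\<in>carrier A. \<lambda>b\<in>carrier A. \<lambda>c\<in>carrier A. fst z (\<tau> a) (\<tau> b) (\<tau> c)),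
     (\<lambda>a\<in>carrier A. \<lambda>b\<in>carrier A. \<lambda>c\<in>carrier A. snd z (\<tau> a) (\<tau> b) (\<tau> c)))"

lemma infl_val [simp]:
  "a \<in> carrier A \<Longrightarrow> infl1 h a = h (\<tau> a)"
  "a \<in> carrier A \<Longrightarrow> b \<in> carrier A \<Longrightarrow> fst (infl2 z) a b = fst z (\<tau> a) (\<tau> b)"
  "a \<in> carrier A \<Longrightarrow> b \<in> carrier A \<Longrightarrow> snd (infl2 z) a b = snd z (\<tau> a) (\<tau> b)"
  "a \<in> carrier A \<Longrightarrow> b \<in> carrier A \<Longrightarrow> c \<in> carrier A \<Longrightarrow> fst (infl3 w) a b c = fst w (\<tau> a) (\<tau> b) (\<tau> c)"
  "a \<in> carrier A \<Longrightarrow> b \<in> carrier A \<Longrightarrow> c \<in> carrier A \<Longrightarrow> snd (infl3 w) a b c = snd w (\<tau> a) (\<tau> b) (\<tau> c)"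
  by (simp_all add: infl1_def infl2_def infl3_def)

lemma infl1_Km1: "h \<in> carrier (Km1 K Q M) \<Longrightarrow> infl1 h \<in> carrier (Km1 K A M)"
  by (simp add: AR.Km1_iff QR.Km1_iff infl1_def lin_map_restrict mA lin_map_comp[OF _ tau_lin])

lemma infl2_K0: assumes "z \<in> carrier (K0 K Q M)" shows "infl2 z \<in> carrier (K0 K A M)"
  unfolding infl2_def AR.K0_iff bilin_map_restrict[OF mA mA]
  by (auto intro!: bilin_mapI bilin_comp_l[OF QR.K0_bil(1)[OF assms]] bilin_comp_r[OF QR.K0_bil(1)[OF assms]]
    bilin_comp_l[OF QR.K0_bil(2)[OF assms]] bilin_comp_r[OF QR.K0_bil(2)[OF assms]] tau_lin)

lemma tri_comp:
  assumes f: "trilin_map K U W f" and t: "lin_map K V U t"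
  shows "trilin_map K V W (\<lambda>x y z. f (t x) (t y) (t z))"
  using lin_map_comp[OF trilin_mapD(1)[OF f] t] lin_map_comp[OF trilin_mapD(2)[OF f] t]
    lin_map_comp[OF trilin_mapD(3)[OF f] t] lin_mapD(1)[OF t]
  by (intro trilin_mapI) auto

lemma infl3_K1: assumes "z \<in> carrier (K1 K Q M)" shows "infl3 z \<in> carrier (K1 K A M)"
  unfolding infl3_def AR.K1_iff trilin_map_restrict[OF mA]
  using tri_comp[OF QR.K1_tri(1)[OF assms] tau_lin] tri_comp[OF QR.K1_tri(2)[OF assms] tau_lin] by auto

lemma infl1_lin: "lin_map K (Km1 K Q M) (Km1 K A M) infl1"
  by (rule lin_mapI, erule infl1_Km1) (auto simp: Km1_def infl1_def hom_mod_ops)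

lemma infl2_lin: "lin_map K (K0 K Q M) (K0 K A M) infl2"
proof (rule lin_mapI, erule infl2_K0)
  show "infl2 (x \<oplus>\<^bsub>K0 K Q M\<^esub> y) = infl2 x \<oplus>\<^bsub>K0 K A M\<^esub> infl2 y" if xy: "x \<in> carrier (K0 K Q M)" "y \<in> carrier (K0 K Q M)" for x y
    by (rule AR.K0_eqI) (simp_all add: xy infl2_K0 module_ops[OF AR.mK0] module_ops[OF QR.mK0] AR.K0_add QR.K0_add)
  show "infl2 (x \<odot>\<^bsub>K0 K Q M\<^esub> y) = x \<odot>\<^bsub>K0 K A M\<^esub> infl2 y" if xy: "x \<in> carrier K" "y \<in> carrier (K0 K Q M)" for x y
    by (rule AR.K0_eqI) (simp_all add: xy infl2_K0 module_ops[OF AR.mK0] module_ops[OF QR.mK0] AR.K0_add QR.K0_add)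
qed

lemma infl3_lin: "lin_map K (K1 K Q M) (K1 K A M) infl3"
proof (rule lin_mapI, erule infl3_K1)
  show "infl3 (x \<oplus>\<^bsub>K1 K Q M\<^esub> y) = infl3 x \<oplus>\<^bsub>K1 K A M\<^esub> infl3 y" if xy: "x \<in> carrier (K1 K Q M)" "y \<in> carrier (K1 K Q M)" for x y
    by (rule AR.K1_eqI) (simp_all add: xy infl3_K1 module_ops[OF AR.mK1] module_ops[OF QR.mK1] AR.K1_add QR.K1_add)
  show "infl3 (x \<odot>\<^bsub>K1 K Q M\<^esub> y) = x \<odot>\<^bsub>K1 K A M\<^esub> infl3 y" if xy: "x \<in> carrier K" "y \<in> carrier (K1 K Q M)" for x y
    by (rule AR.K1_eqI) (simp_all add: xy infl3_K1 module_ops[OF AR.mK1] module_ops[OF QR.mK1] AR.K1_add QR.K1_add)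
qed

lemmas infl1_rules = lin_map_rules[OF QR.mKm1 AR.mKm1 infl1_lin]
lemmas infl2_rules = lin_map_rules[OF QR.mK0 AR.mK0 infl2_lin]
lemmas infl3_rules = lin_map_rules[OF QR.mK1 AR.mK1 infl3_lin]

lemma infl_dm1: assumes "h \<in> carrier (Km1 K Q M)" shows "dm1 A M \<rho>' (infl1 h) = infl2 (dm1 Q M \<rho> h)"
  by (rule AR.K0_eqI)
    (simp_all add: AR.dm1_K0 infl1_Km1 infl2_K0 QR.dm1_K0 assms AR.dm1_val QR.dm1_val rep_along_simps)

lemma infl_d0: assumes "z \<in> carrier (K0 K Q M)" shows "d0 A M \<rho>' (infl2 z) = infl3 (d0 Q M \<rho> z)"
  by (rule AR.K1_eqI)
    (simp_all add: AR.d0_K1 infl2_K0 infl3_K1 QR.d0_K1 assms AR.d0_val QR.d0_val rep_along_simps)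

lemma infl3_cocycles1: assumes "z \<in> cocycles1 K Q M \<rho>" shows "infl3 z \<in> cocycles1 K A M \<rho>'"
proof -
  have "z \<in> carrier (K1 K Q M)" using assms by (simp add: QR.cocycles1_iff)
  then show ?thesis unfolding AR.cocycles1_iff
    using assms by (auto simp: infl3_K1 QR.cocycles1_iff rep_along_simps)
qed

lemma tau_H0_eq: "tau_H0 A \<tau> = infl1" by (simp add: tau_H0_def infl1_def fun_eq_iff)

text \<open>Two representatives differ by a coboundary on \<open>Q\<close>, and inflation turns it
  into a coboundary on \<open>A\<close>. So the set whose \<open>the_elem\<close> defines
  \<open>tau_H1\<close> is a singleton.\<close>

lemma tau_H1_class: assumes z: "z \<in> carrier (K0 K Q M)"
  shows "tau_H1 K A M \<rho> \<tau> (class1 K Q M \<rho> z) = class1 K A M \<rho>' (infl2 z)"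
proof -
  have "tau_H1 K A M \<rho> \<tau> (class1 K Q M \<rho> z) = the_elem ((\<lambda>z. class1 K A M \<rho>' (infl2 z)) ` class1 K Q M \<rho> z)"
    by (simp add: tau_H1_def infl2_def case_prod_unfold)
  also have "\<dots> = class1 K A M \<rho>' (infl2 z)"
  proof (rule the_elem_image)
    show "z \<in> class1 K Q M \<rho> z" unfolding class1_def by (rule coset_self[OF QR.mK0 QR.cobound0_sub z])
    fix y assume "y \<in> class1 K Q M \<rho> z"
    then obtain h where h: "h \<in> carrier (Km1 K Q M)" "y = dm1 Q M \<rho> h \<oplus>\<^bsub>K0 K Q M\<^esub> z" by (auto simp: QR.class1_mem)
    then have "infl2 y = dm1 A M \<rho>' (infl1 h) \<oplus>\<^bsub>K0 K A M\<^esub> infl2 z" by (simp add: infl2_rules QR.dm1_K0 z infl_dm1)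
    then show "class1 K A M \<rho>' (infl2 y) = class1 K A M \<rho>' (infl2 z)"
      using h z by (subst AR.class1_eq_iff) (auto simp: infl1_Km1 infl2_K0 AR.dm1_K0 module_ops[OF AR.mK0])
  qed
  finally show ?thesis .
qed

lemma tau_H2_class: assumes z: "z \<in> carrier (K1 K Q M)"
  shows "tau_H2 K A M \<rho> \<tau> (class2 K Q M \<rho> z) = class2 K A M \<rho>' (infl3 z)"
proof -
  have "tau_H2 K A M \<rho> \<tau> (class2 K Q M \<rho> z) = the_elem ((\<lambda>z. class2 K A M \<rho>' (infl3 z)) ` class2 K Q M \<rho> z)"
    by (simp add: tau_H2_def infl3_def case_prod_unfold)
  also have "\<dots> = class2 K A M \<rho>' (infl3 z)"
  proof (rule the_elem_image)
    show "z \<in> class2 K Q M \<rho> z" unfolding class2_def by (rule coset_self[OF QR.mK1 QR.cobound1_sub z])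
    fix y assume "y \<in> class2 K Q M \<rho> z"
    then obtain h where h: "h \<in> carrier (K0 K Q M)" "y = d0 Q M \<rho> h \<oplus>\<^bsub>K1 K Q M\<^esub> z" by (auto simp: QR.class2_mem)
    then have "infl3 y = d0 A M \<rho>' (infl2 h) \<oplus>\<^bsub>K1 K A M\<^esub> infl3 z" by (simp add: infl3_rules QR.d0_K1 z infl_d0)
    then show "class2 K A M \<rho>' (infl3 y) = class2 K A M \<rho>' (infl3 z)"
      using h z by (subst AR.class2_eq_iff) (auto simp: infl2_K0 infl3_K1 AR.d0_K1 module_ops[OF AR.mK1])
  qed
  finally show ?thesis .
qed

text \<open>By surjectivity of \<tau> every value of a cochain on \<open>Q\<close> is a value of its
  inflation, and extensional functions are determined by these values.\<close>

lemma tau_inj: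
  "inj_on infl1 (carrier (Km1 K Q M))" "inj_on infl2 (carrier (K0 K Q M))" "inj_on infl3 (carrier (K1 K Q M))"
proof -
  have ex: "\<exists>a\<in>carrier A. \<tau> a = x" if "x \<in> carrier Q" for x
    using that unfolding tau_surj[symmetric] by auto
  show "inj_on infl1 (carrier (Km1 K Q M))"
  proof (rule inj_onI)
    fix x y assume *: "x \<in> carrier (Km1 K Q M)" "y \<in> carrier (Km1 K Q M)" and e: "infl1 x = infl1 y"
    have "x q = y q" if "q \<in> carrier Q" for q
    proof -
      obtain a where "a \<in> carrier A" "\<tau> a = q" using ex[OF \<open>q \<in> carrier Q\<close>] by blast
      then show ?thesis using fun_cong[OF e, of a] by simp
    qed
    then show "x = y" using * by (intro extensionalityI[of x "carrier Q" y]) (auto simp: QR.Km1_iff)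
  qed
  show "inj_on infl2 (carrier (K0 K Q M))"
  proof (rule inj_onI)
    fix x y assume *: "x \<in> carrier (K0 K Q M)" "y \<in> carrier (K0 K Q M)" and e: "infl2 x = infl2 y"
    have "fst x (\<tau> a) (\<tau> b) = fst y (\<tau> a) (\<tau> b)" "snd x (\<tau> a) (\<tau> b) = snd y (\<tau> a) (\<tau> b)"
      if "a \<in> carrier A" "b \<in> carrier A" for a b using that infl_val(2)[of a b x] infl_val(2)[of a b y] infl_val(3)[of a b x] infl_val(3)[of a b y] e by simp_all
    note eq = this
    show "x = y"
    proof (rule QR.K0_eqI[OF *])
      fix q r assume "q \<in> carrier Q" "r \<in> carrier Q"
      then obtain a b where "a \<in> carrier A" "b \<in> carrier A" "\<tau> a = q" "\<tau> b = r" using ex by blast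
      then show "fst x q r = fst y q r" "snd x q r = snd y q r" using eq by blast+
    qed
  qed
  show "inj_on infl3 (carrier (K1 K Q M))"
  proof (rule inj_onI)
    fix x y assume *: "x \<in> carrier (K1 K Q M)" "y \<in> carrier (K1 K Q M)" and e: "infl3 x = infl3 y"
    have "fst x (\<tau> a) (\<tau> b) (\<tau> c) = fst y (\<tau> a) (\<tau> b) (\<tau> c)" "snd x (\<tau> a) (\<tau> b) (\<tau> c) = snd y (\<tau> a) (\<tau> b) (\<tau> c)"
      if "a \<in> carrier A" "b \<in> carrier A" "c \<in> carrier A" for a b c using that infl_val(4)[of a b c x] infl_val(4)[of a b c y] infl_val(5)[of a b c x] infl_val(5)[of a b c y] e by simp_all
    note eq = this
    show "x = y"
    proof (rule QR.K1_eqI[OF *])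
      fix q r t assume "q \<in> carrier Q" "r \<in> carrier Q" "t \<in> carrier Q"
      then obtain a b c where "a \<in> carrier A" "b \<in> carrier A" "c \<in> carrier A" "\<tau> a = q" "\<tau> b = r" "\<tau> c = t"
        using ex by metis
      then show "fst x q r t = fst y q r t" "snd x q r t = snd y q r t" using eq by blast+
    qed
  qed
qed

end

context setting
begin

lemma lin_mapB: assumes "lin_map K A M h" shows "lin_map K (A\<lparr>carrier := B\<rparr>) M h"
  using lin_mapD[OF assms] by (intro lin_mapI) (simp_all add: B_in)

lemma section_exists: obtains s where "lin_section K A \<tau> Q s"
  using lin_section_exists[OF fK mA mQ tau_lin tau_surj] .

text \<open>Each cocycle equation at points of \<open>Q\<close> is the equation for the inflation
  read at preimages in \<open>A\<close>.\<close>

lemma infl3_cocycles1D: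
  assumes c: "c \<in> carrier (K1 K Q M)" and t: "infl3 c \<in> cocycles1 K A M \<rho>'"
  shows "c \<in> cocycles1 K Q M \<rho>"
  unfolding QR.cocycles1_iff
proof (intro conjI ballI)
  show "c \<in> carrier (K1 K Q M)" by (rule c)
  fix q0 q1 q2 q3 assume q: "q0 \<in> carrier Q" "q1 \<in> carrier Q" "q2 \<in> carrier Q" "q3 \<in> carrier Q"
  have ex: "\<exists>a\<in>carrier A. \<tau> a = x" if "x \<in> carrier Q" for x using that unfolding tau_surj[symmetric] by auto
  obtain a0 a1 a2 a3 where a: "a0 \<in> carrier A" "a1 \<in> carrier A" "a2 \<in> carrier A" "a3 \<in> carrier A"
    and e: "\<tau> a0 = q0" "\<tau> a1 = q1" "\<tau> a2 = q2" "\<tau> a3 = q3"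
    using ex[OF q(1)] ex[OF q(2)] ex[OF q(3)] ex[OF q(4)] by blast
  have "lact \<rho>' a0 (fst (infl3 c) a1 a2 a3) \<ominus>\<^bsub>M\<^esub> fst (infl3 c) (a0 \<otimes>\<^bsub>A\<^esub> a1) a2 a3 \<oplus>\<^bsub>M\<^esub> fst (infl3 c) a0 (a1 \<otimes>\<^bsub>A\<^esub> a2) a3
        \<ominus>\<^bsub>M\<^esub> fst (infl3 c) a0 a1 (a2 \<otimes>\<^bsub>A\<^esub> a3) \<oplus>\<^bsub>M\<^esub> ract \<rho>' (fst (infl3 c) a0 a1 a2) a3 = \<zero>\<^bsub>M\<^esub> \<and>
      rbr \<rho>' (fst (infl3 c) a0 a1 a2) a3 \<ominus>\<^bsub>M\<^esub> fst (infl3 c) (brk A a0 a3) a1 a2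
        \<ominus>\<^bsub>M\<^esub> fst (infl3 c) a0 (brk A a1 a3) a2 \<ominus>\<^bsub>M\<^esub> fst (infl3 c) a0 a1 (brk A a2 a3)
      = lact \<rho>' a0 (snd (infl3 c) a1 a2 a3) \<ominus>\<^bsub>M\<^esub> snd (infl3 c) (a0 \<otimes>\<^bsub>A\<^esub> a1) a2 a3
        \<oplus>\<^bsub>M\<^esub> snd (infl3 c) a0 (a1 \<otimes>\<^bsub>A\<^esub> a2) a3 \<ominus>\<^bsub>M\<^esub> ract \<rho>' (snd (infl3 c) a0 a1 a3) a2"
    using t a unfolding AR.cocycles1_iff by blast
  then show "lact \<rho> q0 (fst c q1 q2 q3) \<ominus>\<^bsub>M\<^esub> fst c (q0 \<otimes>\<^bsub>Q\<^esub> q1) q2 q3 \<oplus>\<^bsub>M\<^esub> fst c q0 (q1 \<otimes>\<^bsub>Q\<^esub> q2) q3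
        \<ominus>\<^bsub>M\<^esub> fst c q0 q1 (q2 \<otimes>\<^bsub>Q\<^esub> q3) \<oplus>\<^bsub>M\<^esub> ract \<rho> (fst c q0 q1 q2) q3 = \<zero>\<^bsub>M\<^esub>"
      "rbr \<rho> (fst c q0 q1 q2) q3 \<ominus>\<^bsub>M\<^esub> fst c (brk Q q0 q3) q1 q2
        \<ominus>\<^bsub>M\<^esub> fst c q0 (brk Q q1 q3) q2 \<ominus>\<^bsub>M\<^esub> fst c q0 q1 (brk Q q2 q3)
      = lact \<rho> q0 (snd c q1 q2 q3) \<ominus>\<^bsub>M\<^esub> snd c (q0 \<otimes>\<^bsub>Q\<^esub> q1) q2 q3
        \<oplus>\<^bsub>M\<^esub> snd c q0 (q1 \<otimes>\<^bsub>Q\<^esub> q2) q3 \<ominus>\<^bsub>M\<^esub> ract \<rho> (snd c q0 q1 q3) q2"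
    using a by (simp_all add: rep_along_simps e)
qed

text \<open>A cochain on \<open>A\<close> is inflated from \<open>Q\<close> iff it vanishes as soon as one argument lies in \<open>B\<close>.
  Cochains whose coboundary is inflated are the cocycles relative to \<open>Q\<close>.\<close>

definition vanishes1 :: "('a \<Rightarrow> 'm) \<Rightarrow> bool" where "vanishes1 h \<longleftrightarrow> (\<forall>b\<in>B. h b = \<zero>\<^bsub>M\<^esub>)"
definition vanishes2 :: "('a, 'm) cochain0 \<Rightarrow> bool" where
  "vanishes2 z \<longleftrightarrow> (\<forall>a\<in>carrier A. \<forall>b\<in>B. fst z a b = \<zero>\<^bsub>M\<^esub> \<and> fst z b a = \<zero>\<^bsub>M\<^esub> \<and> snd z a b = \<zero>\<^bsub>M\<^esub> \<and> snd z b a = \<zero>\<^bsub>M\<^esub>)"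
definition vanishes3 :: "('a, 'm) cochain1 \<Rightarrow> bool" where
  "vanishes3 z \<longleftrightarrow> (\<forall>a\<in>carrier A. \<forall>a'\<in>carrier A. \<forall>b\<in>B.
     fst z a a' b = \<zero>\<^bsub>M\<^esub> \<and> fst z a b a' = \<zero>\<^bsub>M\<^esub> \<and> fst z b a a' = \<zero>\<^bsub>M\<^esub> \<and>
     snd z a a' b = \<zero>\<^bsub>M\<^esub> \<and> snd z a b a' = \<zero>\<^bsub>M\<^esub> \<and> snd z b a a' = \<zero>\<^bsub>M\<^esub>)"

lemma vanishes_infl1: "h \<in> carrier (Km1 K Q M) \<Longrightarrow> vanishes1 (infl1 h)"
  by (auto simp: B_in B_tau vanishes1_def QR.Km1_iff lin_map_rules[OF mQ mM])

lemma vanishes_infl2: "z \<in> carrier (K0 K Q M) \<Longrightarrow> vanishes2 (infl2 z)"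
  by (auto simp: vanishes2_def QR.K0_rules B_in B_tau)

lemma vanishes_infl3: assumes z: "z \<in> carrier (K1 K Q M)" shows "vanishes3 (infl3 z)"
proof -
  have *: "f x y \<zero>\<^bsub>Q\<^esub> = \<zero>\<^bsub>M\<^esub>" "f x \<zero>\<^bsub>Q\<^esub> y = \<zero>\<^bsub>M\<^esub>" "f \<zero>\<^bsub>Q\<^esub> x y = \<zero>\<^bsub>M\<^esub>"
    if "trilin_map K Q M f" "x \<in> carrier Q" "y \<in> carrier Q" for f x y
    using trilin_mapD[OF that, THEN lin_map_rules(4)[OF mQ mM]] .
  show ?thesis using *[OF QR.K1_tri(1)[OF z]] *[OF QR.K1_tri(2)[OF z]] unfolding vanishes3_def by (simp add: B_in B_tau)
qed

definition relZm1 where "relZm1 = {h \<in> carrier (Km1 K A M). vanishes2 (dm1 A M \<rho>' h)}"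
definition relZ0 where "relZ0 = {z \<in> carrier (K0 K A M). vanishes3 (d0 A M \<rho>' z)}"

end

section \<open>Restriction of cochains along a linear section of the quotient map\<close>

locale setting_sec = setting K A B Q \<tau> M \<rho>
  for K :: "'k ring"
    and A :: "('k, 'a) awb" and B :: "'a set" and Q :: "('k, 'q) awb" and \<tau> :: "'a \<Rightarrow> 'q"
    and M :: "('k, 'm) module" and \<rho> :: "('q, 'm) action" +
  fixes s :: "'q \<Rightarrow> 'a"
  assumes sec: "lin_section K A \<tau> Q s"
begin

lemma s_lin: "lin_map K Q A s" and tau_s [simp]: "x \<in> carrier Q \<Longrightarrow> \<tau> (s x) = x"
  using sec by (auto simp: lin_section_def)

lemmas s_rules [simp] = lin_map_rules[OF mQ mA s_lin]

text \<open>The linear projection of \<open>A\<close> onto \<open>B\<close> along the complement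
  \<open>s Q\<close>. It extends linear maps from \<open>B\<close> to \<open>A\<close> by zero on
  \<open>s Q\<close>.\<close>

definition \<beta> where "\<beta> a = a \<ominus>\<^bsub>A\<^esub> s (\<tau> a)"

lemma beta_B [simp]: "a \<in> carrier A \<Longrightarrow> \<beta> a \<in> B"
  by (simp add: \<beta>_def B_iff module_ops[OF mA] module_ops[OF mQ])

lemmas beta_A [simp] = B_in[OF beta_B]

lemma beta_id [simp]: "b \<in> B \<Longrightarrow> \<beta> b = b"
  by (simp add: \<beta>_def B_in B_tau)

lemma beta_s [simp]: "x \<in> carrier Q \<Longrightarrow> \<beta> (s x) = \<zero>\<^bsub>A\<^esub>"
  by (simp add: \<beta>_def)

lemma beta_lin: "lin_map K A A \<beta>"
  unfolding \<beta>_def by (intro lin_map_minus[OF mA] lin_map_id lin_map_comp[OF s_lin] tau_lin)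

lemma beta_decomp: "a \<in> carrier A \<Longrightarrow> a = \<beta> a \<oplus>\<^bsub>A\<^esub> s (\<tau> a)"
  unfolding \<beta>_def by (rule abelian_group.eq_add_minus[OF module_ag[OF mA]]) simp_all

text \<open>Restriction along \<open>s\<close> is inverse to inflation on cochains that vanish on
  \<open>B\<close>. Since \<open>s\<close> is only linear, compatibility with products, brackets or
  coboundaries cannot be expected.\<close>

definition sec1 :: "('a \<Rightarrow> 'm) \<Rightarrow> 'q \<Rightarrow> 'm" where "sec1 h = (\<lambda>a\<in>carrier Q. h (s a))"
definition sec2 :: "('a, 'm) cochain0 \<Rightarrow> ('q, 'm) cochain0" where
  "sec2 z = ((\<lambda>a\<in>carrier Q. \<lambda>b\<in>carrier Q. fst z (s a) (s b)), (\<lambda>a\<in>carrier Q. \<lambda>b\<in>carrier Q. snd z (s a) (s b)))"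
definition sec3 :: "('a, 'm) cochain1 \<Rightarrow> ('q, 'm) cochain1" where
  "sec3 z = ((\<lambda>a\<in>carrier Q. \<lambda>b\<in>carrier Q. \<lambda>c\<in>carrier Q. fst z (s a) (s b) (s c)),
     (\<lambda>a\<in>carrier Q. \<lambda>b\<in>carrier Q. \<lambda>c\<in>carrier Q. snd z (s a) (s b) (s c)))"

lemma sec1_Km1: "h \<in> carrier (Km1 K A M) \<Longrightarrow> sec1 h \<in> carrier (Km1 K Q M)"
  by (simp add: AR.Km1_iff QR.Km1_iff sec1_def lin_map_restrict mQ lin_map_comp[OF _ s_lin])

lemma sec2_K0: assumes "z \<in> carrier (K0 K A M)" shows "sec2 z \<in> carrier (K0 K Q M)"
  unfolding sec2_def QR.K0_iff bilin_map_restrict[OF mQ mQ]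
  by (auto intro!: bilin_mapI bilin_comp_l[OF AR.K0_bil(1)[OF assms]] bilin_comp_r[OF AR.K0_bil(1)[OF assms]]
    bilin_comp_l[OF AR.K0_bil(2)[OF assms]] bilin_comp_r[OF AR.K0_bil(2)[OF assms]] s_lin)

lemma sec3_K1: assumes "z \<in> carrier (K1 K A M)" shows "sec3 z \<in> carrier (K1 K Q M)"
  unfolding sec3_def QR.K1_iff trilin_map_restrict[OF mQ]
  using tri_comp[OF AR.K1_tri(1)[OF assms] s_lin] tri_comp[OF AR.K1_tri(2)[OF assms] s_lin] by auto

text \<open>Of the decomposition of \<open>a\<close> into \<beta> \<open>a\<close> and
  \<open>s (\<tau> a)\<close> only the second part contributes. Applied to one argument after the
  other, this recovers a multilinear cochain from its values on \<open>s Q\<close>.\<close>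

lemma vanishes_split: assumes f: "lin_map K A M f" and v: "\<And>b. b \<in> B \<Longrightarrow> f b = \<zero>\<^bsub>M\<^esub>" and a: "a \<in> carrier A"
  shows "f (s (\<tau> a)) = f a"
proof -
  note F = lin_map_rules[OF mA mM f]
  have "f a = f (\<beta> a \<oplus>\<^bsub>A\<^esub> s (\<tau> a))" using beta_decomp[OF a] by simp
  then show ?thesis using a by (simp add: F v)
qed

lemma infl_sec1: assumes h: "h \<in> carrier (Km1 K A M)" "vanishes1 h" shows "infl1 (sec1 h) = h"
proof (rule extensionalityI[of _ "carrier A"])
  fix a assume "a \<in> carrier A"
  then show "infl1 (sec1 h) a = h a"
    using vanishes_split[of h a] h by (simp add: sec1_def AR.Km1_iff vanishes1_def)
qed (use h infl1_Km1[OF sec1_Km1[OF h(1)]] in \<open>auto simp: AR.Km1_iff\<close>)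

lemma infl_sec2: assumes z: "z \<in> carrier (K0 K A M)" "vanishes2 z" shows "infl2 (sec2 z) = z"
proof (rule AR.K0_eqI)
  fix a b assume ab: "a \<in> carrier A" "b \<in> carrier A"
  have *: "f (s (\<tau> a)) (s (\<tau> b)) = f a b" if "bilin_map K A A M f" "\<And>a b. a \<in> carrier A \<Longrightarrow> b \<in> B \<Longrightarrow> f a b = \<zero>\<^bsub>M\<^esub>"
     "\<And>a b. a \<in> carrier A \<Longrightarrow> b \<in> B \<Longrightarrow> f b a = \<zero>\<^bsub>M\<^esub>" for f :: "'a \<Rightarrow> 'a \<Rightarrow> 'm"
  proof -
    have "f (s (\<tau> a)) (s (\<tau> b)) = f (s (\<tau> a)) b"
      by (rule vanishes_split[of "f (s (\<tau> a))"]) (use that ab in \<open>auto intro: bilin_mapD\<close>)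
    also have "\<dots> = f a b"
      by (rule vanishes_split[of "\<lambda>a. f a b"]) (use that ab in \<open>auto intro: bilin_mapD\<close>)
    finally show ?thesis .
  qed
  show "fst (infl2 (sec2 z)) a b = fst z a b" "snd (infl2 (sec2 z)) a b = snd z a b"
    using *[of "fst z"] *[of "snd z"] AR.K0_bil[OF z(1)] z(2) ab by (simp_all add: sec2_def vanishes2_def)
qed (simp_all add: infl2_K0 sec2_K0 z)

lemma infl_sec3: assumes z: "z \<in> carrier (K1 K A M)" "vanishes3 z" shows "infl3 (sec3 z) = z"
proof (rule AR.K1_eqI)
  fix a b c assume ab: "a \<in> carrier A" "b \<in> carrier A" "c \<in> carrier A"
  have *: "f (s (\<tau> a)) (s (\<tau> b)) (s (\<tau> c)) = f a b c" if f: "trilin_map K A M f"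
     and v: "\<And>a b c. a \<in> carrier A \<Longrightarrow> b \<in> carrier A \<Longrightarrow> c \<in> B \<Longrightarrow> f a b c = \<zero>\<^bsub>M\<^esub> \<and> f a c b = \<zero>\<^bsub>M\<^esub> \<and> f c a b = \<zero>\<^bsub>M\<^esub>" for f :: "'a \<Rightarrow> 'a \<Rightarrow> 'a \<Rightarrow> 'm"
  proof -
    have "f (s (\<tau> a)) (s (\<tau> b)) (s (\<tau> c)) = f (s (\<tau> a)) (s (\<tau> b)) c"
      by (rule vanishes_split[of "f (s (\<tau> a)) (s (\<tau> b))"]) (use v ab in \<open>auto intro: trilin_mapD[OF f]\<close>)
    also have "\<dots> = f (s (\<tau> a)) b c"
      by (rule vanishes_split[of "\<lambda>b. f (s (\<tau> a)) b c"]) (use v ab in \<open>auto intro: trilin_mapD[OF f]\<close>)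
    also have "\<dots> = f a b c"
      by (rule vanishes_split[of "\<lambda>a. f a b c"]) (use v ab in \<open>auto intro: trilin_mapD[OF f]\<close>)
    finally show ?thesis .
  qed
  show "fst (infl3 (sec3 z)) a b c = fst z a b c" "snd (infl3 (sec3 z)) a b c = snd z a b c"
    using *[of "fst z"] *[of "snd z"] AR.K1_tri[OF z(1)] z(2) ab by (simp_all add: sec3_def vanishes3_def)
qed (simp_all add: infl3_K1 sec3_K1 z)

end

context setting
begin

lemma vanishes1_iff: assumes "h \<in> carrier (Km1 K A M)"
  shows "vanishes1 h \<longleftrightarrow> h \<in> infl1 ` carrier (Km1 K Q M)"
proof -
  obtain s where "lin_section K A \<tau> Q s" by (rule section_exists)
  then interpret setting_sec K A B Q \<tau> M \<rho> s by unfold_locales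
  show ?thesis using vanishes_infl1 by (auto simp: infl_sec1[OF assms] sec1_Km1[OF assms] intro!: image_eqI[of _ infl1 "sec1 h"])
qed

lemma vanishes2_iff: assumes "h \<in> carrier (K0 K A M)"
  shows "vanishes2 h \<longleftrightarrow> h \<in> infl2 ` carrier (K0 K Q M)"
proof -
  obtain s where "lin_section K A \<tau> Q s" by (rule section_exists)
  then interpret setting_sec K A B Q \<tau> M \<rho> s by unfold_locales
  show ?thesis using vanishes_infl2 by (auto simp: infl_sec2[OF assms] sec2_K0[OF assms] intro!: image_eqI[of _ infl2 "sec2 h"])
qed

lemma vanishes3_iff: assumes "h \<in> carrier (K1 K A M)"
  shows "vanishes3 h \<longleftrightarrow> h \<in> infl3 ` carrier (K1 K Q M)"
proof -
  obtain s where "lin_section K A \<tau> Q s" by (rule section_exists)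
  then interpret setting_sec K A B Q \<tau> M \<rho> s by unfold_locales
  show ?thesis using vanishes_infl3 by (auto simp: infl_sec3[OF assms] sec3_K1[OF assms] intro!: image_eqI[of _ infl3 "sec3 h"])
qed

text \<open>\<open>defl2\<close> and \<open>defl3\<close> invert inflation.\<close>

definition defl2 where "defl2 h = inv_into (carrier (K0 K Q M)) infl2 h"
definition defl3 where "defl3 h = inv_into (carrier (K1 K Q M)) infl3 h"

lemma defl2: assumes "h \<in> carrier (K0 K A M)" "vanishes2 h"
  shows "defl2 h \<in> carrier (K0 K Q M)" "infl2 (defl2 h) = h"
  using assms by (auto simp: vanishes2_iff defl2_def inv_into_into f_inv_into_f)

lemma defl3: assumes "h \<in> carrier (K1 K A M)" "vanishes3 h"
  shows "defl3 h \<in> carrier (K1 K Q M)" "infl3 (defl3 h) = h"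
  using assms by (auto simp: vanishes3_iff defl3_def inv_into_into f_inv_into_f)

lemma defl2_eq: "c \<in> carrier (K0 K Q M) \<Longrightarrow> infl2 c = h \<Longrightarrow> defl2 h = c"
  using tau_inj(2) by (auto simp: defl2_def)

lemma defl3_eq: "c \<in> carrier (K1 K Q M) \<Longrightarrow> infl3 c = h \<Longrightarrow> defl3 h = c"
  using tau_inj(3) by (auto simp: defl3_def)

lemma relZm1_sub: "submodule relZm1 K (Km1 K A M)"
proof (rule submoduleI'[OF AR.mKm1])
  note R = lin_map_rules[OF AR.mKm1 AR.mK0 AR.dm1_lin] module_ops[OF AR.mKm1] module_ops[OF mM]
  show "\<zero>\<^bsub>Km1 K A M\<^esub> \<in> relZm1" by (simp add: relZm1_def R vanishes2_def AR.K0_add B_in)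
qed (auto simp: B_in relZm1_def vanishes2_def AR.K0_add module_ops[OF mM] module_ops[OF AR.mKm1] lin_mapD[OF AR.dm1_lin])

lemma relZ0_sub: "submodule relZ0 K (K0 K A M)"
proof (rule submoduleI'[OF AR.mK0])
  note R = lin_map_rules[OF AR.mK0 AR.mK1 AR.d0_lin] module_ops[OF AR.mK0] module_ops[OF mM]
  show "\<zero>\<^bsub>K0 K A M\<^esub> \<in> relZ0" by (simp add: relZ0_def R vanishes3_def AR.K1_add B_in)
qed (auto simp: B_in relZ0_def vanishes3_def AR.K1_add module_ops[OF mM] module_ops[OF AR.mK0] lin_mapD[OF AR.d0_lin])

text \<open>Inflation commutes with the coboundary, and two successive coboundaries of
  \<open>h\<close> give zero on \<open>A\<close>. Injectivity of inflation brings this vanishing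
  down to \<open>Q\<close>.\<close>

lemma defl2_dm1:
  assumes "h \<in> relZm1"
  shows "defl2 (dm1 A M \<rho>' h) \<in> QR.Z1" "infl2 (defl2 (dm1 A M \<rho>' h)) = dm1 A M \<rho>' h"
proof -
  have h: "h \<in> carrier (Km1 K A M)" "vanishes2 (dm1 A M \<rho>' h)" using assms by (auto simp: relZm1_def)
  note c = defl2[OF AR.dm1_K0[OF h(1)] h(2)]
  show "infl2 (defl2 (dm1 A M \<rho>' h)) = dm1 A M \<rho>' h" by (rule c)
  have "infl3 (d0 Q M \<rho> (defl2 (dm1 A M \<rho>' h))) = \<zero>\<^bsub>K1 K A M\<^esub>"
    using infl_d0[OF c(1)] by (simp add: c AR.d0_dm1 h)
  then have "d0 Q M \<rho> (defl2 (dm1 A M \<rho>' h)) = \<zero>\<^bsub>K1 K Q M\<^esub>"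
    using tau_inj(3)[THEN inj_onD, OF _ QR.d0_K1[OF c(1)], of "\<zero>\<^bsub>K1 K Q M\<^esub>"]
    by (simp add: infl3_rules module_ops[OF QR.mK1])
  then show "defl2 (dm1 A M \<rho>' h) \<in> QR.Z1" using c by (simp add: QR.Z1_iff)
qed

text \<open>A coboundary on \<open>A\<close> satisfies the cocycle equations, and these descend to
  \<open>Q\<close> by \<open>infl3_cocycles1D\<close>. The result need not be a coboundary on
  \<open>Q\<close>; its class is the value of \<gamma>.\<close>

lemma defl3_d0:
  assumes "z \<in> relZ0"
  shows "defl3 (d0 A M \<rho>' z) \<in> cocycles1 K Q M \<rho>" "infl3 (defl3 (d0 A M \<rho>' z)) = d0 A M \<rho>' z"
proof -
  have h: "z \<in> carrier (K0 K A M)" "vanishes3 (d0 A M \<rho>' z)" using assms by (auto simp: relZ0_def)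
  note c = defl3[OF AR.d0_K1[OF h(1)] h(2)]
  show "infl3 (defl3 (d0 A M \<rho>' z)) = d0 A M \<rho>' z" by (rule c)
  then show "defl3 (d0 A M \<rho>' z) \<in> cocycles1 K Q M \<rho>"
    using AR.d0_cocycles1[OF h(1)] by (intro infl3_cocycles1D c) simp
qed

text \<open>With one argument in \<open>B\<close>, one of the three terms of the coboundary has
  \<open>B\<close> acting on \<open>M\<close> and drops out. The four equations left are the
  compatibility conditions of the space of homomorphisms on the abelianization.\<close>

lemma relZm1_iff: "h \<in> relZm1 \<longleftrightarrow> h \<in> carrier (Km1 K A M) \<and> (\<forall>a\<in>carrier A. \<forall>b\<in>B.
    h (a \<otimes>\<^bsub>A\<^esub> b) = lact \<rho>' a (h b) \<and> h (b \<otimes>\<^bsub>A\<^esub> a) = ract \<rho>' (h b) a \<and>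
    h (brk A a b) = lbr \<rho>' a (h b) \<and> h (brk A b a) = rbr \<rho>' (h b) a)"
proof (cases "h \<in> carrier (Km1 K A M)")
  case True
  then have h: "lin_map K A M h" by (simp add: AR.Km1_iff)
  interpret agM: abelian_group M by (rule AR.agM)
  have n: "\<ominus>\<^bsub>M\<^esub> x \<oplus>\<^bsub>M\<^esub> y = \<zero>\<^bsub>M\<^esub> \<longleftrightarrow> y = x" if "x \<in> carrier M" "y \<in> carrier M" for x y
    using that agM.l_neg[of x] agM.minus_equality[of y "\<ominus>\<^bsub>M\<^esub> x"] agM.a_comm[of "\<ominus>\<^bsub>M\<^esub> x" y] by auto
  have m: "x \<ominus>\<^bsub>M\<^esub> y = \<zero>\<^bsub>M\<^esub> \<longleftrightarrow> x = y" if "x \<in> carrier M" "y \<in> carrier M" for x y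
    using that agM.minus_eq_zero by auto
  note H = lin_map_rules[OF mA mM h]
  have "fst (dm1 A M \<rho>' h) a b = \<zero>\<^bsub>M\<^esub> \<longleftrightarrow> h (a \<otimes>\<^bsub>A\<^esub> b) = lact \<rho>' a (h b)"
    "fst (dm1 A M \<rho>' h) b a = \<zero>\<^bsub>M\<^esub> \<longleftrightarrow> h (b \<otimes>\<^bsub>A\<^esub> a) = ract \<rho>' (h b) a"
    "snd (dm1 A M \<rho>' h) a b = \<zero>\<^bsub>M\<^esub> \<longleftrightarrow> h (brk A a b) = lbr \<rho>' a (h b)"
    "snd (dm1 A M \<rho>' h) b a = \<zero>\<^bsub>M\<^esub> \<longleftrightarrow> h (brk A b a) = rbr \<rho>' (h b) a"
    if ab: "a \<in> carrier A" "b \<in> B" for a b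
    using n[of "lact \<rho>' a (h b)" "h (a \<otimes>\<^bsub>A\<^esub> b)"] n[of "lbr \<rho>' a (h b)" "h (brk A a b)"]
      m[of "h (b \<otimes>\<^bsub>A\<^esub> a)" "ract \<rho>' (h b) a"] m[of "h (brk A b a)" "rbr \<rho>' (h b) a"] ab
    by (simp_all add: AR.dm1_val H(1) B_in B_act)
  then show ?thesis using True unfolding relZm1_def vanishes2_def by blast
qed (simp add: relZm1_def)

end

section \<open>Homomorphisms out of the abelianization\<close>

context setting
begin

abbreviation BA where "BA \<equiv> A\<lparr>carrier := B\<rparr>"
abbreviation cI where "cI \<equiv> comm_ideal K BA"

text \<open>The zeros of \<open>h\<close> in \<open>B\<close> form a two-sided ideal of
  \<open>B\<close>. It contains all products and brackets, because \<open>h\<close> turns them into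
  actions of an element of \<open>B\<close> on \<open>M\<close>.\<close>

lemma comm_ideal_least:
  assumes h: "h \<in> relZm1"
  shows "cI \<subseteq> {b\<in>B. h b = \<zero>\<^bsub>M\<^esub>}" (is "_ \<subseteq> ?J")
proof -
  have Z: "h (a \<otimes>\<^bsub>A\<^esub> b) = lact \<rho>' a (h b)" "h (brk A a b) = lbr \<rho>' a (h b)"
       "h (b \<otimes>\<^bsub>A\<^esub> a) = ract \<rho>' (h b) a" "h (brk A b a) = rbr \<rho>' (h b) a"
    if "a \<in> carrier A" "b \<in> B" for a b using h that unfolding relZm1_iff by blast+
  have l: "lin_map K A M h" using h by (auto simp: relZm1_def AR.Km1_iff)
  note H = lin_map_rules[OF mA mM l]
  have "submodule ?J K BA"
    by (rule submoduleI'[OF mB]) (auto simp: B_closed H B_in module_ops[OF mM])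
  then have "two_sided_ideal K BA ?J"
    by (auto simp: two_sided_ideal_def B_closed B_in B_act H Z)
  then show ?thesis unfolding comm_ideal_def
    by (intro Inter_lower) (auto simp: B_closed B_in B_act H Z)
qed

lemma cI_sub: "submodule cI K BA"
proof -
  have tB: "two_sided_ideal K BA B"
    using module.carrier_is_submodule[OF mB] by (auto simp: two_sided_ideal_def B_closed B_in)
  \<comment> \<open>\<open>B\<close> is itself one of the intersected ideals; this keeps the
    intersection inside \<open>B\<close>.\<close>
  have B: "B \<in> {I. two_sided_ideal K BA I \<and> (\<forall>x\<in>carrier BA. \<forall>y\<in>carrier BA. x \<otimes>\<^bsub>BA\<^esub> y \<in> I \<and> brk BA x y \<in> I)}"
    using tB by (auto simp: B_closed B_in)
  show ?thesis
  proof (rule submoduleI'[OF mB])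
    show "cI \<subseteq> carrier BA" using B by (auto simp: comm_ideal_def)
    show "\<zero>\<^bsub>BA\<^esub> \<in> cI"
      unfolding comm_ideal_def using submodule_rules(1)[OF mB] by (auto simp: two_sided_ideal_def)
    show "x \<oplus>\<^bsub>BA\<^esub> y \<in> cI" if "x \<in> cI" "y \<in> cI" for x y
      using that submodule_rules(3)[OF mB] unfolding comm_ideal_def two_sided_ideal_def by fastforce
    show "k \<odot>\<^bsub>BA\<^esub> x \<in> cI" if "k \<in> carrier K" "x \<in> cI" for k x
      using that submodule_rules(6)[OF mB] unfolding comm_ideal_def two_sided_ideal_def by fastforce
  qed
qed

abbreviation abB where "abB \<equiv> abelianization K BA"
abbreviation cl where "cl \<equiv> ab_class K A B"

lemma cl_eq: "cl b = cI +>\<^bsub>BA\<^esub> b"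
  by (simp add: ab_class_def)

lemma ab_carrier: "carrier abB = cl ` B"
  by (auto simp: abelianization_def awb_quot_def A_RCOSETS_def' cl_eq)

lemma ab_ops:
  "\<And>x y. x \<in> B \<Longrightarrow> y \<in> B \<Longrightarrow> cl x \<oplus>\<^bsub>abB\<^esub> cl y = cl (x \<oplus>\<^bsub>A\<^esub> y)"
  "\<And>k x. k \<in> carrier K \<Longrightarrow> x \<in> B \<Longrightarrow> k \<odot>\<^bsub>abB\<^esub> cl x = cl (k \<odot>\<^bsub>A\<^esub> x)"
  "\<zero>\<^bsub>abB\<^esub> = cl \<zero>\<^bsub>A\<^esub>"
  using coset_add[OF mB cI_sub] coset_smult[OF mB cI_sub] coset_zero[OF mB cI_sub]
  by (simp_all add: abelianization_def awb_quot_def cl_eq)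

text \<open>\<open>h\<close> kills the commutator ideal, hence is constant on its cosets.\<close>

lemma restr_val: assumes h: "h \<in> relZm1" and b: "b \<in> B" shows "restr_ab K A B h (cl b) = h b"
proof -
  have l: "lin_map K A M h" using h by (auto simp: relZm1_def AR.Km1_iff)
  note H = lin_map_rules[OF mA mM l]
  have "the_elem (h ` cl b) = h b"
  proof (rule the_elem_image)
    show "b \<in> cl b" unfolding cl_eq by (rule coset_self[OF mB cI_sub]) (simp add: b)
    fix y assume "y \<in> cl b"
    then obtain i where "i \<in> cI" "y = i \<oplus>\<^bsub>A\<^esub> b" unfolding cl_eq coset_mem by auto
    then show "h y = h b" using comm_ideal_least[OF h] b by (auto simp: H B_in module_ops[OF mM])
  qed
  then show ?thesis using b by (simp add: restr_ab_def ab_carrier)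
qed

lemma hom_ab_iff: "\<phi> \<in> carrier (Hom_ab K A B M \<rho> \<tau>) \<longleftrightarrow>
   \<phi> \<in> extensional (carrier abB) \<and> lin_map K abB M \<phi> \<and>
   (\<forall>a\<in>carrier A. \<forall>b\<in>B. \<phi> (cl (a \<otimes>\<^bsub>A\<^esub> b)) = lact \<rho>' a (\<phi> (cl b)) \<and> \<phi> (cl (b \<otimes>\<^bsub>A\<^esub> a)) = ract \<rho>' (\<phi> (cl b)) a \<and>
    \<phi> (cl (brk A a b)) = lbr \<rho>' a (\<phi> (cl b)) \<and> \<phi> (cl (brk A b a)) = rbr \<rho>' (\<phi> (cl b)) a)"
  by (simp add: Hom_ab_def hom_mod_carrier rep_along_simps)

lemma restr_Hom: assumes h: "h \<in> relZm1" shows "restr_ab K A B h \<in> carrier (Hom_ab K A B M \<rho> \<tau>)"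
proof -
  have Z: "h (a \<otimes>\<^bsub>A\<^esub> b) = lact \<rho>' a (h b)" "h (brk A a b) = lbr \<rho>' a (h b)"
       "h (b \<otimes>\<^bsub>A\<^esub> a) = ract \<rho>' (h b) a" "h (brk A b a) = rbr \<rho>' (h b) a"
    if "a \<in> carrier A" "b \<in> B" for a b using h that unfolding relZm1_iff by blast+
  have l: "lin_map K A M h" using h by (auto simp: relZm1_def AR.Km1_iff)
  note H = lin_map_rules[OF mA mM l]
  show ?thesis unfolding hom_ab_iff
  proof (intro conjI)
    show "restr_ab K A B h \<in> extensional (carrier abB)" by (simp add: restr_ab_def)
    show "lin_map K abB M (restr_ab K A B h)"
    proof (rule lin_map_image[OF mB, of _ cl])
      show "lin_map K BA M (\<lambda>x. restr_ab K A B h (cl x))"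
        using lin_mapB[OF l] by (subst lin_map_cong[OF mB, of _ h]) (simp_all add: restr_val[OF h])
    qed (simp_all add: ab_carrier ab_ops)
  qed (simp add: restr_val[OF h] B_closed Z)
qed

lemma restr_eqI:
  assumes "\<phi> \<in> extensional (carrier abB)" "h \<in> relZm1" "\<And>b. b \<in> B \<Longrightarrow> \<phi> (cl b) = h b"
  shows "restr_ab K A B h = \<phi>"
  by (rule extensionalityI[of _ "carrier abB"])
    (use assms restr_Hom[OF assms(2)] in \<open>auto simp: ab_carrier restr_val hom_ab_iff\<close>)

text \<open>A homomorphism on the abelianization pulls back to \<open>B\<close> and extends to
  \<open>A\<close> through \<beta>. Membership of the extension in \<open>relZm1\<close> concerns
  only its values on \<open>B\<close>, where it agrees with the given map.\<close>

lemma restr_surj: "carrier (Hom_ab K A B M \<rho> \<tau>) = restr_ab K A B ` relZm1"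
proof (intro equalityI subsetI)
  fix \<phi> assume p: "\<phi> \<in> carrier (Hom_ab K A B M \<rho> \<tau>)"
  then have pl: "lin_map K abB M \<phi>" and pe: "\<phi> \<in> extensional (carrier abB)" by (simp_all add: hom_ab_iff)
  obtain s where "lin_section K A \<tau> Q s" by (rule section_exists)
  then interpret setting_sec K A B Q \<tau> M \<rho> s by unfold_locales
  define h where "h = (\<lambda>a\<in>carrier A. \<phi> (cl (\<beta> a)))"
  have hB: "h b = \<phi> (cl b)" if "b \<in> B" for b using that by (simp add: h_def B_in)
  have "lin_map K BA M (\<lambda>b. \<phi> (cl b))"
    by (rule lin_map_comp[OF pl]) (rule lin_mapI; simp add: ab_carrier ab_ops)
  then have "lin_map K A M (\<lambda>a. \<phi> (cl (\<beta> a)))"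
    by (rule lin_map_comp) (rule lin_mapI; simp add: lin_mapD[OF beta_lin])
  then have "h \<in> carrier (Km1 K A M)" by (simp add: AR.Km1_iff h_def lin_map_restrict mA)
  then have hZ: "h \<in> relZm1" using p by (simp add: relZm1_iff hB B_closed hom_ab_iff)
  have "restr_ab K A B h = \<phi>" by (rule restr_eqI[OF pe hZ]) (simp add: hB)
  then show "\<phi> \<in> restr_ab K A B ` relZm1" using hZ by blast
qed (auto simp: restr_Hom)

lemma mrelZm1: "module K ((Km1 K A M)\<lparr>carrier := relZm1\<rparr>)"
  by (rule submodule.submodule_is_module[OF relZm1_sub AR.mKm1])

lemma Hom_ab_ops:
  "f \<oplus>\<^bsub>Hom_ab K A B M \<rho> \<tau>\<^esub> g = (\<lambda>v\<in>carrier abB. f v \<oplus>\<^bsub>M\<^esub> g v)"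
  "k \<odot>\<^bsub>Hom_ab K A B M \<rho> \<tau>\<^esub> f = (\<lambda>v\<in>carrier abB. k \<odot>\<^bsub>M\<^esub> f v)"
  "\<zero>\<^bsub>Hom_ab K A B M \<rho> \<tau>\<^esub> = (\<lambda>v\<in>carrier abB. \<zero>\<^bsub>M\<^esub>)"
  by (simp_all add: Hom_ab_def hom_mod_ops)

lemma restr_ops:
  "h \<in> relZm1 \<Longrightarrow> h' \<in> relZm1 \<Longrightarrow> restr_ab K A B h \<oplus>\<^bsub>Hom_ab K A B M \<rho> \<tau>\<^esub> restr_ab K A B h' = restr_ab K A B (h \<oplus>\<^bsub>Km1 K A M\<^esub> h')"
  "k \<in> carrier K \<Longrightarrow> h \<in> relZm1 \<Longrightarrow> k \<odot>\<^bsub>Hom_ab K A B M \<rho> \<tau>\<^esub> restr_ab K A B h = restr_ab K A B (k \<odot>\<^bsub>Km1 K A M\<^esub> h)"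
  "\<zero>\<^bsub>Hom_ab K A B M \<rho> \<tau>\<^esub> = restr_ab K A B \<zero>\<^bsub>Km1 K A M\<^esub>"
  using submodule_rules[OF AR.mKm1 relZm1_sub]
  by (auto intro!: restr_eqI[symmetric] simp: Hom_ab_ops restr_val AR.Km1_add B_in ab_carrier)

lemma mHom_ab: "module K (Hom_ab K A B M \<rho> \<tau>)"
  by (rule module_image[OF mrelZm1, of _ "restr_ab K A B"]) (simp_all add: restr_surj restr_ops)

lemma restr_zero_iff: assumes "h \<in> relZm1" shows "restr_ab K A B h = \<zero>\<^bsub>Hom_ab K A B M \<rho> \<tau>\<^esub> \<longleftrightarrow> vanishes1 h"
proof
  assume e: "restr_ab K A B h = \<zero>\<^bsub>Hom_ab K A B M \<rho> \<tau>\<^esub>"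
  show "vanishes1 h" unfolding vanishes1_def
    using restr_val[OF assms] by (simp add: e Hom_ab_ops ab_carrier)
next
  assume "vanishes1 h"
  then show "restr_ab K A B h = \<zero>\<^bsub>Hom_ab K A B M \<rho> \<tau>\<^esub>"
    using assms by (intro restr_eqI) (auto simp: Hom_ab_ops vanishes1_def ab_carrier)
qed

lemma section_defect: "lin_section K A \<tau> Q s \<Longrightarrow> x \<in> carrier Q \<Longrightarrow> y \<in> carrier Q \<Longrightarrow>
   s x \<otimes>\<^bsub>A\<^esub> s y \<ominus>\<^bsub>A\<^esub> s (x \<otimes>\<^bsub>Q\<^esub> y) \<in> B \<and> brk A (s x) (s y) \<ominus>\<^bsub>A\<^esub> s (brk Q x y) \<in> B"
  by (simp add: B_iff lin_section_def lin_mapD[of K Q A s])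

text \<open>For every section \<open>s\<close> the factor set pushed to \<open>M\<close> by
  \<open>h\<close> differs from the deflated coboundary of \<open>h\<close> by the coboundary of
  \<open>h\<close> composed with \<open>s\<close>. This settles independence of the section and
  gives a formula that avoids sections altogether.\<close>

lemma connecting_val:
  assumes h: "h \<in> relZm1"
  shows "connecting K A B Q M \<rho> \<tau> (restr_ab K A B h) = class1 K Q M \<rho> (defl2 (dm1 A M \<rho>' h))"
  unfolding connecting_def
proof -
  let ?c = "defl2 (dm1 A M \<rho>' h)"
  have hK: "h \<in> carrier (Km1 K A M)" using h by (simp add: relZm1_def)
  then have l: "lin_map K A M h" by (simp add: AR.Km1_iff)
  note H = lin_map_rules[OF mA mM l]
  have c: "?c \<in> carrier (K0 K Q M)" "infl2 ?c = dm1 A M \<rho>' h" using defl2_dm1[OF h] by (auto simp: QR.Z1_iff)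
  have main: "class1 K Q M \<rho> (factor_set Q A s (\<lambda>b. restr_ab K A B h (cl b))) = class1 K Q M \<rho> ?c"
    if "lin_section K A \<tau> Q s" for s
  proof -
    interpret setting_sec K A B Q \<tau> M \<rho> s using that by unfold_locales
    note S = section_defect[OF that]
    \<comment> \<open>The coboundary of \<open>g\<close> contains \<open>h (s (x y))\<close> where
      that of \<open>h\<close>, read at \<open>s x\<close> and \<open>s y\<close>, contains
      \<open>h (s x s y)\<close>. Their difference is the factor set.\<close>
    define g where "g = sec1 h"
    have g: "g \<in> carrier (Km1 K Q M)" unfolding g_def by (rule sec1_Km1[OF hK])
    have gv: "g x = h (s x)" if "x \<in> carrier Q" for x using that by (simp add: g_def sec1_def)
    let ?f = "factor_set Q A s (\<lambda>b. restr_ab K A B h (cl b))"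
    have fv: "fst ?f x y = h (s x \<otimes>\<^bsub>A\<^esub> s y) \<ominus>\<^bsub>M\<^esub> h (s (x \<otimes>\<^bsub>Q\<^esub> y))"
        "snd ?f x y = h (brk A (s x) (s y)) \<ominus>\<^bsub>M\<^esub> h (s (brk Q x y))" if "x \<in> carrier Q" "y \<in> carrier Q" for x y
      using that S[OF that] by (simp_all add: factor_set_def restr_val[OF h] H)
    have f: "?f \<in> carrier (K0 K Q M)"
    proof -
      note I = bilin_comp_l[OF QR.bils(5)] bilin_comp_r[OF QR.bils(5)] bilin_comp_l[OF QR.bils(6)] bilin_comp_r[OF QR.bils(6)]
        bilin_comp_l[OF AR.bils(5)] bilin_comp_r[OF AR.bils(5)] bilin_comp_l[OF AR.bils(6)] bilin_comp_r[OF AR.bils(6)]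
      have "?f = (\<lambda>x\<in>carrier Q. \<lambda>y\<in>carrier Q. h (s x \<otimes>\<^bsub>A\<^esub> s y) \<ominus>\<^bsub>M\<^esub> h (s (x \<otimes>\<^bsub>Q\<^esub> y)),
          \<lambda>x\<in>carrier Q. \<lambda>y\<in>carrier Q. h (brk A (s x) (s y)) \<ominus>\<^bsub>M\<^esub> h (s (brk Q x y)))"
        using S by (simp add: factor_set_def restr_val[OF h] H cong: restrict_cong)
      also have "\<dots> \<in> carrier (K0 K Q M)"
        unfolding QR.K0_iff bilin_map_restrict[OF mQ mQ]
        by (auto intro!: bilin_mapI lin_map_minus[OF mM] lin_map_comp[OF l] lin_map_comp[OF s_lin] I lin_map_id s_lin)
      finally show ?thesis .
    qed
    have "?c = dm1 Q M \<rho> g \<oplus>\<^bsub>K0 K Q M\<^esub> ?f"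
    proof (rule QR.K0_eqI[OF c(1) module_ops(2)[OF QR.mK0 QR.dm1_K0[OF g] f]])
      fix x y assume xy [simp]: "x \<in> carrier Q" "y \<in> carrier Q"
      \<comment> \<open>The deflated cochain is known only through its inflation, so its value at
        \<open>x\<close>, \<open>y\<close> is read off at the lifts \<open>s x\<close>,
        \<open>s y\<close>.\<close>
      have "fst (infl2 ?c) (s x) (s y) = fst ?c x y" "snd (infl2 ?c) (s x) (s y) = snd ?c x y" by simp_all
      then have e: "fst ?c x y = fst (dm1 A M \<rho>' h) (s x) (s y)" "snd ?c x y = snd (dm1 A M \<rho>' h) (s x) (s y)"
        by (simp_all add: c)
      note [simp] = H
      show "fst ?c x y = fst (dm1 Q M \<rho> g \<oplus>\<^bsub>K0 K Q M\<^esub> ?f) x y"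
        by (simp add: e AR.dm1_val QR.dm1_val QR.K0_add fv gv rep_along_simps)
          (rule AR.feq, (rule AR.fop | (rule AR.fatom, (simp; fail)))+, simp add: algebra_simps)
      show "snd ?c x y = snd (dm1 Q M \<rho> g \<oplus>\<^bsub>K0 K Q M\<^esub> ?f) x y"
        by (simp add: e AR.dm1_val QR.dm1_val QR.K0_add fv gv rep_along_simps)
          (rule AR.feq, (rule AR.fop | (rule AR.fatom, (simp; fail)))+, simp add: algebra_simps)
    qed
    then show ?thesis using QR.class1_eq_iff[OF c(1) f] g by auto
  qed
  obtain s where "lin_section K A \<tau> Q s" by (rule section_exists)
  then show "the_elem {class1 K Q M \<rho> (factor_set Q A s (\<lambda>b. restr_ab K A B h (cl b))) | s. lin_section K A \<tau> Q s}
     = class1 K Q M \<rho> ?c"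
    by (rule the_elem_Collect[where P="lin_section K A \<tau> Q"]) (rule main)
qed

end

section \<open>Crossed modules and isomorphisms of crossed extensions\<close>

text \<open>Product and bracket of \<open>C\<close> factor through the action, so the axioms (B) and the axioms of an
  algebra with bracket on \<open>C\<close> are consequences of (A).\<close>

lemma crossed_moduleI:
  fixes K :: "'k ring" and A :: "('k, 'a) awb" and C :: "('k, 'c) awb"
  assumes A: "AWB K A" and C: "module K C" and bil: "action_bilin K A C \<alpha>" and act: "action_A A C \<alpha>"
    and nu: "lin_map K C A \<nu>"
    and eq: "\<And>c a. c \<in> carrier C \<Longrightarrow> a \<in> carrier A \<Longrightarrow> \<nu> (ract \<alpha> c a) = \<nu> c \<otimes>\<^bsub>A\<^esub> a"
      "\<And>c a. c \<in> carrier C \<Longrightarrow> a \<in> carrier A \<Longrightarrow> \<nu> (lact \<alpha> a c) = a \<otimes>\<^bsub>A\<^esub> \<nu> c"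
      "\<And>c a. c \<in> carrier C \<Longrightarrow> a \<in> carrier A \<Longrightarrow> \<nu> (rbr \<alpha> c a) = brk A (\<nu> c) a"
      "\<And>c a. c \<in> carrier C \<Longrightarrow> a \<in> carrier A \<Longrightarrow> \<nu> (lbr \<alpha> a c) = brk A a (\<nu> c)"
    and P: "\<And>c c'. c \<in> carrier C \<Longrightarrow> c' \<in> carrier C \<Longrightarrow> c \<otimes>\<^bsub>C\<^esub> c' = lact \<alpha> (\<nu> c) c'"
      "\<And>c c'. c \<in> carrier C \<Longrightarrow> c' \<in> carrier C \<Longrightarrow> ract \<alpha> c (\<nu> c') = lact \<alpha> (\<nu> c) c'"
      "\<And>c c'. c \<in> carrier C \<Longrightarrow> c' \<in> carrier C \<Longrightarrow> brk C c c' = rbr \<alpha> c (\<nu> c')"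
      "\<And>c c'. c \<in> carrier C \<Longrightarrow> c' \<in> carrier C \<Longrightarrow> lbr \<alpha> (\<nu> c) c' = rbr \<alpha> c (\<nu> c')"
  shows "crossed_module K A C \<alpha> \<nu>"
proof -
  interpret actmod K A C \<alpha> by (rule actmod.intro) fact+
  note [simp] = lin_map_rules[OF C mA nu] eq
  \<comment> \<open>A form of the Peiffer identity in which the image under \<nu> may already be
    rewritten: \<open>simp\<close> turns \<open>\<nu> (lbr \<alpha> a c2)\<close> into
    \<open>brk A a (\<nu> c2)\<close>, after which the original pattern no longer matches.\<close>
  have P2: "ract \<alpha> c a' = lact \<alpha> (\<nu> c) c'" if "c \<in> carrier C" "c' \<in> carrier C" "a' = \<nu> c'" for c c' a'
    using that P by simp
  have cc: "c \<otimes>\<^bsub>C\<^esub> c' \<in> carrier C" "brk C c c' \<in> carrier C" if "c \<in> carrier C" "c' \<in> carrier C" for c c'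
    using that by (simp_all add: P(1,3))
  have bC: "bilin_map K C C C (mult C)" "bilin_map K C C C (brk C)"
    using bilin_mapD[OF bils(1)] bilin_mapD[OF bils(4)]
    by (auto simp: P cong: lin_map_cong[OF C] intro!: bilin_mapI bilin_comp_l[OF bils(1)] bilin_comp_r[OF bils(4)] nu)
  have awbC: "AWB K C"
    unfolding AWB_def AWB_axioms_def
  proof (intro conjI allI impI)
    fix a b c assume [simp]: "a \<in> carrier C" "b \<in> carrier C" "c \<in> carrier C"
    show "a \<otimes>\<^bsub>C\<^esub> b \<otimes>\<^bsub>C\<^esub> c = a \<otimes>\<^bsub>C\<^esub> (b \<otimes>\<^bsub>C\<^esub> c)" by (simp add: P(1))
    show "brk C (a \<otimes>\<^bsub>C\<^esub> b) c = brk C a c \<otimes>\<^bsub>C\<^esub> b \<oplus>\<^bsub>C\<^esub> a \<otimes>\<^bsub>C\<^esub> brk C b c"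
      by (simp add: P(1,3) abelian_monoid.a_comm[OF abelian_group.axioms(1)[OF agM]])
  qed (fact fK C bC)+
  have "action_B A C \<alpha>"
    unfolding action_B_def
  proof (intro ballI conjI)
    fix c1 c2 a assume [simp]: "c1 \<in> carrier C" "c2 \<in> carrier C" "a \<in> carrier A"
    show "ract \<alpha> (c1 \<otimes>\<^bsub>C\<^esub> c2) a = c1 \<otimes>\<^bsub>C\<^esub> ract \<alpha> c2 a" by (simp add: P(1))
    show "lact \<alpha> a (c1 \<otimes>\<^bsub>C\<^esub> c2) = lact \<alpha> a c1 \<otimes>\<^bsub>C\<^esub> c2" by (simp add: P(1))
    show "ract \<alpha> c1 a \<otimes>\<^bsub>C\<^esub> c2 = c1 \<otimes>\<^bsub>C\<^esub> lact \<alpha> a c2" by (simp add: P(1))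
    show "brk C (ract \<alpha> c1 a) c2 = c1 \<otimes>\<^bsub>C\<^esub> lbr \<alpha> a c2 \<oplus>\<^bsub>C\<^esub> ract \<alpha> (brk C c1 c2) a"
      using P2[of c1 "lbr \<alpha> a c2" "brk A a (\<nu> c2)"]
      by (simp add: P(1,3) abelian_monoid.a_comm[OF abelian_group.axioms(1)[OF agM]])
    show "brk C (lact \<alpha> a c1) c2 = lact \<alpha> a (brk C c1 c2) \<oplus>\<^bsub>C\<^esub> lbr \<alpha> a c2 \<otimes>\<^bsub>C\<^esub> c1" by (simp add: P(1,3))
    show "rbr \<alpha> (c1 \<otimes>\<^bsub>C\<^esub> c2) a = c1 \<otimes>\<^bsub>C\<^esub> rbr \<alpha> c2 a \<oplus>\<^bsub>C\<^esub> rbr \<alpha> c1 a \<otimes>\<^bsub>C\<^esub> c2" by (simp add: P(1))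
  qed
  then show ?thesis
    unfolding crossed_module_def awb_action_def awb_hom_def
    using A awbC bil act nu by (simp add: P)
qed

text \<open>Compatibility is demanded of bare records, without assuming the axioms of a crossed
  extension on either side. An isomorphism can thus be established first and the axioms transported
  along it.\<close>

definition xiso ::
  "'k ring \<Rightarrow> ('k, 'a) awb \<Rightarrow> ('k, 'm) module \<Rightarrow> ('k, 'm, 'c, 'a) xext \<Rightarrow> ('k, 'm, 'd, 'a) xext \<Rightarrow> ('c \<Rightarrow> 'd) \<Rightarrow> bool" where
  "xiso K A M e e' \<phi> \<longleftrightarrow> bij_betw \<phi> (carrier (xobj e)) (carrier (xobj e')) \<and>
    (\<forall>x\<in>carrier (xobj e). \<forall>y\<in>carrier (xobj e). \<phi> (x \<oplus>\<^bsub>xobj e\<^esub> y) = \<phi> x \<oplus>\<^bsub>xobj e'\<^esub> \<phi> y \<and>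
       \<phi> (x \<otimes>\<^bsub>xobj e\<^esub> y) = \<phi> x \<otimes>\<^bsub>xobj e'\<^esub> \<phi> y \<and> \<phi> (brk (xobj e) x y) = brk (xobj e') (\<phi> x) (\<phi> y)) \<and>
    (\<forall>k\<in>carrier K. \<forall>x\<in>carrier (xobj e). \<phi> (k \<odot>\<^bsub>xobj e\<^esub> x) = k \<odot>\<^bsub>xobj e'\<^esub> \<phi> x) \<and>
    (\<forall>a\<in>carrier A. \<forall>c\<in>carrier (xobj e).
        \<phi> (lact (xact e) a c) = lact (xact e') a (\<phi> c) \<and>
        \<phi> (ract (xact e) c a) = ract (xact e') (\<phi> c) a \<and>
        \<phi> (lbr (xact e) a c) = lbr (xact e') a (\<phi> c) \<and>
        \<phi> (rbr (xact e) c a) = rbr (xact e') (\<phi> c) a) \<and>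
     (\<forall>c\<in>carrier (xobj e). xproj e' (\<phi> c) = xproj e c) \<and>
     (\<forall>m\<in>carrier M. \<phi> (xinc e m) = xinc e' m)"

text \<open>What is needed to invert an \<open>xiso\<close>: the result of each operation lies in
  the carrier, so that the inverse function cancels \<phi> on it.\<close>

definition xclosed ::
  "'k ring \<Rightarrow> ('k, 'a) awb \<Rightarrow> ('k, 'm) module \<Rightarrow> ('k, 'm, 'c, 'a) xext \<Rightarrow> bool" where
  "xclosed K A M e \<longleftrightarrow>
    (\<forall>x\<in>carrier (xobj e). \<forall>y\<in>carrier (xobj e). x \<oplus>\<^bsub>xobj e\<^esub> y \<in> carrier (xobj e) \<and>
       x \<otimes>\<^bsub>xobj e\<^esub> y \<in> carrier (xobj e) \<and> brk (xobj e) x y \<in> carrier (xobj e)) \<and>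
    (\<forall>k\<in>carrier K. \<forall>x\<in>carrier (xobj e). k \<odot>\<^bsub>xobj e\<^esub> x \<in> carrier (xobj e)) \<and>
    (\<forall>a\<in>carrier A. \<forall>c\<in>carrier (xobj e). lact (xact e) a c \<in> carrier (xobj e) \<and> ract (xact e) c a \<in> carrier (xobj e) \<and>
        lbr (xact e) a c \<in> carrier (xobj e) \<and> rbr (xact e) c a \<in> carrier (xobj e)) \<and>
     (\<forall>m\<in>carrier M. xinc e m \<in> carrier (xobj e))"

lemma xiso_sym:
  assumes i: "xiso K A M e e' \<phi>" and c: "xclosed K A M e"
  shows "xiso K A M e' e (inv_into (carrier (xobj e)) \<phi>)"
proof -
  let ?C = "carrier (xobj e)" and ?D = "carrier (xobj e')" and ?\<psi> = "inv_into (carrier (xobj e)) \<phi>"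
  have bij: "bij_betw \<phi> ?C ?D" using i by (simp add: xiso_def)
  have b': "bij_betw ?\<psi> ?D ?C" by (rule bij_betw_inv_into[OF bij])
  have im: "y \<in> ?D \<Longrightarrow> \<exists>x\<in>?C. y = \<phi> x" for y using bij by (auto simp: bij_betw_def)
  have inv: "?\<psi> (\<phi> x) = x" if "x \<in> ?C" for x using bij that by (simp add: bij_betw_inv_into_left)
  have inv': "?\<psi> y = x" if "x \<in> ?C" "\<phi> x = y" for x y using inv that by blast
  show ?thesis
    unfolding xiso_def
  proof (intro conjI ballI b')
    fix y y' k a assume y: "y \<in> ?D"
    then obtain x where x: "x \<in> ?C" "y = \<phi> x" using im by blast
    { fix y' assume y': "y' \<in> ?D"
      then obtain x' where x': "x' \<in> ?C" "y' = \<phi> x'" using im by blast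
      show "?\<psi> (y \<oplus>\<^bsub>xobj e'\<^esub> y') = ?\<psi> y \<oplus>\<^bsub>xobj e\<^esub> ?\<psi> y'"
        by (rule inv') (use x x' i c in \<open>simp_all add: inv xiso_def xclosed_def\<close>)
      show "?\<psi> (y \<otimes>\<^bsub>xobj e'\<^esub> y') = ?\<psi> y \<otimes>\<^bsub>xobj e\<^esub> ?\<psi> y'"
        by (rule inv') (use x x' i c in \<open>simp_all add: inv xiso_def xclosed_def\<close>)
      show "?\<psi> (brk (xobj e') y y') = brk (xobj e) (?\<psi> y) (?\<psi> y')"
        by (rule inv') (use x x' i c in \<open>simp_all add: inv xiso_def xclosed_def\<close>) }
    { fix k assume "k \<in> carrier K"
      then show "?\<psi> (k \<odot>\<^bsub>xobj e'\<^esub> y) = k \<odot>\<^bsub>xobj e\<^esub> ?\<psi> y"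
        by (intro inv') (use x i c in \<open>simp_all add: inv xiso_def xclosed_def\<close>) }
    { fix a assume a: "a \<in> carrier A"
      show "?\<psi> (lact (xact e') a y) = lact (xact e) a (?\<psi> y)"
        by (rule inv') (use x i c a in \<open>simp_all add: inv xiso_def xclosed_def\<close>)
      show "?\<psi> (ract (xact e') y a) = ract (xact e) (?\<psi> y) a"
        by (rule inv') (use x i c a in \<open>simp_all add: inv xiso_def xclosed_def\<close>)
      show "?\<psi> (lbr (xact e') a y) = lbr (xact e) a (?\<psi> y)"
        by (rule inv') (use x i c a in \<open>simp_all add: inv xiso_def xclosed_def\<close>)
      show "?\<psi> (rbr (xact e') y a) = rbr (xact e) (?\<psi> y) a"
        by (rule inv') (use x i c a in \<open>simp_all add: inv xiso_def xclosed_def\<close>) }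
    show "xproj e (?\<psi> y) = xproj e' y" using x i by (simp add: inv xiso_def)
  next
    fix m assume "m \<in> carrier M"
    then show "?\<psi> (xinc e' m) = xinc e m" by (intro inv') (use i c in \<open>simp_all add: xiso_def xclosed_def\<close>)
  qed
qed

lemma xiso_congruent: "xiso K A M e e' \<phi> \<Longrightarrow> congruent K A M e e'"
  unfolding congruent_def
  by (rule bexI[of _ \<phi>]) (auto simp: xiso_def awb_hom_def lin_map_def bij_betw_def)

lemma congruent_trans: "congruent K A M e e' \<Longrightarrow> congruent K A M e' e'' \<Longrightarrow> congruent K A M e e''"
  unfolding congruent_def
proof (elim bexE conjE)
  fix f g assume f: "f \<in> awb_hom K (xobj e) (xobj e')" and g: "g \<in> awb_hom K (xobj e') (xobj e'')"
    and *: "\<forall>a\<in>carrier A. \<forall>c\<in>carrier (xobj e).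
        f (lact (xact e) a c) = lact (xact e') a (f c) \<and> f (ract (xact e) c a) = ract (xact e') (f c) a \<and>
        f (lbr (xact e) a c) = lbr (xact e') a (f c) \<and> f (rbr (xact e) c a) = rbr (xact e') (f c) a"
     "\<forall>c\<in>carrier (xobj e). xproj e' (f c) = xproj e c" "\<forall>m\<in>carrier M. f (xinc e m) = xinc e' m"
     "\<forall>a\<in>carrier A. \<forall>c\<in>carrier (xobj e').
        g (lact (xact e') a c) = lact (xact e'') a (g c) \<and> g (ract (xact e') c a) = ract (xact e'') (g c) a \<and>
        g (lbr (xact e') a c) = lbr (xact e'') a (g c) \<and> g (rbr (xact e') c a) = rbr (xact e'') (g c) a"
     "\<forall>c\<in>carrier (xobj e'). xproj e'' (g c) = xproj e' c" "\<forall>m\<in>carrier M. g (xinc e' m) = xinc e'' m"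
  have m: "f x \<in> carrier (xobj e')" if "x \<in> carrier (xobj e)" for x
    using f that by (auto simp: awb_hom_def lin_map_def)
  have "(\<lambda>x. g (f x)) \<in> awb_hom K (xobj e) (xobj e'')"
    using f g m by (auto simp: awb_hom_def intro: lin_map_comp)
  then show "\<exists>\<phi>\<in>awb_hom K (xobj e) (xobj e''). (\<forall>a\<in>carrier A. \<forall>c\<in>carrier (xobj e).
        \<phi> (lact (xact e) a c) = lact (xact e'') a (\<phi> c) \<and> \<phi> (ract (xact e) c a) = ract (xact e'') (\<phi> c) a \<and>
        \<phi> (lbr (xact e) a c) = lbr (xact e'') a (\<phi> c) \<and> \<phi> (rbr (xact e) c a) = rbr (xact e'') (\<phi> c) a) \<and>
     (\<forall>c\<in>carrier (xobj e). xproj e'' (\<phi> c) = xproj e c) \<and> (\<forall>m\<in>carrier M. \<phi> (xinc e m) = xinc e'' m)"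
    by (rule bexI[rotated]) (use * m in simp)
qed

text \<open>Each axiom holds after applying \<phi>, which is injective on the carrier. It is used to
  carry (A) from a crossed extension back to its cochain model.\<close>

lemma action_A_transfer:
  assumes i: "xiso K A M e e' \<phi>" and c: "xclosed K A M e" and A: "AWB K A" and act: "action_A A (xobj e') (xact e')"
  shows "action_A A (xobj e) (xact e)"
  unfolding action_A_def
proof (intro ballI)
  fix a1 a2 x assume [simp]: "a1 \<in> carrier A" "a2 \<in> carrier A" and x [simp]: "x \<in> carrier (xobj e)"
  have inj: "u = v" if "u \<in> carrier (xobj e)" "v \<in> carrier (xobj e)" "\<phi> u = \<phi> v" for u v
    using i that by (auto simp: xiso_def bij_betw_def inj_on_def)
  have [simp]: "\<phi> x \<in> carrier (xobj e')" using i x by (auto simp: xiso_def bij_betw_def)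
  have "module K A" using A by (simp add: AWB_def)
  then have [simp]: "a1 \<otimes>\<^bsub>A\<^esub> a2 \<in> carrier A" "brk A a1 a2 \<in> carrier A"
    using bilin_rules(1)[OF _ _ _ AWB.mult_bilin[OF A]] bilin_rules(1)[OF _ _ _ AWB.brk_bilin[OF A]] by simp_all
  have [simp]: "lact (xact e) a u \<in> carrier (xobj e)" "ract (xact e) u a \<in> carrier (xobj e)"
    "lbr (xact e) a u \<in> carrier (xobj e)" "rbr (xact e) u a \<in> carrier (xobj e)"
    if "a \<in> carrier A" "u \<in> carrier (xobj e)" for a u
    using c that by (auto simp: xclosed_def)
  have [simp]: "u \<oplus>\<^bsub>xobj e\<^esub> v \<in> carrier (xobj e)" if "u \<in> carrier (xobj e)" "v \<in> carrier (xobj e)" for u v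
    using c that by (auto simp: xclosed_def)
  have [simp]: "\<phi> (lact (xact e) a u) = lact (xact e') a (\<phi> u)" "\<phi> (ract (xact e) u a) = ract (xact e') (\<phi> u) a"
        "\<phi> (lbr (xact e) a u) = lbr (xact e') a (\<phi> u)" "\<phi> (rbr (xact e) u a) = rbr (xact e') (\<phi> u) a"
    if "a \<in> carrier A" "u \<in> carrier (xobj e)" for a u
    using i that by (auto simp: xiso_def)
  have [simp]: "\<phi> (u \<oplus>\<^bsub>xobj e\<^esub> v) = \<phi> u \<oplus>\<^bsub>xobj e'\<^esub> \<phi> v" if "u \<in> carrier (xobj e)" "v \<in> carrier (xobj e)" for u v
    using i that by (auto simp: xiso_def)
  note * = act[unfolded action_A_def, rule_format, of a1 a2 "\<phi> x"]
  show "lact (xact e) (a1 \<otimes>\<^bsub>A\<^esub> a2) x = lact (xact e) a1 (lact (xact e) a2 x) \<and>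
     ract (xact e) x (a1 \<otimes>\<^bsub>A\<^esub> a2) = ract (xact e) (ract (xact e) x a1) a2 \<and>
     ract (xact e) (lact (xact e) a1 x) a2 = lact (xact e) a1 (ract (xact e) x a2) \<and>
     rbr (xact e) (lact (xact e) a1 x) a2 = lact (xact e) a1 (rbr (xact e) x a2) \<oplus>\<^bsub>xobj e\<^esub> lact (xact e) (brk A a1 a2) x \<and>
     rbr (xact e) (ract (xact e) x a1) a2 = ract (xact e) (rbr (xact e) x a2) a1 \<oplus>\<^bsub>xobj e\<^esub> ract (xact e) x (brk A a1 a2) \<and>
     lbr (xact e) (a1 \<otimes>\<^bsub>A\<^esub> a2) x = lact (xact e) a1 (lbr (xact e) a2 x) \<oplus>\<^bsub>xobj e\<^esub> ract (xact e) (lbr (xact e) a1 x) a2"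
    by (intro conjI; rule inj; simp add: *)
qed

section \<open>Crossed extensions from cochains\<close>

context setting
begin

text \<open>Only the values of \<open>z\<close> on \<open>A \<times> B\<close> and \<open>B \<times> A\<close> enter.\<close>

definition xtwist :: "('a, 'm) cochain0 \<Rightarrow> ('k, 'm, 'm \<times> 'a, 'a) xext" where
  "xtwist z = \<lparr>xobj = (awb_prod (abelian_awb M) BA)\<lparr>
      mult := (\<lambda>(m, b) (m', b'). (fst z b b', b \<otimes>\<^bsub>A\<^esub> b')),
      brk := (\<lambda>(m, b) (m', b'). (snd z b b', brk A b b'))\<rparr>,
    xinc = (\<lambda>m. (m, \<zero>\<^bsub>A\<^esub>)), xproj = snd,
    xact = \<lparr>lact = (\<lambda>a (m, b). (lact \<rho>' a m \<oplus>\<^bsub>M\<^esub> fst z a b, a \<otimes>\<^bsub>A\<^esub> b)),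
      lbr = (\<lambda>a (m, b). (lbr \<rho>' a m \<oplus>\<^bsub>M\<^esub> snd z a b, brk A a b)),
      ract = (\<lambda>(m, b) a. (ract \<rho>' m a \<oplus>\<^bsub>M\<^esub> fst z b a, b \<otimes>\<^bsub>A\<^esub> a)),
      rbr = (\<lambda>(m, b) a. (rbr \<rho>' m a \<oplus>\<^bsub>M\<^esub> snd z b a, brk A b a))\<rparr>\<rparr>"

lemma xtwist_simps:
  "carrier (xobj (xtwist z)) = carrier M \<times> B"
  "(m, b) \<otimes>\<^bsub>xobj (xtwist z)\<^esub> (m', b') = (fst z b b', b \<otimes>\<^bsub>A\<^esub> b')"
  "brk (xobj (xtwist z)) (m, b) (m', b') = (snd z b b', brk A b b')"
  "(m, b) \<oplus>\<^bsub>xobj (xtwist z)\<^esub> (m', b') = (m \<oplus>\<^bsub>M\<^esub> m', b \<oplus>\<^bsub>A\<^esub> b')"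
  "k \<odot>\<^bsub>xobj (xtwist z)\<^esub> (m, b) = (k \<odot>\<^bsub>M\<^esub> m, k \<odot>\<^bsub>A\<^esub> b)"
  "\<zero>\<^bsub>xobj (xtwist z)\<^esub> = (\<zero>\<^bsub>M\<^esub>, \<zero>\<^bsub>A\<^esub>)"
  "lact (xact (xtwist z)) a (m, b) = (lact \<rho>' a m \<oplus>\<^bsub>M\<^esub> fst z a b, a \<otimes>\<^bsub>A\<^esub> b)"
  "lbr (xact (xtwist z)) a (m, b) = (lbr \<rho>' a m \<oplus>\<^bsub>M\<^esub> snd z a b, brk A a b)"
  "ract (xact (xtwist z)) (m, b) a = (ract \<rho>' m a \<oplus>\<^bsub>M\<^esub> fst z b a, b \<otimes>\<^bsub>A\<^esub> a)"
  "rbr (xact (xtwist z)) (m, b) a = (rbr \<rho>' m a \<oplus>\<^bsub>M\<^esub> snd z b a, brk A b a)"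
  "xinc (xtwist z) m = (m, \<zero>\<^bsub>A\<^esub>)" "xproj (xtwist z) = snd"
  by (simp_all add: xtwist_def awb_prod_def abelian_awb_def)

lemma xtwist_closed: assumes z: "z \<in> carrier (K0 K A M)" shows "xclosed K A M (xtwist z)"
  unfolding xclosed_def xtwist_simps(1)
  by (auto simp: xtwist_simps AR.K0_rules[OF z] B_in B_closed)

lemma xtwist_module: "module K (xobj (xtwist z))"
  by (rule module_image[OF module_mod_prod[OF mM mB], of _ "\<lambda>x. x"])
    (auto simp: xtwist_simps mod_prod_simps)

lemma xtwist_lin: "lin_map K V (xobj (xtwist z)) f \<longleftrightarrow> (\<forall>x\<in>carrier V. snd (f x) \<in> B) \<and> lin_map K V M (\<lambda>x. fst (f x)) \<and> lin_map K V A (\<lambda>x. snd (f x))"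
  by (auto simp: lin_map_def xtwist_simps Pi_def prod_eq_iff B_in split_beta mem_Times_iff)
    (simp_all add: xtwist_def awb_prod_def abelian_awb_def split_beta)

lemma xtwist_bilin: assumes z: "z \<in> carrier (K0 K A M)"
  shows "action_bilin K A (xobj (xtwist z)) (xact (xtwist z))"
  unfolding action_bilin_def bilin_map_def xtwist_lin
  by (auto intro!: lin_mapI simp: xtwist_simps AR.K0_rules[OF z] B_in B_closed
     abelian_monoid.a_ac[OF abelian_group.axioms(1)[OF AR.agM]])

text \<open>The defect of each of the six axioms (A) is one component of the coboundary, with exactly one
  argument in \<open>B\<close>.\<close>

lemma xtwist_action_ids:
  assumes z: "z \<in> carrier (K0 K A M)" and "a1 \<in> carrier A" "a2 \<in> carrier A" "m \<in> carrier M" "b \<in> B"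
  defines "\<alpha> \<equiv> xact (xtwist z)"
  shows "lact \<alpha> (a1 \<otimes>\<^bsub>A\<^esub> a2) (m, b) = lact \<alpha> a1 (lact \<alpha> a2 (m, b)) \<longleftrightarrow> fst (d0 A M \<rho>' z) a1 a2 b = \<zero>\<^bsub>M\<^esub>"
     "ract \<alpha> (m, b) (a1 \<otimes>\<^bsub>A\<^esub> a2) = ract \<alpha> (ract \<alpha> (m, b) a1) a2 \<longleftrightarrow> fst (d0 A M \<rho>' z) b a1 a2 = \<zero>\<^bsub>M\<^esub>"
     "ract \<alpha> (lact \<alpha> a1 (m, b)) a2 = lact \<alpha> a1 (ract \<alpha> (m, b) a2) \<longleftrightarrow> fst (d0 A M \<rho>' z) a1 b a2 = \<zero>\<^bsub>M\<^esub>"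
     "rbr \<alpha> (lact \<alpha> a1 (m, b)) a2 = lact \<alpha> a1 (rbr \<alpha> (m, b) a2) \<oplus>\<^bsub>xobj (xtwist z)\<^esub> lact \<alpha> (brk A a1 a2) (m, b)
        \<longleftrightarrow> snd (d0 A M \<rho>' z) a1 b a2 = \<zero>\<^bsub>M\<^esub>"
     "rbr \<alpha> (ract \<alpha> (m, b) a1) a2 = ract \<alpha> (rbr \<alpha> (m, b) a2) a1 \<oplus>\<^bsub>xobj (xtwist z)\<^esub> ract \<alpha> (m, b) (brk A a1 a2)
        \<longleftrightarrow> snd (d0 A M \<rho>' z) b a1 a2 = \<zero>\<^bsub>M\<^esub>"
     "lbr \<alpha> (a1 \<otimes>\<^bsub>A\<^esub> a2) (m, b) = lact \<alpha> a1 (lbr \<alpha> a2 (m, b)) \<oplus>\<^bsub>xobj (xtwist z)\<^esub> ract \<alpha> (lbr \<alpha> a1 (m, b)) a2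
        \<longleftrightarrow> snd (d0 A M \<rho>' z) a1 a2 b = \<zero>\<^bsub>M\<^esub>"
proof -
  note [simp] = assms(2-5) AR.K0_rules[OF z] xtwist_simps B_in[OF assms(5)] B_closed B_act \<alpha>_def AR.d0_val
  \<comment> \<open>The two sides of an axiom differ by a value of the coboundary only up to sign,
    and the sign varies from axiom to axiom.\<close>
  have key: "x = y \<longleftrightarrow> d = \<zero>\<^bsub>M\<^esub>" if "x \<in> carrier M" "y \<in> carrier M" "d \<in> carrier M" "d = x \<ominus>\<^bsub>M\<^esub> y \<or> d = y \<ominus>\<^bsub>M\<^esub> x" for x y d
    using that abelian_group.minus_eq_zero[OF AR.agM, of x y] abelian_group.minus_eq_zero[OF AR.agM, of y x]
      module_ops(12)[OF mM] by auto
  show "lact \<alpha> (a1 \<otimes>\<^bsub>A\<^esub> a2) (m, b) = lact \<alpha> a1 (lact \<alpha> a2 (m, b)) \<longleftrightarrow> fst (d0 A M \<rho>' z) a1 a2 b = \<zero>\<^bsub>M\<^esub>"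
    by simp (rule key, simp, simp, simp, rule disjI1, rule AR.feq, (rule AR.fop | (rule AR.fatom, (simp; fail)))+, simp add: algebra_simps)
  show "ract \<alpha> (m, b) (a1 \<otimes>\<^bsub>A\<^esub> a2) = ract \<alpha> (ract \<alpha> (m, b) a1) a2 \<longleftrightarrow> fst (d0 A M \<rho>' z) b a1 a2 = \<zero>\<^bsub>M\<^esub>"
    by simp (rule key, simp, simp, simp, rule disjI2, rule AR.feq, (rule AR.fop | (rule AR.fatom, (simp; fail)))+, simp add: algebra_simps)
  show "ract \<alpha> (lact \<alpha> a1 (m, b)) a2 = lact \<alpha> a1 (ract \<alpha> (m, b) a2) \<longleftrightarrow> fst (d0 A M \<rho>' z) a1 b a2 = \<zero>\<^bsub>M\<^esub>"
    by simp (rule key, simp, simp, simp, rule disjI1, rule AR.feq, (rule AR.fop | (rule AR.fatom, (simp; fail)))+, simp add: algebra_simps)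
  show "rbr \<alpha> (lact \<alpha> a1 (m, b)) a2 = lact \<alpha> a1 (rbr \<alpha> (m, b) a2) \<oplus>\<^bsub>xobj (xtwist z)\<^esub> lact \<alpha> (brk A a1 a2) (m, b)
        \<longleftrightarrow> snd (d0 A M \<rho>' z) a1 b a2 = \<zero>\<^bsub>M\<^esub>"
    by (simp add: abelian_monoid.a_comm[OF abelian_group.axioms(1)[OF AR.agA]])
      (rule key, simp, simp, simp, rule disjI2, rule AR.feq, (rule AR.fop | (rule AR.fatom, (simp; fail)))+, simp add: algebra_simps)
  show "rbr \<alpha> (ract \<alpha> (m, b) a1) a2 = ract \<alpha> (rbr \<alpha> (m, b) a2) a1 \<oplus>\<^bsub>xobj (xtwist z)\<^esub> ract \<alpha> (m, b) (brk A a1 a2)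
        \<longleftrightarrow> snd (d0 A M \<rho>' z) b a1 a2 = \<zero>\<^bsub>M\<^esub>"
    by (simp add: abelian_monoid.a_comm[OF abelian_group.axioms(1)[OF AR.agA]])
     (rule key, simp, simp, simp, rule disjI2, rule AR.feq, (rule AR.fop | (rule AR.fatom, (simp; fail)))+, simp add: algebra_simps)
  show "lbr \<alpha> (a1 \<otimes>\<^bsub>A\<^esub> a2) (m, b) = lact \<alpha> a1 (lbr \<alpha> a2 (m, b)) \<oplus>\<^bsub>xobj (xtwist z)\<^esub> ract \<alpha> (lbr \<alpha> a1 (m, b)) a2
        \<longleftrightarrow> snd (d0 A M \<rho>' z) a1 a2 b = \<zero>\<^bsub>M\<^esub>"
    by (simp add: abelian_monoid.a_comm[OF abelian_group.axioms(1)[OF AR.agA]])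
     (rule key, simp, simp, simp, rule disjI2, rule AR.feq, (rule AR.fop | (rule AR.fatom, (simp; fail)))+, simp add: algebra_simps)
qed

lemma xtwist_action_A:
  assumes z: "z \<in> carrier (K0 K A M)"
  shows "action_A A (xobj (xtwist z)) (xact (xtwist z)) \<longleftrightarrow> vanishes3 (d0 A M \<rho>' z)"
proof
  note ids = xtwist_action_ids[OF z]
  {
    assume act: "action_A A (xobj (xtwist z)) (xact (xtwist z))"
    show "vanishes3 (d0 A M \<rho>' z)"
      unfolding vanishes3_def
    proof (intro ballI)
      fix a a' b assume ab: "a \<in> carrier A" "a' \<in> carrier A" "b \<in> B"
      have "(\<zero>\<^bsub>M\<^esub>, b) \<in> carrier (xobj (xtwist z))" using ab by (simp add: xtwist_simps)
      \<comment> \<open>By \<open>xtwist_action_ids\<close> the defect is independent of the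
        component in \<open>M\<close>, so testing (A) on elements with first component zero is
        enough.\<close>
      note * = act[unfolded action_A_def, rule_format, OF ab(1,2) this]
      show "fst (d0 A M \<rho>' z) a a' b = \<zero>\<^bsub>M\<^esub> \<and> fst (d0 A M \<rho>' z) a b a' = \<zero>\<^bsub>M\<^esub> \<and> fst (d0 A M \<rho>' z) b a a' = \<zero>\<^bsub>M\<^esub> \<and>
         snd (d0 A M \<rho>' z) a a' b = \<zero>\<^bsub>M\<^esub> \<and> snd (d0 A M \<rho>' z) a b a' = \<zero>\<^bsub>M\<^esub> \<and> snd (d0 A M \<rho>' z) b a a' = \<zero>\<^bsub>M\<^esub>"
        unfolding ids[OF ab(1,2) module_ops(1)[OF mM] ab(3), symmetric] using * by blast
    qed
  next
    assume van: "vanishes3 (d0 A M \<rho>' z)"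
    show "action_A A (xobj (xtwist z)) (xact (xtwist z))"
      unfolding action_A_def
    proof (intro ballI)
      fix a1 a2 c assume a: "a1 \<in> carrier A" "a2 \<in> carrier A" and "c \<in> carrier (xobj (xtwist z))"
      then obtain m b where c: "c = (m, b)" "m \<in> carrier M" "b \<in> B" by (auto simp: xtwist_simps)
      show "lact (xact (xtwist z)) (a1 \<otimes>\<^bsub>A\<^esub> a2) c = lact (xact (xtwist z)) a1 (lact (xact (xtwist z)) a2 c) \<and>
         ract (xact (xtwist z)) c (a1 \<otimes>\<^bsub>A\<^esub> a2) = ract (xact (xtwist z)) (ract (xact (xtwist z)) c a1) a2 \<and>
         ract (xact (xtwist z)) (lact (xact (xtwist z)) a1 c) a2 = lact (xact (xtwist z)) a1 (ract (xact (xtwist z)) c a2) \<and>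
         rbr (xact (xtwist z)) (lact (xact (xtwist z)) a1 c) a2 = lact (xact (xtwist z)) a1 (rbr (xact (xtwist z)) c a2) \<oplus>\<^bsub>xobj (xtwist z)\<^esub> lact (xact (xtwist z)) (brk A a1 a2) c \<and>
         rbr (xact (xtwist z)) (ract (xact (xtwist z)) c a1) a2 = ract (xact (xtwist z)) (rbr (xact (xtwist z)) c a2) a1 \<oplus>\<^bsub>xobj (xtwist z)\<^esub> ract (xact (xtwist z)) c (brk A a1 a2) \<and>
         lbr (xact (xtwist z)) (a1 \<otimes>\<^bsub>A\<^esub> a2) c = lact (xact (xtwist z)) a1 (lbr (xact (xtwist z)) a2 c) \<oplus>\<^bsub>xobj (xtwist z)\<^esub> ract (xact (xtwist z)) (lbr (xact (xtwist z)) a1 c) a2"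
        unfolding c(1) ids[OF a c(2,3)] using van a c(3) unfolding vanishes3_def by blast
    qed
  }
qed

lemma abelian_awb_AWB: "AWB K (abelian_awb M)"
proof -
  have m: "module K (abelian_awb M)"
    by (rule module_image[OF mM, of _ "\<lambda>x. x"]) (simp_all add: abelian_awb_def)
  have *: "bilin_map K (abelian_awb M) (abelian_awb M) (abelian_awb M) (\<lambda>x y. \<zero>\<^bsub>abelian_awb M\<^esub>)"
    by (intro bilin_mapI lin_map_zero m)
  show ?thesis
    unfolding AWB_def AWB_axioms_def using fK m * by (simp add: abelian_awb_def)
qed

text \<open>The Peiffer identities hold by construction: product and bracket of the model use the
  same cochain as its action, and the action terms of \<nu> \<open>c\<close> vanish since it lies in
  \<open>B\<close>. The remaining axioms come from \<open>crossed_moduleI\<close>.\<close>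

lemma xtwist_crossed: assumes z: "z \<in> relZ0" shows "crossed_extension K A B M \<rho>' (xtwist z)"
proof -
  have zK: "z \<in> carrier (K0 K A M)" using z by (simp add: relZ0_def)
  note F = AR.K0_rules[OF zK]
  have cm: "crossed_module K A (xobj (xtwist z)) (xact (xtwist z)) (xproj (xtwist z))"
  proof (rule crossed_moduleI[OF awbA xtwist_module xtwist_bilin[OF zK]])
    show "action_A A (xobj (xtwist z)) (xact (xtwist z))" using z by (simp add: xtwist_action_A[OF zK] relZ0_def)
    show "lin_map K (xobj (xtwist z)) A (xproj (xtwist z))" by (rule lin_mapI) (auto simp: xtwist_simps B_in)
  qed (auto simp: xtwist_simps B_in B_act F)
  have ne: "carrier M \<noteq> {}" using module_ops(1)[OF mM] by blast
  from cm have "AWB K (xobj (xtwist z))" by (simp add: crossed_module_def awb_action_def)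
  then show ?thesis
    unfolding crossed_extension_def short_exact_def
    using cm awbB abelian_awb_AWB ne
    by (auto simp: xtwist_simps abelian_awb_def awb_hom_def lin_map_def B_closed B_in F inj_on_def a_kernel_def' image_iff)
qed

end

section \<open>A fixed crossed extension and its structure maps\<close>

locale xext = setting K A B Q \<tau> M \<rho>
  for K :: "'k ring"
    and A :: "('k, 'a) awb" and B :: "'a set" and Q :: "('k, 'q) awb" and \<tau> :: "'a \<Rightarrow> 'q"
    and M :: "('k, 'm) module" and \<rho> :: "('q, 'm) action" +
  fixes e :: "('k, 'm, 'c, 'a) xext"
  assumes crossed: "crossed_extension K A B M (rep_along \<tau> \<rho>) e"
begin

abbreviation C where "C \<equiv> xobj e"
abbreviation \<alpha> where "\<alpha> \<equiv> xact e"
abbreviation \<nu> where "\<nu> \<equiv> xproj e"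
abbreviation i where "i \<equiv> xinc e"

lemma mC: "module K C"
  using crossed by (simp add: crossed_extension_def short_exact_def AWB_def)

sublocale CR: actmod K A C \<alpha>
  by (rule actmod.intro) (use crossed mC awbA in \<open>auto simp: crossed_extension_def crossed_module_def awb_action_def\<close>)

lemma i_lin: "lin_map K M C i"
  using crossed by (simp add: crossed_extension_def short_exact_def awb_hom_def lin_map_def abelian_awb_def)

lemma i_inj: "inj_on i (carrier M)"
  using crossed by (simp add: crossed_extension_def short_exact_def abelian_awb_def)

lemma i_image: "i ` carrier M = {c\<in>carrier C. \<nu> c = \<zero>\<^bsub>A\<^esub>}"
  using crossed by (simp add: crossed_extension_def short_exact_def abelian_awb_def a_kernel_def')

lemma nu_lin: "lin_map K C A \<nu>"
  using crossed by (simp add: crossed_extension_def crossed_module_def awb_hom_def)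

lemma nu_image: "\<nu> ` carrier C = B"
  using crossed by (simp add: crossed_extension_def short_exact_def)

lemmas i_rules [simp] = lin_map_rules[OF mM mC i_lin]
lemmas nu_rules [simp] = lin_map_rules[OF mC mA nu_lin]

lemma nu_B [simp]: "c \<in> carrier C \<Longrightarrow> \<nu> c \<in> B"
  using nu_image by auto

lemma nu_i [simp]: "m \<in> carrier M \<Longrightarrow> \<nu> (i m) = \<zero>\<^bsub>A\<^esub>"
  using i_image by auto

lemma nu_act [simp]:
  assumes "c \<in> carrier C" "a \<in> carrier A"
  shows "\<nu> (ract \<alpha> c a) = \<nu> c \<otimes>\<^bsub>A\<^esub> a" "\<nu> (lact \<alpha> a c) = a \<otimes>\<^bsub>A\<^esub> \<nu> c"
    "\<nu> (rbr \<alpha> c a) = brk A (\<nu> c) a" "\<nu> (lbr \<alpha> a c) = brk A a (\<nu> c)"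
  using crossed assms by (auto simp: crossed_extension_def crossed_module_def)

text \<open>The Peiffer identities, oriented so that products, brackets and right actions by
  elements of \<open>B\<close> all become left actions. The operations of \<open>C\<close> are
  thereby eliminated in favour of the action.\<close>

lemma C_mult:
  assumes "c \<in> carrier C" "c' \<in> carrier C"
  shows "c \<otimes>\<^bsub>C\<^esub> c' = lact \<alpha> (\<nu> c) c'" "ract \<alpha> c (\<nu> c') = lact \<alpha> (\<nu> c) c'"
    "brk C c c' = lbr \<alpha> (\<nu> c) c'" "rbr \<alpha> c (\<nu> c') = lbr \<alpha> (\<nu> c) c'"
proof -
  have "lact \<alpha> (\<nu> c) c' = c \<otimes>\<^bsub>C\<^esub> c' \<and> c \<otimes>\<^bsub>C\<^esub> c' = ract \<alpha> c (\<nu> c') \<and>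
        lbr \<alpha> (\<nu> c) c' = brk C c c' \<and> brk C c c' = rbr \<alpha> c (\<nu> c')"
    using crossed assms unfolding crossed_extension_def crossed_module_def by blast
  then show "c \<otimes>\<^bsub>C\<^esub> c' = lact \<alpha> (\<nu> c) c'" "ract \<alpha> c (\<nu> c') = lact \<alpha> (\<nu> c) c'"
    "brk C c c' = lbr \<alpha> (\<nu> c) c'" "rbr \<alpha> c (\<nu> c') = lbr \<alpha> (\<nu> c) c'" by simp_all
qed

lemma i_act [simp]:
  assumes "a \<in> carrier A" "m \<in> carrier M"
  shows "lact \<alpha> a (i m) = i (lact \<rho>' a m)" "ract \<alpha> (i m) a = i (ract \<rho>' m a)"
    "lbr \<alpha> a (i m) = i (lbr \<rho>' a m)" "rbr \<alpha> (i m) a = i (rbr \<rho>' m a)"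
  using crossed assms by (auto simp: crossed_extension_def)

lemma xclosed: "xclosed K A M e"
  by (auto simp: xclosed_def C_mult)

definition j where "j = inv_into (carrier M) i"

lemma j_i [simp]: "m \<in> carrier M \<Longrightarrow> j (i m) = m"
  using i_inj by (simp add: j_def)

lemma i_j [simp]: "c \<in> carrier C \<Longrightarrow> \<nu> c = \<zero>\<^bsub>A\<^esub> \<Longrightarrow> i (j c) = c"
  unfolding j_def by (rule f_inv_into_f) (simp add: i_image)

lemma j_M [simp]: "c \<in> carrier C \<Longrightarrow> \<nu> c = \<zero>\<^bsub>A\<^esub> \<Longrightarrow> j c \<in> carrier M"
  unfolding j_def by (rule inv_into_into) (simp add: i_image)

lemma j_eqI: "m \<in> carrier M \<Longrightarrow> i m = c \<Longrightarrow> j c = m"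
  by auto

text \<open>\<open>j\<close> inverts \<open>i\<close> only on the kernel of \<nu>, so linearity is
  claimed for its composite with a linear map into that kernel.\<close>

lemma j_lin:
  assumes V: "module K V" and g: "lin_map K V C g" and z: "\<And>v. v \<in> carrier V \<Longrightarrow> \<nu> (g v) = \<zero>\<^bsub>A\<^esub>"
  shows "lin_map K V M (\<lambda>v. j (g v))"
proof -
  note [simp] = lin_map_rules[OF V mC g] z
  show ?thesis by (rule lin_mapI) (auto intro!: j_eqI)
qed

lemma i_eq_iff [simp]: "m \<in> carrier M \<Longrightarrow> m' \<in> carrier M \<Longrightarrow> i m = i m' \<longleftrightarrow> m = m'"
  using i_inj by (auto simp: inj_on_def)

end

section \<open>The cochain of a crossed extension with chosen linear sections\<close>

locale xsec = setting_sec K A B Q \<tau> M \<rho> s + xext K A B Q \<tau> M \<rho> e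
  for K :: "'k ring"
    and A :: "('k, 'a) awb" and B :: "'a set" and Q :: "('k, 'q) awb" and \<tau> :: "'a \<Rightarrow> 'q"
    and M :: "('k, 'm) module" and \<rho> :: "('q, 'm) action" and s :: "'q \<Rightarrow> 'a"
    and e :: "('k, 'm, 'c, 'a) xext" +
  fixes \<sigma> :: "'a \<Rightarrow> 'c"
  assumes sigma: "lin_section K (xobj e) (xproj e) (A\<lparr>carrier := B\<rparr>) \<sigma>"
begin

lemma sigma_lin: "lin_map K BA C \<sigma>" and nu_sigma [simp]: "b \<in> B \<Longrightarrow> \<nu> (\<sigma> b) = b"
  using sigma by (auto simp: lin_section_def)

lemma sigma_rules [simp]:
  "b \<in> B \<Longrightarrow> \<sigma> b \<in> carrier C" "b \<in> B \<Longrightarrow> b' \<in> B \<Longrightarrow> \<sigma> (b \<oplus>\<^bsub>A\<^esub> b') = \<sigma> b \<oplus>\<^bsub>C\<^esub> \<sigma> b'"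
  "k \<in> carrier K \<Longrightarrow> b \<in> B \<Longrightarrow> \<sigma> (k \<odot>\<^bsub>A\<^esub> b) = k \<odot>\<^bsub>C\<^esub> \<sigma> b" "\<sigma> \<zero>\<^bsub>A\<^esub> = \<zero>\<^bsub>C\<^esub>"
  using lin_map_rules(1-4)[OF mB mC sigma_lin] by simp_all

lemma sigma_comp:
  assumes "lin_map K V A g" "\<And>v. v \<in> carrier V \<Longrightarrow> g v \<in> B"
  shows "lin_map K V C (\<lambda>v. \<sigma> (g v))"
  using lin_mapD[OF assms(1)] assms(2) by (intro lin_mapI) simp_all

text \<open>The failure of \<open>\<sigma>\<close> to commute with the action is defined on \<open>A \<times> B\<close> and \<open>B \<times> A\<close>, consistently on
  \<open>B \<times> B\<close> by the Peiffer identities; \<open>F\<close> and \<open>G\<close> extend it by zero on \<open>s Q \<times> s Q\<close>.\<close>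

definition F where "F a a' = j (lact \<alpha> a (\<sigma> (\<beta> a')) \<ominus>\<^bsub>C\<^esub> \<sigma> (a \<otimes>\<^bsub>A\<^esub> \<beta> a'))
   \<oplus>\<^bsub>M\<^esub> j (ract \<alpha> (\<sigma> (\<beta> a)) (s (\<tau> a')) \<ominus>\<^bsub>C\<^esub> \<sigma> (\<beta> a \<otimes>\<^bsub>A\<^esub> s (\<tau> a')))"
definition G where "G a a' = j (lbr \<alpha> a (\<sigma> (\<beta> a')) \<ominus>\<^bsub>C\<^esub> \<sigma> (brk A a (\<beta> a')))
   \<oplus>\<^bsub>M\<^esub> j (rbr \<alpha> (\<sigma> (\<beta> a)) (s (\<tau> a')) \<ominus>\<^bsub>C\<^esub> \<sigma> (brk A (\<beta> a) (s (\<tau> a'))))"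

definition z0 where "z0 = ((\<lambda>a\<in>carrier A. \<lambda>a'\<in>carrier A. F a a'), (\<lambda>a\<in>carrier A. \<lambda>a'\<in>carrier A. G a a'))"

lemma FG_bilin: "bilin_map K A A M F" "bilin_map K A A M G"
proof -
  note I = lin_map_add[OF mM] lin_map_minus[OF mC] lin_map_id j_lin[OF mA] sigma_comp beta_lin s_lin tau_lin
    lin_map_comp[OF beta_lin] lin_map_comp[OF s_lin] lin_map_comp[OF tau_lin]
    bilin_comp_l[OF CR.bils(1)] bilin_comp_r[OF CR.bils(1)] bilin_comp_l[OF CR.bils(2)] bilin_comp_r[OF CR.bils(2)]
    bilin_comp_l[OF CR.bils(3)] bilin_comp_r[OF CR.bils(3)] bilin_comp_l[OF CR.bils(4)] bilin_comp_r[OF CR.bils(4)]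
    bilin_comp_l[OF CR.bils(5)] bilin_comp_r[OF CR.bils(5)] bilin_comp_l[OF CR.bils(6)] bilin_comp_r[OF CR.bils(6)]
  note [simp] = B_closed
  show "bilin_map K A A M F"
    by (rule bilin_mapI; unfold F_def; (intro I)?; simp)
  show "bilin_map K A A M G"
    by (rule bilin_mapI; unfold G_def; (intro I)?; simp)
qed

lemma z0_K0: "z0 \<in> carrier (K0 K A M)"
  unfolding z0_def AR.K0_iff bilin_map_restrict[OF mA mA] using FG_bilin by simp

text \<open>With the second argument in \<open>B\<close>, the second summand of \<open>F\<close> and
  \<open>G\<close> is zero. With the first in \<open>B\<close>, the other argument splits into its
  parts in \<open>B\<close> and in \<open>s Q\<close>: the Peiffer identities turn the left action
  in the first summand into a right action on \<sigma> \<open>b\<close>, and the two summands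
  recombine.\<close>

lemma z0_val:
  assumes "a \<in> carrier A" "b \<in> B"
  shows "fst z0 a b = j (lact \<alpha> a (\<sigma> b) \<ominus>\<^bsub>C\<^esub> \<sigma> (a \<otimes>\<^bsub>A\<^esub> b))"
    "snd z0 a b = j (lbr \<alpha> a (\<sigma> b) \<ominus>\<^bsub>C\<^esub> \<sigma> (brk A a b))"
    "fst z0 b a = j (ract \<alpha> (\<sigma> b) a \<ominus>\<^bsub>C\<^esub> \<sigma> (b \<otimes>\<^bsub>A\<^esub> a))"
    "snd z0 b a = j (rbr \<alpha> (\<sigma> b) a \<ominus>\<^bsub>C\<^esub> \<sigma> (brk A b a))"
proof -
  note [simp] = B_closed B_in B_tau assms
  have j0: "j \<zero>\<^bsub>C\<^esub> = \<zero>\<^bsub>M\<^esub>" by (rule j_eqI) simp_all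
  show "fst z0 a b = j (lact \<alpha> a (\<sigma> b) \<ominus>\<^bsub>C\<^esub> \<sigma> (a \<otimes>\<^bsub>A\<^esub> b))"
    "snd z0 a b = j (lbr \<alpha> a (\<sigma> b) \<ominus>\<^bsub>C\<^esub> \<sigma> (brk A a b))"
    by (simp_all add: z0_def F_def G_def j0)
  \<comment> \<open>The consistency on \<open>B\<close> times \<open>B\<close>: both factors are
    images under \<nu>, so left and right action agree.\<close>
  have *: "lact \<alpha> b (\<sigma> (\<beta> a)) = ract \<alpha> (\<sigma> b) (\<beta> a)" "lbr \<alpha> b (\<sigma> (\<beta> a)) = rbr \<alpha> (\<sigma> b) (\<beta> a)"
    using C_mult(2,4)[of "\<sigma> b" "\<sigma> (\<beta> a)"] by simp_all
  have a: "\<beta> a \<oplus>\<^bsub>A\<^esub> s (\<tau> a) = a" using beta_decomp[of a] by simp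
  have e1: "ract \<alpha> (\<sigma> b) a = ract \<alpha> (\<sigma> b) (\<beta> a) \<oplus>\<^bsub>C\<^esub> ract \<alpha> (\<sigma> b) (s (\<tau> a))"
    "rbr \<alpha> (\<sigma> b) a = rbr \<alpha> (\<sigma> b) (\<beta> a) \<oplus>\<^bsub>C\<^esub> rbr \<alpha> (\<sigma> b) (s (\<tau> a))"
    by (subst a[symmetric], simp)+
  have e2: "\<sigma> (b \<otimes>\<^bsub>A\<^esub> a) = \<sigma> (b \<otimes>\<^bsub>A\<^esub> \<beta> a) \<oplus>\<^bsub>C\<^esub> \<sigma> (b \<otimes>\<^bsub>A\<^esub> s (\<tau> a))"
    "\<sigma> (brk A b a) = \<sigma> (brk A b (\<beta> a)) \<oplus>\<^bsub>C\<^esub> \<sigma> (brk A b (s (\<tau> a)))"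
    by (subst a[symmetric], simp)+
  show "fst z0 b a = j (ract \<alpha> (\<sigma> b) a \<ominus>\<^bsub>C\<^esub> \<sigma> (b \<otimes>\<^bsub>A\<^esub> a))"
    by (rule j_eqI[symmetric]; simp add: z0_def F_def * e1 e2)
      (rule CR.feq, (rule CR.fop | (rule CR.fatom, (simp; fail)))+, simp add: algebra_simps)
  show "snd z0 b a = j (rbr \<alpha> (\<sigma> b) a \<ominus>\<^bsub>C\<^esub> \<sigma> (brk A b a))"
    by (rule j_eqI[symmetric]; simp add: z0_def G_def * e1 e2)
      (rule CR.feq, (rule CR.fop | (rule CR.fatom, (simp; fail)))+, simp add: algebra_simps)
qed

lemma z0_s: assumes "x \<in> carrier Q" "y \<in> carrier Q"
  shows "fst z0 (s x) (s y) = \<zero>\<^bsub>M\<^esub>" "snd z0 (s x) (s y) = \<zero>\<^bsub>M\<^esub>"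
proof -
  have j0: "j \<zero>\<^bsub>C\<^esub> = \<zero>\<^bsub>M\<^esub>" by (rule j_eqI) simp_all
  show "fst z0 (s x) (s y) = \<zero>\<^bsub>M\<^esub>" "snd z0 (s x) (s y) = \<zero>\<^bsub>M\<^esub>"
    using assms by (simp_all add: z0_def F_def G_def j0)
qed

lemma act_sigma:
  assumes "a \<in> carrier A" "b \<in> B"
  shows "lact \<alpha> a (\<sigma> b) = \<sigma> (a \<otimes>\<^bsub>A\<^esub> b) \<oplus>\<^bsub>C\<^esub> i (fst z0 a b)"
    "lbr \<alpha> a (\<sigma> b) = \<sigma> (brk A a b) \<oplus>\<^bsub>C\<^esub> i (snd z0 a b)"
    "ract \<alpha> (\<sigma> b) a = \<sigma> (b \<otimes>\<^bsub>A\<^esub> a) \<oplus>\<^bsub>C\<^esub> i (fst z0 b a)"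
    "rbr \<alpha> (\<sigma> b) a = \<sigma> (brk A b a) \<oplus>\<^bsub>C\<^esub> i (snd z0 b a)"
  using assms by (simp_all add: z0_val B_closed B_in abelian_group.add_minus_cancel[OF CR.agM])

definition \<psi> where "\<psi> = (\<lambda>(m, b). i m \<oplus>\<^bsub>C\<^esub> \<sigma> b)"

text \<open>The linear splitting of \<open>C\<close> into \<open>i M\<close> and \<sigma>
  \<open>B\<close> is compatible with the structure because \<open>act_sigma\<close> says that
  \<open>z0\<close> records exactly how far the action moves \<sigma> \<open>B\<close> away from
  itself.\<close>

lemma psi_iso: "xiso K A M (xtwist z0) e \<psi>"
proof -
  interpret agC: abelian_group C by (rule CR.agM)
  note [simp] = B_closed B_in B_act AR.K0_rules[OF z0_K0] xtwist_simps
  have bij: "bij_betw \<psi> (carrier (xobj (xtwist z0))) (carrier C)"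
    unfolding bij_betw_def
  proof
    show "inj_on \<psi> (carrier (xobj (xtwist z0)))"
    proof (rule inj_onI; clarsimp simp: \<psi>_def)
      fix m b m' b' assume *: "m \<in> carrier M" "m' \<in> carrier M" "b \<in> B" "b' \<in> B" "i m \<oplus>\<^bsub>C\<^esub> \<sigma> b = i m' \<oplus>\<^bsub>C\<^esub> \<sigma> b'"
      from *(5) have "\<nu> (i m \<oplus>\<^bsub>C\<^esub> \<sigma> b) = \<nu> (i m' \<oplus>\<^bsub>C\<^esub> \<sigma> b')" by (rule arg_cong)
      then have "b = b'" using *(1-4) by simp
      then show "m = m' \<and> b = b'" using * by simp
    qed
    show "\<psi> ` carrier (xobj (xtwist z0)) = carrier C"
    proof (intro equalityI subsetI)
      fix c assume c: "c \<in> carrier C"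
      then have "c = \<psi> (j (c \<ominus>\<^bsub>C\<^esub> \<sigma> (\<nu> c)), \<nu> c)"
        using agC.eq_add_minus[of c "\<sigma> (\<nu> c)"] by (simp add: \<psi>_def)
      then show "c \<in> \<psi> ` carrier (xobj (xtwist z0))" using c by (intro image_eqI) auto
    qed (auto simp: \<psi>_def)
  qed
  show ?thesis
    unfolding xiso_def
  proof (intro conjI ballI bij)
    fix x y k a assume "x \<in> carrier (xobj (xtwist z0))"
    then obtain m b where x: "x = (m, b)" and mb [simp]: "m \<in> carrier M" "b \<in> B" by auto
    { fix y assume "y \<in> carrier (xobj (xtwist z0))"
      then obtain m' b' where y: "y = (m', b')" and [simp]: "m' \<in> carrier M" "b' \<in> B" by auto
      show "\<psi> (x \<oplus>\<^bsub>xobj (xtwist z0)\<^esub> y) = \<psi> x \<oplus>\<^bsub>C\<^esub> \<psi> y"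
        by (simp add: x y \<psi>_def agC.a_ac)
      show "\<psi> (x \<otimes>\<^bsub>xobj (xtwist z0)\<^esub> y) = \<psi> x \<otimes>\<^bsub>C\<^esub> \<psi> y"
        by (simp add: x y \<psi>_def C_mult(1) act_sigma agC.a_comm)
      show "\<psi> (brk (xobj (xtwist z0)) x y) = brk C (\<psi> x) (\<psi> y)"
        by (simp add: x y \<psi>_def C_mult(3) act_sigma agC.a_comm) }
    { fix k assume "k \<in> carrier K"
      then show "\<psi> (k \<odot>\<^bsub>xobj (xtwist z0)\<^esub> x) = k \<odot>\<^bsub>C\<^esub> \<psi> x" by (simp add: x \<psi>_def) }
    { fix a assume [simp]: "a \<in> carrier A"
      show "\<psi> (lact (xact (xtwist z0)) a x) = lact \<alpha> a (\<psi> x)" by (simp add: x \<psi>_def act_sigma agC.a_ac)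
      show "\<psi> (ract (xact (xtwist z0)) x a) = ract \<alpha> (\<psi> x) a" by (simp add: x \<psi>_def act_sigma agC.a_ac)
      show "\<psi> (lbr (xact (xtwist z0)) a x) = lbr \<alpha> a (\<psi> x)" by (simp add: x \<psi>_def act_sigma agC.a_ac)
      show "\<psi> (rbr (xact (xtwist z0)) x a) = rbr \<alpha> (\<psi> x) a" by (simp add: x \<psi>_def act_sigma agC.a_ac) }
    show "\<nu> (\<psi> x) = xproj (xtwist z0) x" by (simp add: x \<psi>_def)
  next
    fix m assume "m \<in> carrier M"
    then show "\<psi> (xinc (xtwist z0) m) = i m" by (simp add: \<psi>_def)
  qed
qed

text \<open>The coboundary is not computed: the axioms (A) of \<open>C\<close> are carried back
  along \<psi> to the model, where \<open>xtwist_action_A\<close> reads them as the vanishing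
  condition.\<close>

lemma z0_relZ0: "z0 \<in> relZ0"
proof -
  have "action_A A (xobj (xtwist z0)) (xact (xtwist z0))"
    by (rule action_A_transfer[OF psi_iso xtwist_closed[OF z0_K0] awbA CR.actA])
  then show ?thesis using z0_K0 xtwist_action_A[OF z0_K0] by (simp add: relZ0_def)
qed

text \<open>On \<open>s Q\<close> the coboundary of \<open>z0\<close> only involves \<open>z0\<close> at arguments \<open>s x s y\<close> and \<open>[s x, s y]\<close>, whose
  components in \<open>B\<close> are the factor set; the terms \<open>\<sigma> (\<dots>)\<close> cancel.\<close>

lemma gamma_z0: "gamma_cocycle A Q M e s \<sigma> = defl3 (d0 A M \<rho>' z0)"
proof -
  interpret agC: abelian_group C by (rule CR.agM)
  have zd: "d0 A M \<rho>' z0 \<in> carrier (K1 K A M)" by (rule AR.d0_K1[OF z0_K0])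
  have "vanishes3 (d0 A M \<rho>' z0)" using z0_relZ0 by (simp add: relZ0_def)
  then have ct: "defl3 (d0 A M \<rho>' z0) = sec3 (d0 A M \<rho>' z0)"
    using infl_sec3[OF zd] by (intro defl3_eq sec3_K1 zd) auto
  note S = section_defect[OF sec]
  note [simp] = B_closed B_in
  let ?f = "\<lambda>x y. s x \<otimes>\<^bsub>A\<^esub> s y \<ominus>\<^bsub>A\<^esub> s (x \<otimes>\<^bsub>Q\<^esub> y)"
  let ?g = "\<lambda>x y. brk A (s x) (s y) \<ominus>\<^bsub>A\<^esub> s (brk Q x y)"
  note [simp] = AR.K0_rules[OF z0_K0]
  have fB: "?f x y \<in> B" "?g x y \<in> B" if "x \<in> carrier Q" "y \<in> carrier Q" for x y
    using S[OF that] by auto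
  \<comment> \<open>Since \<open>z0\<close> vanishes at lifts of pairs from \<open>Q\<close>, the
    product or bracket of two lifts may be replaced by its component in \<open>B\<close>, where
    \<open>z0_val\<close> applies.\<close>
  have zl: "fst z0 (s x \<otimes>\<^bsub>A\<^esub> s y) (s t) = j (ract \<alpha> (\<sigma> (?f x y)) (s t) \<ominus>\<^bsub>C\<^esub> \<sigma> (?f x y \<otimes>\<^bsub>A\<^esub> s t))"
    "snd z0 (s x \<otimes>\<^bsub>A\<^esub> s y) (s t) = j (rbr \<alpha> (\<sigma> (?f x y)) (s t) \<ominus>\<^bsub>C\<^esub> \<sigma> (brk A (?f x y) (s t)))"
    "fst z0 (s t) (s x \<otimes>\<^bsub>A\<^esub> s y) = j (lact \<alpha> (s t) (\<sigma> (?f x y)) \<ominus>\<^bsub>C\<^esub> \<sigma> (s t \<otimes>\<^bsub>A\<^esub> ?f x y))"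
    "fst z0 (brk A (s x) (s y)) (s t) = j (ract \<alpha> (\<sigma> (?g x y)) (s t) \<ominus>\<^bsub>C\<^esub> \<sigma> (?g x y \<otimes>\<^bsub>A\<^esub> s t))"
    "fst z0 (s t) (brk A (s x) (s y)) = j (lact \<alpha> (s t) (\<sigma> (?g x y)) \<ominus>\<^bsub>C\<^esub> \<sigma> (s t \<otimes>\<^bsub>A\<^esub> ?g x y))"
    if [simp]: "x \<in> carrier Q" "y \<in> carrier Q" "t \<in> carrier Q" for x y t
    using z0_val[of "s t" "?f x y"] z0_val[of "s t" "?g x y"] fB[of x y] by (simp_all add: z0_s)
  show ?thesis
    unfolding ct sec3_def gamma_cocycle_def Let_def factor_set_def case_prod_conv prod.inject
  proof (intro conjI restrict_ext)
    fix x y t assume [simp]: "x \<in> carrier Q" "y \<in> carrier Q" "t \<in> carrier Q"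
    \<comment> \<open>These are the values of the factor set in the first component of the cocycle.
      Associativity of \<open>s x\<close>, \<open>s y\<close>, \<open>s t\<close> yields one linear
      relation between them in \<open>B\<close>; its image under \<sigma> is solved for \<sigma>
      \<open>u2\<close>, so that the remaining terms cancel formally.\<close>
    define b1 where "b1 = ?f x y"
    define b2 where "b2 = ?f y t"
    define u1 where "u1 = ?f (x \<otimes>\<^bsub>Q\<^esub> y) t"
    define u2 where "u2 = ?f x (y \<otimes>\<^bsub>Q\<^esub> t)"
    have [simp]: "b1 \<in> B" "b2 \<in> B" "u1 \<in> B" "u2 \<in> B" unfolding b1_def b2_def u1_def u2_def by (intro fB; simp)+
    have "u2 \<oplus>\<^bsub>A\<^esub> s x \<otimes>\<^bsub>A\<^esub> b2 = u1 \<oplus>\<^bsub>A\<^esub> b1 \<otimes>\<^bsub>A\<^esub> s t"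
      unfolding b1_def b2_def u1_def u2_def
      by simp (rule abelian_group.formal_eq[OF CR.agA], (rule abelian_group.formal_op[OF CR.agA] |
        (rule abelian_group.formal_atom[OF CR.agA], (simp; fail)))+, simp add: algebra_simps)
    then have "\<sigma> (u2 \<oplus>\<^bsub>A\<^esub> s x \<otimes>\<^bsub>A\<^esub> b2) = \<sigma> (u1 \<oplus>\<^bsub>A\<^esub> b1 \<otimes>\<^bsub>A\<^esub> s t)" by simp
    then have e1: "\<sigma> u2 \<oplus>\<^bsub>C\<^esub> \<sigma> (s x \<otimes>\<^bsub>A\<^esub> b2) = \<sigma> u1 \<oplus>\<^bsub>C\<^esub> \<sigma> (b1 \<otimes>\<^bsub>A\<^esub> s t)" by simp
    have e1': "\<sigma> u2 = \<sigma> u1 \<oplus>\<^bsub>C\<^esub> \<sigma> (b1 \<otimes>\<^bsub>A\<^esub> s t) \<ominus>\<^bsub>C\<^esub> \<sigma> (s x \<otimes>\<^bsub>A\<^esub> b2)"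
      unfolding e1[symmetric]
      by (rule CR.feq, (rule CR.fop | (rule CR.fatom, (simp; fail)))+, simp add: algebra_simps)
    have L: "fst (d0 A M \<rho>' z0) (s x) (s y) (s t) = \<ominus>\<^bsub>M\<^esub> (\<ominus>\<^bsub>M\<^esub> fst z0 (s x \<otimes>\<^bsub>A\<^esub> s y) (s t) \<oplus>\<^bsub>M\<^esub> fst z0 (s x) (s y \<otimes>\<^bsub>A\<^esub> s t))"
      by (simp add: AR.d0_val z0_s a_minus_def)
    have "j (\<ominus>\<^bsub>C\<^esub> (lact \<alpha> (s x) (\<sigma> b2) \<ominus>\<^bsub>C\<^esub> \<sigma> u1 \<oplus>\<^bsub>C\<^esub> \<sigma> u2 \<ominus>\<^bsub>C\<^esub> ract \<alpha> (\<sigma> b1) (s t)))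
      = fst (d0 A M \<rho>' z0) (s x) (s y) (s t)"
      unfolding L zl[OF \<open>x \<in> _\<close> \<open>y \<in> _\<close> \<open>t \<in> _\<close>] zl[OF \<open>y \<in> _\<close> \<open>t \<in> _\<close> \<open>x \<in> _\<close>]
      unfolding b1_def[symmetric] b2_def[symmetric]
      by (rule j_eqI; simp add: e1')
        (rule CR.feq, (rule CR.fop | (rule CR.fatom, (simp; fail)))+, simp add: algebra_simps)
    then show "inv_into (carrier M) i (\<ominus>\<^bsub>C\<^esub> (lact \<alpha> (s x) ((\<lambda>a0\<in>carrier Q. \<lambda>a1\<in>carrier Q. \<sigma> (?f a0 a1)) y t)
       \<ominus>\<^bsub>C\<^esub> (\<lambda>a0\<in>carrier Q. \<lambda>a1\<in>carrier Q. \<sigma> (?f a0 a1)) (x \<otimes>\<^bsub>Q\<^esub> y) t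
       \<oplus>\<^bsub>C\<^esub> (\<lambda>a0\<in>carrier Q. \<lambda>a1\<in>carrier Q. \<sigma> (?f a0 a1)) x (y \<otimes>\<^bsub>Q\<^esub> t)
       \<ominus>\<^bsub>C\<^esub> ract \<alpha> ((\<lambda>a0\<in>carrier Q. \<lambda>a1\<in>carrier Q. \<sigma> (?f a0 a1)) x y) (s t))) = fst (d0 A M \<rho>' z0) (s x) (s y) (s t)"
      by (simp only: j_def[symmetric] restrict_apply' b1_def b2_def u1_def u2_def \<open>x \<in> _\<close> \<open>y \<in> _\<close> \<open>t \<in> _\<close> QR.bils(5)[THEN bilin_rules(1)[OF mQ mQ mQ]])
    \<comment> \<open>The second component is handled likewise. Here the relation comes from
      expanding the bracket of the product \<open>s x s y\<close> with \<open>s t\<close>, and it is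
      solved for \<sigma> \<open>v1\<close>.\<close>
    define c1 where "c1 = ?g x t"
    define c2 where "c2 = ?g y t"
    define v1 where "v1 = ?g (x \<otimes>\<^bsub>Q\<^esub> y) t"
    define v2 where "v2 = ?f (brk Q x t) y"
    define v3 where "v3 = ?f x (brk Q y t)"
    have [simp]: "c1 \<in> B" "c2 \<in> B" "v1 \<in> B" "v2 \<in> B" "v3 \<in> B" unfolding c1_def c2_def v1_def v2_def v3_def by (intro fB; simp)+
    have "v2 \<oplus>\<^bsub>A\<^esub> v3 \<oplus>\<^bsub>A\<^esub> (c1 \<otimes>\<^bsub>A\<^esub> s y \<oplus>\<^bsub>A\<^esub> s x \<otimes>\<^bsub>A\<^esub> c2) = v1 \<oplus>\<^bsub>A\<^esub> brk A b1 (s t)"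
      unfolding c1_def c2_def v1_def v2_def v3_def b1_def
      by simp (rule abelian_group.formal_eq[OF CR.agA], (rule abelian_group.formal_op[OF CR.agA] |
        (rule abelian_group.formal_atom[OF CR.agA], (simp; fail)))+, simp add: algebra_simps)
    then have "\<sigma> (v2 \<oplus>\<^bsub>A\<^esub> v3 \<oplus>\<^bsub>A\<^esub> (c1 \<otimes>\<^bsub>A\<^esub> s y \<oplus>\<^bsub>A\<^esub> s x \<otimes>\<^bsub>A\<^esub> c2)) = \<sigma> (v1 \<oplus>\<^bsub>A\<^esub> brk A b1 (s t))" by simp
    then have e2: "\<sigma> v2 \<oplus>\<^bsub>C\<^esub> \<sigma> v3 \<oplus>\<^bsub>C\<^esub> (\<sigma> (c1 \<otimes>\<^bsub>A\<^esub> s y) \<oplus>\<^bsub>C\<^esub> \<sigma> (s x \<otimes>\<^bsub>A\<^esub> c2)) = \<sigma> v1 \<oplus>\<^bsub>C\<^esub> \<sigma> (brk A b1 (s t))" by simp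
    have e2': "\<sigma> v1 = \<sigma> v2 \<oplus>\<^bsub>C\<^esub> \<sigma> v3 \<oplus>\<^bsub>C\<^esub> (\<sigma> (c1 \<otimes>\<^bsub>A\<^esub> s y) \<oplus>\<^bsub>C\<^esub> \<sigma> (s x \<otimes>\<^bsub>A\<^esub> c2)) \<ominus>\<^bsub>C\<^esub> \<sigma> (brk A b1 (s t))"
      unfolding e2
      by (rule CR.feq, (rule CR.fop | (rule CR.fatom, (simp; fail)))+, simp add: algebra_simps)
    have L2: "snd (d0 A M \<rho>' z0) (s x) (s y) (s t) = \<ominus>\<^bsub>M\<^esub> snd z0 (s x \<otimes>\<^bsub>A\<^esub> s y) (s t)
       \<oplus>\<^bsub>M\<^esub> fst z0 (brk A (s x) (s t)) (s y) \<oplus>\<^bsub>M\<^esub> fst z0 (s x) (brk A (s y) (s t))"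
      by (simp add: AR.d0_val z0_s a_minus_def)
    have "j (lact \<alpha> (s x) (\<sigma> c2) \<ominus>\<^bsub>C\<^esub> \<sigma> v1 \<oplus>\<^bsub>C\<^esub> ract \<alpha> (\<sigma> c1) (s y) \<ominus>\<^bsub>C\<^esub> rbr \<alpha> (\<sigma> b1) (s t) \<oplus>\<^bsub>C\<^esub> \<sigma> v2 \<oplus>\<^bsub>C\<^esub> \<sigma> v3)
      = snd (d0 A M \<rho>' z0) (s x) (s y) (s t)"
      unfolding L2 zl[OF \<open>x \<in> _\<close> \<open>y \<in> _\<close> \<open>t \<in> _\<close>] zl[OF \<open>y \<in> _\<close> \<open>t \<in> _\<close> \<open>x \<in> _\<close>] zl[OF \<open>x \<in> _\<close> \<open>t \<in> _\<close> \<open>y \<in> _\<close>]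
      unfolding b1_def[symmetric] c2_def[symmetric] c1_def[symmetric]
      by (rule j_eqI; simp add: e2')
        (rule CR.feq, (rule CR.fop | (rule CR.fatom, (simp; fail)))+, simp add: algebra_simps)
    then show "inv_into (carrier M) i (lact \<alpha> (s x) ((\<lambda>a0\<in>carrier Q. \<lambda>a1\<in>carrier Q. \<sigma> (?g a0 a1)) y t)
       \<ominus>\<^bsub>C\<^esub> (\<lambda>a0\<in>carrier Q. \<lambda>a1\<in>carrier Q. \<sigma> (?g a0 a1)) (x \<otimes>\<^bsub>Q\<^esub> y) t
       \<oplus>\<^bsub>C\<^esub> ract \<alpha> ((\<lambda>a0\<in>carrier Q. \<lambda>a1\<in>carrier Q. \<sigma> (?g a0 a1)) x t) (s y)
       \<ominus>\<^bsub>C\<^esub> rbr \<alpha> ((\<lambda>a0\<in>carrier Q. \<lambda>a1\<in>carrier Q. \<sigma> (?f a0 a1)) x y) (s t)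
       \<oplus>\<^bsub>C\<^esub> (\<lambda>a0\<in>carrier Q. \<lambda>a1\<in>carrier Q. \<sigma> (?f a0 a1)) (brk Q x t) y
       \<oplus>\<^bsub>C\<^esub> (\<lambda>a0\<in>carrier Q. \<lambda>a1\<in>carrier Q. \<sigma> (?f a0 a1)) x (brk Q y t)) = snd (d0 A M \<rho>' z0) (s x) (s y) (s t)"
      by (simp only: j_def[symmetric] restrict_apply' b1_def c1_def c2_def v1_def v2_def v3_def \<open>x \<in> _\<close> \<open>y \<in> _\<close> \<open>t \<in> _\<close>
        QR.bils(5)[THEN bilin_rules(1)[OF mQ mQ mQ]] QR.bils(6)[THEN bilin_rules(1)[OF mQ mQ mQ]])
  qed
qed

end

section \<open>Quotients and products of algebras with bracket\<close>

lemma xisoD: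
  assumes "xiso K A M e e' \<phi>"
  shows "\<And>x. x \<in> carrier (xobj e) \<Longrightarrow> \<phi> x \<in> carrier (xobj e')"
    "\<And>x y. x \<in> carrier (xobj e) \<Longrightarrow> y \<in> carrier (xobj e) \<Longrightarrow> \<phi> (x \<oplus>\<^bsub>xobj e\<^esub> y) = \<phi> x \<oplus>\<^bsub>xobj e'\<^esub> \<phi> y"
    "\<And>x y. x \<in> carrier (xobj e) \<Longrightarrow> y \<in> carrier (xobj e) \<Longrightarrow> \<phi> (x \<otimes>\<^bsub>xobj e\<^esub> y) = \<phi> x \<otimes>\<^bsub>xobj e'\<^esub> \<phi> y"
    "\<And>x y. x \<in> carrier (xobj e) \<Longrightarrow> y \<in> carrier (xobj e) \<Longrightarrow> \<phi> (brk (xobj e) x y) = brk (xobj e') (\<phi> x) (\<phi> y)"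
    "\<And>k x. k \<in> carrier K \<Longrightarrow> x \<in> carrier (xobj e) \<Longrightarrow> \<phi> (k \<odot>\<^bsub>xobj e\<^esub> x) = k \<odot>\<^bsub>xobj e'\<^esub> \<phi> x"
    "\<And>a c. a \<in> carrier A \<Longrightarrow> c \<in> carrier (xobj e) \<Longrightarrow> \<phi> (lact (xact e) a c) = lact (xact e') a (\<phi> c)"
    "\<And>a c. a \<in> carrier A \<Longrightarrow> c \<in> carrier (xobj e) \<Longrightarrow> \<phi> (ract (xact e) c a) = ract (xact e') (\<phi> c) a"
    "\<And>a c. a \<in> carrier A \<Longrightarrow> c \<in> carrier (xobj e) \<Longrightarrow> \<phi> (lbr (xact e) a c) = lbr (xact e') a (\<phi> c)"
    "\<And>a c. a \<in> carrier A \<Longrightarrow> c \<in> carrier (xobj e) \<Longrightarrow> \<phi> (rbr (xact e) c a) = rbr (xact e') (\<phi> c) a"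
    "\<And>c. c \<in> carrier (xobj e) \<Longrightarrow> xproj e' (\<phi> c) = xproj e c"
    "\<And>m. m \<in> carrier M \<Longrightarrow> \<phi> (xinc e m) = xinc e' m"
    "\<phi> ` carrier (xobj e) = carrier (xobj e')" "inj_on \<phi> (carrier (xobj e))"
  using assms by (auto simp: xiso_def bij_betw_def)

text \<open>Operations on cosets are written as unions over all representatives; on a nonempty coset
  with constant values such a union is that value.\<close>

lemma UN_const: "x \<in> S \<Longrightarrow> (\<And>y. y \<in> S \<Longrightarrow> f y = c) \<Longrightarrow> (\<Union>y\<in>S. f y) = c"
  by auto

text \<open>The cosets of \<open>I\<close> are the fibres of \<open>q\<close>, so every operation of the quotient is transported from
  the target of \<open>q\<close>.\<close>

lemma quot_iso:
  fixes K :: "'k ring" and A :: "('k, 'a) awb" and M :: "('k, 'm) module" and P :: "('k, 'p) awb"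
    and x :: "('k, 'm, 'd, 'a) xext" and \<alpha> :: "('a, 'p) action"
  assumes P: "module K P" and Xm: "module K (xobj x)" and q: "lin_map K P (xobj x) q"
    and surj: "q ` carrier P = carrier (xobj x)"
    and I: "I = {p\<in>carrier P. q p = \<zero>\<^bsub>xobj x\<^esub>}"
    and mul: "\<And>p p'. p \<in> carrier P \<Longrightarrow> p' \<in> carrier P \<Longrightarrow>
      p \<otimes>\<^bsub>P\<^esub> p' \<in> carrier P \<and> brk P p p' \<in> carrier P \<and> q (p \<otimes>\<^bsub>P\<^esub> p') = q p \<otimes>\<^bsub>xobj x\<^esub> q p' \<and> q (brk P p p') = brk (xobj x) (q p) (q p')"
    and act: "\<And>a p. a \<in> carrier A \<Longrightarrow> p \<in> carrier P \<Longrightarrow>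
      lact \<alpha> a p \<in> carrier P \<and> lbr \<alpha> a p \<in> carrier P \<and> ract \<alpha> p a \<in> carrier P \<and> rbr \<alpha> p a \<in> carrier P \<and>
      q (lact \<alpha> a p) = lact (xact x) a (q p) \<and> q (lbr \<alpha> a p) = lbr (xact x) a (q p) \<and>
      q (ract \<alpha> p a) = ract (xact x) (q p) a \<and> q (rbr \<alpha> p a) = rbr (xact x) (q p) a"
    and inc: "\<And>m. m \<in> carrier M \<Longrightarrow> \<iota> m \<in> carrier P \<and> q (\<iota> m) = xinc x m"
    and pr: "\<And>p. p \<in> carrier P \<Longrightarrow> pr p = xproj x (q p)"
  shows "xiso K A M x \<lparr>xobj = awb_quot P I, xinc = (\<lambda>m. I +>\<^bsub>P\<^esub> \<iota> m), xproj = (\<lambda>X. the_elem (pr ` X)),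
     xact = action_quot P I \<alpha>\<rparr> (\<lambda>y. {p\<in>carrier P. q p = y})"
proof -
  define fib where "fib y = {p\<in>carrier P. q p = y}" for y
  note Q = lin_map_rules[OF P Xm q]
  have sub: "submodule I K P" using submodule_kernel[OF P Xm q] unfolding I a_kernel_def' .
  have coset: "I +>\<^bsub>P\<^esub> p = fib (q p)" if p: "p \<in> carrier P" for p
  proof (intro equalityI subsetI)
    fix y assume "y \<in> I +>\<^bsub>P\<^esub> p"
    then show "y \<in> fib (q p)" using p by (auto simp: coset_mem I fib_def Q module_ops[OF P] module_ops[OF Xm])
  next
    fix y assume "y \<in> fib (q p)"
    then have y: "y \<in> carrier P" "q y = q p" by (auto simp: fib_def)
    then have "y \<ominus>\<^bsub>P\<^esub> p \<in> I" using p by (simp add: I Q module_ops[OF P] module_ops[OF Xm])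
    moreover have "y = (y \<ominus>\<^bsub>P\<^esub> p) \<oplus>\<^bsub>P\<^esub> p" by (rule abelian_group.eq_add_minus[OF module_ag[OF P] y(1) p])
    ultimately show "y \<in> I +>\<^bsub>P\<^esub> p" by (auto simp: coset_mem)
  qed
  have ex: "\<exists>p\<in>carrier P. y = q p" if "y \<in> carrier (xobj x)" for y using that unfolding surj[symmetric] by auto
  have fib_mem: "p \<in> carrier P" "q p = y" if "p \<in> fib y" for p y using that by (auto simp: fib_def)
  let ?e = "\<lparr>xobj = awb_quot P I, xinc = (\<lambda>m. I +>\<^bsub>P\<^esub> \<iota> m), xproj = (\<lambda>X. the_elem (pr ` X)), xact = action_quot P I \<alpha>\<rparr>"
  have car: "carrier (awb_quot P I) = fib ` carrier (xobj x)"
    by (auto simp: awb_quot_def A_RCOSETS_def' coset surj[symmetric])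
  have "xiso K A M x ?e fib"
    unfolding xiso_def
  proof (intro conjI ballI)
    show "bij_betw fib (carrier (xobj x)) (carrier (xobj ?e))"
      unfolding bij_betw_def
    proof
      show "inj_on fib (carrier (xobj x))"
      proof (rule inj_onI)
        fix y y' assume "y \<in> carrier (xobj x)" "y' \<in> carrier (xobj x)" and e: "fib y = fib y'"
        then obtain p where "p \<in> carrier P" "y = q p" using ex by blast
        then have "p \<in> fib y'" using e by (auto simp: fib_def)
        then show "y = y'" using \<open>y = q p\<close> by (simp add: fib_def)
      qed
    qed (simp add: car)
    fix y assume "y \<in> carrier (xobj x)"
    then obtain p where p: "p \<in> carrier P" "y = q p" using ex by blast
    have pf: "p \<in> fib y" using p by (simp add: fib_def)
    { fix y' assume "y' \<in> carrier (xobj x)"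
      then obtain p' where p': "p' \<in> carrier P" "y' = q p'" using ex by blast
      have pf': "p' \<in> fib y'" using p' by (simp add: fib_def)
      show "fib (y \<oplus>\<^bsub>xobj x\<^esub> y') = fib y \<oplus>\<^bsub>xobj ?e\<^esub> fib y'"
        using coset_add[OF P sub p(1) p'(1)] p p' by (simp add: awb_quot_def coset module_ops[OF P] Q)
      show "fib (y \<otimes>\<^bsub>xobj x\<^esub> y') = fib y \<otimes>\<^bsub>xobj ?e\<^esub> fib y'"
        by (simp add: awb_quot_def rcoset_mult_def)
          (rule sym, rule UN_const[OF pf], rule UN_const[OF pf'], use mul in \<open>simp add: fib_mem coset\<close>)
      show "fib (brk (xobj x) y y') = brk (xobj ?e) (fib y) (fib y')"
        by (simp add: awb_quot_def)
          (rule sym, rule UN_const[OF pf], rule UN_const[OF pf'], use mul in \<open>simp add: fib_mem coset\<close>) }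
    { fix k assume "k \<in> carrier K"
      then show "fib (k \<odot>\<^bsub>xobj x\<^esub> y) = k \<odot>\<^bsub>xobj ?e\<^esub> fib y"
        using coset_smult[OF P sub p(1)] p by (simp add: awb_quot_def coset module_ops[OF P] Q) }
    { fix a assume a: "a \<in> carrier A"
      show "fib (lact (xact x) a y) = lact (xact ?e) a (fib y)" "fib (ract (xact x) y a) = ract (xact ?e) (fib y) a"
        "fib (lbr (xact x) a y) = lbr (xact ?e) a (fib y)" "fib (rbr (xact x) y a) = rbr (xact ?e) (fib y) a"
        by (simp add: action_quot_def; rule sym, rule UN_const[OF pf], use act[OF a] in \<open>simp add: fib_mem coset\<close>)+ }
    show "xproj ?e (fib y) = xproj x y"
      by simp (rule the_elem_image[OF pf], simp add: fib_mem pr)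
  next
    fix m assume "m \<in> carrier M"
    then show "fib (xinc x m) = xinc ?e m" using inc[of m] by (simp add: coset)
  qed
  then show ?thesis unfolding fib_def .
qed

lemma awb_prod_simps:
  "carrier (awb_prod A B) = carrier A \<times> carrier B"
  "(a, b) \<otimes>\<^bsub>awb_prod A B\<^esub> (a', b') = (a \<otimes>\<^bsub>A\<^esub> a', b \<otimes>\<^bsub>B\<^esub> b')"
  "(a, b) \<oplus>\<^bsub>awb_prod A B\<^esub> (a', b') = (a \<oplus>\<^bsub>A\<^esub> a', b \<oplus>\<^bsub>B\<^esub> b')"
  "k \<odot>\<^bsub>awb_prod A B\<^esub> (a, b) = (k \<odot>\<^bsub>A\<^esub> a, k \<odot>\<^bsub>B\<^esub> b)"
  "brk (awb_prod A B) (a, b) (a', b') = (brk A a a', brk B b b')"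
  "\<zero>\<^bsub>awb_prod A B\<^esub> = (\<zero>\<^bsub>A\<^esub>, \<zero>\<^bsub>B\<^esub>)"
  by (simp_all add: awb_prod_def)

lemma module_awb_prod: "module K A \<Longrightarrow> module K B \<Longrightarrow> module K (awb_prod A B)"
  by (rule module_image[OF module_mod_prod, of K A B _ "\<lambda>x. x"]) (auto simp: mod_prod_simps awb_prod_simps)

lemma module_fibre_prod:
  assumes C: "module K C" and D: "module K D" and V: "module K V" and p: "lin_map K C V p" and q: "lin_map K D V q"
  shows "module K (fibre_prod C p D q)"
  unfolding fibre_prod_def
  by (intro submodule.submodule_is_module[OF submoduleI'] module_awb_prod C D)
    (auto simp: awb_prod_simps module_ops[OF C] module_ops[OF D] lin_map_rules[OF C V p] lin_map_rules[OF D V q])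

lemma abelian_awb_simps:
  "carrier (abelian_awb M) = carrier M" "x \<otimes>\<^bsub>abelian_awb M\<^esub> y = \<zero>\<^bsub>M\<^esub>" "brk (abelian_awb M) x y = \<zero>\<^bsub>M\<^esub>"
  "x \<oplus>\<^bsub>abelian_awb M\<^esub> y = x \<oplus>\<^bsub>M\<^esub> y" "\<zero>\<^bsub>abelian_awb M\<^esub> = \<zero>\<^bsub>M\<^esub>" "k \<odot>\<^bsub>abelian_awb M\<^esub> x = k \<odot>\<^bsub>M\<^esub> x"
  by (simp_all add: abelian_awb_def)

lemma module_abelian_awb: "module K M \<Longrightarrow> module K (abelian_awb M)"
  by (rule module_image[of K M _ "\<lambda>x. x"]) (simp_all add: abelian_awb_simps)

context xext
begin

text \<open>Over a field both \<tau> and \<nu> have linear sections, and these determine the cochain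
  \<open>z0\<close> together with the isomorphism \<psi>.\<close>

lemma represented: "\<exists>z\<in>relZ0. \<exists>\<phi>. xiso K A M (xtwist z) e \<phi>"
proof -
  obtain s where s: "lin_section K A \<tau> Q s" by (rule section_exists)
  have "lin_map K C BA \<nu>" by (rule lin_mapI) simp_all
  then obtain \<sigma> where sg: "lin_section K C \<nu> BA \<sigma>"
    using lin_section_exists[OF fK mC mB] nu_image by auto
  interpret xsec K A B Q \<tau> M \<rho> s e \<sigma>
    by (intro xsec.intro setting_sec.intro setting_sec_axioms.intro xsec_axioms.intro setting_axioms xext_axioms s sg)
  show ?thesis using z0_relZ0 psi_iso by blast
qed

text \<open>The short five lemma: a congruence is the identity on \<open>M\<close> and on
  \<open>B\<close>, hence bijective.\<close>

lemma congruent_xiso: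
  fixes e' :: "('k, 'm, 'd, 'a) xext"
  assumes e': "crossed_extension K A B M \<rho>' e'" and c: "congruent K A M e e'"
  shows "\<exists>\<phi>. xiso K A M e e' \<phi>"
proof -
  interpret X: xext K A B Q \<tau> M \<rho> e' by (intro xext.intro xext_axioms.intro setting_axioms e')
  obtain \<phi> where h: "\<phi> \<in> awb_hom K C (xobj e')"
    and act: "\<forall>a\<in>carrier A. \<forall>c\<in>carrier C.
        \<phi> (lact \<alpha> a c) = lact (xact e') a (\<phi> c) \<and> \<phi> (ract \<alpha> c a) = ract (xact e') (\<phi> c) a \<and>
        \<phi> (lbr \<alpha> a c) = lbr (xact e') a (\<phi> c) \<and> \<phi> (rbr \<alpha> c a) = rbr (xact e') (\<phi> c) a"
    and pr: "\<And>c. c \<in> carrier C \<Longrightarrow> xproj e' (\<phi> c) = \<nu> c" and inc: "\<And>m. m \<in> carrier M \<Longrightarrow> \<phi> (i m) = xinc e' m"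
    using c unfolding congruent_def by blast
  have l: "lin_map K C (xobj e') \<phi>" using h by (simp add: awb_hom_def)
  note L = lin_map_rules[OF mC X.mC l]
  have "bij_betw \<phi> (carrier C) (carrier (xobj e'))"
    unfolding bij_betw_def
  proof
    show "inj_on \<phi> (carrier C)"
    proof (rule inj_onI)
      fix x y assume xy: "x \<in> carrier C" "y \<in> carrier C" "\<phi> x = \<phi> y"
      have d: "\<phi> (x \<ominus>\<^bsub>C\<^esub> y) = \<zero>\<^bsub>xobj e'\<^esub>" using xy by (simp add: L)
      have "\<nu> (x \<ominus>\<^bsub>C\<^esub> y) = \<zero>\<^bsub>A\<^esub>" using pr[of "x \<ominus>\<^bsub>C\<^esub> y"] d xy by simp
      then obtain m where m: "m \<in> carrier M" "x \<ominus>\<^bsub>C\<^esub> y = i m"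
        using i_image xy CR.agM by (metis (no_types, lifting) i_j j_M module_ops(3)[OF mC])
      then have "xinc e' m = xinc e' \<zero>\<^bsub>M\<^esub>" using inc d by simp
      then have "m = \<zero>\<^bsub>M\<^esub>" by (metis X.j_i m(1) module_ops(1)[OF mM])
      then show "x = y" using m xy abelian_group.minus_eq_zero[OF CR.agM, of x y] by simp
    qed
    show "\<phi> ` carrier C = carrier (xobj e')"
    proof (intro equalityI subsetI)
      fix c' assume c': "c' \<in> carrier (xobj e')"
      then have "xproj e' c' \<in> \<nu> ` carrier C" by (simp add: nu_image)
      then obtain c where c: "c \<in> carrier C" "\<nu> c = xproj e' c'" by auto
      \<comment> \<open>\<phi> \<open>c\<close> and \<open>c'\<close> lie over the same element of
        \<open>B\<close>, so they differ by an element of \<open>M\<close>; adding it to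
        \<open>c\<close> gives an exact preimage.\<close>
      define m where "m = X.j (c' \<ominus>\<^bsub>xobj e'\<^esub> \<phi> c)"
      have "xproj e' (c' \<ominus>\<^bsub>xobj e'\<^esub> \<phi> c) = \<zero>\<^bsub>A\<^esub>" using c c' by (simp add: L pr)
      then have m: "m \<in> carrier M" "xinc e' m = c' \<ominus>\<^bsub>xobj e'\<^esub> \<phi> c" using c c' by (simp_all add: m_def L)
      have "c' = \<phi> (i m \<oplus>\<^bsub>C\<^esub> c)"
        using m c c' abelian_group.eq_add_minus[OF X.CR.agM, of c' "\<phi> c"] by (simp add: L inc)
      then show "c' \<in> \<phi> ` carrier C" by (rule image_eqI) (use m c in simp)
    qed (auto simp: L)
  qed
  then have "xiso K A M e e' \<phi>"
    unfolding xiso_def using act pr inc h L(2,3) by (simp add: awb_hom_def)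
  then show ?thesis by blast
qed

end

context setting
begin

text \<open>An isomorphism over \<open>B\<close> that fixes \<open>M\<close> is a shear by a linear
  map \<open>u\<close> from \<open>B\<close> to \<open>M\<close>. Extending \<open>u\<close> to
  \<open>A\<close> turns its effect into a coboundary, up to a cochain that vanishes on
  \<open>B\<close> and is therefore inflated. Conversely, restricting \<open>h\<close> to
  \<open>B\<close> gives a shear.\<close>

lemma xtwist_iso_iff:
  assumes z: "z \<in> carrier (K0 K A M)" and w: "w \<in> carrier (K0 K A M)"
  shows "(\<exists>\<phi>. xiso K A M (xtwist z) (xtwist w) \<phi>) \<longleftrightarrow>
    (\<exists>h\<in>carrier (Km1 K A M). \<exists>c\<in>carrier (K0 K Q M). w = dm1 A M \<rho>' h \<oplus>\<^bsub>K0 K A M\<^esub> (infl2 c \<oplus>\<^bsub>K0 K A M\<^esub> z))"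
proof
  interpret agM: abelian_group M by (rule AR.agM)
  note [simp] = AR.K0_rules[OF z] AR.K0_rules[OF w] xtwist_simps B_closed B_in B_act
  {
    assume "\<exists>\<phi>. xiso K A M (xtwist z) (xtwist w) \<phi>"
    then obtain \<phi> where i: "xiso K A M (xtwist z) (xtwist w) \<phi>" by blast
    obtain s where s: "lin_section K A \<tau> Q s" by (rule section_exists)
    interpret setting_sec K A B Q \<tau> M \<rho> s by (intro setting_sec.intro setting_axioms setting_sec_axioms.intro s)
    \<comment> \<open>Additivity and \<phi> being the identity on \<open>M\<close> reduce \<phi> to
      its values at elements with first component zero.\<close>
    define u where "u b = fst (\<phi> (\<zero>\<^bsub>M\<^esub>, b))" for b
    note D = xisoD[OF i]
    have u: "\<phi> (\<zero>\<^bsub>M\<^esub>, b) = (u b, b)" "u b \<in> carrier M" if "b \<in> B" for b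
      using D(1)[of "(\<zero>\<^bsub>M\<^esub>, b)"] D(10)[of "(\<zero>\<^bsub>M\<^esub>, b)"] that by (auto simp: u_def prod_eq_iff)
    have ph: "\<phi> (m, b) = (m \<oplus>\<^bsub>M\<^esub> u b, b)" if mb: "m \<in> carrier M" "b \<in> B" for m b
      using D(2)[of "(m, \<zero>\<^bsub>A\<^esub>)" "(\<zero>\<^bsub>M\<^esub>, b)"] D(11)[of m] mb by (simp add: u)
    have u_add: "u (b \<oplus>\<^bsub>A\<^esub> b') = u b \<oplus>\<^bsub>M\<^esub> u b'" if b: "b \<in> B" "b' \<in> B" for b b'
      using D(2)[of "(\<zero>\<^bsub>M\<^esub>, b)" "(\<zero>\<^bsub>M\<^esub>, b')"] b by (simp add: u)
    have u_smult: "u (k \<odot>\<^bsub>A\<^esub> b) = k \<odot>\<^bsub>M\<^esub> u b" if b: "b \<in> B" "k \<in> carrier K" for b k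
      using D(5)[of k "(\<zero>\<^bsub>M\<^esub>, b)"] b by (simp add: u)
    \<comment> \<open>A linear extension of \<open>u\<close> to all of \<open>A\<close>, zero on
      \<open>s Q\<close>. Another extension would change \<open>h\<close> by an inflated map, and
      its coboundary by an inflated cochain.\<close>
    define h where "h = (\<lambda>a\<in>carrier A. u (\<beta> a))"
    have hB: "h b = u b" if "b \<in> B" for b using that by (simp add: h_def)
    have "lin_map K A M (\<lambda>a. u (\<beta> a))"
      by (rule lin_mapI) (simp_all add: u u_add u_smult lin_mapD[OF beta_lin])
    then have h: "h \<in> carrier (Km1 K A M)" and hl: "lin_map K A M h"
      by (simp_all add: AR.Km1_iff h_def lin_map_restrict mA)
    define y where "y = dm1 A M \<rho>' h \<oplus>\<^bsub>K0 K A M\<^esub> z"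
    have y: "y \<in> carrier (K0 K A M)" unfolding y_def by (intro module_ops(2)[OF AR.mK0] AR.dm1_K0 h z)
    have eqs: "fst w a b = fst z a b \<oplus>\<^bsub>M\<^esub> u (a \<otimes>\<^bsub>A\<^esub> b) \<ominus>\<^bsub>M\<^esub> lact \<rho>' a (u b)"
       "fst w b a = fst z b a \<oplus>\<^bsub>M\<^esub> u (b \<otimes>\<^bsub>A\<^esub> a) \<ominus>\<^bsub>M\<^esub> ract \<rho>' (u b) a"
       "snd w a b = snd z a b \<oplus>\<^bsub>M\<^esub> u (brk A a b) \<ominus>\<^bsub>M\<^esub> lbr \<rho>' a (u b)"
       "snd w b a = snd z b a \<oplus>\<^bsub>M\<^esub> u (brk A b a) \<ominus>\<^bsub>M\<^esub> rbr \<rho>' (u b) a" if ab: "a \<in> carrier A" "b \<in> B" for a b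
    proof -
      have *: "y = x \<oplus>\<^bsub>M\<^esub> y' \<Longrightarrow> y' = y \<ominus>\<^bsub>M\<^esub> x" if "x \<in> carrier M" "y' \<in> carrier M" for x y y'
      proof -
        note [simp] = that
        have "x \<oplus>\<^bsub>M\<^esub> y' \<ominus>\<^bsub>M\<^esub> x = y'"
          by (rule AR.feq, (rule AR.fop | (rule AR.fatom, (simp; fail)))+, simp)
        then show "y = x \<oplus>\<^bsub>M\<^esub> y' \<Longrightarrow> y' = y \<ominus>\<^bsub>M\<^esub> x" by simp
      qed
      have "\<phi> (lact (xact (xtwist z)) a (\<zero>\<^bsub>M\<^esub>, b)) = lact (xact (xtwist w)) a (\<phi> (\<zero>\<^bsub>M\<^esub>, b))"
        "\<phi> (ract (xact (xtwist z)) (\<zero>\<^bsub>M\<^esub>, b) a) = ract (xact (xtwist w)) (\<phi> (\<zero>\<^bsub>M\<^esub>, b)) a"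
        "\<phi> (lbr (xact (xtwist z)) a (\<zero>\<^bsub>M\<^esub>, b)) = lbr (xact (xtwist w)) a (\<phi> (\<zero>\<^bsub>M\<^esub>, b))"
        "\<phi> (rbr (xact (xtwist z)) (\<zero>\<^bsub>M\<^esub>, b) a) = rbr (xact (xtwist w)) (\<phi> (\<zero>\<^bsub>M\<^esub>, b)) a"
        by (rule D; use ab in \<open>simp; fail\<close>)+
      then show "fst w a b = fst z a b \<oplus>\<^bsub>M\<^esub> u (a \<otimes>\<^bsub>A\<^esub> b) \<ominus>\<^bsub>M\<^esub> lact \<rho>' a (u b)"
       "fst w b a = fst z b a \<oplus>\<^bsub>M\<^esub> u (b \<otimes>\<^bsub>A\<^esub> a) \<ominus>\<^bsub>M\<^esub> ract \<rho>' (u b) a"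
       "snd w a b = snd z a b \<oplus>\<^bsub>M\<^esub> u (brk A a b) \<ominus>\<^bsub>M\<^esub> lbr \<rho>' a (u b)"
       "snd w b a = snd z b a \<oplus>\<^bsub>M\<^esub> u (brk A b a) \<ominus>\<^bsub>M\<^esub> rbr \<rho>' (u b) a"
        using ab u by (auto intro!: * simp: ph)
    qed
    note Hr = lin_map_rules[OF mA mM hl]
    have yv: "fst w a b = fst y a b" "snd w a b = snd y a b" "fst w b a = fst y b a" "snd w b a = snd y b a"
      if ab: "a \<in> carrier A" "b \<in> B" for a b
      using ab u by (simp_all add: y_def eqs AR.K0_add AR.dm1_val Hr hB)
        (rule AR.feq, (rule AR.fop | (rule AR.fatom, (simp; fail)))+, simp add: algebra_simps)+
    \<comment> \<open>Compatibility with the action controls \<open>w\<close> only when one argument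
      lies in \<open>B\<close>. There \<open>w\<close> and \<open>y\<close> agree, so their
      difference is inflated.\<close>
    define d where "d = w \<ominus>\<^bsub>K0 K A M\<^esub> y"
    have d: "d \<in> carrier (K0 K A M)" unfolding d_def by (rule module_ops(3)[OF AR.mK0 w y])
    have wd: "w = d \<oplus>\<^bsub>K0 K A M\<^esub> y" unfolding d_def by (rule abelian_group.eq_add_minus[OF module_ag[OF AR.mK0] w y])
    have "vanishes2 d"
      unfolding vanishes2_def
    proof (intro ballI)
      fix a b assume ab: "a \<in> carrier A" "b \<in> B"
      have c: "x = \<zero>\<^bsub>M\<^esub>" if "y = x \<oplus>\<^bsub>M\<^esub> y" "x \<in> carrier M" "y \<in> carrier M" for x y
        using that by (metis agM.add.r_cancel_one')
      have K: "fst x a b \<in> carrier M" "fst x b a \<in> carrier M" "snd x a b \<in> carrier M" "snd x b a \<in> carrier M"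
        if "x \<in> carrier (K0 K A M)" for x using AR.K0_rules(1,12)[OF that] ab by simp_all
      have e: "fst w a b = fst d a b \<oplus>\<^bsub>M\<^esub> fst y a b" "fst w b a = fst d b a \<oplus>\<^bsub>M\<^esub> fst y b a"
        "snd w a b = snd d a b \<oplus>\<^bsub>M\<^esub> snd y a b" "snd w b a = snd d b a \<oplus>\<^bsub>M\<^esub> snd y b a"
        by (subst wd, simp add: AR.K0_add ab)+
      note e' = e[unfolded yv[OF ab]]
      show "fst d a b = \<zero>\<^bsub>M\<^esub> \<and> fst d b a = \<zero>\<^bsub>M\<^esub> \<and> snd d a b = \<zero>\<^bsub>M\<^esub> \<and> snd d b a = \<zero>\<^bsub>M\<^esub>"
        using c[OF e'(1) K(1)[OF d] K(1)[OF y]] c[OF e'(2) K(2)[OF d] K(2)[OF y]]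
          c[OF e'(3) K(3)[OF d] K(3)[OF y]] c[OF e'(4) K(4)[OF d] K(4)[OF y]] by blast
    qed
    note ct = defl2[OF d this]
    have "w = dm1 A M \<rho>' h \<oplus>\<^bsub>K0 K A M\<^esub> (infl2 (defl2 d) \<oplus>\<^bsub>K0 K A M\<^esub> z)"
    proof -
      interpret agK: abelian_group "K0 K A M" by (rule module_ag[OF AR.mK0])
      show ?thesis using wd d z AR.dm1_K0[OF h] by (simp add: ct y_def agK.a_ac)
    qed
    then show "\<exists>h\<in>carrier (Km1 K A M). \<exists>c\<in>carrier (K0 K Q M). w = dm1 A M \<rho>' h \<oplus>\<^bsub>K0 K A M\<^esub> (infl2 c \<oplus>\<^bsub>K0 K A M\<^esub> z)"
      using h ct by blast
  next
    assume "\<exists>h\<in>carrier (Km1 K A M). \<exists>c\<in>carrier (K0 K Q M). w = dm1 A M \<rho>' h \<oplus>\<^bsub>K0 K A M\<^esub> (infl2 c \<oplus>\<^bsub>K0 K A M\<^esub> z)"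
    then obtain h c where h: "h \<in> carrier (Km1 K A M)" and c: "c \<in> carrier (K0 K Q M)"
      and we: "w = dm1 A M \<rho>' h \<oplus>\<^bsub>K0 K A M\<^esub> (infl2 c \<oplus>\<^bsub>K0 K A M\<^esub> z)" by blast
    have hl: "lin_map K A M h" using h by (simp add: AR.Km1_iff)
    note [simp] = lin_map_rules[OF mA mM hl]
    have tv: "vanishes2 (infl2 c)" by (rule vanishes_infl2[OF c])
    have wv: "fst w a b = \<ominus>\<^bsub>M\<^esub> lact \<rho>' a (h b) \<oplus>\<^bsub>M\<^esub> h (a \<otimes>\<^bsub>A\<^esub> b) \<oplus>\<^bsub>M\<^esub> fst z a b"
      "fst w b a = h (b \<otimes>\<^bsub>A\<^esub> a) \<ominus>\<^bsub>M\<^esub> ract \<rho>' (h b) a \<oplus>\<^bsub>M\<^esub> fst z b a"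
      "snd w a b = \<ominus>\<^bsub>M\<^esub> lbr \<rho>' a (h b) \<oplus>\<^bsub>M\<^esub> h (brk A a b) \<oplus>\<^bsub>M\<^esub> snd z a b"
      "snd w b a = h (brk A b a) \<ominus>\<^bsub>M\<^esub> rbr \<rho>' (h b) a \<oplus>\<^bsub>M\<^esub> snd z b a"
      if ab: "a \<in> carrier A" "b \<in> B" for a b
    proof -
      have "fst (infl2 c) a b = \<zero>\<^bsub>M\<^esub>" "fst (infl2 c) b a = \<zero>\<^bsub>M\<^esub>" "snd (infl2 c) a b = \<zero>\<^bsub>M\<^esub>" "snd (infl2 c) b a = \<zero>\<^bsub>M\<^esub>"
        using tv ab by (auto simp: vanishes2_def simp del: infl_val)
      then show "fst w a b = \<ominus>\<^bsub>M\<^esub> lact \<rho>' a (h b) \<oplus>\<^bsub>M\<^esub> h (a \<otimes>\<^bsub>A\<^esub> b) \<oplus>\<^bsub>M\<^esub> fst z a b"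
      "fst w b a = h (b \<otimes>\<^bsub>A\<^esub> a) \<ominus>\<^bsub>M\<^esub> ract \<rho>' (h b) a \<oplus>\<^bsub>M\<^esub> fst z b a"
      "snd w a b = \<ominus>\<^bsub>M\<^esub> lbr \<rho>' a (h b) \<oplus>\<^bsub>M\<^esub> h (brk A a b) \<oplus>\<^bsub>M\<^esub> snd z a b"
      "snd w b a = h (brk A b a) \<ominus>\<^bsub>M\<^esub> rbr \<rho>' (h b) a \<oplus>\<^bsub>M\<^esub> snd z b a"
        using ab by (simp_all add: we AR.K0_add AR.dm1_val del: infl_val)
    qed
    \<comment> \<open>The shear by \<open>h\<close>. The inflated summand vanishes wherever the
      model evaluates the cochain, so it has no effect on the equations.\<close>
    define \<phi> where "\<phi> = (\<lambda>(m, b). (m \<oplus>\<^bsub>M\<^esub> h b, b))"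
    have "xiso K A M (xtwist z) (xtwist w) \<phi>"
      unfolding xiso_def
    proof (intro conjI ballI)
      have "bij_betw \<phi> (carrier M \<times> B) (carrier M \<times> B)"
        by (rule bij_betw_byWitness[where f'="\<lambda>(m, b). (m \<ominus>\<^bsub>M\<^esub> h b, b)"])
          (auto simp: \<phi>_def a_minus_def agM.a_assoc agM.r_neg agM.l_neg)
      then show "bij_betw \<phi> (carrier (xobj (xtwist z))) (carrier (xobj (xtwist w)))" by simp
      fix x assume "x \<in> carrier (xobj (xtwist z))"
      then obtain m b where x: "x = (m, b)" and [simp]: "m \<in> carrier M" "b \<in> B" by auto
      { fix y assume "y \<in> carrier (xobj (xtwist z))"
        then obtain m' b' where y: "y = (m', b')" and [simp]: "m' \<in> carrier M" "b' \<in> B" by auto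
        show "\<phi> (x \<oplus>\<^bsub>xobj (xtwist z)\<^esub> y) = \<phi> x \<oplus>\<^bsub>xobj (xtwist w)\<^esub> \<phi> y" by (simp add: x y \<phi>_def agM.a_ac)
        show "\<phi> (x \<otimes>\<^bsub>xobj (xtwist z)\<^esub> y) = \<phi> x \<otimes>\<^bsub>xobj (xtwist w)\<^esub> \<phi> y" by (simp add: x y \<phi>_def wv agM.a_ac)
        show "\<phi> (brk (xobj (xtwist z)) x y) = brk (xobj (xtwist w)) (\<phi> x) (\<phi> y)" by (simp add: x y \<phi>_def wv agM.a_ac) }
      { fix k assume "k \<in> carrier K"
        then show "\<phi> (k \<odot>\<^bsub>xobj (xtwist z)\<^esub> x) = k \<odot>\<^bsub>xobj (xtwist w)\<^esub> \<phi> x" by (simp add: x \<phi>_def) }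
      { fix a assume [simp]: "a \<in> carrier A"
        show "\<phi> (lact (xact (xtwist z)) a x) = lact (xact (xtwist w)) a (\<phi> x)"
          "\<phi> (ract (xact (xtwist z)) x a) = ract (xact (xtwist w)) (\<phi> x) a"
          "\<phi> (lbr (xact (xtwist z)) a x) = lbr (xact (xtwist w)) a (\<phi> x)"
          "\<phi> (rbr (xact (xtwist z)) x a) = rbr (xact (xtwist w)) (\<phi> x) a"
          by (simp add: x \<phi>_def wv; rule AR.feq, (rule AR.fop | (rule AR.fatom, (simp; fail)))+, simp add: algebra_simps)+ }
      show "xproj (xtwist w) (\<phi> x) = xproj (xtwist z) x" by (simp add: x \<phi>_def)
    next
      fix m assume "m \<in> carrier M"
      then show "\<phi> (xinc (xtwist z) m) = xinc (xtwist w) m" by (simp add: \<phi>_def)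
    qed
    then show "\<exists>\<phi>. xiso K A M (xtwist z) (xtwist w) \<phi>" by blast
  }
qed

end

section \<open>The component in \<open>M\<close> of an isomorphism with a cochain model\<close>

context xext
begin

text \<open>The first component of an isomorphism from the extension to \<open>xtwist z\<close>, the
  second being \<nu>; the last clause expresses surjectivity of the pair. Such coordinates can be
  added and scaled, which makes Baer sums and multiples computable.\<close>

definition coord :: "('a, 'm) cochain0 \<Rightarrow> ('c \<Rightarrow> 'm) \<Rightarrow> bool" where
  "coord z u \<longleftrightarrow>
    (\<forall>c\<in>carrier C. u c \<in> carrier M \<and>
      (\<forall>c'\<in>carrier C. u (c \<oplus>\<^bsub>C\<^esub> c') = u c \<oplus>\<^bsub>M\<^esub> u c' \<and> u (c \<otimes>\<^bsub>C\<^esub> c') = fst z (\<nu> c) (\<nu> c') \<and>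
         u (brk C c c') = snd z (\<nu> c) (\<nu> c')) \<and>
      (\<forall>k\<in>carrier K. u (k \<odot>\<^bsub>C\<^esub> c) = k \<odot>\<^bsub>M\<^esub> u c) \<and>
      (\<forall>a\<in>carrier A. u (lact \<alpha> a c) = lact \<rho>' a (u c) \<oplus>\<^bsub>M\<^esub> fst z a (\<nu> c) \<and>
        u (ract \<alpha> c a) = ract \<rho>' (u c) a \<oplus>\<^bsub>M\<^esub> fst z (\<nu> c) a \<and>
        u (lbr \<alpha> a c) = lbr \<rho>' a (u c) \<oplus>\<^bsub>M\<^esub> snd z a (\<nu> c) \<and>
        u (rbr \<alpha> c a) = rbr \<rho>' (u c) a \<oplus>\<^bsub>M\<^esub> snd z (\<nu> c) a)) \<and>
    (\<forall>m\<in>carrier M. u (i m) = m \<and> (\<forall>b\<in>B. \<exists>c\<in>carrier C. u c = m \<and> \<nu> c = b))"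

lemma coordD:
  assumes "coord z u"
  shows "\<And>c. c \<in> carrier C \<Longrightarrow> u c \<in> carrier M"
    "\<And>c c'. c \<in> carrier C \<Longrightarrow> c' \<in> carrier C \<Longrightarrow> u (c \<oplus>\<^bsub>C\<^esub> c') = u c \<oplus>\<^bsub>M\<^esub> u c'"
    "\<And>k c. k \<in> carrier K \<Longrightarrow> c \<in> carrier C \<Longrightarrow> u (k \<odot>\<^bsub>C\<^esub> c) = k \<odot>\<^bsub>M\<^esub> u c"
    "\<And>c c'. c \<in> carrier C \<Longrightarrow> c' \<in> carrier C \<Longrightarrow> u (c \<otimes>\<^bsub>C\<^esub> c') = fst z (\<nu> c) (\<nu> c')"
    "\<And>c c'. c \<in> carrier C \<Longrightarrow> c' \<in> carrier C \<Longrightarrow> u (brk C c c') = snd z (\<nu> c) (\<nu> c')"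
    "\<And>a c. a \<in> carrier A \<Longrightarrow> c \<in> carrier C \<Longrightarrow> u (lact \<alpha> a c) = lact \<rho>' a (u c) \<oplus>\<^bsub>M\<^esub> fst z a (\<nu> c)"
    "\<And>a c. a \<in> carrier A \<Longrightarrow> c \<in> carrier C \<Longrightarrow> u (ract \<alpha> c a) = ract \<rho>' (u c) a \<oplus>\<^bsub>M\<^esub> fst z (\<nu> c) a"
    "\<And>a c. a \<in> carrier A \<Longrightarrow> c \<in> carrier C \<Longrightarrow> u (lbr \<alpha> a c) = lbr \<rho>' a (u c) \<oplus>\<^bsub>M\<^esub> snd z a (\<nu> c)"
    "\<And>a c. a \<in> carrier A \<Longrightarrow> c \<in> carrier C \<Longrightarrow> u (rbr \<alpha> c a) = rbr \<rho>' (u c) a \<oplus>\<^bsub>M\<^esub> snd z (\<nu> c) a"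
    "\<And>m. m \<in> carrier M \<Longrightarrow> u (i m) = m"
    "\<And>m b. m \<in> carrier M \<Longrightarrow> b \<in> B \<Longrightarrow> \<exists>c\<in>carrier C. u c = m \<and> \<nu> c = b"
  using assms unfolding coord_def by blast+

lemma coord_exists:
  assumes z: "z \<in> carrier (K0 K A M)" and iso: "xiso K A M (xtwist z) e \<phi>"
  obtains u where "coord z u"
proof -
  obtain p where p: "xiso K A M e (xtwist z) p" using xiso_sym[OF iso xtwist_closed[OF z]] by blast
  note D = xisoD[OF p]
  define u where "u c = fst (p c)" for c
  have pc: "p c = (u c, \<nu> c)" and uM: "u c \<in> carrier M" if "c \<in> carrier C" for c
    using D(1)[OF that] D(10)[OF that] by (auto simp: u_def xtwist_simps prod_eq_iff)
  have cc [simp]: "c \<otimes>\<^bsub>C\<^esub> c' \<in> carrier C" "brk C c c' \<in> carrier C" if "c \<in> carrier C" "c' \<in> carrier C" for c c'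
    using that by (simp_all add: C_mult)
  have "coord z u"
    unfolding coord_def
  proof (intro conjI ballI)
    fix c assume [simp]: "c \<in> carrier C"
    show "u c \<in> carrier M" by (simp add: uM)
    { fix c' assume [simp]: "c' \<in> carrier C"
      show "u (c \<oplus>\<^bsub>C\<^esub> c') = u c \<oplus>\<^bsub>M\<^esub> u c'" "u (c \<otimes>\<^bsub>C\<^esub> c') = fst z (\<nu> c) (\<nu> c')" "u (brk C c c') = snd z (\<nu> c) (\<nu> c')"
        using D(2)[of c c'] D(3)[of c c'] D(4)[of c c'] by (simp_all add: pc xtwist_simps) }
    { fix k assume "k \<in> carrier K"
      then show "u (k \<odot>\<^bsub>C\<^esub> c) = k \<odot>\<^bsub>M\<^esub> u c" using D(5)[of k c] by (simp add: pc xtwist_simps) }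
    { fix a assume [simp]: "a \<in> carrier A"
      show "u (lact \<alpha> a c) = lact \<rho>' a (u c) \<oplus>\<^bsub>M\<^esub> fst z a (\<nu> c)" "u (ract \<alpha> c a) = ract \<rho>' (u c) a \<oplus>\<^bsub>M\<^esub> fst z (\<nu> c) a"
        "u (lbr \<alpha> a c) = lbr \<rho>' a (u c) \<oplus>\<^bsub>M\<^esub> snd z a (\<nu> c)" "u (rbr \<alpha> c a) = rbr \<rho>' (u c) a \<oplus>\<^bsub>M\<^esub> snd z (\<nu> c) a"
        using D(6)[of a c] D(7)[of a c] D(8)[of a c] D(9)[of a c] by (simp_all add: pc xtwist_simps) }
  next
    fix m assume m: "m \<in> carrier M"
    show "u (i m) = m" using D(11)[OF m] by (simp add: u_def xtwist_simps)
    fix b assume "b \<in> B"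
    then have "(m, b) \<in> p ` carrier C" using m by (simp add: D(12) xtwist_simps)
    then obtain c where "c \<in> carrier C" "p c = (m, b)" by auto
    then show "\<exists>c\<in>carrier C. u c = m \<and> \<nu> c = b" by (intro bexI[of _ c]) (simp_all add: pc)
  qed
  then show thesis by (rule that)
qed

end

section \<open>The vector space of crossed extensions and the map \<gamma>\<close>

context setting
begin

definition xclass where "xclass z = xcl K A B M \<rho>' (xtwist z)"

lemma relZ0_K0: "z \<in> relZ0 \<Longrightarrow> z \<in> carrier (K0 K A M)"
  by (simp add: relZ0_def)

lemma xextI: "crossed_extension K A B M \<rho>' e \<Longrightarrow> xext K A B Q \<tau> M \<rho> e"
  by (intro xext.intro xext_axioms.intro setting_axioms)

text \<open>Congruences out of isomorphic records correspond by composition with the isomorphism and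
  its inverse. \<open>e\<close> is an arbitrary record over any type, so Baer sums and pullbacks are
  covered.\<close>

lemma xcl_iso:
  assumes z: "z \<in> carrier (K0 K A M)" and iso: "xiso K A M (xtwist z) e \<phi>"
  shows "xcl K A B M \<rho>' e = xclass z"
  using xiso_congruent[OF iso] xiso_congruent[OF xiso_sym[OF iso xtwist_closed[OF z]]]
  by (auto simp: xclass_def xcl_def intro: congruent_trans)

text \<open>Between crossed extensions a congruence is already an isomorphism, so membership in a
  class can be used in the symmetric form \<open>xiso\<close>.\<close>

lemma xclass_mem:
  assumes z: "z \<in> relZ0"
  shows "e \<in> xclass z \<longleftrightarrow> crossed_extension K A B M \<rho>' e \<and> (\<exists>\<phi>. xiso K A M (xtwist z) e \<phi>)"
  using xext.congruent_xiso[OF xextI[OF xtwist_crossed[OF z]], of e] xiso_congruent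
  by (auto simp: xclass_def xcl_def)

lemma xtwist_refl: "xiso K A M (xtwist z) (xtwist z) (\<lambda>x. x)"
  by (auto simp: xiso_def bij_betw_def)

lemma xtwist_in_class: "z \<in> relZ0 \<Longrightarrow> xtwist z \<in> xclass z"
  using xclass_mem xtwist_crossed xtwist_refl by blast

lemma xclass_eq_iff:
  assumes z: "z \<in> relZ0" and w: "w \<in> relZ0"
  shows "xclass z = xclass w \<longleftrightarrow>
    (\<exists>h\<in>carrier (Km1 K A M). \<exists>c\<in>carrier (K0 K Q M). w = dm1 A M \<rho>' h \<oplus>\<^bsub>K0 K A M\<^esub> (infl2 c \<oplus>\<^bsub>K0 K A M\<^esub> z))"
proof -
  have "xclass z = xclass w \<longleftrightarrow> (\<exists>\<phi>. xiso K A M (xtwist z) (xtwist w) \<phi>)"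
  proof
    assume "xclass z = xclass w"
    then have "xtwist w \<in> xclass z" using xtwist_in_class[OF w] by simp
    then show "\<exists>\<phi>. xiso K A M (xtwist z) (xtwist w) \<phi>" using xclass_mem[OF z] by blast
  next
    assume "\<exists>\<phi>. xiso K A M (xtwist z) (xtwist w) \<phi>"
    then show "xclass z = xclass w" using xcl_iso[OF relZ0_K0[OF z]] by (auto simp: xclass_def)
  qed
  then show ?thesis using xtwist_iso_iff[OF relZ0_K0[OF z] relZ0_K0[OF w]] by simp
qed

lemma XExt_carrier: "carrier (XExt K A B M \<rho>') = xclass ` relZ0"
proof -
  have "xcl K A B M \<rho>' e \<in> xclass ` relZ0" if e: "crossed_extension K A B M \<rho>' e" for e :: "('k, 'm, 'm \<times> 'a, 'a) xext"
    using xext.represented[OF xextI[OF e]] xcl_iso relZ0_K0 by blast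
  moreover have "xclass z \<in> xcl K A B M \<rho>' ` {e :: ('k, 'm, 'm \<times> 'a, 'a) xext. crossed_extension K A B M \<rho>' e}" if "z \<in> relZ0" for z
    using xtwist_crossed[OF that] by (auto simp: xclass_def)
  ultimately show ?thesis by (auto simp: XExt_def)
qed

text \<open>With the zero cochain the model has componentwise operations and action.\<close>

lemma xzero_iso: "xiso K A M (xtwist \<zero>\<^bsub>K0 K A M\<^esub>) (xzero A B M \<rho>') (\<lambda>x. x)"
  by (auto simp: xiso_def bij_betw_def xzero_def xtwist_simps awb_prod_simps abelian_awb_simps AR.K0_add B_in
     action_prod_def self_action_def)

text \<open>Adding the coordinates in \<open>M\<close> of a pair over the same element of
  \<open>B\<close> defines a map \<open>q\<close> from the fibre product onto the model of the sum
  of the cochains. Its kernel is the antidiagonal copy of \<open>M\<close> divided out in the Baer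
  sum, so \<open>quot_iso\<close> applies.\<close>

lemma xadd_iso:
  fixes e :: "('k, 'm, 'c, 'a) xext" and e' :: "('k, 'm, 'd, 'a) xext"
  assumes z: "z \<in> carrier (K0 K A M)" and w: "w \<in> carrier (K0 K A M)"
    and e: "crossed_extension K A B M \<rho>' e" and e': "crossed_extension K A B M \<rho>' e'"
    and iz: "xiso K A M (xtwist z) e \<phi>" and iw: "xiso K A M (xtwist w) e' \<phi>'"
  shows "\<exists>\<psi>. xiso K A M (xtwist (z \<oplus>\<^bsub>K0 K A M\<^esub> w)) (xadd M e e') \<psi>"
proof -
  interpret agM: abelian_group M by (rule AR.agM)
  interpret E: xext K A B Q \<tau> M \<rho> e by (rule xextI[OF e])
  interpret D: xext K A B Q \<tau> M \<rho> e' by (rule xextI[OF e'])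
  obtain u where "E.coord z u" by (rule E.coord_exists[OF z iz])
  note u = E.coordD[OF this]
  obtain v where "D.coord w v" by (rule D.coord_exists[OF w iw])
  note v = D.coordD[OF this]
  let ?x = "xtwist (z \<oplus>\<^bsub>K0 K A M\<^esub> w)"
  let ?P = "fibre_prod E.C E.\<nu> D.C D.\<nu>"
  let ?I = "{(E.i m, \<ominus>\<^bsub>D.C\<^esub> (D.i m)) | m. m \<in> carrier M}"
  define q where "q = (\<lambda>(c, c'). (u c \<oplus>\<^bsub>M\<^esub> v c', E.\<nu> c))"
  have Pc: "p \<in> carrier ?P \<longleftrightarrow> (\<exists>c c'. p = (c, c') \<and> c \<in> carrier E.C \<and> c' \<in> carrier D.C \<and> D.\<nu> c' = E.\<nu> c)" for p
    by (auto simp: fibre_prod_def)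
  have Pop: "mult ?P = mult (awb_prod E.C D.C)" "brk ?P = brk (awb_prod E.C D.C)" "add ?P = add (awb_prod E.C D.C)"
     "smult ?P = smult (awb_prod E.C D.C)"
    by (simp_all add: fibre_prod_def)
  have cE: "c \<otimes>\<^bsub>E.C\<^esub> c' \<in> carrier E.C" "brk E.C c c' \<in> carrier E.C" "E.\<nu> (c \<otimes>\<^bsub>E.C\<^esub> c') = E.\<nu> c \<otimes>\<^bsub>A\<^esub> E.\<nu> c'"
     "E.\<nu> (brk E.C c c') = brk A (E.\<nu> c) (E.\<nu> c')" if "c \<in> carrier E.C" "c' \<in> carrier E.C" for c c'
    using that by (simp_all add: E.C_mult)
  have cD: "c \<otimes>\<^bsub>D.C\<^esub> c' \<in> carrier D.C" "brk D.C c c' \<in> carrier D.C" "D.\<nu> (c \<otimes>\<^bsub>D.C\<^esub> c') = D.\<nu> c \<otimes>\<^bsub>A\<^esub> D.\<nu> c'"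
     "D.\<nu> (brk D.C c c') = brk A (D.\<nu> c) (D.\<nu> c')" if "c \<in> carrier D.C" "c' \<in> carrier D.C" for c c'
    using that by (simp_all add: D.C_mult)
  note [simp] = Pop awb_prod_simps u(1-10) v(1-10) xtwist_simps cE cD AR.K0_add AR.K0_rules(1)[OF z] AR.K0_rules(12)[OF z]
    AR.K0_rules(1)[OF w] AR.K0_rules(12)[OF w]
  have u0: "u \<zero>\<^bsub>E.C\<^esub> = \<zero>\<^bsub>M\<^esub>" using u(10)[of "\<zero>\<^bsub>M\<^esub>"] by simp
  have v0: "v \<zero>\<^bsub>D.C\<^esub> = \<zero>\<^bsub>M\<^esub>" using v(10)[of "\<zero>\<^bsub>M\<^esub>"] by simp
  have "xiso K A M ?x \<lparr>xobj = awb_quot ?P ?I, xinc = (\<lambda>m. ?I +>\<^bsub>?P\<^esub> (E.i m, \<zero>\<^bsub>D.C\<^esub>)),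
     xproj = (\<lambda>X. the_elem ((\<lambda>(c, c'). E.\<nu> c) ` X)), xact = action_quot ?P ?I (action_prod E.\<alpha> D.\<alpha>)\<rparr>
    (\<lambda>y. {p\<in>carrier ?P. q p = y})"
  proof (rule quot_iso)
    show "module K ?P" by (rule module_fibre_prod[OF E.mC D.mC mA E.nu_lin D.nu_lin])
    show "module K (xobj ?x)" by (rule xtwist_module)
    show "lin_map K ?P (xobj ?x) q"
      by (rule lin_mapI) (auto simp: Pc q_def agM.a_ac)
    show "q ` carrier ?P = carrier (xobj ?x)"
    proof (intro equalityI subsetI)
      fix y assume "y \<in> carrier (xobj ?x)"
      \<comment> \<open>A preimage is built by giving the first factor the whole coordinate
        \<open>m\<close> and the second the coordinate zero.\<close>
      then obtain m b where y: "y = (m, b)" "m \<in> carrier M" "b \<in> B" by auto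
      obtain c where c: "c \<in> carrier E.C" "u c = m" "E.\<nu> c = b" using u(11)[OF y(2,3)] by blast
      obtain c' where c': "c' \<in> carrier D.C" "v c' = \<zero>\<^bsub>M\<^esub>" "D.\<nu> c' = b" using v(11)[OF _ y(3), of "\<zero>\<^bsub>M\<^esub>"] by auto
      show "y \<in> q ` carrier ?P"
        by (rule image_eqI[of _ _ "(c, c')"]) (use y c c' in \<open>simp_all add: q_def Pc\<close>)
    qed (auto simp: Pc q_def)
    show "?I = {p \<in> carrier ?P. q p = \<zero>\<^bsub>xobj ?x\<^esub>}"
    proof (intro equalityI subsetI)
      fix p assume "p \<in> ?I"
      then obtain m where m: "p = (E.i m, \<ominus>\<^bsub>D.C\<^esub> (D.i m))" "m \<in> carrier M" by blast
      have "v (\<ominus>\<^bsub>D.C\<^esub> D.i m) = \<ominus>\<^bsub>M\<^esub> m" using m v(10)[of "\<ominus>\<^bsub>M\<^esub> m"] by simp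
      then show "p \<in> {p \<in> carrier ?P. q p = \<zero>\<^bsub>xobj ?x\<^esub>}" using m by (simp add: Pc q_def agM.r_neg)
    next
      fix p assume "p \<in> {p \<in> carrier ?P. q p = \<zero>\<^bsub>xobj ?x\<^esub>}"
      then obtain c c' where c: "p = (c, c')" "c \<in> carrier E.C" "c' \<in> carrier D.C" "D.\<nu> c' = \<zero>\<^bsub>A\<^esub>" "E.\<nu> c = \<zero>\<^bsub>A\<^esub>"
         "u c \<oplus>\<^bsub>M\<^esub> v c' = \<zero>\<^bsub>M\<^esub>" by (auto simp: Pc q_def)
      define m where "m = E.j c"
      define m' where "m' = D.j c'"
      have m: "m \<in> carrier M" "m' \<in> carrier M" "c = E.i m" "c' = D.i m'" using c by (simp_all add: m_def m'_def)
      then have "m \<oplus>\<^bsub>M\<^esub> m' = \<zero>\<^bsub>M\<^esub>" using c by simp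
      then have "m' = \<ominus>\<^bsub>M\<^esub> m" using m agM.minus_equality[of m' m] by (simp add: agM.a_comm)
      then show "p \<in> ?I" using m c by auto
    qed
  next
    fix p p' assume "p \<in> carrier ?P" "p' \<in> carrier ?P"
    then obtain c d c' d' where p: "p = (c, d)" "p' = (c', d')" and [simp]: "c \<in> carrier E.C" "d \<in> carrier D.C" "D.\<nu> d = E.\<nu> c"
      "c' \<in> carrier E.C" "d' \<in> carrier D.C" "D.\<nu> d' = E.\<nu> c'" by (auto simp: Pc)
    show "p \<otimes>\<^bsub>?P\<^esub> p' \<in> carrier ?P \<and> brk ?P p p' \<in> carrier ?P \<and> q (p \<otimes>\<^bsub>?P\<^esub> p') = q p \<otimes>\<^bsub>xobj ?x\<^esub> q p' \<and>
       q (brk ?P p p') = brk (xobj ?x) (q p) (q p')"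
      by (simp add: p Pc q_def B_in)
  next
    fix a p assume [simp]: "a \<in> carrier A" and "p \<in> carrier ?P"
    then obtain c d where p: "p = (c, d)" and [simp]: "c \<in> carrier E.C" "d \<in> carrier D.C" "D.\<nu> d = E.\<nu> c" by (auto simp: Pc)
    show "lact (action_prod E.\<alpha> D.\<alpha>) a p \<in> carrier ?P \<and> lbr (action_prod E.\<alpha> D.\<alpha>) a p \<in> carrier ?P \<and>
      ract (action_prod E.\<alpha> D.\<alpha>) p a \<in> carrier ?P \<and> rbr (action_prod E.\<alpha> D.\<alpha>) p a \<in> carrier ?P \<and>
      q (lact (action_prod E.\<alpha> D.\<alpha>) a p) = lact (xact ?x) a (q p) \<and> q (lbr (action_prod E.\<alpha> D.\<alpha>) a p) = lbr (xact ?x) a (q p) \<and>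
      q (ract (action_prod E.\<alpha> D.\<alpha>) p a) = ract (xact ?x) (q p) a \<and> q (rbr (action_prod E.\<alpha> D.\<alpha>) p a) = rbr (xact ?x) (q p) a"
      by (simp add: p Pc q_def B_in action_prod_def agM.a_ac)
  next
    fix m assume "m \<in> carrier M"
    then show "(E.i m, \<zero>\<^bsub>D.C\<^esub>) \<in> carrier ?P \<and> q (E.i m, \<zero>\<^bsub>D.C\<^esub>) = xinc ?x m" by (simp add: Pc q_def v0)
  qed (auto simp: Pc q_def)
  then show ?thesis unfolding xadd_def Let_def by blast
qed

text \<open>The map \<open>q\<close> sends a pair to its first entry plus \<open>k\<close> times the
  coordinate of the second. The value \<nu> is unchanged, the cochain is multiplied by
  \<open>k\<close>, and the kernel is the submodule divided out.\<close>

lemma xsmult_iso: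
  fixes e :: "('k, 'm, 'c, 'a) xext"
  assumes z: "z \<in> carrier (K0 K A M)" and k: "k \<in> carrier K"
    and e: "crossed_extension K A B M \<rho>' e" and iz: "xiso K A M (xtwist z) e \<phi>"
  shows "\<exists>\<psi>. xiso K A M (xtwist (k \<odot>\<^bsub>K0 K A M\<^esub> z)) (xsmult M \<rho>' k e) \<psi>"
proof -
  interpret agM: abelian_group M by (rule AR.agM)
  interpret E: xext K A B Q \<tau> M \<rho> e by (rule xextI[OF e])
  obtain u where "E.coord z u" by (rule E.coord_exists[OF z iz])
  note u = E.coordD[OF this]
  let ?x = "xtwist (k \<odot>\<^bsub>K0 K A M\<^esub> z)"
  let ?P = "awb_prod (abelian_awb M) E.C"
  let ?I = "{(k \<odot>\<^bsub>M\<^esub> m, \<ominus>\<^bsub>E.C\<^esub> (E.i m)) | m. m \<in> carrier M}"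
  define q where "q = (\<lambda>(m, c). (m \<oplus>\<^bsub>M\<^esub> k \<odot>\<^bsub>M\<^esub> u c, E.\<nu> c))"
  have Pc: "p \<in> carrier ?P \<longleftrightarrow> (\<exists>m c. p = (m, c) \<and> m \<in> carrier M \<and> c \<in> carrier E.C)" for p
    by (auto simp: awb_prod_simps abelian_awb_simps)
  have cE: "c \<otimes>\<^bsub>E.C\<^esub> c' \<in> carrier E.C" "brk E.C c c' \<in> carrier E.C" "E.\<nu> (c \<otimes>\<^bsub>E.C\<^esub> c') = E.\<nu> c \<otimes>\<^bsub>A\<^esub> E.\<nu> c'"
     "E.\<nu> (brk E.C c c') = brk A (E.\<nu> c) (E.\<nu> c')" if "c \<in> carrier E.C" "c' \<in> carrier E.C" for c c'
    using that by (simp_all add: E.C_mult)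
  note [simp] = k awb_prod_simps abelian_awb_simps u(1-10) xtwist_simps cE AR.K0_add AR.K0_rules(1)[OF z] AR.K0_rules(12)[OF z]
  have u0: "u \<zero>\<^bsub>E.C\<^esub> = \<zero>\<^bsub>M\<^esub>" using u(10)[of "\<zero>\<^bsub>M\<^esub>"] by simp
  have kk: "k \<odot>\<^bsub>M\<^esub> (l \<odot>\<^bsub>M\<^esub> m) = l \<odot>\<^bsub>M\<^esub> (k \<odot>\<^bsub>M\<^esub> m)" if "l \<in> carrier K" "m \<in> carrier M" for l m
    using lin_mapD(3)[OF lin_map_smult[OF mM k lin_map_id] that] .
  have "xiso K A M ?x \<lparr>xobj = awb_quot ?P ?I, xinc = (\<lambda>m. ?I +>\<^bsub>?P\<^esub> (m, \<zero>\<^bsub>E.C\<^esub>)),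
     xproj = (\<lambda>X. the_elem ((\<lambda>(m, c). E.\<nu> c) ` X)), xact = action_quot ?P ?I (action_prod \<rho>' E.\<alpha>)\<rparr>
    (\<lambda>y. {p\<in>carrier ?P. q p = y})"
  proof (rule quot_iso)
    show "module K ?P" by (rule module_awb_prod[OF module_abelian_awb[OF mM] E.mC])
    show "module K (xobj ?x)" by (rule xtwist_module)
    show "lin_map K ?P (xobj ?x) q"
      by (rule lin_mapI) (auto simp: Pc q_def agM.a_ac kk)
    show "q ` carrier ?P = carrier (xobj ?x)"
    proof (intro equalityI subsetI)
      fix y assume "y \<in> carrier (xobj ?x)"
      then obtain m b where y: "y = (m, b)" "m \<in> carrier M" "b \<in> B" by auto
      obtain c where c: "c \<in> carrier E.C" "u c = \<zero>\<^bsub>M\<^esub>" "E.\<nu> c = b" using u(11)[OF _ y(3), of "\<zero>\<^bsub>M\<^esub>"] by auto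
      show "y \<in> q ` carrier ?P"
        by (rule image_eqI[of _ _ "(m, c)"]) (use y c in \<open>simp_all add: q_def\<close>)
    qed (auto simp: q_def)
    show "?I = {p \<in> carrier ?P. q p = \<zero>\<^bsub>xobj ?x\<^esub>}"
    proof (intro equalityI subsetI)
      fix p assume "p \<in> ?I"
      then obtain m where m: "p = (k \<odot>\<^bsub>M\<^esub> m, \<ominus>\<^bsub>E.C\<^esub> (E.i m))" "m \<in> carrier M" by blast
      have "u (\<ominus>\<^bsub>E.C\<^esub> E.i m) = \<ominus>\<^bsub>M\<^esub> m" using m u(10)[of "\<ominus>\<^bsub>M\<^esub> m"] by simp
      then show "p \<in> {p \<in> carrier ?P. q p = \<zero>\<^bsub>xobj ?x\<^esub>}" using m by (simp add: q_def agM.r_neg)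
    next
      fix p assume "p \<in> {p \<in> carrier ?P. q p = \<zero>\<^bsub>xobj ?x\<^esub>}"
      then obtain m c where c: "p = (m, c)" "m \<in> carrier M" "c \<in> carrier E.C" "E.\<nu> c = \<zero>\<^bsub>A\<^esub>"
         "m \<oplus>\<^bsub>M\<^esub> k \<odot>\<^bsub>M\<^esub> u c = \<zero>\<^bsub>M\<^esub>" by (auto simp: q_def)
      \<comment> \<open>The sign is forced by the shape of \<open>?I\<close>, whose second entry is
        the negative of \<open>i m\<close>.\<close>
      define m' where "m' = \<ominus>\<^bsub>M\<^esub> E.j c"
      have m': "m' \<in> carrier M" "c = \<ominus>\<^bsub>E.C\<^esub> E.i m'" "u c = \<ominus>\<^bsub>M\<^esub> m'"
        using c u(10)[of "E.j c"] by (simp_all add: m'_def)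
      then have "m = k \<odot>\<^bsub>M\<^esub> m'" using c agM.minus_eq_zero[of m "k \<odot>\<^bsub>M\<^esub> m'"] by (simp add: a_minus_def)
      then show "p \<in> ?I" using m' c by auto
    qed
  next
    fix p p' assume "p \<in> carrier ?P" "p' \<in> carrier ?P"
    then obtain m c m' c' where p: "p = (m, c)" "p' = (m', c')" and [simp]: "c \<in> carrier E.C" "m \<in> carrier M" 
      "c' \<in> carrier E.C" "m' \<in> carrier M" by (auto simp: Pc)
    show "p \<otimes>\<^bsub>?P\<^esub> p' \<in> carrier ?P \<and> brk ?P p p' \<in> carrier ?P \<and> q (p \<otimes>\<^bsub>?P\<^esub> p') = q p \<otimes>\<^bsub>xobj ?x\<^esub> q p' \<and>
       q (brk ?P p p') = brk (xobj ?x) (q p) (q p')"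
      by (simp add: p q_def B_in)
  next
    fix a p assume [simp]: "a \<in> carrier A" and "p \<in> carrier ?P"
    then obtain m c where p: "p = (m, c)" and [simp]: "c \<in> carrier E.C" "m \<in> carrier M" by (auto simp: Pc)
    show "lact (action_prod \<rho>' E.\<alpha>) a p \<in> carrier ?P \<and> lbr (action_prod \<rho>' E.\<alpha>) a p \<in> carrier ?P \<and>
      ract (action_prod \<rho>' E.\<alpha>) p a \<in> carrier ?P \<and> rbr (action_prod \<rho>' E.\<alpha>) p a \<in> carrier ?P \<and>
      q (lact (action_prod \<rho>' E.\<alpha>) a p) = lact (xact ?x) a (q p) \<and> q (lbr (action_prod \<rho>' E.\<alpha>) a p) = lbr (xact ?x) a (q p) \<and>
      q (ract (action_prod \<rho>' E.\<alpha>) p a) = ract (xact ?x) (q p) a \<and> q (rbr (action_prod \<rho>' E.\<alpha>) p a) = rbr (xact ?x) (q p) a"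
      by (simp add: p q_def B_in action_prod_def agM.a_ac)
  next
    fix m assume "m \<in> carrier M"
    then show "(m, \<zero>\<^bsub>E.C\<^esub>) \<in> carrier ?P \<and> q (m, \<zero>\<^bsub>E.C\<^esub>) = xinc ?x m" by (simp add: q_def u0)
  qed (auto simp: q_def)
  then show ?thesis unfolding xsmult_def Let_def by blast
qed

text \<open>The operations range over all representatives, and by the preceding isomorphisms each
  choice yields the class of the same cochain. Addition of classes is thus addition of
  cochains.\<close>

lemma XExt_ops:
  "\<And>z w. z \<in> relZ0 \<Longrightarrow> w \<in> relZ0 \<Longrightarrow> xclass z \<oplus>\<^bsub>XExt K A B M \<rho>'\<^esub> xclass w = xclass (z \<oplus>\<^bsub>K0 K A M\<^esub> w)"
  "\<And>k z. k \<in> carrier K \<Longrightarrow> z \<in> relZ0 \<Longrightarrow> k \<odot>\<^bsub>XExt K A B M \<rho>'\<^esub> xclass z = xclass (k \<odot>\<^bsub>K0 K A M\<^esub> z)"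
  "\<zero>\<^bsub>XExt K A B M \<rho>'\<^esub> = xclass \<zero>\<^bsub>K0 K A M\<^esub>"
proof -
  fix z w assume z: "z \<in> relZ0" and w: "w \<in> relZ0"
  have zw: "z \<oplus>\<^bsub>K0 K A M\<^esub> w \<in> carrier (K0 K A M)" by (intro module_ops(2)[OF AR.mK0] relZ0_K0 z w)
  have "xclass z \<oplus>\<^bsub>XExt K A B M \<rho>'\<^esub> xclass w = the_elem ((\<lambda>(e, e'). xcl K A B M \<rho>' (xadd M e e')) ` (xclass z \<times> xclass w))"
    unfolding XExt_def by (auto intro!: arg_cong[where f=the_elem])
  also have "\<dots> = xclass (z \<oplus>\<^bsub>K0 K A M\<^esub> w)"
  proof (rule the_elem_image)
    show "(xtwist z, xtwist w) \<in> xclass z \<times> xclass w" using xtwist_in_class z w by simp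
    fix y assume "y \<in> xclass z \<times> xclass w"
    then obtain e e' where y: "y = (e, e')" and e: "e \<in> xclass z" "e' \<in> xclass w" by blast
    obtain \<phi> \<phi>' where *: "crossed_extension K A B M \<rho>' e" "crossed_extension K A B M \<rho>' e'"
        "xiso K A M (xtwist z) e \<phi>" "xiso K A M (xtwist w) e' \<phi>'"
      using e by (auto simp: xclass_mem z w)
    obtain \<psi> where "xiso K A M (xtwist (z \<oplus>\<^bsub>K0 K A M\<^esub> w)) (xadd M e e') \<psi>"
      using xadd_iso[OF relZ0_K0[OF z] relZ0_K0[OF w] *] by blast
    then show "(\<lambda>(e, e'). xcl K A B M \<rho>' (xadd M e e')) y = xclass (z \<oplus>\<^bsub>K0 K A M\<^esub> w)"
      using xcl_iso[OF zw] by (simp add: y)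
  qed
  finally show "xclass z \<oplus>\<^bsub>XExt K A B M \<rho>'\<^esub> xclass w = xclass (z \<oplus>\<^bsub>K0 K A M\<^esub> w)" .
next
  fix k z assume k: "k \<in> carrier K" and z: "z \<in> relZ0"
  have kz: "k \<odot>\<^bsub>K0 K A M\<^esub> z \<in> carrier (K0 K A M)" by (intro module_ops(5)[OF AR.mK0] relZ0_K0 z k)
  have "k \<odot>\<^bsub>XExt K A B M \<rho>'\<^esub> xclass z = the_elem ((\<lambda>e. xcl K A B M \<rho>' (xsmult M \<rho>' k e)) ` xclass z)"
    unfolding XExt_def by (auto intro!: arg_cong[where f=the_elem])
  also have "\<dots> = xclass (k \<odot>\<^bsub>K0 K A M\<^esub> z)"
  proof (rule the_elem_image[OF xtwist_in_class[OF z]])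
    fix e assume e: "e \<in> xclass z"
    obtain \<phi> where *: "crossed_extension K A B M \<rho>' e" "xiso K A M (xtwist z) e \<phi>"
      using e by (auto simp: xclass_mem z)
    obtain \<psi> where "xiso K A M (xtwist (k \<odot>\<^bsub>K0 K A M\<^esub> z)) (xsmult M \<rho>' k e) \<psi>"
      using xsmult_iso[OF relZ0_K0[OF z] k *] by blast
    then show "xcl K A B M \<rho>' (xsmult M \<rho>' k e) = xclass (k \<odot>\<^bsub>K0 K A M\<^esub> z)"
      by (rule xcl_iso[OF kz])
  qed
  finally show "k \<odot>\<^bsub>XExt K A B M \<rho>'\<^esub> xclass z = xclass (k \<odot>\<^bsub>K0 K A M\<^esub> z)" .
next
  show "\<zero>\<^bsub>XExt K A B M \<rho>'\<^esub> = xclass \<zero>\<^bsub>K0 K A M\<^esub>"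
    using xcl_iso[OF module_ops(1)[OF AR.mK0] xzero_iso] by (simp add: XExt_def)
qed

lemma mrelZ0: "module K ((K0 K A M)\<lparr>carrier := relZ0\<rparr>)"
  by (rule submodule.submodule_is_module[OF relZ0_sub AR.mK0])

lemma mXExt: "module K (XExt K A B M \<rho>')"
  by (rule module_image[OF mrelZ0, of _ xclass]) (simp_all add: XExt_carrier XExt_ops)

text \<open>For any representative and any sections \<open>gamma_z0\<close> gives the deflated
  coboundary of the cochain \<open>z0\<close> extracted from them. That cochain differs from
  \<open>z\<close> by a coboundary, which is killed, and by an inflated cochain, which contributes a
  coboundary on \<open>Q\<close>.\<close>

lemma gamma_val:
  assumes z: "z \<in> relZ0"
  shows "map_gamma K A B Q M \<rho> \<tau> (xclass z) = class2 K Q M \<rho> (defl3 (d0 A M \<rho>' z))"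
proof -
  let ?P = "\<lambda>(e, s, \<sigma>). e \<in> xclass z \<and> lin_section K A \<tau> Q s \<and> lin_section K (xobj e) (xproj e) BA \<sigma>"
  let ?f = "\<lambda>(e, s, \<sigma>). class2 K Q M \<rho> (gamma_cocycle A Q M e s \<sigma>)"
  have c: "defl3 (d0 A M \<rho>' z) \<in> carrier (K1 K Q M)" "infl3 (defl3 (d0 A M \<rho>' z)) = d0 A M \<rho>' z"
    using defl3_d0[OF z] by (auto simp: QR.cocycles1_iff)
  have "map_gamma K A B Q M \<rho> \<tau> (xclass z) = the_elem {?f y | y. ?P y}"
    unfolding map_gamma_def by (auto intro!: arg_cong[where f=the_elem])
  also have "\<dots> = class2 K Q M \<rho> (defl3 (d0 A M \<rho>' z))"
  proof -
    obtain s where s: "lin_section K A \<tau> Q s" by (rule section_exists)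
    \<comment> \<open>The model has an obvious section of its projection, so at least one admissible
      triple of choices exists.\<close>
    have "lin_section K (xobj (xtwist z)) (xproj (xtwist z)) BA (\<lambda>b. (\<zero>\<^bsub>M\<^esub>, b))"
      by (auto simp: lin_section_def xtwist_simps intro!: lin_mapI)
    then have ex: "?P (xtwist z, s, \<lambda>b. (\<zero>\<^bsub>M\<^esub>, b))" using s xtwist_in_class[OF z] by simp
    show ?thesis
    proof (rule the_elem_Collect[where P="?P", OF ex])
      fix y assume "?P y"
      then obtain e s \<sigma> where y: "y = (e, s, \<sigma>)" and e: "e \<in> xclass z" and s: "lin_section K A \<tau> Q s"
        and sg: "lin_section K (xobj e) (xproj e) BA \<sigma>" by (cases y) auto
      from e obtain \<phi> where cr: "crossed_extension K A B M \<rho>' e" and iso: "xiso K A M (xtwist z) e \<phi>" by (auto simp: xclass_mem z)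
      interpret xsec K A B Q \<tau> M \<rho> s e \<sigma>
        by (intro xsec.intro setting_sec.intro setting_sec_axioms.intro xsec_axioms.intro setting_axioms xextI cr s sg)
      have "xclass z = xclass z0" using xcl_iso[OF relZ0_K0[OF z] iso] xcl_iso[OF z0_K0 psi_iso] by simp
      then obtain h b where h: "h \<in> carrier (Km1 K A M)" and b: "b \<in> carrier (K0 K Q M)"
        and e: "z0 = dm1 A M \<rho>' h \<oplus>\<^bsub>K0 K A M\<^esub> (infl2 b \<oplus>\<^bsub>K0 K A M\<^esub> z)" using xclass_eq_iff[OF z z0_relZ0] by blast
      have "d0 A M \<rho>' z0 = infl3 (d0 Q M \<rho> b \<oplus>\<^bsub>K1 K Q M\<^esub> defl3 (d0 A M \<rho>' z))"
        using h b z by (simp add: e lin_mapD[OF AR.d0_lin] AR.dm1_K0 infl2_K0 relZ0_K0 module_ops[OF AR.mK0] AR.d0_dm1 infl_d0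
          infl3_rules c QR.d0_K1 infl3_K1 AR.d0_K1 module_ops[OF AR.mK1])
      then have g: "gamma_cocycle A Q M e s \<sigma> = d0 Q M \<rho> b \<oplus>\<^bsub>K1 K Q M\<^esub> defl3 (d0 A M \<rho>' z)"
        unfolding gamma_z0 by (intro defl3_eq module_ops(2)[OF QR.mK1] QR.d0_K1 b c) simp
      show "?f y = class2 K Q M \<rho> (defl3 (d0 A M \<rho>' z))"
        using QR.class2_eq_iff[OF module_ops(2)[OF QR.mK1 QR.d0_K1[OF b] c(1)] c(1)] b by (auto simp: y g)
    qed
  qed
  finally show ?thesis .
qed

end

section \<open>Abelian extensions\<close>

locale aext = setting K A B Q \<tau> M \<rho>
  for K :: "'k ring"
    and A :: "('k, 'a) awb" and B :: "'a set" and Q :: "('k, 'q) awb" and \<tau> :: "'a \<Rightarrow> 'q"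
    and M :: "('k, 'm) module" and \<rho> :: "('q, 'm) action" +
  fixes E :: "('k, 'm, 'e, 'a) extension"
  assumes ext: "abelian_extension K A M (rep_along \<tau> \<rho>) E"
begin

abbreviation Y where "Y \<equiv> ext_obj E"
abbreviation p where "p \<equiv> ext_proj E"
abbreviation i where "i \<equiv> ext_inc E"

lemma awbY: "AWB K Y" and mY: "module K Y"
  using ext by (auto simp: abelian_extension_def short_exact_def AWB_def)

lemma agY: "abelian_group Y"
  by (rule module_ag[OF mY])

lemma i_lin: "lin_map K M Y i"
  using ext by (simp add: abelian_extension_def short_exact_def awb_hom_def lin_map_def abelian_awb_simps)

lemma i_inj: "inj_on i (carrier M)"
  using ext by (simp add: abelian_extension_def short_exact_def abelian_awb_simps)

lemma i_image: "i ` carrier M = {c\<in>carrier Y. p c = \<zero>\<^bsub>A\<^esub>}"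
  using ext by (simp add: abelian_extension_def short_exact_def abelian_awb_simps a_kernel_def')

lemma p_lin: "lin_map K Y A p" and p_mult [simp]: "x \<in> carrier Y \<Longrightarrow> y \<in> carrier Y \<Longrightarrow> p (x \<otimes>\<^bsub>Y\<^esub> y) = p x \<otimes>\<^bsub>A\<^esub> p y"
  and p_brk [simp]: "x \<in> carrier Y \<Longrightarrow> y \<in> carrier Y \<Longrightarrow> p (brk Y x y) = brk A (p x) (p y)"
  and p_image: "p ` carrier Y = carrier A"
  using ext by (auto simp: abelian_extension_def short_exact_def awb_hom_def)

lemmas Y_bils = AWB.mult_bilin[OF awbY] AWB.brk_bilin[OF awbY]
lemmas [simp] = lin_map_rules[OF mM mY i_lin] lin_map_rules[OF mY mA p_lin]
  bilin_rules[OF mY mY mY Y_bils(1)] bilin_rules[OF mY mY mY Y_bils(2)] module_ops[OF mY]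

lemma p_i [simp]: "m \<in> carrier M \<Longrightarrow> p (i m) = \<zero>\<^bsub>A\<^esub>"
  using i_image by auto

lemma i_eq_iff [simp]: "m \<in> carrier M \<Longrightarrow> m' \<in> carrier M \<Longrightarrow> i m = i m' \<longleftrightarrow> m = m'"
  using i_inj by (auto simp: inj_on_def)

lemma Y_act:
  assumes "x \<in> carrier Y" "m \<in> carrier M"
  shows "x \<otimes>\<^bsub>Y\<^esub> i m = i (lact \<rho>' (p x) m)" "i m \<otimes>\<^bsub>Y\<^esub> x = i (ract \<rho>' m (p x))"
    "brk Y x (i m) = i (lbr \<rho>' (p x) m)" "brk Y (i m) x = i (rbr \<rho>' m (p x))"
  using ext assms by (auto simp: abelian_extension_def)

definition j where "j = inv_into (carrier M) i"

lemma j_i [simp]: "m \<in> carrier M \<Longrightarrow> j (i m) = m"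
  using i_inj by (simp add: j_def)

lemma i_j [simp]: "c \<in> carrier Y \<Longrightarrow> p c = \<zero>\<^bsub>A\<^esub> \<Longrightarrow> i (j c) = c"
  unfolding j_def by (rule f_inv_into_f) (simp add: i_image)

lemma j_M [simp]: "c \<in> carrier Y \<Longrightarrow> p c = \<zero>\<^bsub>A\<^esub> \<Longrightarrow> j c \<in> carrier M"
  unfolding j_def by (rule inv_into_into) (simp add: i_image)

lemma j_eqI: "m \<in> carrier M \<Longrightarrow> i m = c \<Longrightarrow> j c = m"
  by auto

lemma j_lin:
  assumes V: "module K V" and g: "lin_map K V Y g" and z: "\<And>v. v \<in> carrier V \<Longrightarrow> p (g v) = \<zero>\<^bsub>A\<^esub>"
  shows "lin_map K V M (\<lambda>v. j (g v))"
proof -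
  note [simp] = lin_map_rules[OF V mY g] z
  show ?thesis by (rule lin_mapI) (auto intro!: j_eqI)
qed

definition fset where "fset t = factor_set A Y t j"

lemmas feq = abelian_group.formal_eq[OF agY]
lemmas fop = abelian_group.formal_op[OF agY]
lemmas fatom = abelian_group.formal_atom[OF agY]

context
  fixes t assumes t: "lin_section K Y p A t"
begin

lemma t_lin: "lin_map K A Y t" and p_t: "a \<in> carrier A \<Longrightarrow> p (t a) = a"
  using t by (auto simp: lin_section_def)

lemmas t_rules = lin_map_rules[OF mA mY t_lin] p_t

lemma fset_K0: "fset t \<in> carrier (K0 K A M)"
proof -
  note [simp] = t_rules
  show ?thesis
    unfolding fset_def factor_set_def AR.K0_iff bilin_map_restrict[OF mA mA]
    by (auto intro!: bilin_mapI j_lin[OF mA] lin_map_minus[OF mY] t_lin lin_map_comp[OF t_lin]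
      bilin_comp_l[OF Y_bils(1)] bilin_comp_r[OF Y_bils(1)] bilin_comp_l[OF Y_bils(2)] bilin_comp_r[OF Y_bils(2)]
      bilin_comp_l[OF AR.bils(5)] bilin_comp_r[OF AR.bils(5)] bilin_comp_l[OF AR.bils(6)] bilin_comp_r[OF AR.bils(6)] lin_map_id)
qed

lemma tt:
  assumes [simp]: "a \<in> carrier A" "b \<in> carrier A"
  shows "t a \<otimes>\<^bsub>Y\<^esub> t b = t (a \<otimes>\<^bsub>A\<^esub> b) \<oplus>\<^bsub>Y\<^esub> i (fst (fset t) a b)"
    "brk Y (t a) (t b) = t (brk A a b) \<oplus>\<^bsub>Y\<^esub> i (snd (fset t) a b)"
  by (simp_all add: fset_def factor_set_def t_rules abelian_group.add_minus_cancel[OF agY])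

lemma fset_eqI:
  assumes z: "z \<in> carrier (K0 K A M)"
    and e: "\<And>a b. a \<in> carrier A \<Longrightarrow> b \<in> carrier A \<Longrightarrow> t a \<otimes>\<^bsub>Y\<^esub> t b = t (a \<otimes>\<^bsub>A\<^esub> b) \<oplus>\<^bsub>Y\<^esub> i (fst z a b)"
     "\<And>a b. a \<in> carrier A \<Longrightarrow> b \<in> carrier A \<Longrightarrow> brk Y (t a) (t b) = t (brk A a b) \<oplus>\<^bsub>Y\<^esub> i (snd z a b)"
  shows "fset t = z"
proof (rule AR.K0_eqI[OF fset_K0 z])
  fix a b assume [simp]: "a \<in> carrier A" "b \<in> carrier A"
  note [simp] = AR.K0_rules(1)[OF z] AR.K0_rules(12)[OF z] t_rules
  have *: "x \<oplus>\<^bsub>Y\<^esub> y \<ominus>\<^bsub>Y\<^esub> x = y" if [simp]: "x \<in> carrier Y" "y \<in> carrier Y" for x y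
    by (rule feq, (rule fop | (rule fatom, (simp; fail)))+, simp)
  show "fst (fset t) a b = fst z a b" "snd (fset t) a b = snd z a b"
    by (simp_all add: fset_def factor_set_def e *)
qed

end

text \<open>Expanding products and brackets of lifts once through \<open>t\<close> and once through
  \<open>t'\<close> shows that the factor sets differ by the coboundary of the difference of the
  sections.\<close>

lemma fset_indep:
  assumes t: "lin_section K Y p A t" and t': "lin_section K Y p A t'"
  shows "class1 K A M \<rho>' (fset t') = class1 K A M \<rho>' (fset t)"
proof -
  note [simp] = t_rules[OF t] t_rules[OF t'] AR.K0_rules[OF fset_K0[OF t]] AR.K0_rules[OF fset_K0[OF t']]
  define u where "u = (\<lambda>a\<in>carrier A. j (t a \<ominus>\<^bsub>Y\<^esub> t' a))"
  have u: "u \<in> carrier (Km1 K A M)" unfolding u_def AR.Km1_iff lin_map_restrict[OF mA]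
    by (auto intro!: j_lin[OF mA] lin_map_minus[OF mY] t_lin[OF t] t_lin[OF t'])
  then have "lin_map K A M u" by (simp add: AR.Km1_iff)
  note [simp] = lin_map_rules[OF mA mM this]
  have ta: "t a = i (u a) \<oplus>\<^bsub>Y\<^esub> t' a" if "a \<in> carrier A" for a
    using that abelian_group.eq_add_minus[OF agY, of "t a" "t' a"] by (simp add: u_def)
  let ?z = "dm1 A M \<rho>' u \<oplus>\<^bsub>K0 K A M\<^esub> fset t"
  have z: "?z \<in> carrier (K0 K A M)" by (intro module_ops(2)[OF AR.mK0] AR.dm1_K0 u fset_K0 t)
  have "fset t' = ?z"
  proof (rule AR.K0_eqI[OF fset_K0[OF t'] z])
    fix a b assume [simp]: "a \<in> carrier A" "b \<in> carrier A"
    have "t (a \<otimes>\<^bsub>A\<^esub> b) \<oplus>\<^bsub>Y\<^esub> i (fst (fset t) a b) = t a \<otimes>\<^bsub>Y\<^esub> t b" by (simp add: tt[OF t])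
    also have "\<dots> = i (lact \<rho>' a (u b)) \<oplus>\<^bsub>Y\<^esub> i (ract \<rho>' (u a) b) \<oplus>\<^bsub>Y\<^esub> (t' (a \<otimes>\<^bsub>A\<^esub> b) \<oplus>\<^bsub>Y\<^esub> i (fst (fset t') a b))"
      by (simp add: ta Y_act tt[OF t'])
        (rule feq, (rule fop | (rule fatom, (simp; fail)))+, simp add: algebra_simps)
    finally have 1: "i (u (a \<otimes>\<^bsub>A\<^esub> b)) \<oplus>\<^bsub>Y\<^esub> t' (a \<otimes>\<^bsub>A\<^esub> b) \<oplus>\<^bsub>Y\<^esub> i (fst (fset t) a b)
      = i (lact \<rho>' a (u b)) \<oplus>\<^bsub>Y\<^esub> i (ract \<rho>' (u a) b) \<oplus>\<^bsub>Y\<^esub> (t' (a \<otimes>\<^bsub>A\<^esub> b) \<oplus>\<^bsub>Y\<^esub> i (fst (fset t') a b))"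
      by (simp add: ta)
    have "t (brk A a b) \<oplus>\<^bsub>Y\<^esub> i (snd (fset t) a b) = brk Y (t a) (t b)" by (simp add: tt[OF t])
    also have "\<dots> = i (lbr \<rho>' a (u b)) \<oplus>\<^bsub>Y\<^esub> i (rbr \<rho>' (u a) b) \<oplus>\<^bsub>Y\<^esub> (t' (brk A a b) \<oplus>\<^bsub>Y\<^esub> i (snd (fset t') a b))"
      by (simp add: ta Y_act tt[OF t'])
        (rule feq, (rule fop | (rule fatom, (simp; fail)))+, simp add: algebra_simps)
    finally have 2: "i (u (brk A a b)) \<oplus>\<^bsub>Y\<^esub> t' (brk A a b) \<oplus>\<^bsub>Y\<^esub> i (snd (fset t) a b)
      = i (lbr \<rho>' a (u b)) \<oplus>\<^bsub>Y\<^esub> i (rbr \<rho>' (u a) b) \<oplus>\<^bsub>Y\<^esub> (t' (brk A a b) \<oplus>\<^bsub>Y\<^esub> i (snd (fset t') a b))"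
      by (simp add: ta)
    \<comment> \<open>Solves either comparison for the value of \<open>fset t'\<close>; the order of
      terms on the right is that of \<open>dm1_val\<close> followed by
      \<open>fset t\<close>.\<close>
    have key: "w = \<ominus>\<^bsub>Y\<^esub> x \<oplus>\<^bsub>Y\<^esub> k \<ominus>\<^bsub>Y\<^esub> y \<oplus>\<^bsub>Y\<^esub> l"
      if e: "k \<oplus>\<^bsub>Y\<^esub> r \<oplus>\<^bsub>Y\<^esub> l = x \<oplus>\<^bsub>Y\<^esub> y \<oplus>\<^bsub>Y\<^esub> (r \<oplus>\<^bsub>Y\<^esub> w)"
        and [simp]: "x \<in> carrier Y" "y \<in> carrier Y" "k \<in> carrier Y" "l \<in> carrier Y" "r \<in> carrier Y" "w \<in> carrier Y" for x y k l r w
    proof -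
      have "w = x \<oplus>\<^bsub>Y\<^esub> y \<oplus>\<^bsub>Y\<^esub> (r \<oplus>\<^bsub>Y\<^esub> w) \<ominus>\<^bsub>Y\<^esub> r \<ominus>\<^bsub>Y\<^esub> x \<ominus>\<^bsub>Y\<^esub> y"
        by (rule feq, (rule fop | (rule fatom, (simp; fail)))+, simp add: algebra_simps)
      also have "\<dots> = \<ominus>\<^bsub>Y\<^esub> x \<oplus>\<^bsub>Y\<^esub> k \<ominus>\<^bsub>Y\<^esub> y \<oplus>\<^bsub>Y\<^esub> l"
        unfolding e[symmetric] by (rule feq, (rule fop | (rule fatom, (simp; fail)))+, simp add: algebra_simps)
      finally show ?thesis .
    qed
    have "i (fst (fset t') a b) = i (fst ?z a b)"
      using key[OF 1] by (simp add: AR.K0_add AR.dm1_val)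
    then show "fst (fset t') a b = fst ?z a b" by (subst (asm) i_eq_iff) (simp_all add: AR.K0_rules(1)[OF z])
    have "i (snd (fset t') a b) = i (snd ?z a b)"
      using key[OF 2] by (simp add: AR.K0_add AR.dm1_val)
    then show "snd (fset t') a b = snd ?z a b" by (subst (asm) i_eq_iff) (simp_all add: AR.K0_rules(12)[OF z])
  qed
  then show ?thesis using AR.class1_eq_iff[OF fset_K0[OF t'] fset_K0[OF t]] u by auto
qed

lemma ext_class: assumes t: "lin_section K Y p A t"
  shows "extension_class K A M \<rho>' E = class1 K A M \<rho>' (fset t)"
  unfolding extension_class_def j_def[symmetric] fset_def[symmetric]
  by (rule the_elem_Collect[where P="lin_section K Y p A", OF t]) (rule fset_indep[OF t])

text \<open>The linear splitting given by \<open>t\<close>, restricted to elements over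
  \<open>B\<close>, identifies the fibre product with the model of the factor set. The model uses
  its values on \<open>A\<close> times \<open>B\<close> and \<open>B\<close> times \<open>A\<close>
  only, although the factor set comes from all of \<open>A\<close>.\<close>

lemma pullback_iso:
  assumes t: "lin_section K Y p A t"
  shows "xiso K A M (xtwist (fset t)) (pullback_xext A B E) (\<lambda>(m, b). (i m \<oplus>\<^bsub>Y\<^esub> t b, b))" (is "xiso _ _ _ ?x ?e ?\<psi>")
proof -
  interpret agY: abelian_group Y by (rule agY)
  note [simp] = t_rules[OF t] AR.K0_rules[OF fset_K0[OF t]] B_closed B_in B_act xtwist_simps
  have car: "carrier (xobj ?e) = {(y, b). y \<in> carrier Y \<and> b \<in> B \<and> p y = b}"
    by (simp add: pullback_xext_def fibre_prod_def Let_def)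
  define lift where "lift = inv_into (carrier Y) p"
  have lift [simp]: "lift a \<in> carrier Y" "p (lift a) = a" if "a \<in> carrier A" for a
    using that unfolding lift_def p_image[symmetric] by (auto intro: inv_into_into f_inv_into_f)
  have ops: "(y, b) \<oplus>\<^bsub>xobj ?e\<^esub> (y', b') = (y \<oplus>\<^bsub>Y\<^esub> y', b \<oplus>\<^bsub>A\<^esub> b')" "(y, b) \<otimes>\<^bsub>xobj ?e\<^esub> (y', b') = (y \<otimes>\<^bsub>Y\<^esub> y', b \<otimes>\<^bsub>A\<^esub> b')"
    "brk (xobj ?e) (y, b) (y', b') = (brk Y y y', brk A b b')" "k \<odot>\<^bsub>xobj ?e\<^esub> (y, b) = (k \<odot>\<^bsub>Y\<^esub> y, k \<odot>\<^bsub>A\<^esub> b)"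
    "lact (xact ?e) a (y, b) = (lift a \<otimes>\<^bsub>Y\<^esub> y, a \<otimes>\<^bsub>A\<^esub> b)" "lbr (xact ?e) a (y, b) = (brk Y (lift a) y, brk A a b)"
    "ract (xact ?e) (y, b) a = (y \<otimes>\<^bsub>Y\<^esub> lift a, b \<otimes>\<^bsub>A\<^esub> a)" "rbr (xact ?e) (y, b) a = (brk Y y (lift a), brk A b a)"
    "xproj ?e = snd" "xinc ?e m = (i m, \<zero>\<^bsub>A\<^esub>)" for y b y' b' k a m
    by (simp_all add: pullback_xext_def fibre_prod_def Let_def awb_prod_def lift_def)
  \<comment> \<open>The preimage fixed in \<open>pullback_xext\<close> differs from
    \<open>t a\<close> by an element of \<open>M\<close>. Its products and brackets with elements
    over \<open>B\<close> vanish, so \<open>lift\<close> may be replaced by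
    \<open>t\<close>.\<close>
  have lt: "lift a \<otimes>\<^bsub>Y\<^esub> t b = t (a \<otimes>\<^bsub>A\<^esub> b) \<oplus>\<^bsub>Y\<^esub> i (fst (fset t) a b)" "t b \<otimes>\<^bsub>Y\<^esub> lift a = t (b \<otimes>\<^bsub>A\<^esub> a) \<oplus>\<^bsub>Y\<^esub> i (fst (fset t) b a)"
    "brk Y (lift a) (t b) = t (brk A a b) \<oplus>\<^bsub>Y\<^esub> i (snd (fset t) a b)" "brk Y (t b) (lift a) = t (brk A b a) \<oplus>\<^bsub>Y\<^esub> i (snd (fset t) b a)"
    if [simp]: "a \<in> carrier A" "b \<in> B" for a b
  proof -
    define n where "n = j (lift a \<ominus>\<^bsub>Y\<^esub> t a)"
    have n [simp]: "n \<in> carrier M" by (simp add: n_def)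
    have l: "lift a = i n \<oplus>\<^bsub>Y\<^esub> t a" using agY.eq_add_minus[of "lift a" "t a"] by (simp add: n_def)
    show "lift a \<otimes>\<^bsub>Y\<^esub> t b = t (a \<otimes>\<^bsub>A\<^esub> b) \<oplus>\<^bsub>Y\<^esub> i (fst (fset t) a b)" "t b \<otimes>\<^bsub>Y\<^esub> lift a = t (b \<otimes>\<^bsub>A\<^esub> a) \<oplus>\<^bsub>Y\<^esub> i (fst (fset t) b a)"
    "brk Y (lift a) (t b) = t (brk A a b) \<oplus>\<^bsub>Y\<^esub> i (snd (fset t) a b)" "brk Y (t b) (lift a) = t (brk A b a) \<oplus>\<^bsub>Y\<^esub> i (snd (fset t) b a)"
      by (simp_all add: l Y_act tt[OF t])
  qed
  have bij: "bij_betw ?\<psi> (carrier (xobj ?x)) (carrier (xobj ?e))"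
    unfolding bij_betw_def car
  proof
    show "inj_on ?\<psi> (carrier (xobj ?x))" by (auto simp: inj_on_def)
    show "?\<psi> ` carrier (xobj ?x) = {(y, b). y \<in> carrier Y \<and> b \<in> B \<and> p y = b}"
    proof (intro equalityI subsetI)
      fix c assume "c \<in> {(y, b). y \<in> carrier Y \<and> b \<in> B \<and> p y = b}"
      then obtain y b where c: "c = (y, b)" and y [simp]: "y \<in> carrier Y" "b \<in> B" "p y = b" by blast
      show "c \<in> ?\<psi> ` carrier (xobj ?x)"
        by (rule image_eqI[of _ _ "(j (y \<ominus>\<^bsub>Y\<^esub> t b), b)"])
          (use agY.eq_add_minus[of y "t b"] in \<open>simp_all add: c\<close>)
    qed auto
  qed
  show ?thesis
    unfolding xiso_def
  proof (intro conjI ballI bij)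
    fix x assume "x \<in> carrier (xobj ?x)"
    then obtain m b where x: "x = (m, b)" and [simp]: "m \<in> carrier M" "b \<in> B" by auto
    { fix y assume "y \<in> carrier (xobj ?x)"
      then obtain m' b' where y: "y = (m', b')" and [simp]: "m' \<in> carrier M" "b' \<in> B" by auto
      show "?\<psi> (x \<oplus>\<^bsub>xobj ?x\<^esub> y) = ?\<psi> x \<oplus>\<^bsub>xobj ?e\<^esub> ?\<psi> y" by (simp add: x y ops agY.a_ac)
      show "?\<psi> (x \<otimes>\<^bsub>xobj ?x\<^esub> y) = ?\<psi> x \<otimes>\<^bsub>xobj ?e\<^esub> ?\<psi> y" by (simp add: x y ops Y_act tt[OF t] agY.a_ac)
      show "?\<psi> (brk (xobj ?x) x y) = brk (xobj ?e) (?\<psi> x) (?\<psi> y)" by (simp add: x y ops Y_act tt[OF t] agY.a_ac) }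
    { fix k assume "k \<in> carrier K"
      then show "?\<psi> (k \<odot>\<^bsub>xobj ?x\<^esub> x) = k \<odot>\<^bsub>xobj ?e\<^esub> ?\<psi> x" by (simp add: x ops) }
    { fix a assume [simp]: "a \<in> carrier A"
      show "?\<psi> (lact (xact ?x) a x) = lact (xact ?e) a (?\<psi> x)" "?\<psi> (ract (xact ?x) x a) = ract (xact ?e) (?\<psi> x) a"
        "?\<psi> (lbr (xact ?x) a x) = lbr (xact ?e) a (?\<psi> x)" "?\<psi> (rbr (xact ?x) x a) = rbr (xact ?e) (?\<psi> x) a"
        by (simp_all add: x ops Y_act lt agY.a_ac) }
    show "xproj ?e (?\<psi> x) = xproj ?x x" by (simp add: x ops)
  next
    fix m assume "m \<in> carrier M"
    then show "?\<psi> (xinc ?x m) = xinc ?e m" by (simp add: ops)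
  qed
qed

end

section \<open>Abelian extensions realised by cocycles, and the map \<open>r\<close>\<close>

context setting
begin

text \<open>The semidirect product of \<open>A\<close> with \<open>M\<close>, deformed by the
  cochain \<open>z\<close>. Unlike in \<open>xtwist\<close>, the action terms stay in product and
  bracket, since \<open>A\<close> itself acts on \<open>M\<close>.\<close>

definition etwist_awb :: "('a, 'm) cochain0 \<Rightarrow> ('k, 'm \<times> 'a) awb" where
  "etwist_awb z = (awb_prod (abelian_awb M) A)\<lparr>
     mult := (\<lambda>(m, a) (m', a'). (lact \<rho>' a m' \<oplus>\<^bsub>M\<^esub> ract \<rho>' m a' \<oplus>\<^bsub>M\<^esub> fst z a a', a \<otimes>\<^bsub>A\<^esub> a')),
     brk := (\<lambda>(m, a) (m', a'). (lbr \<rho>' a m' \<oplus>\<^bsub>M\<^esub> rbr \<rho>' m a' \<oplus>\<^bsub>M\<^esub> snd z a a', brk A a a'))\<rparr>"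

lemma etwist_awb_simps:
  "carrier (etwist_awb z) = carrier M \<times> carrier A"
  "(m, a) \<otimes>\<^bsub>etwist_awb z\<^esub> (m', a') = (lact \<rho>' a m' \<oplus>\<^bsub>M\<^esub> ract \<rho>' m a' \<oplus>\<^bsub>M\<^esub> fst z a a', a \<otimes>\<^bsub>A\<^esub> a')"
  "brk (etwist_awb z) (m, a) (m', a') = (lbr \<rho>' a m' \<oplus>\<^bsub>M\<^esub> rbr \<rho>' m a' \<oplus>\<^bsub>M\<^esub> snd z a a', brk A a a')"
  "(m, a) \<oplus>\<^bsub>etwist_awb z\<^esub> (m', a') = (m \<oplus>\<^bsub>M\<^esub> m', a \<oplus>\<^bsub>A\<^esub> a')"
  "k \<odot>\<^bsub>etwist_awb z\<^esub> (m, a) = (k \<odot>\<^bsub>M\<^esub> m, k \<odot>\<^bsub>A\<^esub> a)"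
  "\<zero>\<^bsub>etwist_awb z\<^esub> = (\<zero>\<^bsub>M\<^esub>, \<zero>\<^bsub>A\<^esub>)"
  by (simp_all add: etwist_awb_def awb_prod_def abelian_awb_simps)

text \<open>The defect of associativity is the first component of the coboundary of
  \<open>z\<close>, read from left to right. The defect of the bracket rule is the second component
  with the opposite sign. Both vanish for a cocycle.\<close>

lemma AWB_etwist:
  assumes z: "z \<in> AR.Z1"
  shows "AWB K (etwist_awb z)"
proof -
  have zK: "z \<in> carrier (K0 K A M)" and d: "d0 A M \<rho>' z = \<zero>\<^bsub>K1 K A M\<^esub>" using z by (auto simp: AR.Z1_iff)
  note [simp] = AR.K0_rules[OF zK] etwist_awb_simps
  have m: "module K (etwist_awb z)"
    by (rule module_image[OF module_mod_prod[OF mM mA], of _ "\<lambda>x. x"]) (auto simp: mod_prod_simps)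
  have b: "bilin_map K (etwist_awb z) (etwist_awb z) (etwist_awb z) (mult (etwist_awb z))" "bilin_map K (etwist_awb z) (etwist_awb z) (etwist_awb z) (brk (etwist_awb z))"
    by (rule bilin_mapI; rule lin_mapI; clarsimp;
      rule AR.feq, (rule AR.fop | (rule AR.fatom, (simp; fail)))+, simp add: algebra_simps)+
  show ?thesis
    unfolding AWB_def AWB_axioms_def
  proof (intro conjI allI impI fK m b)
    fix x y w assume "x \<in> carrier (etwist_awb z)" "y \<in> carrier (etwist_awb z)" "w \<in> carrier (etwist_awb z)"
    then obtain m0 a0 m1 a1 m2 a2 where x: "x = (m0, a0)" "y = (m1, a1)" "w = (m2, a2)"
      and [simp]: "m0 \<in> carrier M" "m1 \<in> carrier M" "m2 \<in> carrier M" "a0 \<in> carrier A" "a1 \<in> carrier A" "a2 \<in> carrier A" by auto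
    have d1: "fst (d0 A M \<rho>' z) a0 a1 a2 = \<zero>\<^bsub>M\<^esub>" and d2: "snd (d0 A M \<rho>' z) a0 a1 a2 = \<zero>\<^bsub>M\<^esub>"
      by (simp_all add: d AR.K1_add)
    have zz: "u = v" if "u \<ominus>\<^bsub>M\<^esub> v = d" "d = \<zero>\<^bsub>M\<^esub>" "u \<in> carrier M" "v \<in> carrier M" for u v d
      using that abelian_group.minus_eq_zero[OF AR.agM] by simp
    show "x \<otimes>\<^bsub>etwist_awb z\<^esub> y \<otimes>\<^bsub>etwist_awb z\<^esub> w = x \<otimes>\<^bsub>etwist_awb z\<^esub> (y \<otimes>\<^bsub>etwist_awb z\<^esub> w)"
      by (simp add: x, rule zz[OF _ d1]; simp add: AR.d0_val)
        (rule AR.feq, (rule AR.fop | (rule AR.fatom, (simp; fail)))+, simp add: algebra_simps)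
    show "brk (etwist_awb z) (x \<otimes>\<^bsub>etwist_awb z\<^esub> y) w = brk (etwist_awb z) x w \<otimes>\<^bsub>etwist_awb z\<^esub> y \<oplus>\<^bsub>etwist_awb z\<^esub> x \<otimes>\<^bsub>etwist_awb z\<^esub> brk (etwist_awb z) y w"
      by (simp add: x, rule sym, rule zz[OF _ d2]; simp add: AR.d0_val)
        (rule AR.feq, (rule AR.fop | (rule AR.fatom, (simp; fail)))+, simp add: algebra_simps)
  qed
qed

definition etwist :: "('a, 'm) cochain0 \<Rightarrow> ('k, 'm, 'm \<times> 'a, 'a) extension" where
  "etwist z = \<lparr>ext_obj = etwist_awb z, ext_inc = (\<lambda>m. (m, \<zero>\<^bsub>A\<^esub>)), ext_proj = snd\<rparr>"

lemma etwist_ext: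
  assumes z: "z \<in> AR.Z1"
  shows "abelian_extension K A M \<rho>' (etwist z)"
proof -
  have zK: "z \<in> carrier (K0 K A M)" using z by (auto simp: AR.Z1_iff)
  note [simp] = AR.K0_rules[OF zK] etwist_awb_simps
  have ne: "carrier M \<noteq> {}" using module_ops(1)[OF mM] by blast
  show ?thesis
    unfolding abelian_extension_def short_exact_def etwist_def
    using AWB_etwist[OF z] abelian_awb_AWB awbA ne
    by (auto simp: abelian_awb_simps awb_hom_def lin_map_def inj_on_def a_kernel_def' image_iff)
qed

text \<open>The section with zero component in \<open>M\<close> has factor set exactly
  \<open>z\<close>; hence every class is realised by an extension.\<close>

lemma etwist_class:
  assumes z: "z \<in> AR.Z1"
  shows "extension_class K A M \<rho>' (etwist z) = class1 K A M \<rho>' z"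
proof -
  have zK: "z \<in> carrier (K0 K A M)" using z by (auto simp: AR.Z1_iff)
  interpret E: aext K A B Q \<tau> M \<rho> "etwist z" by (intro aext.intro aext_axioms.intro setting_axioms etwist_ext z)
  let ?t = "\<lambda>a. (\<zero>\<^bsub>M\<^esub>, a)"
  have t: "lin_section K E.Y E.p A ?t" by (auto simp: lin_section_def etwist_def etwist_awb_simps intro!: lin_mapI)
  have "E.fset ?t = z"
    by (rule E.fset_eqI[OF t zK]) (simp_all add: etwist_def etwist_awb_simps AR.K0_rules[OF zK])
  then show ?thesis using E.ext_class[OF t] by simp
qed

lemma Z1_relZ0: "AR.Z1 \<subseteq> relZ0"
  by (auto simp: AR.Z1_iff relZ0_def vanishes3_def AR.K1_add B_in)

text \<open>For an extension in the given class, the pullback is isomorphic to the model of a factor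
  set cohomologous to \<open>z\<close>. Cohomologous cochains give the same \<open>xclass\<close>,
  so all choices of extension agree.\<close>

lemma r_val:
  assumes z: "z \<in> AR.Z1"
  shows "map_r K A B M \<rho>' (class1 K A M \<rho>' z) = xclass z"
proof -
  have zK: "z \<in> carrier (K0 K A M)" using z by (auto simp: AR.Z1_iff)
  let ?P = "\<lambda>E :: ('k, 'm, 'm \<times> 'a, 'a) extension. abelian_extension K A M \<rho>' E \<and> extension_class K A M \<rho>' E = class1 K A M \<rho>' z"
  show ?thesis
    unfolding map_r_def
  proof (rule the_elem_Collect[where P="?P"])
    show "?P (etwist z)" using etwist_ext etwist_class z by simp
    fix E assume E: "?P E"
    then interpret E: aext K A B Q \<tau> M \<rho> E by (intro aext.intro aext_axioms.intro setting_axioms) simp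
    obtain t where t: "lin_section K E.Y E.p A t"
      using lin_section_exists[OF fK E.mY mA E.p_lin E.p_image] .
    have fK: "E.fset t \<in> carrier (K0 K A M)" by (rule E.fset_K0[OF t])
    have "class1 K A M \<rho>' (E.fset t) = class1 K A M \<rho>' z" using E E.ext_class[OF t] by simp
    then obtain h where h: "h \<in> carrier (Km1 K A M)" and e: "E.fset t = dm1 A M \<rho>' h \<oplus>\<^bsub>K0 K A M\<^esub> z"
      using AR.class1_eq_iff[OF fK zK] by blast
    have "E.fset t \<in> AR.Z1"
      unfolding e by (rule submodule_rules(3)[OF AR.mK0 AR.Z1_sub _ z]) (simp add: AR.Z1_iff AR.d0_dm1 AR.dm1_K0 h)
    then have fZ: "E.fset t \<in> relZ0" using Z1_relZ0 by blast
    have "xclass z = xclass (E.fset t)"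
      unfolding xclass_eq_iff[OF subsetD[OF Z1_relZ0 z] fZ]
    proof (intro bexI[of _ h] bexI[of _ "\<zero>\<^bsub>K0 K Q M\<^esub>"])
      show "E.fset t = dm1 A M \<rho>' h \<oplus>\<^bsub>K0 K A M\<^esub> (infl2 \<zero>\<^bsub>K0 K Q M\<^esub> \<oplus>\<^bsub>K0 K A M\<^esub> z)"
        using zK by (simp add: e infl2_rules module_ops[OF AR.mK0])
    qed (use h module_ops(1)[OF QR.mK0] in auto)
    then show "xcl K A B M \<rho>' (pullback_xext A B E) = xclass z"
      using xcl_iso[OF fK E.pullback_iso[OF t]] by simp
  qed
qed

section \<open>Exactness\<close>

lemma H0A_relZm1: "carrier (H0 K A M \<rho>') \<subseteq> relZm1"
  by (auto simp: AR.H0_carrier relZm1_def vanishes2_def AR.K0_add B_in)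

lemma infl2_Z1: "z \<in> QR.Z1 \<Longrightarrow> infl2 z \<in> AR.Z1"
  by (simp add: QR.Z1_iff AR.Z1_iff infl2_K0 infl_d0 infl3_rules)

lemma infl2_Z1D: assumes "c \<in> carrier (K0 K Q M)" "infl2 c \<in> AR.Z1" shows "c \<in> QR.Z1"
proof -
  have "infl3 (d0 Q M \<rho> c) = infl3 \<zero>\<^bsub>K1 K Q M\<^esub>" using assms by (simp add: AR.Z1_iff infl_d0 infl3_rules)
  then show ?thesis
    using tau_inj(3)[THEN inj_onD] assms by (simp add: QR.Z1_iff QR.d0_K1 module_ops[OF QR.mK1])
qed

text \<open>Deflation inverts an injective linear map, so it suffices to exhibit a cochain on
  \<open>Q\<close> with the right inflation.\<close>

lemma defl2_add:
  assumes "h \<in> relZm1" "h' \<in> relZm1"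
  shows "defl2 (dm1 A M \<rho>' (h \<oplus>\<^bsub>Km1 K A M\<^esub> h')) = defl2 (dm1 A M \<rho>' h) \<oplus>\<^bsub>K0 K Q M\<^esub> defl2 (dm1 A M \<rho>' h')"
  using defl2_dm1[OF assms(1)] defl2_dm1[OF assms(2)] assms
  by (intro defl2_eq) (simp_all add: QR.Z1_iff infl2_rules lin_mapD[OF AR.dm1_lin] relZm1_def module_ops[OF QR.mK0])

lemma defl2_smult:
  assumes "k \<in> carrier K" "h \<in> relZm1"
  shows "defl2 (dm1 A M \<rho>' (k \<odot>\<^bsub>Km1 K A M\<^esub> h)) = k \<odot>\<^bsub>K0 K Q M\<^esub> defl2 (dm1 A M \<rho>' h)"
  using defl2_dm1[OF assms(2)] assms
  by (intro defl2_eq) (simp_all add: QR.Z1_iff infl2_rules lin_mapD[OF AR.dm1_lin] relZm1_def module_ops[OF QR.mK0])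

lemma defl3_add:
  assumes "z \<in> relZ0" "w \<in> relZ0"
  shows "defl3 (d0 A M \<rho>' (z \<oplus>\<^bsub>K0 K A M\<^esub> w)) = defl3 (d0 A M \<rho>' z) \<oplus>\<^bsub>K1 K Q M\<^esub> defl3 (d0 A M \<rho>' w)"
  using defl3_d0[OF assms(1)] defl3_d0[OF assms(2)] assms
  by (intro defl3_eq) (simp_all add: QR.cocycles1_iff infl3_rules lin_mapD[OF AR.d0_lin] relZ0_def module_ops[OF QR.mK1])

lemma defl3_smult:
  assumes "k \<in> carrier K" "z \<in> relZ0"
  shows "defl3 (d0 A M \<rho>' (k \<odot>\<^bsub>K0 K A M\<^esub> z)) = k \<odot>\<^bsub>K1 K Q M\<^esub> defl3 (d0 A M \<rho>' z)"
  using defl3_d0[OF assms(2)] assms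
  by (intro defl3_eq) (simp_all add: QR.cocycles1_iff infl3_rules lin_mapD[OF AR.d0_lin] relZ0_def module_ops[OF QR.mK1])

lemma H0_lin: "lin_map K (H0 K Q M \<rho>) (H0 K A M \<rho>') infl1"
proof (rule lin_mapI)
  show "infl1 x \<in> carrier (H0 K A M \<rho>')" if "x \<in> carrier (H0 K Q M \<rho>)" for x
    using that by (simp add: AR.H0_carrier QR.H0_carrier infl1_Km1 infl_dm1 infl2_rules)
qed (simp_all add: QR.H0_carrier, simp_all add: H0_def infl1_rules)

lemma restr_H0_lin: "lin_map K (H0 K A M \<rho>') (Hom_ab K A B M \<rho> \<tau>) (restr_ab K A B)"
  by (rule lin_mapI) (use H0A_relZm1 in \<open>auto simp: restr_Hom H0_def restr_ops[symmetric] subsetD\<close>)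

lemma connecting_lin: "lin_map K (Hom_ab K A B M \<rho> \<tau>) (H1 K Q M \<rho>) (connecting K A B Q M \<rho> \<tau>)"
proof (rule lin_map_image[OF mrelZm1, of _ "restr_ab K A B"])
  show "lin_map K ((Km1 K A M)\<lparr>carrier := relZm1\<rparr>) (H1 K Q M \<rho>) (\<lambda>h. connecting K A B Q M \<rho> \<tau> (restr_ab K A B h))"
    by (rule lin_mapI) (simp_all add: connecting_val defl2_dm1(1) QR.H1_carrier QR.H1_ops defl2_add defl2_smult
        submodule_rules(3,6)[OF AR.mKm1 relZm1_sub])
qed (simp_all add: restr_surj restr_ops)

lemma tau_H1_lin: "lin_map K (H1 K Q M \<rho>) (H1 K A M \<rho>') (tau_H1 K A M \<rho> \<tau>)"
proof (rule lin_map_image[OF QR.mZ1, of _ "class1 K Q M \<rho>"])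
  have K: "z \<in> carrier (K0 K Q M)" if "z \<in> QR.Z1" for z using that by (simp add: QR.Z1_iff)
  show "lin_map K ((K0 K Q M)\<lparr>carrier := QR.Z1\<rparr>) (H1 K A M \<rho>') (\<lambda>z. tau_H1 K A M \<rho> \<tau> (class1 K Q M \<rho> z))"
    by (rule lin_mapI) (simp_all add: tau_H1_class K infl2_Z1 AR.H1_carrier AR.H1_ops infl2_rules module_ops[OF QR.mK0])
qed (simp_all add: QR.H1_carrier QR.H1_ops)

lemma tau_H2_lin: "lin_map K (H2 K Q M \<rho>) (H2 K A M \<rho>') (tau_H2 K A M \<rho> \<tau>)"
proof (rule lin_map_image[OF QR.mcocycles1, of _ "class2 K Q M \<rho>"])
  have K: "z \<in> carrier (K1 K Q M)" if "z \<in> cocycles1 K Q M \<rho>" for z using that by (simp add: QR.cocycles1_iff)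
  show "lin_map K ((K1 K Q M)\<lparr>carrier := cocycles1 K Q M \<rho>\<rparr>) (H2 K A M \<rho>') (\<lambda>z. tau_H2 K A M \<rho> \<tau> (class2 K Q M \<rho> z))"
    by (rule lin_mapI) (simp_all add: tau_H2_class K infl3_cocycles1 AR.H2_carrier AR.H2_ops infl3_rules module_ops[OF QR.mK1])
qed (simp_all add: QR.H2_carrier QR.H2_ops)

text \<open>On representatives \<open>r\<close> is the inclusion of cocycles into
  \<open>relZ0\<close>; its linearity is the content of \<open>XExt_ops\<close>.\<close>

lemma r_lin: "lin_map K (H1 K A M \<rho>') (XExt K A B M \<rho>') (map_r K A B M \<rho>')"
proof (rule lin_map_image[OF AR.mZ1, of _ "class1 K A M \<rho>'"])
  show "lin_map K ((K0 K A M)\<lparr>carrier := AR.Z1\<rparr>) (XExt K A B M \<rho>') (\<lambda>z. map_r K A B M \<rho>' (class1 K A M \<rho>' z))"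
    by (rule lin_mapI) (simp_all add: r_val XExt_carrier XExt_ops subsetD[OF Z1_relZ0]
       submodule_rules(3,6)[OF AR.mK0 AR.Z1_sub])
qed (simp_all add: AR.H1_carrier AR.H1_ops)

lemma gamma_lin: "lin_map K (XExt K A B M \<rho>') (H2 K Q M \<rho>) (map_gamma K A B Q M \<rho> \<tau>)"
proof (rule lin_map_image[OF mrelZ0, of _ xclass])
  show "lin_map K ((K0 K A M)\<lparr>carrier := relZ0\<rparr>) (H2 K Q M \<rho>) (\<lambda>z. map_gamma K A B Q M \<rho> \<tau> (xclass z))"
    by (rule lin_mapI) (simp_all add: gamma_val defl3_d0(1) QR.H2_carrier QR.H2_ops defl3_add defl3_smult
       submodule_rules(3,6)[OF AR.mK0 relZ0_sub])
qed (simp_all add: XExt_carrier XExt_ops)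

lemma class1_zero_iff:
  "z \<in> AR.Z1 \<Longrightarrow> class1 K A M \<rho>' z = \<zero>\<^bsub>H1 K A M \<rho>'\<^esub> \<longleftrightarrow> (\<exists>h\<in>carrier (Km1 K A M). z = dm1 A M \<rho>' h)"
  "w \<in> QR.Z1 \<Longrightarrow> class1 K Q M \<rho> w = \<zero>\<^bsub>H1 K Q M \<rho>\<^esub> \<longleftrightarrow> (\<exists>h\<in>carrier (Km1 K Q M). w = dm1 Q M \<rho> h)"
  using AR.class1_eq_iff[of z "\<zero>\<^bsub>K0 K A M\<^esub>"] QR.class1_eq_iff[of w "\<zero>\<^bsub>K0 K Q M\<^esub>"]
  by (auto simp: AR.H1_ops QR.H1_ops AR.Z1_iff QR.Z1_iff AR.dm1_K0 QR.dm1_K0 module_ops[OF AR.mK0] module_ops[OF QR.mK0])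

lemma class2_zero_iff:
  "z \<in> cocycles1 K A M \<rho>' \<Longrightarrow> class2 K A M \<rho>' z = \<zero>\<^bsub>H2 K A M \<rho>'\<^esub> \<longleftrightarrow> (\<exists>h\<in>carrier (K0 K A M). z = d0 A M \<rho>' h)"
  "w \<in> cocycles1 K Q M \<rho> \<Longrightarrow> class2 K Q M \<rho> w = \<zero>\<^bsub>H2 K Q M \<rho>\<^esub> \<longleftrightarrow> (\<exists>h\<in>carrier (K0 K Q M). w = d0 Q M \<rho> h)"
  using AR.class2_eq_iff[of z "\<zero>\<^bsub>K1 K A M\<^esub>"] QR.class2_eq_iff[of w "\<zero>\<^bsub>K1 K Q M\<^esub>"]
  by (auto simp: AR.H2_ops QR.H2_ops AR.cocycles1_iff QR.cocycles1_iff AR.d0_K1 QR.d0_K1 module_ops[OF AR.mK1] module_ops[OF QR.mK1])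

lemma xclass_zero_iff:
  assumes "z \<in> relZ0"
  shows "xclass z = \<zero>\<^bsub>XExt K A B M \<rho>'\<^esub> \<longleftrightarrow>
    (\<exists>h\<in>carrier (Km1 K A M). \<exists>c\<in>carrier (K0 K Q M). z = dm1 A M \<rho>' h \<oplus>\<^bsub>K0 K A M\<^esub> infl2 c)"
proof -
  have "\<zero>\<^bsub>K0 K A M\<^esub> \<in> relZ0" by (rule submodule_rules(1)[OF AR.mK0 relZ0_sub])
  from xclass_eq_iff[OF this assms] show ?thesis
    by (auto simp: XExt_ops infl2_K0 module_ops[OF AR.mK0])
qed

text \<open>A map on \<open>A\<close> restricting to zero on \<open>B\<close> is inflated.
  Injectivity of inflation one degree higher transfers the cocycle condition to the map on
  \<open>Q\<close>.\<close>

lemma exact_H0: "exact_at K (H0 K Q M \<rho>) (tau_H0 A \<tau>) (H0 K A M \<rho>') (restr_ab K A B) (Hom_ab K A B M \<rho> \<tau>)"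
proof -
  have "infl1 ` carrier (H0 K Q M \<rho>) = a_kernel (H0 K A M \<rho>') (Hom_ab K A B M \<rho> \<tau>) (restr_ab K A B)"
    unfolding a_kernel_def'
  proof (intro equalityI subsetI)
    fix h assume "h \<in> infl1 ` carrier (H0 K Q M \<rho>)"
    then obtain g where g: "h = infl1 g" "g \<in> carrier (H0 K Q M \<rho>)" by blast
    then have h: "h \<in> carrier (H0 K A M \<rho>')" using lin_mapD(1)[OF H0_lin] by simp
    moreover have "vanishes1 h" using g by (simp add: QR.H0_carrier vanishes_infl1)
    ultimately show "h \<in> {h \<in> carrier (H0 K A M \<rho>'). restr_ab K A B h = \<zero>\<^bsub>Hom_ab K A B M \<rho> \<tau>\<^esub>}"
      using restr_zero_iff[OF subsetD[OF H0A_relZm1 h]] by simp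
  next
    fix h assume "h \<in> {h \<in> carrier (H0 K A M \<rho>'). restr_ab K A B h = \<zero>\<^bsub>Hom_ab K A B M \<rho> \<tau>\<^esub>}"
    then have h: "h \<in> carrier (H0 K A M \<rho>')" "vanishes1 h" using restr_zero_iff H0A_relZm1 by auto
    then obtain g where g: "h = infl1 g" "g \<in> carrier (Km1 K Q M)" using vanishes1_iff by (auto simp: AR.H0_carrier)
    have "infl2 (dm1 Q M \<rho> g) = infl2 \<zero>\<^bsub>K0 K Q M\<^esub>" using h g by (simp add: AR.H0_carrier infl_dm1 infl2_rules)
    then have "dm1 Q M \<rho> g = \<zero>\<^bsub>K0 K Q M\<^esub>"
      using tau_inj(2)[THEN inj_onD] g by (simp add: QR.dm1_K0 module_ops[OF QR.mK0])
    then show "h \<in> infl1 ` carrier (H0 K Q M \<rho>)" using g by (auto simp: QR.H0_carrier)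
  qed
  then show ?thesis
    unfolding exact_at_def tau_H0_eq using QR.mH0 AR.mH0 mHom_ab H0_lin restr_H0_lin by blast
qed

text \<open>A homomorphism with trivial image extends to some \<open>h\<close> whose coboundary is
  inflated from a coboundary on \<open>Q\<close>; changing the extension makes its coboundary
  zero.\<close>

lemma exact_Hom: "exact_at K (H0 K A M \<rho>') (restr_ab K A B) (Hom_ab K A B M \<rho> \<tau>) (connecting K A B Q M \<rho> \<tau>) (H1 K Q M \<rho>)"
proof -
  interpret agK: abelian_group "Km1 K A M" by (rule module_ag[OF AR.mKm1])
  have "restr_ab K A B ` carrier (H0 K A M \<rho>') = a_kernel (Hom_ab K A B M \<rho> \<tau>) (H1 K Q M \<rho>) (connecting K A B Q M \<rho> \<tau>)"
    unfolding a_kernel_def'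
  proof (intro equalityI subsetI)
    fix \<phi> assume "\<phi> \<in> restr_ab K A B ` carrier (H0 K A M \<rho>')"
    then obtain h where h: "\<phi> = restr_ab K A B h" "h \<in> carrier (H0 K A M \<rho>')" by blast
    then have hZ: "h \<in> relZm1" using H0A_relZm1 by blast
    have "defl2 (dm1 A M \<rho>' h) = \<zero>\<^bsub>K0 K Q M\<^esub>"
      using h by (intro defl2_eq) (simp_all add: AR.H0_carrier infl2_rules module_ops[OF QR.mK0])
    then show "\<phi> \<in> {\<phi> \<in> carrier (Hom_ab K A B M \<rho> \<tau>). connecting K A B Q M \<rho> \<tau> \<phi> = \<zero>\<^bsub>H1 K Q M \<rho>\<^esub>}"
      using h hZ by (simp add: restr_Hom connecting_val QR.H1_ops)
  next
    fix \<phi> assume "\<phi> \<in> {\<phi> \<in> carrier (Hom_ab K A B M \<rho> \<tau>). connecting K A B Q M \<rho> \<tau> \<phi> = \<zero>\<^bsub>H1 K Q M \<rho>\<^esub>}"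
    then obtain h where h: "h \<in> relZm1" "\<phi> = restr_ab K A B h" "connecting K A B Q M \<rho> \<tau> \<phi> = \<zero>\<^bsub>H1 K Q M \<rho>\<^esub>"
      by (auto simp: restr_surj)
    then obtain g where g: "g \<in> carrier (Km1 K Q M)" "defl2 (dm1 A M \<rho>' h) = dm1 Q M \<rho> g"
      using class1_zero_iff(2)[OF defl2_dm1(1)[OF h(1)]] by (auto simp: connecting_val)
    have hK: "h \<in> carrier (Km1 K A M)" using h by (simp add: relZm1_def)
    have gA: "infl1 g \<in> carrier (Km1 K A M)" by (rule infl1_Km1[OF g(1)])
    have e: "dm1 A M \<rho>' h = dm1 A M \<rho>' (infl1 g)" using defl2_dm1(2)[OF h(1)] g by (simp add: infl_dm1)
    \<comment> \<open>Subtracting the inflated map removes the coboundary and leaves the restriction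
      to \<open>B\<close> unchanged, since inflated maps vanish on \<open>B\<close>.\<close>
    define h' where "h' = h \<ominus>\<^bsub>Km1 K A M\<^esub> infl1 g"
    have h'K: "h' \<in> carrier (Km1 K A M)" unfolding h'_def using hK gA by simp
    have "dm1 A M \<rho>' h' = \<zero>\<^bsub>K0 K A M\<^esub>"
      unfolding h'_def using hK gA e
      by (simp add: lin_map_rules[OF AR.mKm1 AR.mK0 AR.dm1_lin] module_ops[OF AR.mK0])
    then have h'0: "h' \<in> carrier (H0 K A M \<rho>')" using h'K by (simp add: AR.H0_carrier)
    have hh: "h = h' \<oplus>\<^bsub>Km1 K A M\<^esub> infl1 g" unfolding h'_def by (rule agK.eq_add_minus[OF hK gA])
    have "restr_ab K A B h' = restr_ab K A B h"
    proof (rule restr_eqI)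
      show "restr_ab K A B h \<in> extensional (carrier abB)" by (simp add: restr_ab_def)
      show "h' \<in> relZm1" using h'0 H0A_relZm1 by blast
      fix b assume b: "b \<in> B"
      have "infl1 g b = \<zero>\<^bsub>M\<^esub>" using vanishes_infl1[OF g(1)] b unfolding vanishes1_def by blast
      moreover have "h' b \<in> carrier M" using h'K b by (auto simp: AR.Km1_iff B_in lin_mapD)
      ultimately have "h b = h' b" using b by (subst hh) (simp add: AR.Km1_add B_in del: infl_val)
      then show "restr_ab K A B h (cl b) = h' b" using restr_val[OF h(1) b] by simp
    qed
    then show "\<phi> \<in> restr_ab K A B ` carrier (H0 K A M \<rho>')" using h h'0 by (metis imageI)
  qed
  then show ?thesis
    unfolding exact_at_def using AR.mH0 mHom_ab QR.mH1 restr_H0_lin connecting_lin by blast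
qed

text \<open>A cocycle on \<open>Q\<close> dies on \<open>A\<close> exactly when its inflation is the
  coboundary of some \<open>h\<close>. Such an \<open>h\<close> lies in \<open>relZm1\<close>, and
  the formula \<open>connecting_val\<close> returns the given class.\<close>

lemma exact_H1Q: "exact_at K (Hom_ab K A B M \<rho> \<tau>) (connecting K A B Q M \<rho> \<tau>) (H1 K Q M \<rho>) (tau_H1 K A M \<rho> \<tau>) (H1 K A M \<rho>')"
proof -
  have "connecting K A B Q M \<rho> \<tau> ` carrier (Hom_ab K A B M \<rho> \<tau>) = a_kernel (H1 K Q M \<rho>) (H1 K A M \<rho>') (tau_H1 K A M \<rho> \<tau>)"
    unfolding a_kernel_def'
  proof (intro equalityI subsetI)
    fix x assume "x \<in> connecting K A B Q M \<rho> \<tau> ` carrier (Hom_ab K A B M \<rho> \<tau>)"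
    then obtain h where h: "h \<in> relZm1" "x = class1 K Q M \<rho> (defl2 (dm1 A M \<rho>' h))"
      by (auto simp: restr_surj connecting_val)
    note c = defl2_dm1[OF h(1)]
    have hK: "h \<in> carrier (Km1 K A M)" using h by (simp add: relZm1_def)
    have "tau_H1 K A M \<rho> \<tau> x = class1 K A M \<rho>' (dm1 A M \<rho>' h)"
      using c tau_H1_class[of "defl2 (dm1 A M \<rho>' h)"] by (simp add: h QR.Z1_iff)
    also have "\<dots> = \<zero>\<^bsub>H1 K A M \<rho>'\<^esub>"
      using class1_zero_iff(1)[of "dm1 A M \<rho>' h"] hK by (auto simp: AR.Z1_iff AR.dm1_K0 AR.d0_dm1)
    finally show "x \<in> {x \<in> carrier (H1 K Q M \<rho>). tau_H1 K A M \<rho> \<tau> x = \<zero>\<^bsub>H1 K A M \<rho>'\<^esub>}"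
      using c h by (simp add: QR.H1_carrier)
  next
    fix x assume "x \<in> {x \<in> carrier (H1 K Q M \<rho>). tau_H1 K A M \<rho> \<tau> x = \<zero>\<^bsub>H1 K A M \<rho>'\<^esub>}"
    then obtain z where z: "z \<in> QR.Z1" "x = class1 K Q M \<rho> z" "tau_H1 K A M \<rho> \<tau> x = \<zero>\<^bsub>H1 K A M \<rho>'\<^esub>"
      by (auto simp: QR.H1_carrier)
    have zK: "z \<in> carrier (K0 K Q M)" using z by (simp add: QR.Z1_iff)
    have "class1 K A M \<rho>' (infl2 z) = \<zero>\<^bsub>H1 K A M \<rho>'\<^esub>" using z zK by (simp add: tau_H1_class)
    then obtain h where h: "h \<in> carrier (Km1 K A M)" "infl2 z = dm1 A M \<rho>' h"
      using class1_zero_iff(1)[OF infl2_Z1[OF z(1)]] by blast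
    then have hZ: "h \<in> relZm1" using vanishes_infl2[OF zK] by (simp add: relZm1_def)
    have "defl2 (dm1 A M \<rho>' h) = z" by (rule defl2_eq[OF zK h(2)])
    then have "x = connecting K A B Q M \<rho> \<tau> (restr_ab K A B h)" using z hZ by (simp add: connecting_val)
    then show "x \<in> connecting K A B Q M \<rho> \<tau> ` carrier (Hom_ab K A B M \<rho> \<tau>)" using restr_Hom[OF hZ] by blast
  qed
  then show ?thesis
    unfolding exact_at_def using mHom_ab QR.mH1 AR.mH1 connecting_lin tau_H1_lin by blast
qed

text \<open>By \<open>xclass_zero_iff\<close> a cocycle gives the zero extension iff it is
  cohomologous to an inflated cochain.\<close>

lemma exact_H1A: "exact_at K (H1 K Q M \<rho>) (tau_H1 K A M \<rho> \<tau>) (H1 K A M \<rho>') (map_r K A B M \<rho>') (XExt K A B M \<rho>')"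
proof -
  have "tau_H1 K A M \<rho> \<tau> ` carrier (H1 K Q M \<rho>) = a_kernel (H1 K A M \<rho>') (XExt K A B M \<rho>') (map_r K A B M \<rho>')"
    unfolding a_kernel_def'
  proof (intro equalityI subsetI)
    fix x assume "x \<in> tau_H1 K A M \<rho> \<tau> ` carrier (H1 K Q M \<rho>)"
    then obtain c where c: "c \<in> QR.Z1" "x = tau_H1 K A M \<rho> \<tau> (class1 K Q M \<rho> c)" by (auto simp: QR.H1_carrier)
    have cK: "c \<in> carrier (K0 K Q M)" using c by (simp add: QR.Z1_iff)
    have x: "x = class1 K A M \<rho>' (infl2 c)" using c cK by (simp add: tau_H1_class)
    note z = infl2_Z1[OF c(1)]
    have "xclass (infl2 c) = \<zero>\<^bsub>XExt K A B M \<rho>'\<^esub>"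
      unfolding xclass_zero_iff[OF subsetD[OF Z1_relZ0 z]]
      using cK by (intro bexI[of _ "\<zero>\<^bsub>Km1 K A M\<^esub>"] bexI[of _ c])
        (simp_all add: lin_map_rules(4)[OF AR.mKm1 AR.mK0 AR.dm1_lin] module_ops[OF AR.mKm1] module_ops[OF AR.mK0] infl2_K0)
    then show "x \<in> {x \<in> carrier (H1 K A M \<rho>'). map_r K A B M \<rho>' x = \<zero>\<^bsub>XExt K A B M \<rho>'\<^esub>}"
      using z by (simp add: x AR.H1_carrier r_val)
  next
    fix x assume "x \<in> {x \<in> carrier (H1 K A M \<rho>'). map_r K A B M \<rho>' x = \<zero>\<^bsub>XExt K A B M \<rho>'\<^esub>}"
    then obtain z where z: "z \<in> AR.Z1" "x = class1 K A M \<rho>' z" "xclass z = \<zero>\<^bsub>XExt K A B M \<rho>'\<^esub>"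
      by (auto simp: AR.H1_carrier r_val)
    have zK: "z \<in> carrier (K0 K A M)" using z by (simp add: AR.Z1_iff)
    obtain h c where h: "h \<in> carrier (Km1 K A M)" and c: "c \<in> carrier (K0 K Q M)"
      and e: "z = dm1 A M \<rho>' h \<oplus>\<^bsub>K0 K A M\<^esub> infl2 c" using z xclass_zero_iff[OF subsetD[OF Z1_relZ0 z(1)]] by blast
    \<comment> \<open>The inflated part differs from the cocycle \<open>z\<close> by a coboundary,
      so it is a cocycle; injectivity of inflation makes \<open>c\<close> a cocycle on
      \<open>Q\<close>.\<close>
    have "d0 A M \<rho>' (infl2 c) = d0 A M \<rho>' z"
      using h c by (simp add: e lin_mapD[OF AR.d0_lin] AR.dm1_K0 infl2_K0 AR.d0_dm1 module_ops[OF AR.mK1] AR.d0_K1)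
    then have cZ: "c \<in> QR.Z1" using z c by (intro infl2_Z1D) (simp_all add: AR.Z1_iff infl2_K0)
    have "x = class1 K A M \<rho>' (infl2 c)"
      using AR.class1_eq_iff[OF zK infl2_K0[OF c]] h e z(2) by blast
    then have "x = tau_H1 K A M \<rho> \<tau> (class1 K Q M \<rho> c)" using c by (simp add: tau_H1_class)
    then show "x \<in> tau_H1 K A M \<rho> \<tau> ` carrier (H1 K Q M \<rho>)" using cZ by (auto simp: QR.H1_carrier)
  qed
  then show ?thesis
    unfolding exact_at_def using QR.mH1 AR.mH1 mXExt tau_H1_lin r_lin by blast
qed

text \<open>The class under \<gamma> vanishes iff the coboundary of \<open>z\<close> is inflated
  from a coboundary on \<open>Q\<close>, which means that an inflated cochain corrects
  \<open>z\<close> to a cocycle.\<close>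

lemma exact_XExt: "exact_at K (H1 K A M \<rho>') (map_r K A B M \<rho>') (XExt K A B M \<rho>') (map_gamma K A B Q M \<rho> \<tau>) (H2 K Q M \<rho>)"
proof -
  interpret agK: abelian_group "K0 K A M" by (rule module_ag[OF AR.mK0])
  have "map_r K A B M \<rho>' ` carrier (H1 K A M \<rho>') = a_kernel (XExt K A B M \<rho>') (H2 K Q M \<rho>) (map_gamma K A B Q M \<rho> \<tau>)"
    unfolding a_kernel_def'
  proof (intro equalityI subsetI)
    fix x assume "x \<in> map_r K A B M \<rho>' ` carrier (H1 K A M \<rho>')"
    then obtain z where z: "z \<in> AR.Z1" "x = xclass z" by (auto simp: AR.H1_carrier r_val)
    then have zZ: "z \<in> relZ0" using Z1_relZ0 by blast
    have "defl3 (d0 A M \<rho>' z) = \<zero>\<^bsub>K1 K Q M\<^esub>"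
      using z by (intro defl3_eq) (simp_all add: AR.Z1_iff infl3_rules module_ops[OF QR.mK1])
    then show "x \<in> {x \<in> carrier (XExt K A B M \<rho>'). map_gamma K A B Q M \<rho> \<tau> x = \<zero>\<^bsub>H2 K Q M \<rho>\<^esub>}"
      using zZ by (simp add: z XExt_carrier gamma_val QR.H2_ops)
  next
    fix x assume "x \<in> {x \<in> carrier (XExt K A B M \<rho>'). map_gamma K A B Q M \<rho> \<tau> x = \<zero>\<^bsub>H2 K Q M \<rho>\<^esub>}"
    then obtain z where z: "z \<in> relZ0" "x = xclass z" "class2 K Q M \<rho> (defl3 (d0 A M \<rho>' z)) = \<zero>\<^bsub>H2 K Q M \<rho>\<^esub>"
      by (auto simp: XExt_carrier gamma_val)
    have zK: "z \<in> carrier (K0 K A M)" by (rule relZ0_K0[OF z(1)])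
    obtain b where b: "b \<in> carrier (K0 K Q M)" "defl3 (d0 A M \<rho>' z) = d0 Q M \<rho> b"
      using z class2_zero_iff(2)[OF defl3_d0(1)[OF z(1)]] by blast
    note bA = infl2_K0[OF b(1)]
    have e: "d0 A M \<rho>' z = d0 A M \<rho>' (infl2 b)" using defl3_d0(2)[OF z(1)] b by (simp add: infl_d0)
    \<comment> \<open>Subtracting an inflated cochain does not change the class of the extension,
      and by the choice of \<open>b\<close> it kills the coboundary.\<close>
    define w where "w = z \<ominus>\<^bsub>K0 K A M\<^esub> infl2 b"
    have wK: "w \<in> carrier (K0 K A M)" unfolding w_def using zK bA by simp
    have w: "w \<in> AR.Z1"
      unfolding AR.Z1_iff w_def using zK bA e
      by (simp add: lin_map_rules[OF AR.mK0 AR.mK1 AR.d0_lin] module_ops[OF AR.mK1])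
    have zw: "z = w \<oplus>\<^bsub>K0 K A M\<^esub> infl2 b" unfolding w_def by (rule agK.eq_add_minus[OF zK bA])
    have "xclass w = xclass z"
      unfolding xclass_eq_iff[OF subsetD[OF Z1_relZ0 w] z(1)]
      using b zw by (intro bexI[of _ "\<zero>\<^bsub>Km1 K A M\<^esub>"] bexI[of _ b])
        (simp_all add: lin_map_rules(4)[OF AR.mKm1 AR.mK0 AR.dm1_lin] module_ops[OF AR.mKm1] bA wK agK.a_comm)
    then have "x = map_r K A B M \<rho>' (class1 K A M \<rho>' w)" using w z by (simp add: r_val)
    then show "x \<in> map_r K A B M \<rho>' ` carrier (H1 K A M \<rho>')" using w by (auto simp: AR.H1_carrier)
  qed
  then show ?thesis
    unfolding exact_at_def using AR.mH1 mXExt QR.mH2 r_lin gamma_lin by blast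
qed

text \<open>A cocycle on \<open>Q\<close> becomes trivial on \<open>A\<close> iff its inflation is
  the coboundary of some \<open>z\<close>. Being inflated, that coboundary vanishes on
  \<open>B\<close>, so \<open>z\<close> defines a crossed extension, and \<open>gamma_val\<close>
  returns the cocycle.\<close>

lemma exact_H2Q: "exact_at K (XExt K A B M \<rho>') (map_gamma K A B Q M \<rho> \<tau>) (H2 K Q M \<rho>) (tau_H2 K A M \<rho> \<tau>) (H2 K A M \<rho>')"
proof -
  have "map_gamma K A B Q M \<rho> \<tau> ` carrier (XExt K A B M \<rho>') = a_kernel (H2 K Q M \<rho>) (H2 K A M \<rho>') (tau_H2 K A M \<rho> \<tau>)"
    unfolding a_kernel_def'
  proof (intro equalityI subsetI)
    fix x assume "x \<in> map_gamma K A B Q M \<rho> \<tau> ` carrier (XExt K A B M \<rho>')"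
    then obtain z where z: "z \<in> relZ0" "x = class2 K Q M \<rho> (defl3 (d0 A M \<rho>' z))" by (auto simp: XExt_carrier gamma_val)
    note c = defl3_d0[OF z(1)]
    have "tau_H2 K A M \<rho> \<tau> x = class2 K A M \<rho>' (d0 A M \<rho>' z)"
      using c tau_H2_class[of "defl3 (d0 A M \<rho>' z)"] by (simp add: z QR.cocycles1_iff)
    also have "\<dots> = \<zero>\<^bsub>H2 K A M \<rho>'\<^esub>"
      using class2_zero_iff(1)[OF AR.d0_cocycles1] relZ0_K0[OF z(1)] by blast
    finally show "x \<in> {x \<in> carrier (H2 K Q M \<rho>). tau_H2 K A M \<rho> \<tau> x = \<zero>\<^bsub>H2 K A M \<rho>'\<^esub>}"
      using c z by (simp add: QR.H2_carrier)
  next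
    fix x assume "x \<in> {x \<in> carrier (H2 K Q M \<rho>). tau_H2 K A M \<rho> \<tau> x = \<zero>\<^bsub>H2 K A M \<rho>'\<^esub>}"
    then obtain c where c: "c \<in> cocycles1 K Q M \<rho>" "x = class2 K Q M \<rho> c" "tau_H2 K A M \<rho> \<tau> x = \<zero>\<^bsub>H2 K A M \<rho>'\<^esub>"
      by (auto simp: QR.H2_carrier)
    have cK: "c \<in> carrier (K1 K Q M)" using c by (simp add: QR.cocycles1_iff)
    have "class2 K A M \<rho>' (infl3 c) = \<zero>\<^bsub>H2 K A M \<rho>'\<^esub>" using c cK by (simp add: tau_H2_class)
    then obtain z where z: "z \<in> carrier (K0 K A M)" "infl3 c = d0 A M \<rho>' z"
      using class2_zero_iff(1)[OF infl3_cocycles1[OF c(1)]] by blast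
    then have zZ: "z \<in> relZ0" using vanishes_infl3[OF cK] by (simp add: relZ0_def)
    have "defl3 (d0 A M \<rho>' z) = c" by (rule defl3_eq[OF cK z(2)])
    then have "x = map_gamma K A B Q M \<rho> \<tau> (xclass z)" using c zZ by (simp add: gamma_val)
    then show "x \<in> map_gamma K A B Q M \<rho> \<tau> ` carrier (XExt K A B M \<rho>')" using zZ by (auto simp: XExt_carrier)
  qed
  then show ?thesis
    unfolding exact_at_def using mXExt QR.mH2 AR.mH2 gamma_lin tau_H2_lin by blast
qed

lemma tau_H0_inj: "inj_on (tau_H0 A \<tau>) (carrier (H0 K Q M \<rho>))"
  unfolding tau_H0_eq by (rule inj_on_subset[OF tau_inj(1)]) (auto simp: QR.H0_carrier)

end

theorem theorem6p5:
  fixes K :: "'k ring"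
    and A :: "('k, 'a) awb" and B :: "'a set" and Q :: "('k, 'q) awb" and \<tau> :: "'a \<Rightarrow> 'q"
    and M :: "('k, 'm) module" and \<rho> :: "('q, 'm) action"
  assumes "field K"
    and "short_exact K (A\<lparr>carrier := B\<rparr>) (\<lambda>b. b) A \<tau> Q"
    and "representation K Q M \<rho>"
  shows "inj_on (tau_H0 A \<tau>) (carrier (H0 K Q M \<rho>)) \<and>
    exact_at K (H0 K Q M \<rho>) (tau_H0 A \<tau>) (H0 K A M (rep_along \<tau> \<rho>))
      (restr_ab K A B) (Hom_ab K A B M \<rho> \<tau>) \<and>
    exact_at K (H0 K A M (rep_along \<tau> \<rho>)) (restr_ab K A B) (Hom_ab K A B M \<rho> \<tau>)
      (connecting K A B Q M \<rho> \<tau>) (H1 K Q M \<rho>) \<and>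
    exact_at K (Hom_ab K A B M \<rho> \<tau>) (connecting K A B Q M \<rho> \<tau>) (H1 K Q M \<rho>)
      (tau_H1 K A M \<rho> \<tau>) (H1 K A M (rep_along \<tau> \<rho>)) \<and>
    exact_at K (H1 K Q M \<rho>) (tau_H1 K A M \<rho> \<tau>) (H1 K A M (rep_along \<tau> \<rho>))
      (map_r K A B M (rep_along \<tau> \<rho>)) (XExt K A B M (rep_along \<tau> \<rho>)) \<and>
    exact_at K (H1 K A M (rep_along \<tau> \<rho>)) (map_r K A B M (rep_along \<tau> \<rho>))
      (XExt K A B M (rep_along \<tau> \<rho>)) (map_gamma K A B Q M \<rho> \<tau>) (H2 K Q M \<rho>) \<and>
    exact_at K (XExt K A B M (rep_along \<tau> \<rho>)) (map_gamma K A B Q M \<rho> \<tau>) (H2 K Q M \<rho>)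
      (tau_H2 K A M \<rho> \<tau>) (H2 K A M (rep_along \<tau> \<rho>))"
proof -
  interpret setting K A B Q \<tau> M \<rho> by (rule setting.intro) fact+
  show ?thesis
    using tau_H0_inj exact_H0 exact_Hom exact_H1Q exact_H1A exact_XExt exact_H2Q by blast
qed

end
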